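(* Let $\alpha\in(0,1/2)$, $\varepsilon\in(0,2\alpha)$ and let $d>0$ be an arbitrary number. For any $\lambda,\beta>0$ and any $w\in\overline{B(d,p_0,p_1)}$ the functional $J_{\lambda,\beta}$ has a Fréchet derivative $J'_{\lambda,\beta}(w)\in H_0^3(R)$. Let $\lambda_0=\lambda_0(\alpha)\ge1$ be the number for which the Carleman estimate recalled in the context holds. Then there exist a sufficiently large number $\lambda_1=\lambda_1(\alpha,\varepsilon,d)\ge\lambda_0$ and a number $C_1=C_1(\alpha,\varepsilon,d)>0$, both depending only on the listed parameters, such that for all $\lambda\ge\lambda_1$ and all $\beta\in[2e^{-\lambda\alpha T},1)$ the functional $J_{\lambda,\beta}$ is strictly convex on the set $\overline{B(d,p_0,p_1)}$. More precisely, for all $w_1,w_2\in\overline{B(d,p_0,p_1)}$ and all $\lambda\ge\lambda_1$, $$\begin{aligned}&J_{\lambda,\beta}(w_2)-J_{\lambda,\beta}(w_1)-J'_{\lambda,\beta}(w_1)(w_2-w_1)\ \ge\ C_1e^{-2\lambda(2\alpha-\varepsilon)}\|w_2-w_1\|^2_{H^1(Tr_{\alpha,\varepsilon})}\\ &\qquad+C_1e^{-2\lambda(2\alpha-\varepsilon)}\|w_2(x,0)-w_1(x,0)\|^2_{H^1(0,2\alpha-\varepsilon)}+\frac{\beta}{2}\|w_2-w_1\|^2_{H^3(R)}.\end{aligned}$$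
   Context: $R=(0,1)\times(0,T)$, where $T\ge2$ is fixed; all functions are real valued. $\varphi_\lambda(x,t)=\exp(-2\lambda(x+\alpha t))$. The quasilinear integro-differential operator $L$ is $$L(w)=w_{xx}-2w_{xt}+2w_x\int_0^tw_x(x,\tau)d\tau-2w_xw-2w_t\int_0^tw_x(x,\tau)d\tau .$$ The functional is $$J_{\lambda,\beta}(w)=\int_R[L(w)]^2\varphi_\lambda\,dxdt+\beta\|w\|^2_{H^3(R)} .$$ For given functions $p_0,p_1$ of $t\in(0,T)$, $$B(d,p_0,p_1)=\{w\in H^3(R): w(0,t)=p_0(t),\ w_x(0,t)=p_1(t),\ w_x(1,t)=0,\ \|w\|_{H^3(R)}<d\},$$ and the overline denotes closure in $H^3(R)$. $H_0^2(R)=\{u\in H^2(R):u(0,t)=u_x(0,t)=0\}$ and $H_0^3(R)=H^3(R)\cap H_0^2(R)$. The Fréchet derivative $J'_{\lambda,\beta}(w)\in H_0^3(R)$ is with respect to increments $h\in H_0^3(R)$, and $J'_{\lambda,\beta}(w)(h)$ is its $H^3(R)$ scalar product with $h$. $Tr_{\alpha,\varepsilon}=\{(x,t):x+\alpha t<2\alpha-\varepsilon;\ x,t>0\}$. Carleman estimate: $\lambda_0=\lambda_0(\alpha)\ge1$ is a number such that, for some $C=C(\alpha)>0$, all $u\in H_0^2(R)$ and all $\lambda\ge\lambda_0$, $$\begin{aligned}\int_R (u_{xx}-2u_{xt})^2\varphi_\lambda dxdt\ge\ & C\lambda\int_R (u_x^2+u_t^2)\varphi_\lambda dxdt+C\lambda^3\int_R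 u^2\varphi_\lambda dxdt+C\lambda\int_0^1 u_x^2(x,0)e^{-2\lambda x}dx\\&+C\lambda^3\int_0^1 u^2(x,0)e^{-2\lambda x}dx-C\lambda e^{-2\lambda\alpha T}\int_0^1 u_x^2(x,T)dx-C\lambda^3e^{-2\lambda\alpha T}\int_0^1u^2(x,T)dx;\end{aligned}$$ such $\lambda_0$ exists. *)

theory Defs
  imports "HOL-Analysis.Analysis" "HOL-Library.Multiset"
begin

section \<open>Smooth functions and test functions\<close>

primrec pderivs :: "'a::euclidean_space list \<Rightarrow> ('a \<Rightarrow> real) \<Rightarrow> 'a \<Rightarrow> real" where
  "pderivs [] f = f"
| "pderivs (b # bs) f = (\<lambda>x. frechet_derivative (pderivs bs f) (at x) b)"

definition smooth :: "('a::euclidean_space \<Rightarrow> real) \<Rightarrow> bool" where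
  "smooth f \<longleftrightarrow> (\<forall>bs. set bs \<subseteq> Basis \<longrightarrow> pderivs bs f differentiable_on UNIV)"

definition test_fun :: "'a::euclidean_space set \<Rightarrow> ('a \<Rightarrow> real) \<Rightarrow> bool" where
  "test_fun S f \<longleftrightarrow> smooth f \<and> compact (closure {x. f x \<noteq> 0}) \<and> closure {x. f x \<noteq> 0} \<subseteq> S"


section \<open>Weak derivatives and the Sobolev spaces of square integrable functions\<close>

text \<open>
  Elements of a Sobolev space on an open set \<open>S\<close> are represented by Borel functions on the whole
  Euclidean space. Only the almost-everywhere class on \<open>S\<close> matters for the notions below.
  A multi-index is a multiset of basis vectors, so that \<open>{#}\<close> stands for no differentiation and
  \<open>{#b, c#}\<close> for the mixed derivative in the directions \<open>b\<close> and \<open>c\<close>.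
\<close>

definition L2 :: "'a::euclidean_space set \<Rightarrow> ('a \<Rightarrow> real) set" where
  "L2 S = {u. set_borel_measurable lborel S u \<and> set_integrable lborel S (\<lambda>x. (u x)\<^sup>2)}"

definition loc_integrable :: "'a::euclidean_space set \<Rightarrow> ('a \<Rightarrow> real) \<Rightarrow> bool" where
  "loc_integrable S u \<longleftrightarrow> (\<forall>K. compact K \<and> K \<subseteq> S \<longrightarrow> set_integrable lborel K u)"

text \<open>The order \<open>bs\<close> in which a test function is differentiated is immaterial.\<close>

definition has_weak_deriv ::
  "'a::euclidean_space set \<Rightarrow> 'a multiset \<Rightarrow> ('a \<Rightarrow> real) \<Rightarrow> ('a \<Rightarrow> real) \<Rightarrow> bool" where
  "has_weak_deriv S m u v \<longleftrightarrow> loc_integrable S u \<and> loc_integrable S v \<and>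
     (\<forall>f bs. test_fun S f \<and> mset bs = m \<longrightarrow>
        (LINT x:S|lborel. u x * pderivs bs f x) = (-1) ^ size m * (LINT x:S|lborel. v x * f x))"

definition weak_deriv ::
  "'a::euclidean_space set \<Rightarrow> 'a multiset \<Rightarrow> ('a \<Rightarrow> real) \<Rightarrow> 'a \<Rightarrow> real" where
  "weak_deriv S m u = (SOME v. has_weak_deriv S m u v)"

definition multi_indices :: "nat \<Rightarrow> 'a::euclidean_space multiset set" where
  "multi_indices k = {m. set_mset m \<subseteq> Basis \<and> size m \<le> k}"

lemma finite_multi_indices: "finite (multi_indices k :: 'a::euclidean_space multiset set)"
proof -
  have "multi_indices k \<subseteq> mset ` {xs :: 'a list. set xs \<subseteq> Basis \<and> length xs \<le> k}"
  proof
    fix m :: "'a multiset"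
    assume m: "m \<in> multi_indices k"
    obtain xs where "mset xs = m" using ex_mset by blast
    with m show "m \<in> mset ` {xs :: 'a list. set xs \<subseteq> Basis \<and> length xs \<le> k}"
      by (auto simp: multi_indices_def)
  qed
  then show ?thesis
    by (rule finite_subset) (simp add: finite_lists_length_le)
qed

definition sobolev :: "nat \<Rightarrow> 'a::euclidean_space set \<Rightarrow> ('a \<Rightarrow> real) set" where
  "sobolev k S =
     {u. u \<in> L2 S \<and> (\<forall>m\<in>multi_indices k. \<exists>v. has_weak_deriv S m u v \<and> v \<in> L2 S)}"

definition sobolev_inner ::
  "nat \<Rightarrow> 'a::euclidean_space set \<Rightarrow> ('a \<Rightarrow> real) \<Rightarrow> ('a \<Rightarrow> real) \<Rightarrow> real" where
  "sobolev_inner k S u v =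
     (\<Sum>m\<in>multi_indices k. LINT x:S|lborel. weak_deriv S m u x * weak_deriv S m v x)"

definition sobolev_norm :: "nat \<Rightarrow> 'a::euclidean_space set \<Rightarrow> ('a \<Rightarrow> real) \<Rightarrow> real" where
  "sobolev_norm k S u = sqrt (sobolev_inner k S u u)"


section \<open>Traces\<close>

text \<open>
  \<open>g\<close> is the trace of \<open>u \<in> H\<^sup>1(S)\<close> along the boundary piece parametrised by \<open>c\<close> on \<open>I\<close>: the
  \<open>L\<^sup>2(I)\<close> limit of the restrictions of smooth functions that converge to \<open>u\<close> in \<open>H\<^sup>1(S)\<close>.
\<close>

definition has_trace ::
  "(real \<times> real) set \<Rightarrow> (real \<Rightarrow> real \<times> real) \<Rightarrow> real set \<Rightarrow>
   (real \<times> real \<Rightarrow> real) \<Rightarrow> (real \<Rightarrow> real) \<Rightarrow> bool" where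
  "has_trace S c I u g \<longleftrightarrow> u \<in> sobolev 1 S \<and> g \<in> L2 I \<and>
     (\<exists>f :: nat \<Rightarrow> real \<times> real \<Rightarrow> real. (\<forall>n. smooth (f n)) \<and>
        (\<lambda>n. sobolev_norm 1 S (\<lambda>z. f n z - u z)) \<longlonglongrightarrow> 0 \<and>
        (\<lambda>n. LINT s:I|lborel. (f n (c s) - g s)\<^sup>2) \<longlonglongrightarrow> 0)"

definition trace_on ::
  "(real \<times> real) set \<Rightarrow> (real \<Rightarrow> real \<times> real) \<Rightarrow> real set \<Rightarrow>
   (real \<times> real \<Rightarrow> real) \<Rightarrow> real \<Rightarrow> real" where
  "trace_on S c I u = (SOME g. has_trace S c I u g)"


section \<open>The rectangle, the operator and the functional\<close>

abbreviation e_x :: "real \<times> real" where "e_x \<equiv> (1, 0)"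
abbreviation e_t :: "real \<times> real" where "e_t \<equiv> (0, 1)"

definition rect :: "real \<Rightarrow> (real \<times> real) set" where
  "rect T = {0<..<1} \<times> {0<..<T}"

definition Tr :: "real \<Rightarrow> real \<Rightarrow> (real \<times> real) set" where
  "Tr \<alpha> \<epsilon> = {(x, t). x + \<alpha> * t < 2 * \<alpha> - \<epsilon> \<and> x > 0 \<and> t > 0}"

definition weight :: "real \<Rightarrow> real \<Rightarrow> real \<times> real \<Rightarrow> real" where
  "weight \<alpha> lam = (\<lambda>(x, t). exp (- 2 * lam * (x + \<alpha> * t)))"

abbreviation dx :: "real \<Rightarrow> (real \<times> real \<Rightarrow> real) \<Rightarrow> real \<times> real \<Rightarrow> real" where
  "dx T u \<equiv> weak_deriv (rect T) {#e_x#} u"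
abbreviation dt :: "real \<Rightarrow> (real \<times> real \<Rightarrow> real) \<Rightarrow> real \<times> real \<Rightarrow> real" where
  "dt T u \<equiv> weak_deriv (rect T) {#e_t#} u"
abbreviation dxx :: "real \<Rightarrow> (real \<times> real \<Rightarrow> real) \<Rightarrow> real \<times> real \<Rightarrow> real" where
  "dxx T u \<equiv> weak_deriv (rect T) {#e_x, e_x#} u"
abbreviation dxt :: "real \<Rightarrow> (real \<times> real \<Rightarrow> real) \<Rightarrow> real \<times> real \<Rightarrow> real" where
  "dxt T u \<equiv> weak_deriv (rect T) {#e_x, e_t#} u"

abbreviation left_trace :: "real \<Rightarrow> (real \<times> real \<Rightarrow> real) \<Rightarrow> (real \<Rightarrow> real) \<Rightarrow> bool" where
  "left_trace T u g \<equiv> has_trace (rect T) (\<lambda>t. (0, t)) {0<..<T} u g"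
abbreviation right_trace :: "real \<Rightarrow> (real \<times> real \<Rightarrow> real) \<Rightarrow> (real \<Rightarrow> real) \<Rightarrow> bool" where
  "right_trace T u g \<equiv> has_trace (rect T) (\<lambda>t. (1, t)) {0<..<T} u g"
abbreviation trace_t :: "real \<Rightarrow> real \<Rightarrow> (real \<times> real \<Rightarrow> real) \<Rightarrow> real \<Rightarrow> real" where
  "trace_t T s u \<equiv> trace_on (rect T) (\<lambda>x. (x, s)) {0<..<1} u"

definition L_op :: "real \<Rightarrow> (real \<times> real \<Rightarrow> real) \<Rightarrow> real \<times> real \<Rightarrow> real" where
  "L_op T w = (\<lambda>(x, t).
     let I = (LINT \<tau>:{0<..<t}|lborel. dx T w (x, \<tau>))
     in dxx T w (x, t) - 2 * dxt T w (x, t) + 2 * dx T w (x, t) * I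
        - 2 * dx T w (x, t) * w (x, t) - 2 * dt T w (x, t) * I)"

definition J :: "real \<Rightarrow> real \<Rightarrow> real \<Rightarrow> real \<Rightarrow> (real \<times> real \<Rightarrow> real) \<Rightarrow> real" where
  "J T \<alpha> lam \<beta> w = (LINT z:rect T|lborel. (L_op T w z)\<^sup>2 * weight \<alpha> lam z)
     + \<beta> * (sobolev_norm 3 (rect T) w)\<^sup>2"

definition B :: "real \<Rightarrow> real \<Rightarrow> (real \<Rightarrow> real) \<Rightarrow> (real \<Rightarrow> real) \<Rightarrow> (real \<times> real \<Rightarrow> real) set" where
  "B T d p0 p1 = {w \<in> sobolev 3 (rect T).
     left_trace T w p0 \<and> left_trace T (dx T w) p1 \<and> right_trace T (dx T w) (\<lambda>_. 0) \<and>
     sobolev_norm 3 (rect T) w < d}"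

definition H3_closure :: "real \<Rightarrow> (real \<times> real \<Rightarrow> real) set \<Rightarrow> (real \<times> real \<Rightarrow> real) set" where
  "H3_closure T A = {w \<in> sobolev 3 (rect T).
     \<forall>e>0. \<exists>v\<in>A. sobolev_norm 3 (rect T) (\<lambda>z. v z - w z) < e}"

definition H02 :: "real \<Rightarrow> (real \<times> real \<Rightarrow> real) set" where
  "H02 T = {u \<in> sobolev 2 (rect T). left_trace T u (\<lambda>_. 0) \<and> left_trace T (dx T u) (\<lambda>_. 0)}"

definition H03 :: "real \<Rightarrow> (real \<times> real \<Rightarrow> real) set" where
  "H03 T = sobolev 3 (rect T) \<inter> H02 T"


section \<open>Frechet derivative and strict convexity\<close>

text \<open>
  The Frechet derivative at \<open>w\<close> with respect to increments in \<open>H\<^sub>0\<^sup>3\<close>, represented by an element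
  \<open>G\<close> of \<open>H\<^sub>0\<^sup>3\<close> acting through the \<open>H\<^sup>3\<close> scalar product. It is unique almost everywhere.
\<close>

definition has_frechet_deriv ::
  "real \<Rightarrow> ((real \<times> real \<Rightarrow> real) \<Rightarrow> real) \<Rightarrow> (real \<times> real \<Rightarrow> real) \<Rightarrow>
   (real \<times> real \<Rightarrow> real) \<Rightarrow> bool" where
  "has_frechet_deriv T F w G \<longleftrightarrow> G \<in> H03 T \<and>
     (\<forall>e>0. \<exists>\<delta>>0. \<forall>h\<in>H03 T. sobolev_norm 3 (rect T) h < \<delta> \<longrightarrow>
        \<bar>F (\<lambda>z. w z + h z) - F w - sobolev_inner 3 (rect T) G h\<bar> \<le> e * sobolev_norm 3 (rect T) h)"

definition frechet_deriv ::
  "real \<Rightarrow> ((real \<times> real \<Rightarrow> real) \<Rightarrow> real) \<Rightarrow> (real \<times> real \<Rightarrow> real) \<Rightarrow> real \<times> real \<Rightarrow> real" where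
  "frechet_deriv T F w = (SOME G. has_frechet_deriv T F w G)"

text \<open>Two representatives are distinct elements of \<open>H\<^sup>3\<close> iff their difference has nonzero norm.\<close>

definition strictly_convex_on ::
  "real \<Rightarrow> (real \<times> real \<Rightarrow> real) set \<Rightarrow> ((real \<times> real \<Rightarrow> real) \<Rightarrow> real) \<Rightarrow> bool" where
  "strictly_convex_on T A F \<longleftrightarrow>
     (\<forall>w1\<in>A. \<forall>w2\<in>A. \<forall>s\<in>{0<..<1}. sobolev_norm 3 (rect T) (\<lambda>z. w2 z - w1 z) \<noteq> 0 \<longrightarrow>
        F (\<lambda>z. (1 - s) * w1 z + s * w2 z) < (1 - s) * F w1 + s * F w2)"


section \<open>The Carleman estimate\<close>

definition carleman_estimate :: "real \<Rightarrow> real \<Rightarrow> real \<Rightarrow> bool" where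
  "carleman_estimate T \<alpha> lam0 \<longleftrightarrow> lam0 \<ge> 1 \<and>
     (\<exists>C>0. \<forall>u\<in>H02 T. \<forall>lam\<ge>lam0.
        (LINT z:rect T|lborel. (dxx T u z - 2 * dxt T u z)\<^sup>2 * weight \<alpha> lam z)
        \<ge> C * lam * (LINT z:rect T|lborel. ((dx T u z)\<^sup>2 + (dt T u z)\<^sup>2) * weight \<alpha> lam z)
          + C * lam ^ 3 * (LINT z:rect T|lborel. (u z)\<^sup>2 * weight \<alpha> lam z)
          + C * lam * (LINT x:{0<..<1}|lborel. (trace_t T 0 (dx T u) x)\<^sup>2 * exp (- 2 * lam * x))
          + C * lam ^ 3 * (LINT x:{0<..<1}|lborel. (trace_t T 0 u x)\<^sup>2 * exp (- 2 * lam * x))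
          - C * lam * exp (- 2 * lam * \<alpha> * T) * (LINT x:{0<..<1}|lborel. (trace_t T T (dx T u) x)\<^sup>2)
          - C * lam ^ 3 * exp (- 2 * lam * \<alpha> * T) * (LINT x:{0<..<1}|lborel. (trace_t T T u x)\<^sup>2))"

end

theory Submission
  imports Defs
begin

text \<open>
  Write \<open>L(w) = A w + N(w, w)\<close> with the linear part \<open>A u = u\<^sub>x\<^sub>x - 2 u\<^sub>x\<^sub>t\<close> and the bilinear map
  \<open>N(u, v) = 2 u\<^sub>x S v - 2 u\<^sub>x v - 2 u\<^sub>t S v\<close>, where \<open>S v (x, t)\<close> is the integral of \<open>v\<^sub>x\<close> over \<open>(0, t)\<close>. For an
  increment \<open>h\<close> the functional expands exactly (\<open>J_expansion\<close>):
  \<open>J(w + h) - J(w) - J'(w)(h)\<close> is the sum of the weighted integral of \<open>(A h + b)\<^sup>2\<close>, where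
  \<open>b = N(w + h, h) + N(h, w)\<close>, twice the weighted integral of \<open>L(w) N(h, h)\<close>, and \<open>\<beta> \<parallel>h\<parallel>\<^sup>2\<close>. With
  \<open>2 (A h + b)\<^sup>2 + 2 b\<^sup>2 \<ge> (A h)\<^sup>2\<close>, everything except \<open>\<beta> \<parallel>h\<parallel>\<^sup>2\<close> and half of the weighted integral of \<open>(A h)\<^sup>2\<close> is
  dominated by a constant, independent of \<open>\<lambda>\<close>, times the weighted integral of \<open>h\<^sub>x\<^sup>2 + h\<^sub>t\<^sup>2\<close> (the energy). The
  Carleman estimate bounds the integral of \<open>(A h)\<^sup>2\<close> from below by \<open>C \<lambda>\<close> times the energy and further
  positive terms, so a large \<open>\<lambda>\<close> absorbs the constant; its negative terms live at \<open>t = T\<close>, carry the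
  factor \<open>\<lambda>\<^sup>3 exp (- 2 \<lambda> \<alpha> T)\<close>, and are absorbed by half of \<open>\<beta> \<parallel>h\<parallel>\<^sup>2\<close> because \<open>\<beta> \<ge> 2 exp (- \<lambda> \<alpha> T)\<close>. On the
  triangle and on \<open>(0, 2\<alpha> - \<epsilon>)\<close> the weight is at least \<open>exp (- 2 \<lambda> (2\<alpha> - \<epsilon>))\<close>, which gives the inequality, and
  the inequality at the point \<open>(1 - s) w\<^sub>1 + s w\<^sub>2\<close> gives strict convexity.

  Two domination arguments carry the weight. First, the weight decreases in \<open>t\<close> and in \<open>x\<close>, so it can be
  moved inside a primitive that starts at \<open>0\<close> (\<open>kern_integral_weighted_le\<close>): \<open>(S h)\<^sup>2 \<phi>\<close> is bounded by a
  function of \<open>x\<close> alone and, as \<open>h\<close> vanishes at \<open>x = 0\<close>, \<open>h\<^sup>2 \<phi>\<close> by a function of \<open>t\<close> alone, both with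
  integral bounded by the energy. Secondly, \<open>w\<close>, \<open>w\<^sub>x\<close>, \<open>w\<^sub>t\<close> are bounded for \<open>w\<close> in \<open>H\<^sup>3\<close>, but \<open>A w\<close>, which is
  only in \<open>H\<^sup>1\<close>, need not be. It satisfies, however, \<open>(A w)\<^sup>2 \<le> p(t)\<close> and \<open>(A w)\<^sup>2 \<le> q(x)\<close> with integrable
  \<open>p\<close>, \<open>q\<close> (\<open>A_op_slice_bounds\<close>), and the product of a function of \<open>t\<close> with a function of \<open>x\<close> is integrable
  (\<open>weighted_second_order_bound\<close>).

  The gradient is obtained from the Riesz theorem on \<open>H\<^sub>0\<^sup>3\<close>, a closed subspace of the complete space
  \<open>H\<^sup>3\<close>. Completeness rests on the completeness of \<open>L\<^sup>2\<close> and the fundamental lemma of the calculus of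
  variations. All facts about traces and pointwise bounds come from one formula: a function on a
  rectangle with a weak derivative in one variable is a primitive of it up to a function of the other
  variable (\<open>primitive_representation\<close>). A trace is that function, read off at the given height
  (\<open>trace_representation\<close>). Existence of traces needs the density of smooth functions in \<open>H\<^sup>1\<close>: an
  element orthogonal to the functions \<open>cos (k \<pi> x / a) cos (l \<pi> t / b)\<close> in \<open>H\<^sup>1\<close> is orthogonal to them in
  \<open>L\<^sup>2\<close>, since they satisfy Neumann conditions, and hence vanishes by the Stone-Weierstrass theorem.
\<close>

section \<open>Smooth functions\<close>

lemma pderivs_append: "pderivs (as @ bs) f = pderivs as (pderivs bs f)"
  by (induction as) simp_all

text \<open>A family of differentiable functions that is closed under partial derivatives consists of
  smooth functions: no derivative of higher order has to be computed.\<close>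

lemma smooth_coinduct:
  assumes "f \<in> P"
    and diff: "\<And>f. f \<in> P \<Longrightarrow> f differentiable_on UNIV"
    and closed: "\<And>f b. f \<in> P \<Longrightarrow> b \<in> Basis \<Longrightarrow> pderivs [b] f \<in> P"
  shows "smooth f"
proof -
  have "pderivs bs f \<in> P" if "set bs \<subseteq> Basis" for bs
    using that by (induction bs) (use assms(1) closed in auto)
  then show ?thesis by (auto simp: smooth_def diff)
qed

lemma smooth_differentiable: "smooth f \<Longrightarrow> f differentiable (at x)"
  unfolding smooth_def by (metis differentiable_on_eq_differentiable_at empty_set empty_subsetI open_UNIV pderivs.simps(1) iso_tuple_UNIV_I)

lemma smooth_pderivs: "smooth f \<Longrightarrow> set bs \<subseteq> Basis \<Longrightarrow> smooth (pderivs bs f)"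
  unfolding smooth_def by (metis pderivs_append le_sup_iff set_append)

lemma smooth_pderiv: "smooth f \<Longrightarrow> b \<in> Basis \<Longrightarrow> smooth (\<lambda>x. frechet_derivative f (at x) b)"
  using smooth_pderivs[of f "[b]"] by simp

lemma smooth_continuous_on: "smooth f \<Longrightarrow> continuous_on S f"
  by (meson continuous_at_imp_continuous_on differentiable_imp_continuous_within smooth_differentiable)

lemma smooth_measurable: "smooth f \<Longrightarrow> f \<in> borel_measurable borel"
  by (intro borel_measurable_continuous_onI smooth_continuous_on)

lemma has_derivative_frechet: "f differentiable (at x) \<Longrightarrow> (f has_derivative frechet_derivative f (at x)) (at x)"
  by (simp add: frechet_derivative_works)

lemma frechet_derivative_eq: "(f has_derivative f') (at x) \<Longrightarrow> frechet_derivative f (at x) = f'"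
  using frechet_derivative_at by blast

text \<open>The product rule leads from \<open>f g\<close> to a sum of products, so smoothness of
  products is proved for the whole algebra generated by the smooth functions, which is closed under
  partial derivatives.\<close>

inductive_set smooth_alg :: "('a::euclidean_space \<Rightarrow> real) set" where
  base: "smooth f \<Longrightarrow> f \<in> smooth_alg"
| add: "f \<in> smooth_alg \<Longrightarrow> g \<in> smooth_alg \<Longrightarrow> (\<lambda>x. f x + g x) \<in> smooth_alg"
| mult: "f \<in> smooth_alg \<Longrightarrow> g \<in> smooth_alg \<Longrightarrow> (\<lambda>x. f x * g x) \<in> smooth_alg"

lemma smooth_alg_step:
  assumes "f \<in> smooth_alg"
  shows "(\<forall>x. f differentiable (at x)) \<and> (\<forall>b\<in>Basis. pderivs [b] f \<in> smooth_alg)"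
  using assms
proof induction
  case (base f)
  then show ?case by (auto simp: smooth_differentiable intro!: smooth_alg.base smooth_pderiv)
next
  case (add f g)
  have "frechet_derivative (\<lambda>x. f x + g x) (at x) =
      (\<lambda>h. frechet_derivative f (at x) h + frechet_derivative g (at x) h)" for x
    by (intro frechet_derivative_eq has_derivative_add has_derivative_frechet) (use add in blast)+
  with add show ?case by (auto intro!: smooth_alg.add)
next
  case (mult f g)
  have "frechet_derivative (\<lambda>x. f x * g x) (at x) =
      (\<lambda>h. f x * frechet_derivative g (at x) h + frechet_derivative f (at x) h * g x)" for x
    by (intro frechet_derivative_eq has_derivative_mult has_derivative_frechet) (use mult in blast)+
  with mult show ?case by (auto intro!: smooth_alg.add smooth_alg.mult)
qed

lemma smooth_alg_smooth: "f \<in> smooth_alg \<Longrightarrow> smooth f"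
  by (rule smooth_coinduct[of _ smooth_alg])
    (use smooth_alg_step in \<open>auto simp: differentiable_on_eq_differentiable_at\<close>)

lemma smooth_add: "smooth f \<Longrightarrow> smooth g \<Longrightarrow> smooth (\<lambda>x. f x + g x)"
  and smooth_mult: "smooth f \<Longrightarrow> smooth g \<Longrightarrow> smooth (\<lambda>x. f x * g x)"
  by (blast intro: smooth_alg_smooth smooth_alg.intros)+

lemma smooth_const: "smooth (\<lambda>x::'a::euclidean_space. c)"
  by (rule smooth_coinduct[of _ "range (\<lambda>c x. c)"]) auto

lemma smooth_cmult: "smooth f \<Longrightarrow> smooth (\<lambda>x. c * f x)"
  by (intro smooth_mult smooth_const)

lemma smooth_diff: "smooth f \<Longrightarrow> smooth g \<Longrightarrow> smooth (\<lambda>x. f x - g x)"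
  using smooth_add[of f "\<lambda>x. (-1) * g x"] smooth_cmult[of g "-1"] by simp

lemma smooth_power: "smooth f \<Longrightarrow> smooth (\<lambda>x. f x ^ n)"
  by (induction n) (auto intro: smooth_mult smooth_const)

lemma smooth_prod: "(\<And>i. i \<in> I \<Longrightarrow> smooth (f i)) \<Longrightarrow> smooth (\<lambda>x. \<Prod>i\<in>I. f i x)"
  by (induction I rule: infinite_finite_induct) (auto intro: smooth_mult smooth_const)

lemma smooth_antideriv:
  fixes f :: "real \<Rightarrow> real"
  assumes "\<And>x. (f has_real_derivative f' x) (at x)" "smooth f'"
  shows "smooth f"
proof (rule smooth_coinduct[of _ "insert f {g. smooth g}"])
  have *: "frechet_derivative f (at x) = (\<lambda>h. f' x * h)" for x
    using assms(1)[of x] by (intro frechet_derivative_eq) (simp add: has_field_derivative_def)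
  show "pderivs [b] g \<in> insert f {g. smooth g}" if "g \<in> insert f {g. smooth g}" "b \<in> Basis" for g b
    using that assms(2) smooth_pderiv[of g b] by (auto simp: *)
  show "g differentiable_on UNIV" if "g \<in> insert f {g. smooth g}" for g
    using that assms(1) smooth_differentiable[of g] has_field_derivative_imp_has_derivative
    unfolding differentiable_on_eq_differentiable_at[OF open_UNIV] differentiable_def by blast
qed simp

lemma smooth_cos: "smooth (\<lambda>x::real. cos (k * x))"
proof (rule smooth_coinduct[of _ "range (\<lambda>(a, b) x. a * cos (k * x) + b * sin (k * x))"])
  show "(\<lambda>x. cos (k * x)) \<in> range (\<lambda>(a, b) x. a * cos (k * x) + b * sin (k * x))"
    by (rule image_eqI[of _ _ "(1, 0)"]) auto
  have *: "((\<lambda>x. a * cos (k * x) + b * sin (k * x)) has_derivative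
     (\<lambda>h. h * ((b * k) * cos (k * x) + (- a * k) * sin (k * x)))) (at x)" for a b x
    by (auto intro!: derivative_eq_intros ext simp: algebra_simps)
  show "f differentiable_on UNIV" if "f \<in> range (\<lambda>(a, b) x. a * cos (k * x) + b * sin (k * x))" for f
    using that * by (auto simp: differentiable_on_eq_differentiable_at differentiable_def)
  show "pderivs [b] f \<in> range (\<lambda>(a, b) x. a * cos (k * x) + b * sin (k * x))"
    if "f \<in> range (\<lambda>(a, b) x. a * cos (k * x) + b * sin (k * x))" "b \<in> Basis" for f b
  proof -
    from that obtain a c where f: "f = (\<lambda>x. a * cos (k * x) + c * sin (k * x))" by auto
    show ?thesis
      using that(2) unfolding f pderivs.simps frechet_derivative_eq[OF *]
      by (intro image_eqI[of _ _ "(c * k, - a * k)"]) auto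
  qed
qed

lemma smooth_compose_inner:
  fixes f :: "real \<Rightarrow> real" and b :: "'a::euclidean_space"
  assumes "smooth f"
  shows "smooth (\<lambda>x. f (x \<bullet> b))"
proof (rule smooth_coinduct[of _ "{\<lambda>x. c * f (x \<bullet> b) | c f. smooth f}"])
  show "(\<lambda>x. f (x \<bullet> b)) \<in> {\<lambda>x. c * f (x \<bullet> b) | c f. smooth f}"
    using assms by (auto intro!: exI[of _ 1] exI[of _ f])
  have *: "((\<lambda>x. c * f (x \<bullet> b)) has_derivative
      (\<lambda>h. c * ((h \<bullet> b) * frechet_derivative f (at (x \<bullet> b)) 1))) (at x)"
    if "smooth f" for c f x
  proof -
    have d: "(f has_derivative frechet_derivative f (at (x \<bullet> b))) (at (x \<bullet> b))"
      using that by (intro has_derivative_frechet smooth_differentiable)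
    have "((\<lambda>x. f (x \<bullet> b)) has_derivative (\<lambda>h. frechet_derivative f (at (x \<bullet> b)) (h \<bullet> b))) (at x)"
      by (rule has_derivative_compose[where f="\<lambda>x. x \<bullet> b" and g=f and f'="\<lambda>h. h \<bullet> b", OF _ d])
        (rule has_derivative_inner_left[OF has_derivative_ident])
    from has_derivative_mult_right[OF this, of c]
    have "((\<lambda>x. c * f (x \<bullet> b)) has_derivative
      (\<lambda>h. c * frechet_derivative f (at (x \<bullet> b)) (h \<bullet> b))) (at x)" .
    moreover have "frechet_derivative f (at (x \<bullet> b)) (h \<bullet> b) = (h \<bullet> b) * frechet_derivative f (at (x \<bullet> b)) 1" for h
      using linear_frechet_derivative[OF smooth_differentiable[OF that], of "x \<bullet> b"]
        linear_scale[of "frechet_derivative f (at (x \<bullet> b))" "h \<bullet> b" 1] by (simp only: real_scaleR_def mult_1_right)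
    ultimately show ?thesis by (simp only:)
  qed
  show "g differentiable_on UNIV" if "g \<in> {\<lambda>x. c * f (x \<bullet> b) | c f. smooth f}" for g
  proof -
    from that obtain c f where f: "g = (\<lambda>x. c * f (x \<bullet> b))" "smooth f" by auto
    show ?thesis
      unfolding f differentiable_on_eq_differentiable_at[OF open_UNIV] differentiable_def
      using *[OF f(2)] by blast
  qed
  show "pderivs [i] g \<in> {\<lambda>x. c * f (x \<bullet> b) | c f. smooth f}"
    if "g \<in> {\<lambda>x. c * f (x \<bullet> b) | c f. smooth f}" "i \<in> Basis" for g i
  proof -
    from that obtain c f where f: "g = (\<lambda>x. c * f (x \<bullet> b))" "smooth f" by auto
    show ?thesis
      unfolding f pderivs.simps frechet_derivative_eq[OF *[OF f(2)]] mem_Collect_eq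
      by (intro exI[of _ "c * (i \<bullet> b)"] exI[of _ "\<lambda>y. frechet_derivative f (at y) 1"] conjI)
        (use f in \<open>simp_all add: smooth_pderiv mult.assoc\<close>)
  qed
qed

section \<open>Test functions\<close>

text \<open>The standard function that is flat at \<open>0\<close> without vanishing to the right of
  it.\<close>

definition flat_exp :: "real \<Rightarrow> real" where
  "flat_exp x = (if x > 0 then exp (- 1 / x) else 0)"

lemma tendsto_poly_mult_exp_neg: "((\<lambda>y::real. poly p y * exp (- y)) \<longlongrightarrow> 0) at_top"
proof -
  have "((\<lambda>y::real. (\<Sum>i\<le>degree p. coeff p i * (y ^ i / exp y))) \<longlongrightarrow> (\<Sum>i\<le>degree p. coeff p i * 0)) at_top"
    by (intro tendsto_intros tendsto_power_div_exp_0)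
  then show ?thesis
    by (simp add: poly_altdef exp_minus sum_distrib_right divide_inverse mult.assoc)
qed

lemma smooth_flat_exp: "smooth flat_exp"
proof -
  \<comment> \<open>Functions \<open>p (1 / x) exp (- 1 / x)\<close> with a polynomial
    \<open>p\<close> are closed under differentiation.\<close>
  define F where "F p = (\<lambda>x. if x > 0 then poly p (1 / x) * exp (- 1 / x) else 0)" for p :: "real poly" and x :: real
  have F_deriv: "(F p has_real_derivative F ([:0, 0, 1:] * (p - pderiv p)) x) (at x)" for p x
  proof -
    consider "x > 0" | "x < 0" | "x = 0" by linarith
    then show ?thesis
    proof cases
      case 1
      have "((\<lambda>x. poly p (1 / x) * exp (- 1 / x)) has_real_derivative
          F ([:0, 0, 1:] * (p - pderiv p)) x) (at x)"
        using 1 by (auto intro!: derivative_eq_intros poly_DERIV[THEN DERIV_chain2]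
            simp: F_def field_simps power2_eq_square)
      then show ?thesis
        using 1 has_field_derivative_transform_within_open[of _ _ x "{0<..}" "F p"] by (auto simp: F_def)
    next
      case 2
      have "((\<lambda>x. 0) has_real_derivative F ([:0, 0, 1:] * (p - pderiv p)) x) (at x)"
        using 2 by (simp add: F_def)
      then show ?thesis
        using 2 has_field_derivative_transform_within_open[of "\<lambda>x. 0" _ x "{..<0}" "F p"] by (auto simp: F_def)
    next
      case 3
      have "((\<lambda>y. F p y / y) \<longlongrightarrow> 0) (at_right 0)"
      proof -
        have "((\<lambda>y. poly ([:0, 1:] * p) y * exp (- y)) \<longlongrightarrow> 0) at_top"
          by (rule tendsto_poly_mult_exp_neg)
        then have "((\<lambda>y. poly ([:0, 1:] * p) (inverse y) * exp (- inverse y)) \<longlongrightarrow> 0) (at_right 0)"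
          by (rule filterlim_compose[OF _ filterlim_inverse_at_top_right])
        then show ?thesis
          by (rule Lim_transform_eventually)
            (auto simp: eventually_at_right_field F_def field_simps intro: exI[of _ 1])
      qed
      moreover have "((\<lambda>y. F p y / y) \<longlongrightarrow> 0) (at_left 0)"
        by (rule Lim_transform_eventually[OF tendsto_const])
          (auto simp: eventually_at_left_field F_def intro: exI[of _ "-1"])
      ultimately have "((\<lambda>y. F p y / y) \<longlongrightarrow> 0) (at 0)"
        by (simp add: filterlim_split_at)
      then show ?thesis
        using 3 by (simp add: has_field_derivative_iff F_def)
    qed
  qed
  have "flat_exp = F 1" by (auto simp: F_def flat_exp_def)
  moreover have "smooth (F 1)"
  proof (rule smooth_coinduct[of _ "range F"])
    show "f differentiable_on UNIV" if "f \<in> range F" for f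
      using that F_deriv by (auto simp: differentiable_on_eq_differentiable_at real_differentiable_def)
    show "pderivs [b] f \<in> range F" if "f \<in> range F" "b \<in> Basis" for f b
    proof -
      from that(1) obtain p where p: "f = F p" by (rule imageE)
      have "frechet_derivative (F p) (at x) = (\<lambda>h. F ([:0, 0, 1:] * (p - pderiv p)) x * h)" for x
        using F_deriv[of p x] by (intro frechet_derivative_eq) (simp add: has_field_derivative_def)
      then show ?thesis using that(2) by (auto simp: p)
    qed
  qed auto
  ultimately show ?thesis by simp
qed

lemma flat_exp_bounds: "0 \<le> flat_exp x" "flat_exp x \<le> 1" "flat_exp x > 0 \<longleftrightarrow> x > 0" "flat_exp x = 0 \<longleftrightarrow> x \<le> 0"
  by (auto simp: flat_exp_def)

text \<open>Each factor vanishes on one side of a face, so the product is positive exactly on the open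
  box.\<close>

definition box_bump :: "'a::euclidean_space \<Rightarrow> 'a \<Rightarrow> 'a \<Rightarrow> real" where
  "box_bump a b x = (\<Prod>i\<in>Basis. flat_exp ((x - a) \<bullet> i) * flat_exp ((b - x) \<bullet> i))"

lemma smooth_compose_affine_inner:
  fixes f :: "real \<Rightarrow> real" and b :: "'a::euclidean_space"
  assumes "smooth f"
  shows "smooth (\<lambda>x. f (x \<bullet> b + r))"
proof -
  have "smooth (\<lambda>y. f (y + r))"
  proof (rule smooth_coinduct[of _ "{\<lambda>y. f (y + r) | f. smooth f}"])
    have *: "((\<lambda>y. f (y + r)) has_derivative frechet_derivative f (at (y + r))) (at y)"
      if "smooth f" for f y
      by (rule has_derivative_compose[where f="\<lambda>y. y + r" and g=f and f'="\<lambda>h. h",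
          OF has_derivative_add_const[OF has_derivative_ident]
            has_derivative_frechet[OF smooth_differentiable[OF that]]])
    show "g differentiable_on UNIV" if "g \<in> {\<lambda>y. f (y + r) | f. smooth f}" for g
    proof -
      from that obtain f where f: "g = (\<lambda>x. f (x + r))" "smooth f" by auto
      show ?thesis
        unfolding f differentiable_on_eq_differentiable_at[OF open_UNIV] differentiable_def
        using *[OF f(2)] by blast
    qed
    show "pderivs [i] g \<in> {\<lambda>y. f (y + r) | f. smooth f}"
      if g: "g \<in> {\<lambda>y. f (y + r) | f. smooth f}" "i \<in> Basis" for g i
    proof -
      from g obtain f where f: "g = (\<lambda>y. f (y + r))" "smooth f" by auto
      show ?thesis
        unfolding f pderivs.simps frechet_derivative_eq[OF *[OF f(2)]] mem_Collect_eq
        by (rule exI[of _ "\<lambda>x. frechet_derivative f (at x) i"], rule conjI[OF refl smooth_pderiv[OF f(2) g(2)]])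
    qed
  qed (use assms in auto)
  from smooth_compose_inner[OF this, of b] show ?thesis by simp
qed

lemma smooth_box_bump: "smooth (box_bump a b)"
proof -
  have "smooth (\<lambda>x::'a. flat_exp (x \<bullet> i + - (a \<bullet> i)))" for i
    by (rule smooth_compose_affine_inner[OF smooth_flat_exp])
  then have 1: "smooth (\<lambda>x::'a. flat_exp ((x - a) \<bullet> i))" for i by (simp add: inner_diff_left)
  have "smooth (\<lambda>x::'a. flat_exp (x \<bullet> (- i) + b \<bullet> i))" for i
    by (rule smooth_compose_affine_inner[OF smooth_flat_exp])
  then have 2: "smooth (\<lambda>x::'a. flat_exp ((b - x) \<bullet> i))" for i by (simp add: inner_diff_left)
  show ?thesis
    unfolding box_bump_def[abs_def] by (rule smooth_prod, rule smooth_mult[OF 1 2])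
qed

lemma box_bump_bounds: "0 \<le> box_bump a b x" "box_bump a b x \<le> 1"
proof -
  have *: "0 \<le> flat_exp ((x - a) \<bullet> i) * flat_exp ((b - x) \<bullet> i)"
    "flat_exp ((x - a) \<bullet> i) * flat_exp ((b - x) \<bullet> i) \<le> 1" for i
    by (simp_all add: flat_exp_bounds mult_le_one)
  show "0 \<le> box_bump a b x" "box_bump a b x \<le> 1"
    unfolding box_bump_def using * by (auto intro: prod_nonneg prod_le_1)
qed

lemma box_bump_eq_0_iff: "box_bump a b x = 0 \<longleftrightarrow> x \<notin> box a b"
  unfolding box_bump_def mem_box prod_zero_iff[OF finite_Basis] mult_eq_0_iff flat_exp_bounds
  by (auto simp: inner_diff_left not_less)

lemma test_fun_cmult: "test_fun S f \<Longrightarrow> test_fun S (\<lambda>x. c * f x)"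
proof (cases "c = 0")
  case True then show ?thesis
    by (auto simp: test_fun_def smooth_const)
next
  case False then show "test_fun S f \<Longrightarrow> ?thesis"
    by (auto simp: test_fun_def smooth_cmult)
qed

lemma test_fun_supportI:
  assumes "smooth f" "compact K" "K \<subseteq> S" "\<And>x. x \<notin> K \<Longrightarrow> f x = 0"
  shows "test_fun S f"
proof -
  have "closure {x. f x \<noteq> 0} \<subseteq> K"
    by (rule closure_minimal) (use assms in \<open>auto simp: compact_imp_closed\<close>)
  moreover from this have "compact (closure {x. f x \<noteq> 0})"
    by (intro compact_closure[THEN iffD2]) (meson assms(2) bounded_subset closure_subset compact_imp_bounded)
  ultimately show ?thesis using assms by (simp add: test_fun_def)
qed

lemma test_fun_supportE:
  assumes "test_fun S f"
  obtains K where "smooth f" "compact K" "K \<subseteq> S" "\<And>x. x \<notin> K \<Longrightarrow> f x = 0"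
proof (rule that)
  show "f x = 0" if "x \<notin> closure {x. f x \<noteq> 0}" for x
    using that closure_subset[of "{x. f x \<noteq> 0}"] by blast
qed (use assms in \<open>simp_all add: test_fun_def\<close>)

lemma test_fun_add: "test_fun S f \<Longrightarrow> test_fun S g \<Longrightarrow> test_fun S (\<lambda>x. f x + g x)"
proof (elim test_fun_supportE)
  fix K L assume "smooth f" "compact K" "K \<subseteq> S" "\<And>x. x \<notin> K \<Longrightarrow> f x = 0"
   "smooth g" "compact L" "L \<subseteq> S" "\<And>x. x \<notin> L \<Longrightarrow> g x = 0"
  then show ?thesis
    by (intro test_fun_supportI[of _ "K \<union> L"]) (auto intro: smooth_add)
qed

lemma test_fun_mono: "test_fun S f \<Longrightarrow> S \<subseteq> S' \<Longrightarrow> test_fun S' f"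
  by (auto simp: test_fun_def)

lemma pderiv_eq_0_outside:
  fixes f :: "'a::euclidean_space \<Rightarrow> real"
  assumes "closed K" "\<And>x. x \<notin> K \<Longrightarrow> f x = 0" "x \<notin> K"
  shows "pderivs bs f x = 0"
  using \<open>x \<notin> K\<close>
proof (induction bs arbitrary: x)
  case (Cons b bs)
  have "(pderivs bs f has_derivative (\<lambda>_. 0)) (at x)"
    using has_derivative_const
    by (rule has_derivative_transform_within_open[of _ _ _ _ "- K"])
      (use Cons assms(1) in auto)
  then show ?case by (simp add: frechet_derivative_eq)
qed (use assms in auto)

lemma test_fun_pderivs:
  assumes "test_fun S f" "set bs \<subseteq> Basis"
  shows "test_fun S (pderivs bs f)"
  using assms(1)
proof (rule test_fun_supportE)
  fix K assume "smooth f" "compact K" "K \<subseteq> S" "\<And>x. x \<notin> K \<Longrightarrow> f x = 0"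
  then show ?thesis
    by (intro test_fun_supportI[of _ K] smooth_pderivs assms)
      (simp_all add: pderiv_eq_0_outside[of K f] compact_imp_closed)
qed

text \<open>The indicator of a box is a bounded pointwise limit of test functions: with
  \<open>\<beta>\<close> the bump of the box, \<open>1 - (1 - \<beta>)\<^sup>n\<close> vanishes wherever \<open>\<beta>\<close> does and tends to \<open>1\<close> elsewhere.\<close>

definition box_plateau :: "'a::euclidean_space \<Rightarrow> 'a \<Rightarrow> nat \<Rightarrow> 'a \<Rightarrow> real" where
  "box_plateau a b n x = 1 - (1 - box_bump a b x) ^ n"

lemma test_fun_box_plateau:
  assumes "cbox a b \<subseteq> S"
  shows "test_fun S (box_plateau a b n)"
proof (rule test_fun_supportI[of _ "cbox a b"])
  show "smooth (box_plateau a b n)" unfolding box_plateau_def[abs_def]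
    by (intro smooth_diff smooth_const smooth_power smooth_box_bump)
  show "box_plateau a b n x = 0" if "x \<notin> cbox a b" for x
    using that box_bump_eq_0_iff[of a b x] box_subset_cbox[of a b] by (auto simp: box_plateau_def)
qed (use assms in auto)

lemma box_plateau_bounds: "\<bar>box_plateau a b n x\<bar> \<le> 1"
  using box_bump_bounds[of a b x] power_le_one[of "1 - box_bump a b x" n]
    zero_le_power[of "1 - box_bump a b x" n]
  by (auto simp: box_plateau_def)

lemma box_plateau_tendsto: "(\<lambda>n. box_plateau a b n x) \<longlonglongrightarrow> indicator (box a b) x"
proof (cases "x \<in> box a b")
  case True
  then have "box_bump a b x > 0" using box_bump_bounds[of a b x] box_bump_eq_0_iff[of a b x] by auto
  then have "(\<lambda>n. 1 - (1 - box_bump a b x) ^ n) \<longlonglongrightarrow> 1 - 0"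
    using box_bump_bounds[of a b x] by (intro tendsto_intros LIMSEQ_realpow_zero) auto
  then show ?thesis using True by (simp add: box_plateau_def)
next
  case False
  then have "box_bump a b x = 0" by (simp add: box_bump_eq_0_iff)
  with False show ?thesis by (simp add: box_plateau_def)
qed

section \<open>Square integrable functions\<close>

abbreviation lres :: "'a::euclidean_space set \<Rightarrow> 'a measure" where
  "lres S \<equiv> restrict_space lborel S"

lemma space_lres [simp]: "space (lres S) = S"
  by (simp add: space_restrict_space)

lemma lres_simps:
  fixes f :: "'a::euclidean_space \<Rightarrow> real"
  assumes "S \<in> sets borel"
  shows set_borel_measurable_lres: "set_borel_measurable lborel S f \<longleftrightarrow> f \<in> borel_measurable (lres S)"
    and set_integrable_lres: "set_integrable lborel S f \<longleftrightarrow> integrable (lres S) f"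
    and set_integral_lres: "(LINT x:S|lborel. f x) = (LINT x|lres S. f x)"
  using assms
  by (simp_all add: set_borel_measurable_def borel_measurable_restrict_space_iff set_integrable_def
      integrable_restrict_space set_lebesgue_integral_def integral_restrict_space)

lemma AE_lres_iff:
  assumes "S \<in> sets borel"
  shows "(AE x in lres S. P x) \<longleftrightarrow> (AE x in lborel. x \<in> S \<longrightarrow> P x)"
  using assms by (simp add: AE_restrict_space_iff)

lemma AE_lres_mono: "AE x in lres S. P x \<Longrightarrow> A \<subseteq> S \<Longrightarrow> S \<in> sets borel \<Longrightarrow> A \<in> sets borel \<Longrightarrow> AE x in lres A. P x"
  by (simp add: AE_lres_iff) (auto elim: AE_mp)

lemma lres_measurable_mono:
  assumes "f \<in> borel_measurable (lres S)" "A \<subseteq> S" "A \<in> sets borel" "S \<in> sets borel"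
  shows "f \<in> borel_measurable (lres A)"
proof -
  have "f \<in> borel_measurable (restrict_space (lres S) A)"
    using assms(1) by (rule measurable_restrict_space1)
  then show ?thesis
    using assms by (simp add: restrict_restrict_space Int_absorb1)
qed

lemma finite_measure_lres:
  assumes "bounded S" "S \<in> sets borel"
  shows "finite_measure (lres S)"
proof
  have "emeasure lborel S < \<infinity>" using assms(1) emeasure_bounded_finite by blast
  then show "emeasure (lres S) (space (lres S)) \<noteq> \<infinity>"
    using assms by (simp add: emeasure_restrict_space)
qed

definition sq_integrable :: "'a measure \<Rightarrow> ('a \<Rightarrow> real) \<Rightarrow> bool" where
  "sq_integrable M u \<longleftrightarrow> u \<in> borel_measurable M \<and> integrable M (\<lambda>x. (u x)\<^sup>2)"

lemma L2_iff_sq_integrable: "S \<in> sets borel \<Longrightarrow> u \<in> L2 S \<longleftrightarrow> sq_integrable (lres S) u"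
  by (simp add: L2_def sq_integrable_def lres_simps)

lemma sq_integrable_measurable [measurable_dest]: "sq_integrable M u \<Longrightarrow> u \<in> borel_measurable M"
  by (simp add: sq_integrable_def)

lemma sq_integrable_mult:
  assumes "sq_integrable M u" "sq_integrable M v"
  shows "integrable M (\<lambda>x. u x * v x)"
proof (rule Bochner_Integration.integrable_bound)
  show "integrable M (\<lambda>x. (u x)\<^sup>2 + (v x)\<^sup>2)" using assms by (simp add: sq_integrable_def)
  show "(\<lambda>x. u x * v x) \<in> borel_measurable M" using assms by (auto simp: sq_integrable_def)
  have "\<bar>a * b\<bar> \<le> \<bar>a\<^sup>2 + b\<^sup>2\<bar>" for a b :: real
  proof -
    have "2 * (\<bar>a\<bar> * \<bar>b\<bar>) \<le> a\<^sup>2 + b\<^sup>2" using sum_squares_bound[of "\<bar>a\<bar>" "\<bar>b\<bar>"] by simp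
    moreover have "0 \<le> \<bar>a\<bar> * \<bar>b\<bar>" by simp
    ultimately show ?thesis unfolding abs_mult by linarith
  qed
  then show "AE x in M. norm (u x * v x) \<le> norm ((u x)\<^sup>2 + (v x)\<^sup>2)" by simp
qed

lemma sq_integrable_add:
  assumes "sq_integrable M u" "sq_integrable M v"
  shows "sq_integrable M (\<lambda>x. u x + v x)"
  using assms sq_integrable_mult[OF assms]
  by (auto simp: sq_integrable_def power2_sum mult.assoc)

lemma sq_integrable_cmult:
  assumes "sq_integrable M u"
  shows "sq_integrable M (\<lambda>x. c * u x)"
  using assms by (auto simp: sq_integrable_def power_mult_distrib)

lemma sq_integrable_diff:
  assumes "sq_integrable M u" "sq_integrable M v"
  shows "sq_integrable M (\<lambda>x. u x - v x)"
  using sq_integrable_add[OF assms(1) sq_integrable_cmult[OF assms(2), of "-1"]] by simp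

lemma sq_integrable_cong_AE:
  assumes "sq_integrable M u" "v \<in> borel_measurable M" "AE x in M. u x = v x"
  shows "sq_integrable M v"
proof -
  have "integrable M (\<lambda>x. (v x)\<^sup>2) \<longleftrightarrow> integrable M (\<lambda>x. (u x)\<^sup>2)"
    using assms by (intro integrable_cong_AE) (auto simp: sq_integrable_def)
  with assms show ?thesis by (simp add: sq_integrable_def)
qed

lemma sq_integrable_bound:
  assumes "sq_integrable M u" "v \<in> borel_measurable M" "AE x in M. \<bar>v x\<bar> \<le> \<bar>u x\<bar>"
  shows "sq_integrable M v"
proof -
  have "integrable M (\<lambda>x. (v x)\<^sup>2)"
  proof (rule Bochner_Integration.integrable_bound)
    show "integrable M (\<lambda>x. (u x)\<^sup>2)" using assms by (simp add: sq_integrable_def)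
    show "AE x in M. norm ((v x)\<^sup>2) \<le> norm ((u x)\<^sup>2)"
      using assms(3) by eventually_elim (simp add: abs_le_square_iff)
  qed (use assms in simp)
  with assms show ?thesis by (simp add: sq_integrable_def)
qed

lemma (in finite_measure) sq_integrable_const: "sq_integrable M (\<lambda>_. c)"
  by (simp add: sq_integrable_def)

lemma (in finite_measure) sq_integrable_bounded:
  assumes "u \<in> borel_measurable M" "AE x in M. \<bar>u x\<bar> \<le> c"
  shows "sq_integrable M u"
  by (rule sq_integrable_bound[OF sq_integrable_const[of c] assms(1)])
    (use assms(2) in \<open>eventually_elim, simp\<close>)

lemma (in finite_measure) sq_integrable_integrable:
  "sq_integrable M u \<Longrightarrow> integrable M u"
  using sq_integrable_mult[OF _ sq_integrable_const[of 1], of u] by simp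

lemma quadratic_nonneg_discriminant:
  fixes a b c :: real
  assumes "\<And>r. 0 \<le> a + 2 * r * b + r\<^sup>2 * c" "0 \<le> c"
  shows "b\<^sup>2 \<le> a * c"
proof (cases "c = 0")
  case True
  have "b = 0"
  proof (rule ccontr)
    assume "b \<noteq> 0"
    then show False using assms(1)[of "- (a + 1) / (2 * b)"] True by (simp add: field_simps)
  qed
  then show ?thesis using True by simp
next
  case False
  with assms(2) have c: "c > 0" by simp
  have "0 \<le> (a + 2 * (- b / c) * b + (- b / c)\<^sup>2 * c) * c"
    using assms(1)[of "- b / c"] c by (intro mult_nonneg_nonneg) auto
  also have "\<dots> = a * c - b\<^sup>2" using c by (simp add: field_simps power2_eq_square)
  finally show ?thesis by simp
qed

lemma Cauchy_Schwarz_integral: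
  assumes "sq_integrable M u" "sq_integrable M v"
  shows "(LINT x|M. u x * v x)\<^sup>2 \<le> (LINT x|M. (u x)\<^sup>2) * (LINT x|M. (v x)\<^sup>2)"
proof (rule quadratic_nonneg_discriminant)
  fix r
  have i: "integrable M (\<lambda>x. (u x)\<^sup>2)" "integrable M (\<lambda>x. (v x)\<^sup>2)" "integrable M (\<lambda>x. u x * v x)"
    using assms sq_integrable_mult by (auto simp: sq_integrable_def)
  have "0 \<le> (LINT x|M. (u x + r * v x)\<^sup>2)" by simp
  also have "(\<lambda>x. (u x + r * v x)\<^sup>2) = (\<lambda>x. (u x)\<^sup>2 + 2 * r * (u x * v x) + r\<^sup>2 * (v x)\<^sup>2)"
    by (auto simp: power2_eq_square algebra_simps)
  also have "(LINT x|M. \<dots> x) = (LINT x|M. (u x)\<^sup>2) + 2 * r * (LINT x|M. u x * v x) + r\<^sup>2 * (LINT x|M. (v x)\<^sup>2)"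
    using i by simp
  finally show "0 \<le> (LINT x|M. (u x)\<^sup>2) + 2 * r * (LINT x|M. u x * v x) + r\<^sup>2 * (LINT x|M. (v x)\<^sup>2)" .
qed simp

lemma (in finite_measure) square_integral_le:
  assumes "sq_integrable M u"
  shows "(LINT x|M. u x)\<^sup>2 \<le> measure M (space M) * (LINT x|M. (u x)\<^sup>2)"
  using Cauchy_Schwarz_integral[OF sq_integrable_const[of 1] assms] by simp

text \<open>The Riesz-Fischer theorem. On a finite measure, a Cauchy sequence in \<open>L\<^sup>2\<close> is Cauchy in \<open>L\<^sup>1\<close>,
  so a subsequence converges almost everywhere; Fatou's lemma turns this into \<open>L\<^sup>2\<close> convergence.\<close>

lemma (in finite_measure) L2_complete:
  fixes s :: "nat \<Rightarrow> 'a \<Rightarrow> real"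
  assumes s: "\<And>n. sq_integrable M (s n)"
    and Cauchy: "\<And>e. e > 0 \<Longrightarrow> \<exists>N. \<forall>m\<ge>N. \<forall>n\<ge>N. (LINT x|M. (s m x - s n x)\<^sup>2) < e"
  shows "\<exists>u. sq_integrable M u \<and> (\<lambda>n. LINT x|M. (s n x - u x)\<^sup>2) \<longlonglongrightarrow> 0"
proof -
  let ?\<mu> = "measure M (space M)"
  have [measurable]: "s n \<in> borel_measurable M" for n using s by auto
  have "\<exists>N. \<forall>i\<ge>N. \<forall>j\<ge>N. (LINT x|M. norm (s i x - s j x)) < e" if "e > 0" for e
  proof -
    obtain N where N: "\<forall>m\<ge>N. \<forall>n\<ge>N. (LINT x|M. (s m x - s n x)\<^sup>2) < e\<^sup>2 / (?\<mu> + 1)"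
      using Cauchy[of "e\<^sup>2 / (?\<mu> + 1)"] \<open>e > 0\<close> by (auto simp: add_nonneg_pos)
    have "(LINT x|M. norm (s i x - s j x)) < e" if "i \<ge> N" "j \<ge> N" for i j
    proof (rule power2_less_imp_less)
      have "sq_integrable M (\<lambda>x. norm (s i x - s j x))"
        using sq_integrable_diff[OF s s, of i j] by (simp add: sq_integrable_def)
      from square_integral_le[OF this]
      have "(LINT x|M. norm (s i x - s j x))\<^sup>2 \<le> ?\<mu> * (LINT x|M. (s i x - s j x)\<^sup>2)" by simp
      also have "\<dots> \<le> ?\<mu> * (e\<^sup>2 / (?\<mu> + 1))"
        using N that by (intro mult_left_mono) (auto intro: less_imp_le)
      also have "\<dots> = e\<^sup>2 * (?\<mu> / (?\<mu> + 1))" by simp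
      also have "\<dots> < e\<^sup>2 * 1"
        using \<open>e > 0\<close> by (intro mult_strict_left_mono) (auto simp: divide_less_eq add_nonneg_pos)
      finally show "(LINT x|M. norm (s i x - s j x))\<^sup>2 < e\<^sup>2" by simp
    qed (use \<open>e > 0\<close> in simp)
    then show ?thesis by blast
  qed
  \<comment> \<open>The almost everywhere limit of a subsequence is the candidate.\<close>
  from cauchy_L1_AE_cauchy_subseq[OF sq_integrable_integrable[OF s] this]
  obtain r where r: "strict_mono r" "AE x in M. Cauchy (\<lambda>i. s (r i) x)" by blast
  define u where "u x = lim (\<lambda>i. s (r i) x)" for x
  have [measurable]: "u \<in> borel_measurable M" unfolding u_def[abs_def] by measurable
  have lim: "AE x in M. (\<lambda>i. s (r i) x) \<longlonglongrightarrow> u x"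
    using r(2) by eventually_elim (simp add: Cauchy_convergent convergent_LIMSEQ_iff[symmetric] u_def)
  have bound: "\<exists>N. \<forall>n\<ge>N. (\<integral>\<^sup>+x. ennreal ((s n x - u x)\<^sup>2) \<partial>M) \<le> ennreal e" if "e > 0" for e
  proof -
    obtain N where N: "\<And>m n. m \<ge> N \<Longrightarrow> n \<ge> N \<Longrightarrow> (LINT x|M. (s m x - s n x)\<^sup>2) < e"
      using Cauchy[OF \<open>e > 0\<close>] by blast
    have "(\<integral>\<^sup>+x. ennreal ((s n x - u x)\<^sup>2) \<partial>M) \<le> ennreal e" if "n \<ge> N" for n
    proof -
      have "(\<integral>\<^sup>+x. ennreal ((s n x - u x)\<^sup>2) \<partial>M) = (\<integral>\<^sup>+x. liminf (\<lambda>i. ennreal ((s n x - s (r i) x)\<^sup>2)) \<partial>M)"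
      proof (rule nn_integral_cong_AE)
        show "AE x in M. ennreal ((s n x - u x)\<^sup>2) = liminf (\<lambda>i. ennreal ((s n x - s (r i) x)\<^sup>2))"
          using lim
        proof eventually_elim
          case (elim x)
          have "(\<lambda>i. ennreal ((s n x - s (r i) x)\<^sup>2)) \<longlonglongrightarrow> ennreal ((s n x - u x)\<^sup>2)"
            by (intro tendsto_ennrealI tendsto_intros elim)
          from lim_imp_Liminf[OF _ this] show ?case by simp
        qed
      qed
      also have "\<dots> \<le> liminf (\<lambda>i. \<integral>\<^sup>+x. ennreal ((s n x - s (r i) x)\<^sup>2) \<partial>M)"
        by (rule nn_integral_liminf) measurable
      also have "\<dots> \<le> ennreal e"
      proof (rule Liminf_le)
        show "\<forall>\<^sub>F i in sequentially. (\<integral>\<^sup>+x. ennreal ((s n x - s (r i) x)\<^sup>2) \<partial>M) \<le> ennreal e"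
          using eventually_ge_at_top[of N]
        proof eventually_elim
          case (elim i)
          have "r i \<ge> N" using elim seq_suble[OF r(1), of i] by simp
          moreover have "integrable M (\<lambda>x. (s n x - s (r i) x)\<^sup>2)"
            using sq_integrable_diff[OF s s] by (simp add: sq_integrable_def)
          ultimately show ?case
            using N[OF \<open>n \<ge> N\<close>, of "r i"] by (subst nn_integral_eq_integral) (auto intro!: ennreal_leI)
        qed
      qed simp
      finally show ?thesis .
    qed
    then show ?thesis by blast
  qed
  have int: "integrable M (\<lambda>x. (s n x - u x)\<^sup>2) \<and> (LINT x|M. (s n x - u x)\<^sup>2) \<le> e"
    if "(\<integral>\<^sup>+x. ennreal ((s n x - u x)\<^sup>2) \<partial>M) \<le> ennreal e" "e > 0" for n e
  proof
    show i: "integrable M (\<lambda>x. (s n x - u x)\<^sup>2)"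
      using that by (intro integrableI_bounded) (auto simp: le_less_trans)
    show "(LINT x|M. (s n x - u x)\<^sup>2) \<le> e"
      using that nn_integral_eq_integral[OF i] by simp
  qed
  have "sq_integrable M u"
  proof -
    obtain N where "(\<integral>\<^sup>+x. ennreal ((s N x - u x)\<^sup>2) \<partial>M) \<le> ennreal 1" using bound[of 1] by auto
    then have "sq_integrable M (\<lambda>x. s N x - u x)" using int[of N 1] by (simp add: sq_integrable_def)
    from sq_integrable_diff[OF s[of N] this] show ?thesis by simp
  qed
  moreover have "(\<lambda>n. LINT x|M. (s n x - u x)\<^sup>2) \<longlonglongrightarrow> 0"
  proof (rule LIMSEQ_I)
    fix e :: real assume "e > 0"
    obtain N where N: "\<forall>n\<ge>N. (\<integral>\<^sup>+x. ennreal ((s n x - u x)\<^sup>2) \<partial>M) \<le> ennreal (e / 2)"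
      using bound[of "e / 2"] \<open>e > 0\<close> by auto
    have "norm ((LINT x|M. (s n x - u x)\<^sup>2) - 0) < e" if "n \<ge> N" for n
      using int[of n "e / 2"] N that \<open>e > 0\<close> by force
    then show "\<exists>N. \<forall>n\<ge>N. norm ((LINT x|M. (s n x - u x)\<^sup>2) - 0) < e" by blast
  qed
  ultimately show ?thesis by blast
qed

section \<open>The fundamental lemma of the calculus of variations\<close>

text \<open>Open boxes are closed under intersection and generate the Borel sets, so the integrals over
  all Borel sets vanish.\<close>

lemma AE_eq_0_if_box_integrals_eq_0:
  fixes f :: "'a::euclidean_space \<Rightarrow> real"
  assumes f: "integrable lborel f" and zero: "\<And>x. x \<notin> box a b \<Longrightarrow> f x = 0"
    and boxes: "\<And>l u. cbox l u \<subseteq> cbox a b \<Longrightarrow> (LINT x:box l u|lborel. f x) = 0"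
  shows "AE x in lborel. f x = 0"
proof (rule sigma_finite_measure.density_zero[OF sigma_finite_lborel f])
  have si: "set_integrable lborel A f" if "A \<in> sets borel" for A
    unfolding set_integrable_def by (rule integrable_mult_indicator) (use that f in auto)
  have total: "(LINT x|lborel. f x) = 0"
  proof -
    have "(LINT x|lborel. f x) = (LINT x:box a b|lborel. f x)"
      unfolding set_lebesgue_integral_def
      by (intro Bochner_Integration.integral_cong) (use zero in \<open>auto simp: indicator_def\<close>)
    then show ?thesis using boxes[of a b] by simp
  qed
  fix A :: "'a set" assume "A \<in> sets lborel"
  then have mem: "A \<in> sigma_sets UNIV (range (\<lambda>(a, b). box a b :: 'a set))"
    by (simp add: borel_eq_box)
  have "Int_stable (range (\<lambda>(a, b). box a b :: 'a set))" "range (\<lambda>(a, b). box a b :: 'a set) \<subseteq> Pow UNIV"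
    by (auto simp: Int_stable_def box_Int_box)
  from this mem show "(LINT x:A|lborel. f x) = 0"
  proof (induction rule: sigma_sets_induct_disjoint)
    case (basic A)
    then obtain l u where A: "A = box l u" by auto
    obtain l' u' where i: "box l u \<inter> box a b = box l' u'" by (auto simp: box_Int_box)
    have "(LINT x:A|lborel. f x) = (LINT x:box l' u'|lborel. f x)"
      unfolding set_lebesgue_integral_def
      by (intro Bochner_Integration.integral_cong)
        (use zero i in \<open>auto simp: A indicator_def set_eq_iff\<close>)
    also have "\<dots> = 0"
    proof (cases "box l' u' = {}")
      case False
      have "cbox l' u' = closure (box l' u')" using False by (simp add: closure_box)
      also have "\<dots> \<subseteq> closure (box a b)" by (rule closure_mono) (use i in blast)
      also have "\<dots> \<subseteq> cbox a b" by (rule closure_minimal) (auto simp: box_subset_cbox)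
      finally show ?thesis by (rule boxes)
    qed (simp add: set_lebesgue_integral_def)
    finally show ?case .
  next
    case (compl A)
    then have A: "A \<in> sets borel" by (simp add: borel_eq_box)
    have "(LINT x:(A \<union> (UNIV - A))|lborel. f x) = (LINT x:A|lborel. f x) + (LINT x:UNIV - A|lborel. f x)"
      by (rule set_integral_Un) (use A si in auto)
    then show ?case using compl total by (simp add: set_lebesgue_integral_def)
  next
    case (union A)
    then have A: "A i \<in> sets borel" for i by (auto simp: borel_eq_box)
    have "(LINT x:(\<Union>i. A i)|lborel. f x) = (\<Sum>i. (LINT x:A i|lborel. f x))"
      by (rule lebesgue_integral_countable_add)
        (use A union(1) si in \<open>auto simp: disjoint_family_on_def\<close>)
    then show ?case using union by simp
  qed (auto simp: set_lebesgue_integral_def)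
qed

text \<open>An open set is a countable union of boxes, which reduces the claim to functions supported in
  one box.\<close>

lemma AE_eq_0_if_all_box_integrals_eq_0:
  fixes u :: "'a::euclidean_space \<Rightarrow> real"
  assumes "open S"
    and int: "\<And>a b. cbox a b \<subseteq> S \<Longrightarrow> set_integrable lborel (box a b) u"
    and zero: "\<And>a b. cbox a b \<subseteq> S \<Longrightarrow> (LINT x:box a b|lborel. u x) = 0"
  shows "AE x in lborel. x \<in> S \<longrightarrow> u x = 0"
proof -
  have box: "AE x in lborel. x \<in> box a b \<longrightarrow> u x = 0" if "cbox a b \<subseteq> S" for a b
  proof -
    have "AE x in lborel. indicator (box a b) x * u x = 0"
    proof (rule AE_eq_0_if_box_integrals_eq_0[of _ a b])
      show "integrable lborel (\<lambda>x. indicator (box a b) x * u x)"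
        using int[OF that] by (simp add: set_integrable_def)
      fix l v assume lv: "cbox l v \<subseteq> cbox a b"
      have sub: "box l v \<subseteq> box a b"
        using interior_mono[OF lv] by (simp add: interior_cbox)
      have "(LINT x:box l v|lborel. indicator (box a b) x * u x) = (LINT x:box l v|lborel. u x)"
        by (rule set_lebesgue_integral_cong) (use sub in \<open>auto simp: indicator_def\<close>)
      then show "(LINT x:box l v|lborel. indicator (box a b) x * u x) = 0"
        using zero[of l v] lv that by auto
    qed auto
    then show ?thesis by eventually_elim (auto simp: indicator_def)
  qed
  obtain \<D> where D: "countable \<D>" "\<D> \<subseteq> Pow S" "\<And>X. X \<in> \<D> \<Longrightarrow> \<exists>a b. X = cbox a b" "\<Union>\<D> = S"
    using open_countable_Union_open_cbox[OF assms(1)] by metis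
  have cbox: "AE x in lborel. x \<in> X \<longrightarrow> u x = 0" if "X \<in> \<D>" for X
  proof -
    obtain a b where X: "X = cbox a b" using D(3)[OF \<open>X \<in> \<D>\<close>] by blast
    have "AE x in lborel. x \<notin> cbox a b - box a b"
      using null_sets_cbox_Diff_box[of a b] by (rule AE_not_in)
    moreover have "AE x in lborel. x \<in> box a b \<longrightarrow> u x = 0"
      using D(2) \<open>X \<in> \<D>\<close> X by (intro box) blast
    ultimately show ?thesis by eventually_elim (auto simp: X)
  qed
  have "AE x in lborel. \<forall>X\<in>\<D>. x \<in> X \<longrightarrow> u x = 0"
    unfolding AE_ball_countable[OF D(1)] using cbox by blast
  then show ?thesis by eventually_elim (use D(4) in blast)
qed

lemma box_plateau_integral_tendsto:
  assumes "integrable M u" "sets M = sets borel"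
  shows "(\<lambda>n. LINT x|M. u x * box_plateau a b n x) \<longlonglongrightarrow> (LINT x|M. u x * indicator (box a b) x)"
proof (rule integral_dominated_convergence)
  show "integrable M (\<lambda>x. \<bar>u x\<bar>)" using assms by simp
  have [measurable]: "u \<in> borel_measurable M" using assms by simp
  have [measurable]: "box_plateau a b n \<in> borel_measurable M" for n
    using smooth_measurable[of "box_plateau a b n"] test_fun_box_plateau[of a b UNIV n] assms(2)
    by (simp add: test_fun_def cong: measurable_cong_sets)
  show "(\<lambda>x. u x * box_plateau a b n x) \<in> borel_measurable M" for n by measurable
  show "(\<lambda>x. u x * indicator (box a b) x) \<in> borel_measurable M"
    using assms(2) by measurable
  show "AE x in M. (\<lambda>n. u x * box_plateau a b n x) \<longlonglongrightarrow> u x * indicator (box a b) x"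
    by (intro AE_I2 tendsto_intros box_plateau_tendsto)
  show "AE x in M. norm (u x * box_plateau a b n x) \<le> \<bar>u x\<bar>" for n
    using box_plateau_bounds[of a b n] by (simp add: abs_mult mult_left_le)
qed

lemma loc_integrable_mult_test_fun:
  assumes "loc_integrable S u" "test_fun S f" "S \<in> sets borel"
  shows "set_integrable lborel S (\<lambda>x. u x * f x)"
  using assms(2)
proof (rule test_fun_supportE)
  fix K assume K: "smooth f" "compact K" "K \<subseteq> S" "\<And>x. x \<notin> K \<Longrightarrow> f x = 0"
  have [measurable]: "f \<in> borel_measurable borel" using K(1) by (rule smooth_measurable)
  have "bounded (f ` K)"
    using K by (intro compact_imp_bounded compact_continuous_image smooth_continuous_on)
  then obtain B where B: "\<And>x. x \<in> K \<Longrightarrow> \<bar>f x\<bar> \<le> B" by (auto simp: bounded_iff)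
  have iK: "integrable lborel (\<lambda>x. indicator K x *\<^sub>R u x)"
    using assms(1) K by (auto simp: loc_integrable_def set_integrable_def)
  have "integrable lborel (\<lambda>x. (indicator K x *\<^sub>R u x) * f x)"
  proof (rule Bochner_Integration.integrable_bound)
    show "integrable lborel (\<lambda>x. B * (indicator K x *\<^sub>R u x))" using iK by simp
    show "(\<lambda>x. (indicator K x *\<^sub>R u x) * f x) \<in> borel_measurable lborel"
      using borel_measurable_integrable[OF iK] by measurable
    have "norm (indicator K x *\<^sub>R u x * f x) \<le> norm (B * (indicator K x *\<^sub>R u x))" for x
    proof (cases "x \<in> K")
      case True
      then have "\<bar>u x\<bar> * \<bar>f x\<bar> \<le> \<bar>u x\<bar> * \<bar>B\<bar>"
        using B[of x] by (intro mult_left_mono) auto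
      then show ?thesis using True by (simp add: abs_mult mult.commute)
    qed simp
    then show "AE x in lborel. norm (indicator K x *\<^sub>R u x * f x) \<le> norm (B * (indicator K x *\<^sub>R u x))"
      by simp
  qed
  moreover have "(\<lambda>x. (indicator K x *\<^sub>R u x) * f x) = (\<lambda>x. indicator S x *\<^sub>R (u x * f x))"
    using K by (auto simp: indicator_def fun_eq_iff)
  ultimately show ?thesis by (simp add: set_integrable_def)
qed

text \<open>An exhaustion by compact sets exhibits the function as a pointwise limit of integrable
  ones.\<close>

lemma loc_integrable_measurable:
  assumes "loc_integrable S u" "open S"
  shows "u \<in> borel_measurable (lres S)"
proof -
  obtain K where K: "\<And>n::nat. compact (K n)" "\<And>n. K n \<subseteq> S" "(\<Union>n. K n) = S" "\<And>n. K n \<subseteq> interior (K (Suc n))"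
    using open_Union_compact_subsets[OF assms(2)] by metis
  have "(\<lambda>x. indicator S x *\<^sub>R u x) \<in> borel_measurable lborel"
  proof (rule borel_measurable_LIMSEQ_real)
    show "(\<lambda>x. indicator (K n) x *\<^sub>R u x) \<in> borel_measurable lborel" for n
    proof -
      have "set_integrable lborel (K n) u"
        using assms(1) K(1,2) unfolding loc_integrable_def by blast
      then show ?thesis unfolding set_integrable_def by (rule borel_measurable_integrable)
    qed
    show "(\<lambda>n. indicator (K n) x *\<^sub>R u x) \<longlonglongrightarrow> indicator S x *\<^sub>R u x" for x
    proof (cases "x \<in> S")
      case True
      then obtain m where "x \<in> K m" using K(3) by blast
      have mono: "K i \<subseteq> K j" if "i \<le> j" for i j
        by (rule lift_Suc_mono_le[of K, OF _ that]) (meson K(4) interior_subset order_trans)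
      have "\<forall>\<^sub>F n in sequentially. indicator (K n) x *\<^sub>R u x = indicator S x *\<^sub>R u x"
        using eventually_ge_at_top[of m]
        by eventually_elim (use mono \<open>x \<in> K m\<close> True in \<open>auto simp: indicator_def\<close>)
      then show ?thesis by (rule tendsto_eventually)
    next
      case False
      then have "x \<notin> K n" for n using K(2) by blast
      with False show ?thesis by simp
    qed
  qed
  then show ?thesis using assms(2) by (simp add: borel_measurable_restrict_space_iff)
qed

text \<open>Plateau functions pass from test functions to indicators of boxes by dominated
  convergence.\<close>

lemma AE_eq_0_if_test_integrals_eq_0:
  fixes u :: "'a::euclidean_space \<Rightarrow> real"
  assumes "open S" "loc_integrable S u"
    and zero: "\<And>f. test_fun S f \<Longrightarrow> (LINT x:S|lborel. u x * f x) = 0"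
  shows "AE x in lborel. x \<in> S \<longrightarrow> u x = 0"
proof (rule AE_eq_0_if_all_box_integrals_eq_0[OF assms(1)])
  fix a b assume ab: "cbox a b \<subseteq> S"
  have cb: "set_integrable lborel (cbox a b) u"
    using assms(2) ab by (auto simp: loc_integrable_def)
  then show b: "set_integrable lborel (box a b) u"
    by (rule set_integrable_subset) (auto simp: box_subset_cbox)
  have out: "box_plateau a b n x = 0" if "x \<notin> cbox a b" for n x
    using that box_bump_eq_0_iff[of a b x] box_subset_cbox[of a b] by (auto simp: box_plateau_def)
  have "(\<lambda>n. LINT x|lborel. (indicator (cbox a b) x *\<^sub>R u x) * box_plateau a b n x)
      \<longlonglongrightarrow> (LINT x|lborel. (indicator (cbox a b) x *\<^sub>R u x) * indicator (box a b) x)"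
    using cb by (intro box_plateau_integral_tendsto) (auto simp: set_integrable_def)
  moreover have "(LINT x|lborel. (indicator (cbox a b) x *\<^sub>R u x) * box_plateau a b n x) = 0" for n
  proof -
    have "(\<lambda>x. (indicator (cbox a b) x *\<^sub>R u x) * box_plateau a b n x)
        = (\<lambda>x. indicator S x *\<^sub>R (u x * box_plateau a b n x))"
    proof
      show "(indicator (cbox a b) x *\<^sub>R u x) * box_plateau a b n x = indicator S x *\<^sub>R (u x * box_plateau a b n x)" for x
        using out[of x n] ab by (cases "x \<in> cbox a b") (auto simp: indicator_def)
    qed
    then show ?thesis
      using zero[OF test_fun_box_plateau[OF ab, of n]] by (simp only: set_lebesgue_integral_def)
  qed
  moreover have "(LINT x|lborel. (indicator (cbox a b) x *\<^sub>R u x) * indicator (box a b) x) = (LINT x:box a b|lborel. u x)"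
    unfolding set_lebesgue_integral_def
    by (intro Bochner_Integration.integral_cong)
      (use box_subset_cbox[of a b] in \<open>auto simp: indicator_def\<close>)
  ultimately show "(LINT x:box a b|lborel. u x) = 0"
    by (simp add: LIMSEQ_const_iff)
qed

section \<open>Restricting Lebesgue measure to a rectangle\<close>

text \<open>With this identity Fubini's theorem applies to integrals over a rectangle.\<close>

lemma lres_Times:
  fixes A :: "'a::euclidean_space set" and B :: "'b::euclidean_space set"
  assumes [measurable]: "A \<in> sets borel" "B \<in> sets borel"
  shows "lres (A \<times> B) = lres A \<Otimes>\<^sub>M lres B"
proof (rule pair_measure_eqI[symmetric])
  show "sigma_finite_measure (lres A)" "sigma_finite_measure (lres B)"
    by (intro sigma_finite_measure_restrict_space sigma_finite_lborel; simp)+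
  have AB: "A \<times> B \<in> sets (lborel \<Otimes>\<^sub>M lborel)" by (intro pair_measureI) simp_all
  show "sets (lres A \<Otimes>\<^sub>M lres B) = sets (lres (A \<times> B))"
  proof
    show "sets (lres A \<Otimes>\<^sub>M lres B) \<subseteq> sets (lres (A \<times> B))"
      unfolding sets_pair_measure space_lres
    proof (rule sets.sigma_sets_subset[of _ "lres (A \<times> B)", simplified])
      show "{a \<times> b | a b. a \<in> sets (lres A) \<and> b \<in> sets (lres B)} \<subseteq> sets (lres (A \<times> B))"
      proof safe
        fix a b assume "a \<in> sets (lres A)" "b \<in> sets (lres B)"
        then have ab: "a \<subseteq> A" "a \<in> sets lborel" "b \<subseteq> B" "b \<in> sets lborel"
          by (auto simp: sets_restrict_space_iff)
        then show "a \<times> b \<in> sets (lres (A \<times> B))"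
          by (subst sets_restrict_space_iff) (auto intro!: borel_Times)
      qed
    qed
  next
    show "sets (lres (A \<times> B)) \<subseteq> sets (lres A \<Otimes>\<^sub>M lres B)"
    proof
      fix C assume "C \<in> sets (lres (A \<times> B))"
      then obtain D where D: "D \<in> sets (lborel \<Otimes>\<^sub>M lborel)" "C = (A \<times> B) \<inter> D"
        unfolding lborel_prod sets_restrict_space by blast
      have "(\<lambda>z. (fst z, snd z)) \<in> measurable (lres A \<Otimes>\<^sub>M lres B) (lborel \<Otimes>\<^sub>M lborel)"
        by (intro measurable_Pair measurable_compose[OF measurable_fst measurable_restrict_space1]
            measurable_compose[OF measurable_snd measurable_restrict_space1]) simp_all
      from measurable_sets[OF this D(1)] show "C \<in> sets (lres A \<Otimes>\<^sub>M lres B)"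
        by (simp add: space_pair_measure D(2) Int_commute)
    qed
  qed
  fix C D assume CD: "C \<in> sets (lres A)" "D \<in> sets (lres B)"
  then have *: "C \<in> sets borel" "D \<in> sets borel" "C \<subseteq> A" "D \<subseteq> B"
    by (auto simp: sets_restrict_space_iff)
  have "emeasure (lres (A \<times> B)) (C \<times> D) = emeasure (lborel \<Otimes>\<^sub>M lborel) (C \<times> D)"
    using * borel_Times[OF assms] by (subst emeasure_restrict_space) (auto simp: lborel_prod)
  also have "\<dots> = emeasure lborel C * emeasure lborel D"
    using * by (intro lborel.emeasure_pair_measure_Times) auto
  finally show "emeasure (lres A) C * emeasure (lres B) D = emeasure (lres (A \<times> B)) (C \<times> D)"
    using * by (simp add: emeasure_restrict_space)
qed

section \<open>The Riesz representation theorem in a complete semi-inner-product space\<close>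

text \<open>Elements of a Sobolev space are represented by functions, and functions that agree almost
  everywhere have distance zero. The inner product is therefore only semi-definite, and completeness
  provides some limit rather than a unique one.\<close>

locale semi_hilbert =
  fixes X :: "('a \<Rightarrow> real) set" and ip :: "('a \<Rightarrow> real) \<Rightarrow> ('a \<Rightarrow> real) \<Rightarrow> real"
  assumes lin_closed: "u \<in> X \<Longrightarrow> v \<in> X \<Longrightarrow> (\<lambda>z. a * u z + b * v z) \<in> X"
    and ip_lin: "u \<in> X \<Longrightarrow> v \<in> X \<Longrightarrow> w \<in> X \<Longrightarrow> ip (\<lambda>z. a * u z + b * v z) w = a * ip u w + b * ip v w"
    and ip_sym: "u \<in> X \<Longrightarrow> v \<in> X \<Longrightarrow> ip u v = ip v u"
    and ip_nonneg: "u \<in> X \<Longrightarrow> 0 \<le> ip u u"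
    and complete: "\<And>s. (\<And>n::nat. s n \<in> X) \<Longrightarrow>
        (\<And>e. e > 0 \<Longrightarrow> \<exists>N. \<forall>m\<ge>N. \<forall>n\<ge>N. ip (\<lambda>z. s m z - s n z) (\<lambda>z. s m z - s n z) < e) \<Longrightarrow>
        \<exists>u\<in>X. (\<lambda>n. ip (\<lambda>z. s n z - u z) (\<lambda>z. s n z - u z)) \<longlonglongrightarrow> 0"
begin

lemma diff_closed: "u \<in> X \<Longrightarrow> v \<in> X \<Longrightarrow> (\<lambda>z. u z - v z) \<in> X"
  using lin_closed[of u v 1 "-1"] by simp

lemma ip_diff: "u \<in> X \<Longrightarrow> v \<in> X \<Longrightarrow> w \<in> X \<Longrightarrow> ip (\<lambda>z. u z - v z) w = ip u w - ip v w"
  using ip_lin[of u v w 1 "-1"] by simp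

lemma ip_lin_lin:
  assumes "u \<in> X" "v \<in> X"
  shows "ip (\<lambda>z. a * u z + b * v z) (\<lambda>z. a * u z + b * v z) = a\<^sup>2 * ip u u + 2 * (a * b) * ip u v + b\<^sup>2 * ip v v"
proof -
  let ?w = "\<lambda>z. a * u z + b * v z"
  have w: "?w \<in> X" using assms by (rule lin_closed)
  have "ip ?w ?w = a * ip ?w u + b * ip ?w v"
    using ip_lin[OF assms w, of a b] ip_sym[OF assms(1) w] ip_sym[OF assms(2) w] by simp
  also have "\<dots> = a * (a * ip u u + b * ip v u) + b * (a * ip u v + b * ip v v)"
    using assms by (simp only: ip_lin)
  also have "ip v u = ip u v" using assms by (intro ip_sym)
  finally show ?thesis by (simp add: power2_eq_square algebra_simps)
qed

lemma ip_diff_diff: "u \<in> X \<Longrightarrow> v \<in> X \<Longrightarrow>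
    ip (\<lambda>z. u z - v z) (\<lambda>z. u z - v z) = ip u u - 2 * ip u v + ip v v"
  using ip_lin_lin[of u v 1 "-1"] by simp

lemma Cauchy_Schwarz: "u \<in> X \<Longrightarrow> v \<in> X \<Longrightarrow> (ip u v)\<^sup>2 \<le> ip u u * ip v v"
proof (rule quadratic_nonneg_discriminant)
  fix r assume uv: "u \<in> X" "v \<in> X"
  show "0 \<le> ip u u + 2 * r * ip u v + r\<^sup>2 * ip v v"
    using ip_nonneg[OF lin_closed[OF uv, of 1 r]] ip_lin_lin[OF uv, of 1 r] by simp
qed (rule ip_nonneg)

lemma abs_ip_le: "u \<in> X \<Longrightarrow> v \<in> X \<Longrightarrow> \<bar>ip u v\<bar> \<le> sqrt (ip u u) * sqrt (ip v v)"
  by (metis Cauchy_Schwarz power2_abs real_le_rsqrt real_sqrt_mult)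

lemma norm_triangle:
  assumes "u \<in> X" "v \<in> X"
  shows "sqrt (ip (\<lambda>z. u z + v z) (\<lambda>z. u z + v z)) \<le> sqrt (ip u u) + sqrt (ip v v)"
proof (rule real_le_lsqrt)
  have "ip (\<lambda>z. u z + v z) (\<lambda>z. u z + v z) = ip u u + 2 * ip u v + ip v v"
    using ip_lin_lin[OF assms, of 1 1] by simp
  also have "\<dots> \<le> (sqrt (ip u u) + sqrt (ip v v))\<^sup>2"
    using abs_ip_le[OF assms] ip_nonneg assms by (simp add: power2_sum)
  finally show "ip (\<lambda>z. u z + v z) (\<lambda>z. u z + v z) \<le> (sqrt (ip u u) + sqrt (ip v v))\<^sup>2" .
qed (use ip_nonneg assms in simp)

text \<open>A functional \<open>\<ell>\<close> on a subspace \<open>V\<close> is represented by the limit of a minimising sequence of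
  \<open>ip v v - 2 \<ell> v\<close>, which is Cauchy by the parallelogram identity. As \<open>V\<close> need not be closed, this
  contains both the Riesz theorem and the orthogonal projection onto the closure of \<open>V\<close>.\<close>

theorem riesz_subspace:
  assumes V: "V \<subseteq> X" "V \<noteq> {}" "\<And>u v a b. u \<in> V \<Longrightarrow> v \<in> V \<Longrightarrow> (\<lambda>z. a * u z + b * v z) \<in> V"
    and l: "\<And>u v a b. u \<in> V \<Longrightarrow> v \<in> V \<Longrightarrow> l (\<lambda>z. a * u z + b * v z) = a * l u + b * l v"
    and bounded: "\<And>v. v \<in> V \<Longrightarrow> \<bar>l v\<bar> \<le> K * sqrt (ip v v)"
  obtains g where "g \<in> X" "\<And>v. v \<in> V \<Longrightarrow> ip g v = l v"
    "\<And>e. e > 0 \<Longrightarrow> \<exists>v\<in>V. ip (\<lambda>z. v z - g z) (\<lambda>z. v z - g z) < e"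
proof -
  define Q where "Q v = ip v v - 2 * l v" for v
  have Q_lower: "- K\<^sup>2 \<le> Q v" if "v \<in> V" for v
  proof -
    have "0 \<le> (sqrt (ip v v) - K)\<^sup>2" by simp
    also have "\<dots> = ip v v - 2 * (K * sqrt (ip v v)) + K\<^sup>2"
      using ip_nonneg that V(1) by (auto simp: power2_diff)
    finally show ?thesis using bounded[OF that] by (simp add: Q_def)
  qed
  define m where "m = Inf (Q ` V)"
  have m_le: "m \<le> Q v" if "v \<in> V" for v
    unfolding m_def using that Q_lower by (intro cInf_lower bdd_belowI2[of _ "- K\<^sup>2"]) auto
  have "\<exists>v\<in>V. Q v < m + 1 / Suc n" for n
    using cInf_lessD[of "Q ` V" "m + 1 / Suc n"] V(2) by (auto simp: m_def)
  then obtain s where s: "\<And>n. s n \<in> V" "\<And>n. Q (s n) < m + 1 / Suc n" by metis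
  have sX: "s n \<in> X" for n using s(1) V(1) by blast
  \<comment> \<open>The parallelogram identity for the midpoint, at which \<open>Q\<close> is at
    least \<open>m\<close>.\<close>
  have para: "ip (\<lambda>z. u z - v z) (\<lambda>z. u z - v z) \<le> 2 * (Q u - m) + 2 * (Q v - m)"
    if uv: "u \<in> V" "v \<in> V" for u v
  proof -
    have X: "u \<in> X" "v \<in> X" using uv V(1) by auto
    let ?w = "\<lambda>z. 1/2 * u z + 1/2 * v z"
    have "m \<le> Q ?w" by (intro m_le V uv)
    also have "Q ?w = (1/2)\<^sup>2 * ip u u + 2 * (1/2 * (1/2)) * ip u v + (1/2)\<^sup>2 * ip v v - (l u + l v)"
      unfolding Q_def ip_lin_lin[OF X] l[OF uv] by simp
    finally show ?thesis
      unfolding ip_diff_diff[OF X] Q_def by (simp add: power2_eq_square)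
  qed
  have "\<exists>N. \<forall>i\<ge>N. \<forall>j\<ge>N. ip (\<lambda>z. s i z - s j z) (\<lambda>z. s i z - s j z) < e" if "e > 0" for e
  proof -
    obtain N where N: "1 / real (Suc N) < e / 4" using \<open>e > 0\<close> nat_approx_posE[of "e / 4"] by auto
    have "ip (\<lambda>z. s i z - s j z) (\<lambda>z. s i z - s j z) < e" if "i \<ge> N" "j \<ge> N" for i j
    proof -
      have "Q (s k) < m + e / 4" if "k \<ge> N" for k
      proof -
        have "1 / real (Suc k) \<le> 1 / real (Suc N)"
          using that by (intro divide_left_mono) auto
        then have "m + 1 / real (Suc k) < m + e / 4" using N by (intro add_strict_left_mono) (rule le_less_trans)
        with s(2)[of k] show ?thesis by (rule less_trans)
      qed
      from para[OF s(1) s(1), of i j] this[OF that(1)] this[OF that(2)] show ?thesis by argo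
    qed
    then show ?thesis by blast
  qed
  from complete[OF sX this] obtain g where g: "g \<in> X"
    "(\<lambda>n. ip (\<lambda>z. s n z - g z) (\<lambda>z. s n z - g z)) \<longlonglongrightarrow> 0" by auto
  have "ip g v = l v" if v: "v \<in> V" for v
  proof -
    have vX: "v \<in> X" using v V(1) by blast
    have "(\<lambda>n. ip (\<lambda>z. s n z - g z) v) \<longlonglongrightarrow> 0"
    proof (rule Lim_null_comparison)
      show "\<forall>\<^sub>F n in sequentially. norm (ip (\<lambda>z. s n z - g z) v)
          \<le> sqrt (ip (\<lambda>z. s n z - g z) (\<lambda>z. s n z - g z)) * sqrt (ip v v)"
        using abs_ip_le[OF diff_closed[OF sX g(1)] vX] by simp
      show "(\<lambda>n. sqrt (ip (\<lambda>z. s n z - g z) (\<lambda>z. s n z - g z)) * sqrt (ip v v)) \<longlonglongrightarrow> 0"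
        using tendsto_mult_left_zero[OF tendsto_real_sqrt[OF g(2), unfolded real_sqrt_zero]] by simp
    qed
    then have lim: "(\<lambda>n. ip (s n) v) \<longlonglongrightarrow> ip g v"
      by (simp add: ip_diff[OF sX g(1) vX] LIM_zero_iff)
    \<comment> \<open>Minimality in the direction \<open>v\<close>, in the limit; a quadratic in
      \<open>r\<close> without constant term that is nonnegative has no linear term.\<close>
    have "0 \<le> 0 + 2 * r * (ip g v - l v) + r\<^sup>2 * ip v v" for r
    proof (rule LIMSEQ_le_const)
      show "(\<lambda>n. 1 / Suc n + 2 * r * (ip (s n) v - l v) + r\<^sup>2 * ip v v) \<longlonglongrightarrow> 0 + 2 * r * (ip g v - l v) + r\<^sup>2 * ip v v"
        by (intro tendsto_intros lim LIMSEQ_Suc[OF lim_1_over_n])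
      have "0 \<le> 1 / Suc n + 2 * r * (ip (s n) v - l v) + r\<^sup>2 * ip v v" for n
      proof -
        have "m \<le> Q (\<lambda>z. 1 * s n z + r * v z)" by (intro m_le V s v)
        also have "\<dots> = Q (s n) + 2 * r * (ip (s n) v - l v) + r\<^sup>2 * ip v v"
          unfolding Q_def ip_lin_lin[OF sX vX] l[OF s(1) v] by (simp add: algebra_simps)
        finally show ?thesis using s(2)[of n] by linarith
      qed
      then show "\<exists>N. \<forall>n\<ge>N. 0 \<le> 1 / Suc n + 2 * r * (ip (s n) v - l v) + r\<^sup>2 * ip v v" by blast
    qed
    from quadratic_nonneg_discriminant[OF this ip_nonneg[OF vX]] show ?thesis by simp
  qed
  moreover have "\<exists>v\<in>V. ip (\<lambda>z. v z - g z) (\<lambda>z. v z - g z) < e" if "e > 0" for e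
  proof -
    have "\<forall>\<^sub>F n in sequentially. ip (\<lambda>z. s n z - g z) (\<lambda>z. s n z - g z) < e"
      using g(2) that by (rule order_tendstoD)
    then show ?thesis using s(1) eventually_happens'[OF sequentially_bot] by blast
  qed
  ultimately show thesis using that[of g] g(1) by blast
qed

text \<open>The element \<open>g\<close> that represents the functional \<open>ip u\<close> on
  \<open>V\<close> is a limit of elements of \<open>V\<close>, and \<open>g - u\<close> is orthogonal to
  \<open>V\<close>.\<close>

lemma dense_if_orthogonal_trivial:
  assumes V: "V \<subseteq> X" "V \<noteq> {}" "\<And>u v a b. u \<in> V \<Longrightarrow> v \<in> V \<Longrightarrow> (\<lambda>z. a * u z + b * v z) \<in> V"
    and triv: "\<And>z. z \<in> X \<Longrightarrow> (\<And>v. v \<in> V \<Longrightarrow> ip z v = 0) \<Longrightarrow> ip z z = 0"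
    and u: "u \<in> X" and e: "e > 0"
  shows "\<exists>v\<in>V. ip (\<lambda>z. v z - u z) (\<lambda>z. v z - u z) < e"
proof -
  have lin: "ip u (\<lambda>z. a * v z + b * w z) = a * ip u v + b * ip u w" if "v \<in> V" "w \<in> V" for v w a b
  proof -
    have X: "v \<in> X" "w \<in> X" using that V(1) by auto
    show ?thesis using ip_lin[OF X u] ip_sym[OF u lin_closed[OF X]] ip_sym[OF u] X by simp
  qed
  have bound: "\<bar>ip u v\<bar> \<le> sqrt (ip u u) * sqrt (ip v v)" if "v \<in> V" for v
    using that V(1) u by (intro abs_ip_le) auto
  obtain g where g: "g \<in> X" "\<And>v. v \<in> V \<Longrightarrow> ip g v = ip u v"
    "\<And>e. e > 0 \<Longrightarrow> \<exists>v\<in>V. ip (\<lambda>z. v z - g z) (\<lambda>z. v z - g z) < e"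
    by (rule riesz_subspace[of V "ip u" "sqrt (ip u u)"]) (use V lin bound in auto)
  have gu: "(\<lambda>z. g z - u z) \<in> X" by (rule diff_closed[OF g(1) u])
  have z: "ip (\<lambda>z. g z - u z) (\<lambda>z. g z - u z) = 0"
    using gu by (rule triv) (use g V(1) u in \<open>auto simp: ip_diff\<close>)
  obtain v where v: "v \<in> V" "ip (\<lambda>z. v z - g z) (\<lambda>z. v z - g z) < e" using g(3)[OF e] by blast
  have vg: "(\<lambda>z. v z - g z) \<in> X" using v V(1) g(1) diff_closed by blast
  have "sqrt (ip (\<lambda>z. v z - u z) (\<lambda>z. v z - u z)) \<le> sqrt (ip (\<lambda>z. v z - g z) (\<lambda>z. v z - g z))"
    using norm_triangle[OF vg gu] z by simp
  then have "ip (\<lambda>z. v z - u z) (\<lambda>z. v z - u z) < e" using v(2) by simp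
  with v(1) show ?thesis by blast
qed

end

section \<open>Weak derivatives\<close>

lemma sq_integrable_loc_integrable:
  assumes "sq_integrable (lres S) u" "S \<in> sets borel"
  shows "loc_integrable S u"
  unfolding loc_integrable_def
proof (intro allI impI)
  fix K :: "'a set" assume K: "compact K \<and> K \<subseteq> S"
  then have [measurable]: "K \<in> sets borel" by (intro borel_compact) auto
  interpret finite_measure "lres K"
    using K by (intro finite_measure_lres compact_imp_bounded) auto
  have "set_integrable lborel S (\<lambda>x. (u x)\<^sup>2)"
    using assms by (simp add: sq_integrable_def set_integrable_lres)
  then have i: "set_integrable lborel K (\<lambda>x. (u x)\<^sup>2)"
    by (rule set_integrable_subset) (use K in auto)
  have "u \<in> borel_measurable (lres S)" using assms(1) by (rule sq_integrable_measurable)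
  then have "u \<in> borel_measurable (lres K)"
    by (rule lres_measurable_mono) (use K assms(2) in auto)
  with i have "sq_integrable (lres K) u" by (simp add: sq_integrable_def set_integrable_lres)
  then show "set_integrable lborel K u"
    by (simp add: set_integrable_lres sq_integrable_integrable)
qed

lemma test_fun_sq_integrable:
  assumes "test_fun S f" "S \<in> sets borel"
  shows "sq_integrable (lres S) f"
  using assms(1)
proof (rule test_fun_supportE)
  fix K assume K: "smooth f" "compact K" "K \<subseteq> S" "\<And>x. x \<notin> K \<Longrightarrow> f x = 0"
  have [measurable]: "f \<in> borel_measurable borel" using K(1) by (rule smooth_measurable)
  have "loc_integrable S f"
    unfolding loc_integrable_def
    unfolding set_integrable_def
    by (intro allI impI borel_integrable_compact smooth_continuous_on K(1)) blast
  from loc_integrable_mult_test_fun[OF this assms]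
  have "integrable (lres S) (\<lambda>x. (f x)\<^sup>2)"
    using assms(2) by (simp add: set_integrable_lres power2_eq_square)
  moreover have "f \<in> borel_measurable (lres S)"
    by (rule measurable_restrict_space1) simp
  ultimately show ?thesis by (simp add: sq_integrable_def)
qed

context
  fixes S :: "'a::euclidean_space set"
  assumes S: "open S"
begin

lemma open_S_borel [measurable]: "S \<in> sets borel"
  using S by simp

lemma has_weak_deriv_measurable:
  assumes "has_weak_deriv S m u v"
  shows "u \<in> borel_measurable (lres S)" "v \<in> borel_measurable (lres S)"
  using assms loc_integrable_measurable[OF _ S] by (auto simp: has_weak_deriv_def)

lemma has_weak_deriv_test:
  assumes "has_weak_deriv S (mset bs) u v" "test_fun S f"
  shows "(LINT x|lres S. u x * pderivs bs f x) = (-1) ^ length bs * (LINT x|lres S. v x * f x)"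
proof -
  have "(LINT x:S|lborel. u x * pderivs bs f x) = (-1) ^ size (mset bs) * (LINT x:S|lborel. v x * f x)"
    using assms unfolding has_weak_deriv_def by blast
  then show ?thesis by (simp add: set_integral_lres[OF open_S_borel])
qed

lemma has_weak_deriv_test_integrable:
  assumes "has_weak_deriv S (mset bs) u v" "test_fun S f" "set bs \<subseteq> Basis"
  shows "integrable (lres S) (\<lambda>x. u x * pderivs bs f x)" "integrable (lres S) (\<lambda>x. v x * f x)"
  using assms(1) unfolding has_weak_deriv_def set_integrable_lres[OF open_S_borel, symmetric]
  by (intro loc_integrable_mult_test_fun test_fun_pderivs assms open_S_borel; blast)+

lemma loc_integrable_lin:
  "loc_integrable S u \<Longrightarrow> loc_integrable S v \<Longrightarrow> loc_integrable S (\<lambda>x. a * u x + b * v x)"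
  by (auto simp: loc_integrable_def intro!: set_integral_add(1))

lemma has_weak_derivI:
  assumes "loc_integrable S u" "loc_integrable S v"
    "\<And>bs f. mset bs = m \<Longrightarrow> test_fun S f \<Longrightarrow>
      (LINT x|lres S. u x * pderivs bs f x) = (-1) ^ length bs * (LINT x|lres S. v x * f x)"
  shows "has_weak_deriv S m u v"
  using assms unfolding has_weak_deriv_def by (auto simp: set_integral_lres[OF open_S_borel])

lemma has_weak_deriv_lin:
  assumes "has_weak_deriv S m u u'" "has_weak_deriv S m v v'" "set_mset m \<subseteq> Basis"
  shows "has_weak_deriv S m (\<lambda>x. a * u x + b * v x) (\<lambda>x. a * u' x + b * v' x)"
proof (rule has_weak_derivI)
  show "loc_integrable S (\<lambda>x. a * u x + b * v x)" "loc_integrable S (\<lambda>x. a * u' x + b * v' x)"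
    using assms by (auto simp: has_weak_deriv_def intro!: loc_integrable_lin)
  fix bs f assume bs: "mset bs = m" and f: "test_fun S f"
  have sb: "set bs \<subseteq> Basis" using assms(3) bs by auto
  note i = has_weak_deriv_test_integrable[OF assms(1)[folded bs] f sb]
    has_weak_deriv_test_integrable[OF assms(2)[folded bs] f sb]
  show "(LINT x|lres S. (a * u x + b * v x) * pderivs bs f x) =
      (-1) ^ length bs * (LINT x|lres S. (a * u' x + b * v' x) * f x)"
    unfolding distrib_right mult.assoc
    using i has_weak_deriv_test[OF assms(1)[folded bs] f] has_weak_deriv_test[OF assms(2)[folded bs] f]
    by (simp add: distrib_left)
qed

lemma loc_integrable_cong_AE:
  assumes "loc_integrable S u" "v \<in> borel_measurable (lres S)" "AE x in lres S. u x = v x"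
  shows "loc_integrable S v"
  unfolding loc_integrable_def
proof (intro allI impI)
  fix K assume K: "compact K \<and> K \<subseteq> S"
  then have Kb: "K \<in> sets borel" by (intro borel_compact) auto
  have "integrable (lres K) u" using assms(1) K Kb by (auto simp: loc_integrable_def set_integrable_lres)
  moreover have "v \<in> borel_measurable (lres K)"
    by (rule lres_measurable_mono[of _ S]) (use assms(2) K Kb open_S_borel in blast)+
  moreover have "AE x in lres K. u x = v x"
    by (rule AE_lres_mono[OF assms(3)]) (use K Kb open_S_borel in blast)+
  ultimately have "integrable (lres K) v"
    using integrable_cong_AE[of u "lres K" v] by (auto dest: borel_measurable_integrable)
  then show "set_integrable lborel K v" using Kb by (simp add: set_integrable_lres)
qed

lemma has_weak_deriv_cong_AE:
  assumes "has_weak_deriv S m u v" "set_mset m \<subseteq> Basis"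
    and "u' \<in> borel_measurable (lres S)" "AE x in lres S. u x = u' x"
    and "v' \<in> borel_measurable (lres S)" "AE x in lres S. v x = v' x"
  shows "has_weak_deriv S m u' v'"
proof (rule has_weak_derivI)
  show "loc_integrable S u'" "loc_integrable S v'"
    using assms loc_integrable_cong_AE by (auto simp: has_weak_deriv_def)
  fix bs f assume bs: "mset bs = m" and f: "test_fun S f"
  have sb: "set bs \<subseteq> Basis" using assms(2) bs by auto
  have [measurable]: "f \<in> borel_measurable (lres S)" "pderivs bs f \<in> borel_measurable (lres S)"
    using test_fun_sq_integrable[OF f open_S_borel] test_fun_sq_integrable[OF test_fun_pderivs[OF f sb] open_S_borel]
    by auto
  note has_weak_deriv_measurable[OF assms(1), measurable] assms(3,5)[measurable]
  have "(LINT x|lres S. u' x * pderivs bs f x) = (LINT x|lres S. u x * pderivs bs f x)"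
    by (intro integral_cong_AE) (use assms(4) in \<open>auto elim!: AE_mp\<close>)
  moreover have "(LINT x|lres S. v' x * f x) = (LINT x|lres S. v x * f x)"
    by (intro integral_cong_AE) (use assms(6) in \<open>auto elim!: AE_mp\<close>)
  ultimately show "(LINT x|lres S. u' x * pderivs bs f x) = (-1) ^ length bs * (LINT x|lres S. v' x * f x)"
    using has_weak_deriv_test[OF assms(1)[folded bs] f] by simp
qed

text \<open>The difference of two weak derivatives has vanishing integral against every test
  function.\<close>

lemma has_weak_deriv_unique:
  assumes "has_weak_deriv S m u v" "has_weak_deriv S m u v'" "set_mset m \<subseteq> Basis"
  shows "AE x in lres S. v x = v' x"
proof -
  obtain bs where bs: "mset bs = m" using ex_mset by blast
  have sb: "set bs \<subseteq> Basis" using assms(3) bs by auto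
  have "loc_integrable S (\<lambda>x. v x - v' x)"
    using assms loc_integrable_lin[of v v' 1 "-1"] by (auto simp: has_weak_deriv_def)
  moreover have "(LINT x:S|lborel. (v x - v' x) * f x) = 0" if f: "test_fun S f" for f
    using has_weak_deriv_test_integrable[OF assms(1)[folded bs] f sb]
      has_weak_deriv_test_integrable[OF assms(2)[folded bs] f sb]
      has_weak_deriv_test[OF assms(1)[folded bs] f] has_weak_deriv_test[OF assms(2)[folded bs] f]
    by (simp add: set_integral_lres[OF open_S_borel] left_diff_distrib)
  ultimately have "AE x in lborel. x \<in> S \<longrightarrow> v x - v' x = 0"
    by (rule AE_eq_0_if_test_integrals_eq_0[OF S])
  then show ?thesis by (simp add: AE_lres_iff)
qed

lemma weak_deriv_eq:
  assumes "has_weak_deriv S m u v" "set_mset m \<subseteq> Basis"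
  shows "has_weak_deriv S m u (weak_deriv S m u)" "AE x in lres S. weak_deriv S m u x = v x"
proof -
  show w: "has_weak_deriv S m u (weak_deriv S m u)"
    unfolding weak_deriv_def by (rule someI[of "has_weak_deriv S m u", OF assms(1)])
  show "AE x in lres S. weak_deriv S m u x = v x"
    by (rule has_weak_deriv_unique[OF w assms])
qed

text \<open>The two sides choose from the same set of weak derivatives, so they are equal and not only
  almost everywhere equal.\<close>

lemma weak_deriv_cong_AE:
  assumes "u' \<in> borel_measurable (lres S)" "u \<in> borel_measurable (lres S)" "AE x in lres S. u x = u' x"
    "set_mset m \<subseteq> Basis"
  shows "weak_deriv S m u = weak_deriv S m u'"
proof -
  have "has_weak_deriv S m u v \<longleftrightarrow> has_weak_deriv S m u' v" for v
  proof
    assume w: "has_weak_deriv S m u v"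
    show "has_weak_deriv S m u' v"
      by (rule has_weak_deriv_cong_AE[OF w assms(4,1,3) has_weak_deriv_measurable(2)[OF w]]) simp
  next
    assume w: "has_weak_deriv S m u' v"
    have "AE x in lres S. u' x = u x" using assms(3) by eventually_elim simp
    then show "has_weak_deriv S m u v"
      by (rule has_weak_deriv_cong_AE[OF w assms(4,2) _ has_weak_deriv_measurable(2)[OF w]]) simp
  qed
  then show ?thesis by (simp add: weak_deriv_def)
qed

lemma has_weak_deriv_empty:
  assumes "loc_integrable S u"
  shows "has_weak_deriv S {#} u u"
  by (rule has_weak_derivI) (use assms in auto)

text \<open>Derivatives of test functions are test functions, so a weak derivative can be tested with
  them.\<close>

lemma has_weak_deriv_step:
  assumes "has_weak_deriv S n u v" "has_weak_deriv S (n + m) u g" "set_mset n \<subseteq> Basis" "set_mset m \<subseteq> Basis"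
  shows "has_weak_deriv S m v g"
proof (rule has_weak_derivI)
  show "loc_integrable S v" "loc_integrable S g"
    using assms by (auto simp: has_weak_deriv_def)
  fix bs f assume bs: "mset bs = m" and f: "test_fun S f"
  obtain cs where cs: "mset cs = n" using ex_mset by blast
  have f': "test_fun S (pderivs bs f)" using f assms(4) bs by (intro test_fun_pderivs) auto
  have "(-1) ^ length cs * (LINT x|lres S. v x * pderivs bs f x) = (LINT x|lres S. u x * pderivs cs (pderivs bs f) x)"
    using has_weak_deriv_test[OF assms(1)[folded cs] f'] by simp
  also have "\<dots> = (LINT x|lres S. u x * pderivs (cs @ bs) f x)" by (simp only: pderivs_append)
  also have "\<dots> = (-1) ^ length (cs @ bs) * (LINT x|lres S. g x * f x)"
    by (rule has_weak_deriv_test[OF _ f]) (use assms(2) cs bs in simp)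
  also have "\<dots> = (-1) ^ length cs * ((-1) ^ length bs * (LINT x|lres S. g x * f x))"
    by (simp add: power_add)
  finally show "(LINT x|lres S. v x * pderivs bs f x) = (-1) ^ length bs * (LINT x|lres S. g x * f x)"
    by (rule mult_left_cancel[THEN iffD1, rotated]) simp
qed

end

section \<open>Sobolev spaces are complete\<close>

lemma multi_indices_Basis: "m \<in> multi_indices k \<Longrightarrow> set_mset m \<subseteq> Basis"
  by (simp add: multi_indices_def)

lemma multi_indices_mono: "k \<le> l \<Longrightarrow> multi_indices k \<subseteq> multi_indices l"
  by (auto simp: multi_indices_def)

lemma empty_multi_indices: "{#} \<in> multi_indices k"
  by (simp add: multi_indices_def)

context
  fixes S :: "'a::euclidean_space set"
  assumes S: "open S"
begin

lemma sobolev_sq_integrable: "u \<in> sobolev k S \<Longrightarrow> sq_integrable (lres S) u"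
  using S by (simp add: sobolev_def L2_iff_sq_integrable)

lemma sobolev_weak_deriv:
  assumes "u \<in> sobolev k S" "m \<in> multi_indices k"
  shows "has_weak_deriv S m u (weak_deriv S m u)" "sq_integrable (lres S) (weak_deriv S m u)"
proof -
  obtain v where v: "has_weak_deriv S m u v" "sq_integrable (lres S) v"
    using assms S by (auto simp: sobolev_def L2_iff_sq_integrable)
  show w: "has_weak_deriv S m u (weak_deriv S m u)"
    by (rule weak_deriv_eq[OF S v(1) multi_indices_Basis[OF assms(2)]])
  have "AE x in lres S. v x = weak_deriv S m u x"
    using weak_deriv_eq(2)[OF S v(1) multi_indices_Basis[OF assms(2)]] by eventually_elim simp
  then show "sq_integrable (lres S) (weak_deriv S m u)"
    by (rule sq_integrable_cong_AE[OF v(2) has_weak_deriv_measurable(2)[OF S w]])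
qed

lemma sobolevI:
  assumes "sq_integrable (lres S) u"
    "\<And>m. m \<in> multi_indices k \<Longrightarrow> has_weak_deriv S m u (v m)"
    "\<And>m. m \<in> multi_indices k \<Longrightarrow> sq_integrable (lres S) (v m)"
  shows "u \<in> sobolev k S"
  using assms S unfolding sobolev_def by (auto simp: L2_iff_sq_integrable)

lemma sobolev_mono: "k \<le> l \<Longrightarrow> u \<in> sobolev l S \<Longrightarrow> u \<in> sobolev k S"
  using multi_indices_mono[of k l] unfolding sobolev_def by blast

lemma sobolev_lin:
  assumes "u \<in> sobolev k S" "v \<in> sobolev k S"
  shows "(\<lambda>z. a * u z + b * v z) \<in> sobolev k S"
proof (rule sobolevI)
  show "sq_integrable (lres S) (\<lambda>z. a * u z + b * v z)"
    using assms by (intro sq_integrable_add sq_integrable_cmult sobolev_sq_integrable)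
  show "has_weak_deriv S m (\<lambda>z. a * u z + b * v z) (\<lambda>z. a * weak_deriv S m u z + b * weak_deriv S m v z)"
    "sq_integrable (lres S) (\<lambda>z. a * weak_deriv S m u z + b * weak_deriv S m v z)"
    if "m \<in> multi_indices k" for m
    using that assms multi_indices_Basis[OF that]
    by (auto intro!: sq_integrable_add sq_integrable_cmult has_weak_deriv_lin[OF S] sobolev_weak_deriv)
qed

lemma weak_deriv_lin:
  assumes "u \<in> sobolev k S" "v \<in> sobolev k S" "m \<in> multi_indices k"
  shows "AE z in lres S. weak_deriv S m (\<lambda>z. a * u z + b * v z) z = a * weak_deriv S m u z + b * weak_deriv S m v z"
  using assms multi_indices_Basis[OF assms(3)]
  by (intro weak_deriv_eq(2)[OF S] has_weak_deriv_lin[OF S] sobolev_weak_deriv(1))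

lemma weak_deriv_diff:
  assumes "u \<in> sobolev k S" "v \<in> sobolev k S" "m \<in> multi_indices k"
  shows "AE z in lres S. weak_deriv S m (\<lambda>z. u z - v z) z = weak_deriv S m u z - weak_deriv S m v z"
  using weak_deriv_lin[OF assms, of 1 "-1"] by simp

lemma weak_deriv_empty:
  assumes "u \<in> sobolev k S"
  shows "AE z in lres S. weak_deriv S {#} u z = u z"
  using S assms
  by (intro weak_deriv_eq(2) has_weak_deriv_empty sq_integrable_loc_integrable sobolev_sq_integrable) auto

lemma weak_deriv_sobolev:
  assumes "u \<in> sobolev (Suc k) S" "b \<in> Basis"
  shows "weak_deriv S {#b#} u \<in> sobolev k S"
    "m \<in> multi_indices k \<Longrightarrow> AE z in lres S. weak_deriv S m (weak_deriv S {#b#} u) z = weak_deriv S (add_mset b m) u z"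
proof -
  have b: "{#b#} \<in> multi_indices (Suc k)" using assms(2) by (simp add: multi_indices_def)
  have bm: "add_mset b m \<in> multi_indices (Suc k)" if "m \<in> multi_indices k" for m
    using that assms(2) by (simp add: multi_indices_def)
  have w: "has_weak_deriv S m (weak_deriv S {#b#} u) (weak_deriv S (add_mset b m) u)"
    if "m \<in> multi_indices k" for m
    by (rule has_weak_deriv_step[OF S sobolev_weak_deriv(1)[OF assms(1) b], of m])
      (use sobolev_weak_deriv(1)[OF assms(1) bm[OF that]] that assms(2) in \<open>simp_all add: multi_indices_def\<close>)
  show "weak_deriv S {#b#} u \<in> sobolev k S"
    by (rule sobolevI[OF sobolev_weak_deriv(2)[OF assms(1) b] w sobolev_weak_deriv(2)[OF assms(1) bm]])
  show "AE z in lres S. weak_deriv S m (weak_deriv S {#b#} u) z = weak_deriv S (add_mset b m) u z"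
    if "m \<in> multi_indices k"
    by (rule weak_deriv_eq(2)[OF S w[OF that] multi_indices_Basis[OF that]])
qed

lemma sobolev_cong_AE:
  assumes "u \<in> sobolev k S" "u' \<in> borel_measurable (lres S)" "AE z in lres S. u z = u' z"
  shows "u' \<in> sobolev k S"
proof (rule sobolevI)
  show "sq_integrable (lres S) u'"
    by (rule sq_integrable_cong_AE[OF sobolev_sq_integrable[OF assms(1)] assms(2,3)])
  show "has_weak_deriv S m u' (weak_deriv S m u)" if "m \<in> multi_indices k" for m
    using sobolev_weak_deriv(1)[OF assms(1) that] multi_indices_Basis[OF that] assms(2,3)
      has_weak_deriv_measurable(2)[OF S sobolev_weak_deriv(1)[OF assms(1) that]]
    by (rule has_weak_deriv_cong_AE[OF S]) simp
  show "sq_integrable (lres S) (weak_deriv S m u)" if "m \<in> multi_indices k" for m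
    by (rule sobolev_weak_deriv(2)[OF assms(1) that])
qed

lemma sobolev_inner_lres:
  "sobolev_inner k S u v = (\<Sum>m\<in>multi_indices k. LINT x|lres S. weak_deriv S m u x * weak_deriv S m v x)"
  using S by (simp add: sobolev_inner_def set_integral_lres)

lemma sobolev_inner_self_eq:
  "sobolev_inner k S u u = (\<Sum>m\<in>multi_indices k. LINT x|lres S. (weak_deriv S m u x)\<^sup>2)"
  unfolding sobolev_inner_lres power2_eq_square ..

lemma sobolev_inner_self_nonneg: "0 \<le> sobolev_inner k S u u"
  unfolding sobolev_inner_self_eq by (intro sum_nonneg Bochner_Integration.integral_nonneg) simp

lemma sobolev_inner_self: "sobolev_inner k S u u = (sobolev_norm k S u)\<^sup>2"
  unfolding sobolev_norm_def using sobolev_inner_self_nonneg by simp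

lemma sobolev_norm_sq:
  "(sobolev_norm k S u)\<^sup>2 = (\<Sum>m\<in>multi_indices k. LINT x|lres S. (weak_deriv S m u x)\<^sup>2)"
  by (simp only: sobolev_inner_self[symmetric] sobolev_inner_self_eq)

lemma sobolev_norm_nonneg: "0 \<le> sobolev_norm k S u"
  unfolding sobolev_norm_def by (simp add: sobolev_inner_self_nonneg)

lemma weak_deriv_norm_le:
  assumes "m \<in> multi_indices k"
  shows "(LINT x|lres S. (weak_deriv S m u x)\<^sup>2) \<le> (sobolev_norm k S u)\<^sup>2"
  unfolding sobolev_norm_sq
  by (rule member_le_sum[OF assms]) (auto simp: finite_multi_indices)

lemma sobolev_norm_cong_AE:
  assumes "u' \<in> borel_measurable (lres S)" "u \<in> borel_measurable (lres S)" "AE x in lres S. u x = u' x"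
  shows "sobolev_norm k S u = sobolev_norm k S u'"
proof -
  have "(sobolev_norm k S u)\<^sup>2 = (sobolev_norm k S u')\<^sup>2"
    unfolding sobolev_norm_sq
    using weak_deriv_cong_AE[OF S assms multi_indices_Basis] by (intro sum.cong) auto
  then show ?thesis using sobolev_norm_nonneg by (simp add: power2_eq_iff_nonneg)
qed

lemma sobolev_inner_lin:
  assumes "u \<in> sobolev k S" "v \<in> sobolev k S" "w \<in> sobolev k S"
  shows "sobolev_inner k S (\<lambda>z. a * u z + b * v z) w = a * sobolev_inner k S u w + b * sobolev_inner k S v w"
proof -
  have "(LINT x|lres S. weak_deriv S m (\<lambda>z. a * u z + b * v z) x * weak_deriv S m w x) =
      a * (LINT x|lres S. weak_deriv S m u x * weak_deriv S m w x)
      + b * (LINT x|lres S. weak_deriv S m v x * weak_deriv S m w x)" if m: "m \<in> multi_indices k" for m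
  proof -
    note sq = assms[THEN sobolev_weak_deriv(2), OF m]
    note [measurable] = sq[THEN sq_integrable_measurable]
      sobolev_weak_deriv(2)[OF sobolev_lin[OF assms(1,2)] m, THEN sq_integrable_measurable]
    have "(LINT x|lres S. weak_deriv S m (\<lambda>z. a * u z + b * v z) x * weak_deriv S m w x) =
       (LINT x|lres S. a * (weak_deriv S m u x * weak_deriv S m w x) + b * (weak_deriv S m v x * weak_deriv S m w x))"
    proof (rule integral_cong_AE)
      show "AE x in lres S. weak_deriv S m (\<lambda>z. a * u z + b * v z) x * weak_deriv S m w x =
          a * (weak_deriv S m u x * weak_deriv S m w x) + b * (weak_deriv S m v x * weak_deriv S m w x)"
        using weak_deriv_lin[OF assms(1,2) m, of a b] by eventually_elim (simp add: algebra_simps)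
    qed measurable
    also have "\<dots> = a * (LINT x|lres S. weak_deriv S m u x * weak_deriv S m w x)
      + b * (LINT x|lres S. weak_deriv S m v x * weak_deriv S m w x)"
      using sq_integrable_mult[OF sq(1) sq(3)] sq_integrable_mult[OF sq(2) sq(3)] by simp
    finally show ?thesis .
  qed
  then show ?thesis
    by (simp add: sobolev_inner_lres sum.distrib sum_distrib_left)
qed

lemma sobolev_inner_sym: "sobolev_inner k S u v = sobolev_inner k S v u"
  by (simp add: sobolev_inner_lres mult.commute)

text \<open>Convergence in \<open>L\<^sup>2\<close> carries the defining identity of weak derivatives
  over to limits.\<close>

lemma L2_limit_integral:
  assumes "\<And>n. sq_integrable (lres S) (s n)" "sq_integrable (lres S) u" "sq_integrable (lres S) f"
    and "(\<lambda>n. LINT x|lres S. (s n x - u x)\<^sup>2) \<longlonglongrightarrow> 0"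
  shows "(\<lambda>n. LINT x|lres S. s n x * f x) \<longlonglongrightarrow> (LINT x|lres S. u x * f x)"
proof -
  have "(\<lambda>n. LINT x|lres S. (s n x - u x) * f x) \<longlonglongrightarrow> 0"
  proof (rule Lim_null_comparison)
    have "\<bar>LINT x|lres S. (s n x - u x) * f x\<bar>
        \<le> sqrt ((LINT x|lres S. (s n x - u x)\<^sup>2) * (LINT x|lres S. (f x)\<^sup>2))" for n
      using Cauchy_Schwarz_integral[OF sq_integrable_diff[OF assms(1,2)] assms(3), of n]
      by (intro real_le_rsqrt) simp
    then show "\<forall>\<^sub>F n in sequentially. norm (LINT x|lres S. (s n x - u x) * f x)
        \<le> sqrt ((LINT x|lres S. (s n x - u x)\<^sup>2) * (LINT x|lres S. (f x)\<^sup>2))" by simp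
    show "(\<lambda>n. sqrt ((LINT x|lres S. (s n x - u x)\<^sup>2) * (LINT x|lres S. (f x)\<^sup>2))) \<longlonglongrightarrow> 0"
      using tendsto_real_sqrt[OF tendsto_mult_left_zero[OF assms(4)]] by simp
  qed
  moreover have "(LINT x|lres S. (s n x - u x) * f x) = (LINT x|lres S. s n x * f x) - (LINT x|lres S. u x * f x)" for n
    using sq_integrable_mult[OF assms(1,3), of n] sq_integrable_mult[OF assms(2,3)]
    by (simp add: left_diff_distrib)
  ultimately show ?thesis by (simp add: LIM_zero_iff)
qed

text \<open>All weak derivatives of a Cauchy sequence converge in \<open>L\<^sup>2\<close>, and the
  limit of the derivatives is a weak derivative of the limit.\<close>

theorem sobolev_semi_hilbert:
  assumes "bounded S"
  shows "semi_hilbert (sobolev k S) (sobolev_inner k S)"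
proof
  interpret finite_measure "lres S" using assms S by (intro finite_measure_lres) auto
  fix s assume s: "\<And>n::nat. s n \<in> sobolev k S"
    and Cauchy: "\<And>e. e > 0 \<Longrightarrow> \<exists>N. \<forall>m\<ge>N. \<forall>n\<ge>N. sobolev_inner k S (\<lambda>z. s m z - s n z) (\<lambda>z. s m z - s n z) < e"
  have sd: "(\<lambda>z. s i z - s j z) \<in> sobolev k S" for i j
    using sobolev_lin[OF s s, of 1 i "-1" j] by simp
  have "\<exists>v. sq_integrable (lres S) v \<and> (\<lambda>n. LINT x|lres S. (weak_deriv S m (s n) x - v x)\<^sup>2) \<longlonglongrightarrow> 0"
    if m: "m \<in> multi_indices k" for m
  proof (rule L2_complete[of "\<lambda>n. weak_deriv S m (s n)"])
    show "sq_integrable (lres S) (weak_deriv S m (s n))" for n by (rule sobolev_weak_deriv(2)[OF s m])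
    fix e :: real assume "e > 0"
    have "(LINT x|lres S. (weak_deriv S m (s i) x - weak_deriv S m (s j) x)\<^sup>2)
        \<le> sobolev_inner k S (\<lambda>z. s i z - s j z) (\<lambda>z. s i z - s j z)" for i j
    proof -
      note [measurable] = sobolev_weak_deriv(2)[OF s m, THEN sq_integrable_measurable]
        sobolev_weak_deriv(2)[OF sd m, THEN sq_integrable_measurable]
      have "(LINT x|lres S. (weak_deriv S m (s i) x - weak_deriv S m (s j) x)\<^sup>2)
          = (LINT x|lres S. (weak_deriv S m (\<lambda>z. s i z - s j z) x)\<^sup>2)"
      proof (rule integral_cong_AE)
        show "AE x in lres S. (weak_deriv S m (s i) x - weak_deriv S m (s j) x)\<^sup>2 = (weak_deriv S m (\<lambda>z. s i z - s j z) x)\<^sup>2"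
          using weak_deriv_diff[OF s s m, of i j] by eventually_elim simp
      qed measurable
      also have "\<dots> \<le> sobolev_inner k S (\<lambda>z. s i z - s j z) (\<lambda>z. s i z - s j z)"
        unfolding sobolev_inner_self by (rule weak_deriv_norm_le[OF m])
      finally show ?thesis .
    qed
    with Cauchy[OF \<open>e > 0\<close>]
    show "\<exists>N. \<forall>i\<ge>N. \<forall>j\<ge>N. (LINT x|lres S. (weak_deriv S m (s i) x - weak_deriv S m (s j) x)\<^sup>2) < e"
      by (meson le_less_trans)
  qed
  then have "\<forall>m\<in>multi_indices k. \<exists>v. sq_integrable (lres S) v \<and> (\<lambda>n. LINT x|lres S. (weak_deriv S m (s n) x - v x)\<^sup>2) \<longlonglongrightarrow> 0"
    by (rule ballI)
  from bchoice[OF this] obtain v where vv: "\<forall>m\<in>multi_indices k. sq_integrable (lres S) (v m) \<and>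
      (\<lambda>n. LINT x|lres S. (weak_deriv S m (s n) x - v m x)\<^sup>2) \<longlonglongrightarrow> 0" by (rule exE)
  have v: "sq_integrable (lres S) (v m)"
    "(\<lambda>n. LINT x|lres S. (weak_deriv S m (s n) x - v m x)\<^sup>2) \<longlonglongrightarrow> 0" if "m \<in> multi_indices k" for m
    using bspec[OF vv that] by (rule conjunct1, rule conjunct2)
  define u where "u = v {#}"
  have u: "sq_integrable (lres S) u" using v(1)[OF empty_multi_indices] by (simp add: u_def)
  have us: "(\<lambda>n. LINT x|lres S. (s n x - u x)\<^sup>2) \<longlonglongrightarrow> 0"
  proof -
    note [measurable] = sobolev_weak_deriv(2)[OF s empty_multi_indices, THEN sq_integrable_measurable]
      sobolev_sq_integrable[OF s, THEN sq_integrable_measurable] u[THEN sq_integrable_measurable]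
    have "(LINT x|lres S. (s n x - u x)\<^sup>2) = (LINT x|lres S. (weak_deriv S {#} (s n) x - u x)\<^sup>2)" for n
    proof (rule integral_cong_AE)
      show "AE x in lres S. (s n x - u x)\<^sup>2 = (weak_deriv S {#} (s n) x - u x)\<^sup>2"
        using weak_deriv_empty[OF s, of n] by eventually_elim simp
    qed measurable
    with v(2)[OF empty_multi_indices] show ?thesis by (simp add: u_def)
  qed
  have w: "has_weak_deriv S m u (v m)" if m: "m \<in> multi_indices k" for m
  proof (rule has_weak_derivI[OF S])
    show "loc_integrable S u" "loc_integrable S (v m)"
      using u v(1)[OF m] S by (auto intro: sq_integrable_loc_integrable)
    fix bs f assume bs: "mset bs = m" and f: "test_fun S f"
    have sb: "set bs \<subseteq> Basis" using multi_indices_Basis[OF m] bs by auto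
    have sf: "sq_integrable (lres S) f" "sq_integrable (lres S) (pderivs bs f)"
      using f sb S by (auto intro!: test_fun_sq_integrable test_fun_pderivs)
    have l1: "(\<lambda>n. LINT x|lres S. s n x * pderivs bs f x) \<longlonglongrightarrow> (LINT x|lres S. u x * pderivs bs f x)"
      by (rule L2_limit_integral[OF sobolev_sq_integrable[OF s] u sf(2) us])
    have l2: "(\<lambda>n. (-1) ^ length bs * (LINT x|lres S. weak_deriv S m (s n) x * f x))
        \<longlonglongrightarrow> (-1) ^ length bs * (LINT x|lres S. v m x * f x)"
      by (rule tendsto_mult_left[OF L2_limit_integral[OF sobolev_weak_deriv(2)[OF s m] v(1)[OF m] sf(1) v(2)[OF m]]])
    have eq: "(LINT x|lres S. s n x * pderivs bs f x) = (-1) ^ length bs * (LINT x|lres S. weak_deriv S m (s n) x * f x)" for n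
      by (rule has_weak_deriv_test[OF S _ f]) (simp add: bs sobolev_weak_deriv(1)[OF s m])
    show "(LINT x|lres S. u x * pderivs bs f x) = (-1) ^ length bs * (LINT x|lres S. v m x * f x)"
      by (rule LIMSEQ_unique[OF l1 l2[folded eq]])
  qed
  have uX: "u \<in> sobolev k S" by (rule sobolevI[OF u w v(1)])
  have "sobolev_inner k S (\<lambda>z. s n z - u z) (\<lambda>z. s n z - u z)
      = (\<Sum>m\<in>multi_indices k. LINT x|lres S. (weak_deriv S m (s n) x - v m x)\<^sup>2)" for n
    unfolding sobolev_inner_self sobolev_norm_sq
  proof (intro sum.cong refl integral_cong_AE)
    fix m :: "'a multiset" assume m: "m \<in> multi_indices k"
    have sn: "(\<lambda>z. s n z - u z) \<in> sobolev k S" using sobolev_lin[OF s uX, of 1 n "-1"] by simp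
    note [measurable] = sobolev_weak_deriv(2)[OF s m, THEN sq_integrable_measurable]
      sobolev_weak_deriv(2)[OF sn m, THEN sq_integrable_measurable] v(1)[OF m, THEN sq_integrable_measurable]
    show "(\<lambda>x. (weak_deriv S m (\<lambda>z. s n z - u z) x)\<^sup>2) \<in> borel_measurable (lres S)"
      "(\<lambda>x. (weak_deriv S m (s n) x - v m x)\<^sup>2) \<in> borel_measurable (lres S)" by measurable
    show "AE x in lres S. (weak_deriv S m (\<lambda>z. s n z - u z) x)\<^sup>2 = (weak_deriv S m (s n) x - v m x)\<^sup>2"
      using weak_deriv_diff[OF s uX m, of n] weak_deriv_eq(2)[OF S w[OF m] multi_indices_Basis[OF m]]
      by eventually_elim simp
  qed
  note eq = this
  have lim: "(\<lambda>n. \<Sum>m\<in>multi_indices k. LINT x|lres S. (weak_deriv S m (s n) x - v m x)\<^sup>2)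
      \<longlonglongrightarrow> 0"
    by (rule tendsto_null_sum) (rule v(2))
  show "\<exists>u\<in>sobolev k S. (\<lambda>n. sobolev_inner k S (\<lambda>z. s n z - u z) (\<lambda>z. s n z - u z)) \<longlonglongrightarrow> 0"
    by (rule bexI[OF _ uX]) (use lim in \<open>simp only: eq\<close>)
qed (blast intro: sobolev_lin sobolev_inner_lin sobolev_inner_sym, blast intro: sobolev_inner_lin,
    blast intro: sobolev_inner_sym, simp only: sobolev_inner_self zero_le_power2)

lemma sobolev_diff: "u \<in> sobolev k S \<Longrightarrow> v \<in> sobolev k S \<Longrightarrow> (\<lambda>z. u z - v z) \<in> sobolev k S"
  using sobolev_lin[of u k v 1 "-1"] by simp

lemma sobolev_add: "u \<in> sobolev k S \<Longrightarrow> v \<in> sobolev k S \<Longrightarrow> (\<lambda>z. u z + v z) \<in> sobolev k S"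
  using sobolev_lin[of u k v 1 1] by simp

lemma sobolev_norm_triangle:
  assumes "bounded S" "u \<in> sobolev k S" "v \<in> sobolev k S"
  shows "sobolev_norm k S (\<lambda>z. u z + v z) \<le> sobolev_norm k S u + sobolev_norm k S v"
  using semi_hilbert.norm_triangle[OF sobolev_semi_hilbert[OF assms(1)] assms(2,3)]
  by (simp add: sobolev_norm_def)

lemma sobolev_norm_cmult:
  assumes "u \<in> sobolev k S"
  shows "sobolev_norm k S (\<lambda>z. c * u z) = \<bar>c\<bar> * sobolev_norm k S u"
proof -
  have X: "(\<lambda>z. c * u z) \<in> sobolev k S" using sobolev_lin[OF assms assms, of c 0] by simp
  have lin: "sobolev_inner k S (\<lambda>z. c * u z) w = c * sobolev_inner k S u w" if "w \<in> sobolev k S" for w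
    using sobolev_inner_lin[OF assms assms that, of c 0] by simp
  have "sobolev_inner k S (\<lambda>z. c * u z) (\<lambda>z. c * u z) = c * sobolev_inner k S (\<lambda>z. c * u z) u"
    unfolding lin[OF X] by (simp only: sobolev_inner_sym)
  also have "\<dots> = c\<^sup>2 * sobolev_inner k S u u"
    unfolding lin[OF assms] by (simp add: power2_eq_square)
  finally show ?thesis by (simp add: sobolev_norm_def real_sqrt_mult)
qed

end

section \<open>Functions on a rectangle with a weak derivative in one variable\<close>

abbreviation Iv :: "real \<Rightarrow> real measure" where "Iv b \<equiv> lres {0<..<b}"
abbreviation Iv2 :: "real \<Rightarrow> real \<Rightarrow> (real \<times> real) measure" where "Iv2 a b \<equiv> Iv a \<Otimes>\<^sub>M Iv b"

lemma finite_measure_Iv: "finite_measure (Iv b)"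
  by (rule finite_measure_lres) auto

lemma sigma_finite_Iv: "sigma_finite_measure (Iv b)"
  by (rule sigma_finite_measure_restrict_space[OF sigma_finite_lborel]) simp

lemma pair_sigma_finite_Iv: "pair_sigma_finite (Iv a) (Iv b)"
  by (intro pair_sigma_finite.intro sigma_finite_Iv)

lemma finite_measure_Iv_pair: "finite_measure (Iv2 a b)"
  by (intro finite_measure_pair_measure finite_measure_Iv)

lemma Iv_pair: "Iv2 a b = lres ({0<..<a} \<times> {0<..<b})"
  by (rule lres_Times[symmetric]) auto

lemma measure_Iv: "b \<ge> 0 \<Longrightarrow> measure (Iv b) (space (Iv b)) = b"
  by (simp add: measure_restrict_space)

lemma Iv_measurable: "f \<in> borel_measurable borel \<Longrightarrow> f \<in> borel_measurable (Iv b)"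
  by (intro measurable_restrict_space1) simp

lemma Iv_ident: "(\<lambda>x. x) \<in> borel_measurable (Iv b)"
  by (rule Iv_measurable) simp

lemma continuous_bounded_Iv:
  fixes f :: "real \<Rightarrow> real"
  assumes "continuous_on UNIV f"
  obtains K where "K \<ge> 0" "\<And>x. x \<in> {0..b} \<Longrightarrow> \<bar>f x\<bar> \<le> K"
proof -
  have "bounded (f ` {0..b})"
    by (intro compact_imp_bounded compact_continuous_image continuous_on_subset[OF assms]) auto
  then obtain K where "\<forall>x\<in>{0..b}. \<bar>f x\<bar> \<le> K" by (auto simp: bounded_iff)
  then have "\<bar>f x\<bar> \<le> max K 0" if "x \<in> {0..b}" for x using that by (simp add: le_max_iff_disj)
  then show thesis by (rule that[OF max.cobounded2])
qed

lemma sq_integrable_continuous_Iv: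
  fixes f :: "real \<Rightarrow> real"
  assumes "continuous_on UNIV f"
  shows "sq_integrable (Iv b) f"
proof -
  interpret finite_measure "Iv b" by (rule finite_measure_Iv)
  obtain K where K: "\<And>x. x \<in> {0..b} \<Longrightarrow> \<bar>f x\<bar> \<le> K" using continuous_bounded_Iv[OF assms] by metis
  show ?thesis
  proof (rule sq_integrable_bounded)
    show "f \<in> borel_measurable (Iv b)"
      using assms by (intro Iv_measurable borel_measurable_continuous_onI)
    show "AE x in Iv b. \<bar>f x\<bar> \<le> K" by (rule AE_I2) (use K in auto)
  qed
qed

lemma integrable_continuous_Iv:
  fixes f :: "real \<Rightarrow> real"
  assumes "continuous_on UNIV f"
  shows "integrable (Iv b) f"
  using finite_measure.sq_integrable_integrable[OF finite_measure_Iv sq_integrable_continuous_Iv[OF assms]] .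

lemma FTC_Iv:
  assumes F: "\<And>x. (F has_real_derivative f x) (at x)" and f: "continuous_on UNIV f"
    and ab: "0 \<le> a" "a \<le> c" "c \<le> b"
  shows "(LINT x|Iv b. indicator {a<..<c} x * f x) = F c - F a"
proof -
  have "(LINT x|Iv b. indicator {a<..<c} x * f x) = (LINT x|lborel. indicator {a<..<c} x * f x)"
    using ab by (subst integral_restrict_space) (auto intro!: Bochner_Integration.integral_cong simp: indicator_def)
  also have "\<dots> = (LINT x|lborel. indicator {a..c} x *\<^sub>R f x)"
  proof (rule integral_cong_AE)
    show "AE x in lborel. indicator {a<..<c} x * f x = indicator {a..c} x *\<^sub>R f x"
      using AE_lborel_singleton[of a] AE_lborel_singleton[of c] by eventually_elim (auto simp: indicator_def)
    have [measurable]: "f \<in> borel_measurable borel" using f by (rule borel_measurable_continuous_onI)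
    show "(\<lambda>x. indicator {a<..<c} x * f x) \<in> borel_measurable lborel"
      "(\<lambda>x. indicator {a..c} x *\<^sub>R f x) \<in> borel_measurable lborel" by measurable
  qed
  also have "\<dots> = F c - F a"
  proof (rule integral_FTC_atLeastAtMost[OF ab(2)])
    show "continuous_on {a..c} f" using f by (rule continuous_on_subset) simp
    show "(F has_vector_derivative f x) (at x within {a..c})" for x
      using F[of x] by (simp add: has_real_derivative_iff_has_vector_derivative[symmetric] has_field_derivative_at_within)
  qed
  finally show ?thesis .
qed

text \<open>The signed indicator of the interval between \<open>s0\<close> and \<open>t\<close>: the
  integral of \<open>kern s0 t s * g s\<close> over \<open>s\<close> is the primitive of
  \<open>g\<close> that vanishes at \<open>s0\<close>. As an integral over a fixed interval it is
  accessible to Fubini's theorem and to the Cauchy-Schwarz inequality for either order of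
  \<open>s0\<close> and \<open>t\<close>.\<close>

definition kern :: "real \<Rightarrow> real \<Rightarrow> real \<Rightarrow> real" where
  "kern s0 t s = indicator {s0<..<t} s - indicator {t<..<s0} s"

lemma kern_bound: "\<bar>kern s0 t s\<bar> \<le> 1"
  by (auto simp: kern_def indicator_def)

lemma kern_measurable [measurable]:
  "(\<lambda>z. kern s0 (f z) (g z)) \<in> borel_measurable M"
  if [measurable]: "f \<in> borel_measurable M" "g \<in> borel_measurable M"
proof -
  have "(\<lambda>z. kern s0 (f z) (g z)) = (\<lambda>z. (if s0 < g z \<and> g z < f z then 1 else 0) - (if f z < g z \<and> g z < s0 then 1 else 0))"
    by (auto simp: kern_def indicator_def)
  then show ?thesis by simp
qed

lemma FTC_kern:
  assumes F: "\<And>x. (F has_real_derivative f x) (at x)" and f: "continuous_on UNIV f"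
    and "s0 \<in> {0..b}" "t \<in> {0..b}"
  shows "(LINT s|Iv b. kern s0 t s * f s) = F t - F s0"
proof (cases "s0 \<le> t")
  case True
  then have "kern s0 t s = indicator {s0<..<t} s" for s by (auto simp: kern_def indicator_def)
  then show ?thesis using FTC_Iv[OF F f, of s0 t b] True assms(3,4) by simp
next
  case False
  then have "kern s0 t s = - indicator {t<..<s0} s" for s by (auto simp: kern_def indicator_def)
  then show ?thesis using FTC_Iv[OF F f, of t s0 b] False assms(3,4) by simp
qed

lemma integrable_kern:
  assumes "integrable (Iv b) g"
  shows "integrable (Iv b) (\<lambda>s. kern s0 t s * g s)"
proof (rule Bochner_Integration.integrable_bound[OF assms])
  show "(\<lambda>s. kern s0 t s * g s) \<in> borel_measurable (Iv b)"
    using borel_measurable_integrable[OF assms] Iv_ident[measurable] by measurable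
  show "AE x in Iv b. norm (kern s0 t x * g x) \<le> norm (g x)"
    using kern_bound[of s0 t] by (simp add: abs_mult mult_left_le_one_le)
qed

lemma kern_integral_sq_le:
  assumes "sq_integrable (Iv b) g" "b \<ge> 0"
  shows "(LINT s|Iv b. kern s0 t s * g s)\<^sup>2 \<le> b * (LINT s|Iv b. (g s)\<^sup>2)"
proof -
  interpret finite_measure "Iv b" by (rule finite_measure_Iv)
  note Iv_ident[measurable]
  have [measurable]: "g \<in> borel_measurable (Iv b)" using assms(1) by (rule sq_integrable_measurable)
  have k: "sq_integrable (Iv b) (kern s0 t)"
    by (rule sq_integrable_bounded[of _ 1]) (use kern_bound in auto)
  have "(LINT s|Iv b. kern s0 t s * g s)\<^sup>2 \<le> (LINT s|Iv b. (kern s0 t s)\<^sup>2) * (LINT s|Iv b. (g s)\<^sup>2)"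
    by (rule Cauchy_Schwarz_integral[OF k assms(1)])
  also have "\<dots> \<le> b * (LINT s|Iv b. (g s)\<^sup>2)"
  proof (rule mult_right_mono)
    have "(LINT s|Iv b. (kern s0 t s)\<^sup>2) \<le> (LINT s|Iv b. 1)"
      using k kern_bound[of s0 t] by (intro integral_mono) (auto simp: sq_integrable_def abs_square_le_1)
    then show "(LINT s|Iv b. (kern s0 t s)\<^sup>2) \<le> b" using measure_Iv[OF assms(2)] by simp
  qed simp
  finally show ?thesis .
qed

text \<open>The function \<open>g\<close> is merely integrable, so the boundary term is avoided by
  exchanging the order of integration on the triangle \<open>s < t\<close>.\<close>

lemma kern_integral_by_parts:
  assumes g: "integrable (Iv b) g" and b: "b > 0"
    and P: "\<And>x. (P has_real_derivative p x) (at x)" "continuous_on UNIV p" "P b = 0"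
  shows "(LINT s|Iv b. g s * P s) = - (LINT t|Iv b. (LINT s|Iv b. kern 0 t s * g s) * p t)"
proof -
  interpret pair_sigma_finite "Iv b" "Iv b" by (rule pair_sigma_finite_Iv)
  note Iv_ident[measurable]
  have [measurable]: "g \<in> borel_measurable (Iv b)" "p \<in> borel_measurable (Iv b)"
    using g P(2) by (auto intro!: Iv_measurable borel_measurable_continuous_onI)
  obtain K where K: "K \<ge> 0" "\<And>x. x \<in> {0..b} \<Longrightarrow> \<bar>p x\<bar> \<le> K" using continuous_bounded_Iv[OF P(2)] by metis
  have int: "integrable (Iv2 b b) (\<lambda>(s, t). kern 0 t s * g s * p t)"
  proof (rule Fubini_integrable)
    show "(\<lambda>(s, t). kern 0 t s * g s * p t) \<in> borel_measurable (Iv2 b b)" by measurable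
    have bnd: "norm (kern 0 t s * g s * p t) \<le> \<bar>g s\<bar> * K" if "t \<in> {0<..<b}" for s t
    proof -
      have "\<bar>kern 0 t s\<bar> * \<bar>g s\<bar> * \<bar>p t\<bar> \<le> 1 * \<bar>g s\<bar> * K"
        using K that by (intro mult_mono kern_bound) auto
      then show ?thesis by (simp add: abs_mult)
    qed
    interpret fm: finite_measure "Iv b" by (rule finite_measure_Iv)
    have int1: "integrable (Iv b) (\<lambda>t. kern 0 t s * g s * p t)" if "s \<in> {0<..<b}" for s
      by (rule fm.integrable_const_bound[of _ "\<bar>g s\<bar> * K"]) (use bnd in \<open>auto intro!: AE_I2\<close>)
    show "AE s in Iv b. integrable (Iv b) (\<lambda>t. case (s, t) of (s, t) \<Rightarrow> kern 0 t s * g s * p t)"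
      by (rule AE_I2) (use int1 in auto)
    show "integrable (Iv b) (\<lambda>s. LINT t|Iv b. norm (case (s, t) of (s, t) \<Rightarrow> kern 0 t s * g s * p t))"
    proof (rule Bochner_Integration.integrable_bound)
      show "integrable (Iv b) (\<lambda>s. b * (\<bar>g s\<bar> * K))" using g by simp
      show "(\<lambda>s. LINT t|Iv b. norm (case (s, t) of (s, t) \<Rightarrow> kern 0 t s * g s * p t)) \<in> borel_measurable (Iv b)"
        by measurable
      show "AE s in Iv b. norm (LINT t|Iv b. norm (case (s, t) of (s, t) \<Rightarrow> kern 0 t s * g s * p t)) \<le> norm (b * (\<bar>g s\<bar> * K))"
      proof (rule AE_I2)
        fix s assume s: "s \<in> space (Iv b)"
        have "(LINT t|Iv b. norm (kern 0 t s * g s * p t)) \<le> (LINT t|Iv b. \<bar>g s\<bar> * K)"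
          using int1[of s] s bnd by (intro integral_mono) auto
        also have "\<dots> = b * (\<bar>g s\<bar> * K)" using measure_Iv[of b] b by simp
        finally show "norm (LINT t|Iv b. norm (case (s, t) of (s, t) \<Rightarrow> kern 0 t s * g s * p t)) \<le> norm (b * (\<bar>g s\<bar> * K))"
          by simp
      qed
    qed
  qed
  have "(LINT s|Iv b. g s * P s) = (LINT s|Iv b. - (LINT t|Iv b. kern 0 t s * g s * p t))"
  proof (rule Bochner_Integration.integral_cong[OF refl])
    fix s assume s: "s \<in> space (Iv b)"
    have "(LINT t|Iv b. kern 0 t s * g s * p t) = (LINT t|Iv b. g s * (indicator {s<..<b} t * p t))"
      by (rule Bochner_Integration.integral_cong[OF refl]) (use s in \<open>auto simp: kern_def indicator_def\<close>)
    also have "\<dots> = g s * (P b - P s)"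
      using FTC_Iv[OF P(1,2), of s b b] s by simp
    finally show "g s * P s = - (LINT t|Iv b. kern 0 t s * g s * p t)" using P(3) by simp
  qed
  also have "\<dots> = - (LINT s|Iv b. LINT t|Iv b. kern 0 t s * g s * p t)" by simp
  also have "(LINT s|Iv b. LINT t|Iv b. kern 0 t s * g s * p t) = (LINT t|Iv b. LINT s|Iv b. kern 0 t s * g s * p t)"
    using int by (rule Fubini_integral[symmetric])
  also have "\<dots> = (LINT t|Iv b. (LINT s|Iv b. kern 0 t s * g s) * p t)" by simp
  finally show ?thesis .
qed

subsection \<open>Tests of product form\<close>

lemma smooth_has_real_derivative:
  fixes f :: "real \<Rightarrow> real"
  assumes "smooth f"
  shows "(f has_real_derivative pderivs [1] f x) (at x)"
proof -
  have d: "(f has_derivative frechet_derivative f (at x)) (at x)"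
    using assms by (intro has_derivative_frechet smooth_differentiable)
  have "frechet_derivative f (at x) h = frechet_derivative f (at x) 1 * h" for h
  proof -
    have "frechet_derivative f (at x) h = h * frechet_derivative f (at x) 1"
      using linear_scale[OF linear_frechet_derivative[OF smooth_differentiable[OF assms]], of x h 1]
      by (simp only: real_scaleR_def mult_1_right)
    then show ?thesis by (simp only: mult.commute)
  qed
  then have "frechet_derivative f (at x) = (\<lambda>h. frechet_derivative f (at x) 1 * h)" by (rule ext)
  with d show ?thesis unfolding has_field_derivative_def pderivs.simps by (simp only:)
qed

lemma smooth_tensor:
  fixes f g :: "real \<Rightarrow> real"
  assumes "smooth f" "smooth g"
  shows "smooth (\<lambda>z::real \<times> real. f (fst z) * g (snd z))"
proof -
  have "smooth (\<lambda>z::real \<times> real. f (z \<bullet> (1, 0)))" "smooth (\<lambda>z::real \<times> real. g (z \<bullet> (0, 1)))"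
    by (intro smooth_compose_inner assms)+
  then show ?thesis by (intro smooth_mult) (simp_all add: inner_prod_def)
qed

lemma pderivs_tensor:
  fixes f g :: "real \<Rightarrow> real"
  assumes "smooth f" "smooth g"
  shows "pderivs [(1, 0)] (\<lambda>z. f (fst z) * g (snd z)) = (\<lambda>z. pderivs [1] f (fst z) * g (snd z))"
    "pderivs [(0, 1)] (\<lambda>z. f (fst z) * g (snd z)) = (\<lambda>z. f (fst z) * pderivs [1] g (snd z))"
proof -
  have "((\<lambda>z. f (fst z) * g (snd z)) has_derivative
     (\<lambda>h. f (fst z) * (pderivs [1] g (snd z) * snd h) + (pderivs [1] f (fst z) * fst h) * g (snd z))) (at z)" for z
  proof (rule has_derivative_mult)
    show "((\<lambda>z. f (fst z)) has_derivative (\<lambda>h. pderivs [1] f (fst z) * fst h)) (at z)"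
      using smooth_has_real_derivative[OF assms(1), of "fst z"]
      by (intro has_derivative_compose[where f=fst and f'=fst and g=f])
        (auto simp: has_field_derivative_def intro!: derivative_intros)
    show "((\<lambda>z. g (snd z)) has_derivative (\<lambda>h. pderivs [1] g (snd z) * snd h)) (at z)"
      using smooth_has_real_derivative[OF assms(2), of "snd z"]
      by (intro has_derivative_compose[where f=snd and f'=snd and g=g])
        (auto simp: has_field_derivative_def intro!: derivative_intros)
  qed
  then have *: "frechet_derivative (\<lambda>z. f (fst z) * g (snd z)) (at z) =
     (\<lambda>h. f (fst z) * (pderivs [1] g (snd z) * snd h) + (pderivs [1] f (fst z) * fst h) * g (snd z))" for z
    by (rule frechet_derivative_eq)
  show "pderivs [(1, 0)] (\<lambda>z. f (fst z) * g (snd z)) = (\<lambda>z. pderivs [1] f (fst z) * g (snd z))"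
    "pderivs [(0, 1)] (\<lambda>z. f (fst z) * g (snd z)) = (\<lambda>z. f (fst z) * pderivs [1] g (snd z))"
    by (simp_all add: * del: pderivs.simps(2) add: pderivs.simps(2)[of "(1, 0) :: real \<times> real"] pderivs.simps(2)[of "(0, 1) :: real \<times> real"])
qed

lemma test_fun_tensor:
  fixes f g :: "real \<Rightarrow> real"
  assumes "test_fun S f" "test_fun T g"
  shows "test_fun (S \<times> T) (\<lambda>z. f (fst z) * g (snd z))"
  using assms
proof (elim test_fun_supportE)
  fix K L assume "smooth f" "compact K" "K \<subseteq> S" "\<And>x. x \<notin> K \<Longrightarrow> f x = 0"
   "smooth g" "compact L" "L \<subseteq> T" "\<And>x. x \<notin> L \<Longrightarrow> g x = 0"
  then show ?thesis
    by (intro test_fun_supportI[of _ "K \<times> L"] smooth_tensor compact_Times) (auto simp: mem_Times_iff)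
qed

lemma test_fun_bounded:
  assumes "test_fun S f"
  obtains K where "K \<ge> 0" "\<And>x. \<bar>f x\<bar> \<le> K"
  using assms
proof (rule test_fun_supportE)
  fix L assume L: "smooth f" "compact L" "L \<subseteq> S" "\<And>x. x \<notin> L \<Longrightarrow> f x = 0"
  have "bounded (f ` L)"
    using L by (intro compact_imp_bounded compact_continuous_image smooth_continuous_on)
  then obtain K where K: "\<And>x. x \<in> L \<Longrightarrow> \<bar>f x\<bar> \<le> K" by (auto simp: bounded_iff)
  have "\<bar>f x\<bar> \<le> max K 0" for x using K[of x] L(4)[of x] by (cases "x \<in> L") auto
  then show thesis by (rule that[OF max.cobounded2])
qed

lemma test_fun_smooth: "test_fun S f \<Longrightarrow> smooth f"
  by (simp add: test_fun_def)

lemma test_fun_measurable: "test_fun S f \<Longrightarrow> f \<in> borel_measurable borel"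
  by (simp add: test_fun_def smooth_measurable)

lemma integrable_mult_tensor:
  assumes "integrable (Iv2 a b) u" "test_fun S f" "test_fun T g"
  shows "integrable (Iv2 a b) (\<lambda>z. u z * (f (fst z) * g (snd z)))"
proof -
  obtain K where K: "K \<ge> 0" "\<And>x. \<bar>f x\<bar> \<le> K" using test_fun_bounded[OF assms(2)] by metis
  obtain L where L: "L \<ge> 0" "\<And>x. \<bar>g x\<bar> \<le> L" using test_fun_bounded[OF assms(3)] by metis
  have [measurable]: "f \<in> borel_measurable (Iv a)" "g \<in> borel_measurable (Iv b)"
    using assms(2,3) by (auto intro!: Iv_measurable test_fun_measurable)
  show ?thesis
  proof (rule Bochner_Integration.integrable_bound)
    show "integrable (Iv2 a b) (\<lambda>z. u z * (K * L))" using assms(1) by simp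
    show "(\<lambda>z. u z * (f (fst z) * g (snd z))) \<in> borel_measurable (Iv2 a b)"
      using borel_measurable_integrable[OF assms(1)] by measurable
    have "norm (u z * (f (fst z) * g (snd z))) \<le> norm (u z * (K * L))" for z
    proof -
      have "\<bar>u z\<bar> * (\<bar>f (fst z)\<bar> * \<bar>g (snd z)\<bar>) \<le> \<bar>u z\<bar> * (K * L)"
        using K L by (intro mult_left_mono mult_mono) auto
      then show ?thesis using K L by (simp add: abs_mult)
    qed
    then show "AE z in Iv2 a b. norm (u z * (f (fst z) * g (snd z))) \<le> norm (u z * (K * L))" by simp
  qed
qed

text \<open>Products of plateau functions of one variable tend boundedly to indicators of
  rectangles.\<close>

lemma AE_eq_0_if_tensor_tests_eq_0:
  assumes int: "integrable (Iv2 a b) u"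
    and zero: "\<And>f g. test_fun {0<..<a} f \<Longrightarrow> test_fun {0<..<b} g \<Longrightarrow>
      (LINT z|Iv2 a b. u z * (f (fst z) * g (snd z))) = 0"
  shows "AE z in Iv2 a b. u z = 0"
proof -
  let ?Q = "{0<..<a} \<times> {0<..<b}"
  have Q: "?Q \<in> sets borel" by (intro borel_Times) auto
  have i: "integrable (lres ?Q) u" using int by (simp add: Iv_pair)
  have "AE z in lborel. z \<in> ?Q \<longrightarrow> u z = 0"
  proof (rule AE_eq_0_if_all_box_integrals_eq_0)
    show "open ?Q" by (intro open_Times) auto
    fix p q :: "real \<times> real" assume pq: "cbox p q \<subseteq> ?Q"
    have "set_integrable lborel ?Q u" using i Q by (simp add: set_integrable_lres)
    then show si: "set_integrable lborel (box p q) u"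
      by (rule set_integrable_subset) (use pq box_subset_cbox[of p q] in auto)
    show "(LINT z:box p q|lborel. u z) = 0"
    proof (cases "box p q = {}")
      case False
      obtain p1 p2 q1 q2 where pq12: "p = (p1, p2)" "q = (q1, q2)" by (metis surj_pair)
      have "cbox p q = cbox p1 q1 \<times> cbox p2 q2" by (simp add: pq12 cbox_Pair_eq)
      moreover have "cbox p q \<noteq> {}" using False box_subset_cbox[of p q] by auto
      ultimately have sub: "cbox p1 q1 \<subseteq> {0<..<a}" "cbox p2 q2 \<subseteq> {0<..<b}"
        using pq unfolding times_subset_iff by (metis times_subset_iff Sigma_empty1 Sigma_empty2)+
      have bx: "indicator (box p q) z = (indicator (box p1 q1) (fst z) * indicator (box p2 q2) (snd z) :: real)" for z
        by (cases z) (auto simp: pq12 mem_box Basis_prod_def indicator_def)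
      have t: "test_fun {0<..<a} (box_plateau p1 q1 n)" "test_fun {0<..<b} (box_plateau p2 q2 n)" for n
        by (rule test_fun_box_plateau[OF sub(1)], rule test_fun_box_plateau[OF sub(2)])
      have [measurable]: "box_plateau p1 q1 n \<in> borel_measurable (Iv a)" "box_plateau p2 q2 n \<in> borel_measurable (Iv b)" for n
        using t by (auto intro!: Iv_measurable test_fun_measurable)
      have [measurable]: "(indicator (box p1 q1) :: real \<Rightarrow> real) \<in> borel_measurable (Iv a)"
         "(indicator (box p2 q2) :: real \<Rightarrow> real) \<in> borel_measurable (Iv b)"
        by (auto intro!: Iv_measurable)
      note [measurable] = borel_measurable_integrable[OF int]
      have "(\<lambda>n. LINT z|Iv2 a b. u z * (box_plateau p1 q1 n (fst z) * box_plateau p2 q2 n (snd z)))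
         \<longlonglongrightarrow> (LINT z|Iv2 a b. u z * (indicator (box p1 q1) (fst z) * indicator (box p2 q2) (snd z)))"
      proof (rule integral_dominated_convergence)
        show "integrable (Iv2 a b) (\<lambda>z. \<bar>u z\<bar>)" using int by simp
        show "AE z in Iv2 a b. (\<lambda>n. u z * (box_plateau p1 q1 n (fst z) * box_plateau p2 q2 n (snd z)))
          \<longlonglongrightarrow> u z * (indicator (box p1 q1) (fst z) * indicator (box p2 q2) (snd z))"
          by (intro AE_I2 tendsto_intros box_plateau_tendsto)
        have "norm (u z * (box_plateau p1 q1 n (fst z) * box_plateau p2 q2 n (snd z))) \<le> \<bar>u z\<bar>" for n z
        proof -
          have "\<bar>box_plateau p1 q1 n (fst z)\<bar> * \<bar>box_plateau p2 q2 n (snd z)\<bar> \<le> 1 * 1"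
            by (intro mult_mono box_plateau_bounds) auto
          then show ?thesis by (simp add: abs_mult mult_left_le)
        qed
        then show "AE z in Iv2 a b. norm (u z * (box_plateau p1 q1 n (fst z) * box_plateau p2 q2 n (snd z))) \<le> \<bar>u z\<bar>" for n
          by simp
      qed measurable
      then have "(LINT z|Iv2 a b. u z * (indicator (box p1 q1) (fst z) * indicator (box p2 q2) (snd z))) = 0"
        unfolding zero[OF t] by (simp add: LIMSEQ_const_iff)
      moreover have "(LINT z:box p q|lborel. u z) = (LINT z|Iv2 a b. u z * (indicator (box p1 q1) (fst z) * indicator (box p2 q2) (snd z)))"
      proof -
        have "box p q \<subseteq> ?Q" using pq box_subset_cbox[of p q] by (rule order_trans[rotated])
        then have eq: "indicator ?Q z *\<^sub>R (u z * indicator (box p q) z) = indicator (box p q) z *\<^sub>R u z" for z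
          by (auto simp: indicator_def simp del: mem_Times_iff)
        have "(LINT z|lres ?Q. u z * indicator (box p q) z) = (LINT z|lborel. indicator ?Q z *\<^sub>R (u z * indicator (box p q) z))"
          by (rule integral_restrict_space) (use Q in simp)
        then show ?thesis
          unfolding Iv_pair bx[symmetric] set_lebesgue_integral_def eq by simp
      qed
      ultimately show ?thesis by simp
    qed (simp add: set_lebesgue_integral_def)
  qed
  then show ?thesis unfolding Iv_pair using Q by (simp add: AE_lres_iff)
qed

subsection \<open>Representation by a primitive\<close>

text \<open>The antiderivative that starts to the left of the support vanishes there; to the right of
  the support it is equal to the total mass.\<close>

lemma test_fun_antideriv:
  assumes f: "test_fun {0<..<b} f" and zero: "(LINT t|Iv b. f t) = 0"
  obtains \<eta> where "test_fun {0<..<b} \<eta>" "\<And>t. (\<eta> has_real_derivative f t) (at t)"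
proof -
  obtain K where K: "smooth f" "compact K" "K \<subseteq> {0<..<b}" "\<And>x. x \<notin> K \<Longrightarrow> f x = 0"
    using test_fun_supportE[OF f] by metis
  show thesis
  proof (cases "K = {}")
    case True
    then have "f = (\<lambda>_. 0)" using K(4) by auto
    then show thesis using that[OF f] by simp
  next
    case False
    obtain p where p: "p \<in> K" "\<And>x. x \<in> K \<Longrightarrow> p \<le> x" using compact_attains_inf[OF K(2) False] by metis
    obtain q where q: "q \<in> K" "\<And>x. x \<in> K \<Longrightarrow> x \<le> q" using compact_attains_sup[OF K(2) False] by metis
    have pq: "0 < p" "p \<le> q" "q < b" using p q K(3) by auto
    have out: "f x = 0" if "x \<notin> {p..q}" for x using that K(4)[of x] p(2)[of x] q(2)[of x] by auto
    have cont: "continuous_on S f" for S using K(1) by (rule smooth_continuous_on)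
    define \<eta> where "\<eta> t = integral {p - 1..t} f" for t
    have deriv: "(\<eta> has_real_derivative f t) (at t)" for t
    proof (cases "t < p")
      case True
      have "(\<eta> has_real_derivative 0) (at t)"
      proof (rule has_field_derivative_transform_within_open[of "\<lambda>_. 0" 0 t "{..<p}"])
        show "0 = \<eta> y" if "y \<in> {..<p}" for y
        proof -
          have "\<eta> y = integral {p - 1..y} (\<lambda>_. 0)"
            unfolding \<eta>_def by (rule Henstock_Kurzweil_Integration.integral_cong) (use out that in auto)
          then show ?thesis by simp
        qed
      qed (use True in auto)
      then show ?thesis using out[of t] True by simp
    next
      case False
      have "(\<eta> has_real_derivative f t) (at t within {p - 1..t + 1})"
        unfolding \<eta>_def using False by (intro integral_has_real_derivative cont) auto
      moreover have "at t within {p - 1..t + 1} = at t"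
        using False by (intro at_within_interior) auto
      ultimately show ?thesis by simp
    qed
    have sm: "smooth \<eta>" using deriv K(1) by (rule smooth_antideriv)
    have eta0: "\<eta> t = 0" if "t \<le> p" for t
    proof -
      have "\<eta> t = integral {p - 1..t} (\<lambda>_. 0)"
        unfolding \<eta>_def
      proof (rule integral_spike[of "{p}"])
        show "0 = f x" if "x \<in> {p - 1..t} - {p}" for x using that \<open>t \<le> p\<close> out[of x] by auto
      qed auto
      then show ?thesis by simp
    qed
    have "(LINT t|Iv b. f t) = (LINT t|Iv b. indicator {0<..<b} t * f t)"
      by (rule Bochner_Integration.integral_cong) auto
    also have "\<dots> = \<eta> b - \<eta> 0" using FTC_Iv[OF deriv cont, of 0 b b] pq by simp
    finally have etab: "\<eta> b = 0" using zero eta0[of 0] pq by simp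
    have etaq: "\<eta> t = 0" if "q < t" for t
    proof -
      have "\<exists>c. \<forall>x\<in>{q<..}. \<eta> x = c"
      proof (rule has_field_derivative_zero_constant)
        show "(\<eta> has_real_derivative 0) (at x within {q<..})" if "x \<in> {q<..}" for x
          using deriv[of x] out[of x] that by (simp add: has_field_derivative_at_within)
      qed auto
      then show ?thesis using that pq etab by (metis greaterThan_iff)
    qed
    have "test_fun {0<..<b} \<eta>"
      by (rule test_fun_supportI[OF sm, of "{p..q}"]) (use pq eta0 etaq in \<open>auto simp: not_le\<close>)
    then show thesis using deriv by (rule that)
  qed
qed

lemma unit_mass_test_fun:
  assumes "b > 0"
  obtains \<theta> where "test_fun {0<..<b} \<theta>" "(LINT t|Iv b. \<theta> t) = 1"
proof -
  let ?f = "box_bump (b / 4) (b / 2)"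
  have "test_fun {0<..<b} (box_plateau (b / 4) (b / 2) 1)"
    by (rule test_fun_box_plateau) (use assms in auto)
  then have t: "test_fun {0<..<b} ?f" by (simp add: box_plateau_def[abs_def])
  have int: "integrable (Iv b) ?f"
    by (rule integrable_continuous_Iv[OF smooth_continuous_on[OF smooth_box_bump]])
  have "(LINT t|Iv b. ?f t) \<noteq> 0"
  proof
    assume "(LINT t|Iv b. ?f t) = 0"
    then have "AE t in Iv b. ?f t = 0"
      using integral_nonneg_eq_0_iff_AE[OF int] box_bump_bounds by auto
    then have "AE t in lborel. t \<in> {0<..<b} \<longrightarrow> ?f t = 0" by (simp add: AE_lres_iff)
    then have "AE t in lborel. t \<notin> {b/4<..<b/2}"
    proof eventually_elim
      case (elim t)
      then show ?case using box_bump_eq_0_iff[of "b/4" "b/2" t] assms by auto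
    qed
    then have "{b/4<..<b/2} \<in> null_sets lborel" by (subst AE_iff_null_sets) simp_all
    then have "emeasure lborel {b/4<..<b/2} = 0" by (rule null_setsD1)
    then show False using assms by simp
  qed
  then have "(LINT t|Iv b. (1 / (LINT t|Iv b. ?f t)) * ?f t) = 1"
    using int by simp
  with test_fun_cmult[OF t] show thesis by (rule that)
qed

lemma prim_measurable:
  assumes "g \<in> borel_measurable (Iv2 a b)"
  shows "(\<lambda>z. LINT s|Iv b. kern s0 (snd z) s * g (fst z, s)) \<in> borel_measurable (Iv2 a b)"
proof -
  interpret sigma_finite_measure "Iv b" by (rule sigma_finite_Iv)
  note assms[measurable] Iv_ident[measurable]
  show ?thesis by measurable
qed

lemma Iv_pair_slices:
  fixes f :: "real \<times> real \<Rightarrow> real"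
  assumes "integrable (Iv2 a b) f"
  shows "AE x in Iv a. integrable (Iv b) (\<lambda>t. f (x, t))"
    "integrable (Iv a) (\<lambda>x. LINT t|Iv b. f (x, t))"
    "(LINT x|Iv a. LINT t|Iv b. f (x, t)) = (LINT z|Iv2 a b. f z)"
proof -
  interpret pair_sigma_finite "Iv a" "Iv b" by (rule pair_sigma_finite_Iv)
  show "AE x in Iv a. integrable (Iv b) (\<lambda>t. f (x, t))"
    "integrable (Iv a) (\<lambda>x. LINT t|Iv b. f (x, t))"
    "(LINT x|Iv a. LINT t|Iv b. f (x, t)) = (LINT z|Iv2 a b. f z)"
    using AE_integrable_fst'[OF assms] integrable_fst'[OF assms] integral_fst'[OF assms] by auto
qed

lemma AE_Iv_pairI:
  assumes "AE x in Iv a. AE t in Iv b. P (x, t)" "Measurable.pred (Iv2 a b) P"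
  shows "AE z in Iv2 a b. P z"
proof -
  interpret pair_sigma_finite "Iv a" "Iv b" by (rule pair_sigma_finite_Iv)
  show ?thesis using assms by (intro AE_pair_measure) auto
qed

lemma AE_Iv_pairD:
  assumes "AE z in Iv2 a b. P z"
  shows "AE x in Iv a. AE t in Iv b. P (x, t)"
proof -
  interpret pair_sigma_finite "Iv a" "Iv b" by (rule pair_sigma_finite_Iv)
  show ?thesis using assms by (rule AE_pair)
qed

lemma sq_integrable_pair_slices:
  assumes "sq_integrable (Iv2 a b) g"
  shows "AE x in Iv a. sq_integrable (Iv b) (\<lambda>t. g (x, t))"
    "integrable (Iv a) (\<lambda>x. LINT t|Iv b. (g (x, t))\<^sup>2)"
    "(LINT x|Iv a. LINT t|Iv b. (g (x, t))\<^sup>2) = (LINT z|Iv2 a b. (g z)\<^sup>2)"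
proof -
  have [measurable]: "g \<in> borel_measurable (Iv2 a b)" using assms by (rule sq_integrable_measurable)
  have i: "integrable (Iv2 a b) (\<lambda>z. (g z)\<^sup>2)" using assms by (simp add: sq_integrable_def)
  show "integrable (Iv a) (\<lambda>x. LINT t|Iv b. (g (x, t))\<^sup>2)"
    "(LINT x|Iv a. LINT t|Iv b. (g (x, t))\<^sup>2) = (LINT z|Iv2 a b. (g z)\<^sup>2)"
    using Iv_pair_slices[OF i] by auto
  show "AE x in Iv a. sq_integrable (Iv b) (\<lambda>t. g (x, t))"
    using Iv_pair_slices(1)[OF i] AE_space
    by eventually_elim (simp add: sq_integrable_def)
qed

lemma integrable_fst_Iv:
  fixes f :: "real \<Rightarrow> real"
  assumes "integrable (Iv a) f" "b \<ge> 0"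
  shows "integrable (Iv2 a b) (\<lambda>z. f (fst z))"
    "(LINT z|Iv2 a b. f (fst z)) = b * (LINT x|Iv a. f x)"
proof -
  interpret pair_sigma_finite "Iv a" "Iv b" by (rule pair_sigma_finite_Iv)
  interpret N: finite_measure "Iv b" by (rule finite_measure_Iv)
  note [measurable] = borel_measurable_integrable[OF assms(1)]
  show i: "integrable (Iv2 a b) (\<lambda>z. f (fst z))"
  proof (rule Fubini_integrable)
    show "integrable (Iv a) (\<lambda>x. LINT y|Iv b. norm (f (fst (x, y))))" using assms(1) by simp
  qed auto
  show "(LINT z|Iv2 a b. f (fst z)) = b * (LINT x|Iv a. f x)"
    using integral_fst'[OF i] measure_Iv[OF assms(2)] assms(1) by simp
qed

lemma integrable_snd_Iv:
  fixes f :: "real \<Rightarrow> real"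
  assumes "integrable (Iv b) f" "a \<ge> 0"
  shows "integrable (Iv2 a b) (\<lambda>z. f (snd z))"
    "(LINT z|Iv2 a b. f (snd z)) = a * (LINT x|Iv b. f x)"
proof -
  interpret pair_sigma_finite "Iv a" "Iv b" by (rule pair_sigma_finite_Iv)
  interpret N: finite_measure "Iv a" by (rule finite_measure_Iv)
  note [measurable] = borel_measurable_integrable[OF assms(1)]
  show i: "integrable (Iv2 a b) (\<lambda>z. f (snd z))"
  proof (rule Fubini_integrable)
    show "integrable (Iv a) (\<lambda>x. LINT y|Iv b. norm (f (snd (x, y))))" by simp
  qed (use assms in auto)
  show "(LINT z|Iv2 a b. f (snd z)) = a * (LINT x|Iv b. f x)"
    using integral_fst'[OF i] measure_Iv[OF assms(2)] by simp
qed

lemma sq_integrable_prim: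
  assumes "sq_integrable (Iv2 a b) g" "b \<ge> 0"
  shows "sq_integrable (Iv2 a b) (\<lambda>z. LINT s|Iv b. kern s0 (snd z) s * g (fst z, s))"
    "(LINT z|Iv2 a b. (LINT s|Iv b. kern s0 (snd z) s * g (fst z, s))\<^sup>2) \<le> b\<^sup>2 * (LINT z|Iv2 a b. (g z)\<^sup>2)"
proof -
  let ?G = "\<lambda>z. LINT s|Iv b. kern s0 (snd z) s * g (fst z, s)"
  have m[measurable]: "?G \<in> borel_measurable (Iv2 a b)"
    using assms(1) by (intro prim_measurable sq_integrable_measurable)
  have i: "integrable (Iv a) (\<lambda>x. b * (LINT t|Iv b. (g (x, t))\<^sup>2))"
    using sq_integrable_pair_slices(2)[OF assms(1)] by simp
  note i2 = integrable_fst_Iv[OF i assms(2)]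
  note [measurable] = borel_measurable_integrable[OF i]
  have bnd: "AE z in Iv2 a b. (?G z)\<^sup>2 \<le> b * (LINT t|Iv b. (g (fst z, t))\<^sup>2)"
  proof (rule AE_Iv_pairI)
    show "AE x in Iv a. AE t in Iv b. (?G (x, t))\<^sup>2 \<le> b * (LINT r|Iv b. (g (fst (x, t), r))\<^sup>2)"
      using sq_integrable_pair_slices(1)[OF assms(1)]
      by eventually_elim (use kern_integral_sq_le[OF _ assms(2)] in auto)
  qed measurable
  have "integrable (Iv2 a b) (\<lambda>z. (?G z)\<^sup>2)"
    by (rule Bochner_Integration.integrable_bound[OF i2(1)]) (use bnd in \<open>auto elim!: eventually_mono\<close>)
  then show "sq_integrable (Iv2 a b) ?G" using m by (simp add: sq_integrable_def)
  have "(LINT z|Iv2 a b. (?G z)\<^sup>2) \<le> (LINT z|Iv2 a b. b * (LINT t|Iv b. (g (fst z, t))\<^sup>2))"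
    by (rule integral_mono_AE) (use i2(1) bnd \<open>integrable (Iv2 a b) (\<lambda>z. (?G z)\<^sup>2)\<close> in auto)
  also have "\<dots> = b\<^sup>2 * (LINT z|Iv2 a b. (g z)\<^sup>2)"
    unfolding i2(2) sq_integrable_pair_slices(3)[OF assms(1), symmetric]
    by (simp add: power2_eq_square)
  finally show "(LINT z|Iv2 a b. (?G z)\<^sup>2) \<le> b\<^sup>2 * (LINT z|Iv2 a b. (g z)\<^sup>2)" .
qed

text \<open>Subtracting the primitive leaves a function \<open>D\<close> whose weak derivative in the
  second variable is zero; such a function depends on the first variable only. To see this, take
  \<open>\<theta>\<close> of mass one: every test function \<open>\<psi>\<close> is a multiple of
  \<open>\<theta>\<close> plus the derivative of a test function, so only the integrals of
  \<open>D\<close> against \<open>\<theta>\<close> matter.\<close>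

theorem primitive_representation:
  assumes v: "sq_integrable (Iv2 a b) v" and g: "sq_integrable (Iv2 a b) g" and b: "b > 0"
    and weak: "\<And>\<zeta> \<psi>. test_fun {0<..<a} \<zeta> \<Longrightarrow> test_fun {0<..<b} \<psi> \<Longrightarrow>
      (LINT z|Iv2 a b. v z * (\<zeta> (fst z) * pderivs [1] \<psi> (snd z)))
        = - (LINT z|Iv2 a b. g z * (\<zeta> (fst z) * \<psi> (snd z)))"
  obtains c where "c \<in> borel_measurable (Iv a)"
    "AE z in Iv2 a b. v z = c (fst z) + (LINT s|Iv b. kern 0 (snd z) s * g (fst z, s))"
proof -
  let ?M = "Iv2 a b"
  interpret finite_measure ?M by (rule finite_measure_Iv_pair)
  define G where "G z = (LINT s|Iv b. kern 0 (snd z) s * g (fst z, s))" for z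
  have G: "sq_integrable ?M G" unfolding G_def using sq_integrable_prim(1)[OF g] b by simp
  define D where "D z = v z - G z" for z
  have iv: "integrable ?M v" and ig: "integrable ?M g" and iG: "integrable ?M G"
    using v g G by (auto intro: sq_integrable_integrable)
  have iD: "integrable ?M D" unfolding D_def using iv iG by simp
  obtain \<theta> where \<theta>: "test_fun {0<..<b} \<theta>" "(LINT t|Iv b. \<theta> t) = 1" using unit_mass_test_fun[OF b] .
  define c where "c x = (LINT t|Iv b. D (x, t) * \<theta> t)" for x
  have key: "(LINT z|?M. D z * (\<zeta> (fst z) * \<eta>' (snd z))) = 0"
    if \<zeta>: "test_fun {0<..<a} \<zeta>" and \<eta>: "test_fun {0<..<b} \<eta>" and \<eta>': "\<eta>' = pderivs [1] \<eta>" for \<zeta> \<eta> \<eta>'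
  proof -
    have t': "test_fun {0<..<b} \<eta>'" unfolding \<eta>' using \<eta> by (rule test_fun_pderivs) simp
    have d: "(\<eta> has_real_derivative \<eta>' t) (at t)" for t
      unfolding \<eta>' by (rule smooth_has_real_derivative[OF test_fun_smooth[OF \<eta>]])
    have \<eta>b: "\<eta> b = 0"
    proof (rule test_fun_supportE[OF \<eta>])
      fix K assume "K \<subseteq> {0<..<b}" "\<And>x. x \<notin> K \<Longrightarrow> \<eta> x = 0"
      moreover from this have "b \<notin> K" by auto
      ultimately show ?thesis by blast
    qed
    have "(LINT z|?M. g z * (\<zeta> (fst z) * \<eta> (snd z))) = (LINT x|Iv a. LINT t|Iv b. g (x, t) * (\<zeta> x * \<eta> t))"
      using Iv_pair_slices(3)[OF integrable_mult_tensor[OF ig \<zeta> \<eta>]] by simp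
    also have "\<dots> = (LINT x|Iv a. - (LINT t|Iv b. G (x, t) * (\<zeta> x * \<eta>' t)))"
    proof (rule integral_cong_AE)
      show "AE x in Iv a. (LINT t|Iv b. g (x, t) * (\<zeta> x * \<eta> t)) = - (LINT t|Iv b. G (x, t) * (\<zeta> x * \<eta>' t))"
        using Iv_pair_slices(1)[OF ig]
      proof eventually_elim
        case (elim x)
        have "(LINT t|Iv b. g (x, t) * \<eta> t) = - (LINT t|Iv b. G (x, t) * \<eta>' t)"
          unfolding G_def fst_conv snd_conv
          by (rule kern_integral_by_parts[OF elim b d smooth_continuous_on[OF test_fun_smooth[OF t']] \<eta>b])
        moreover have "(LINT t|Iv b. g (x, t) * (\<zeta> x * \<eta> t)) = \<zeta> x * (LINT t|Iv b. g (x, t) * \<eta> t)"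
          "(LINT t|Iv b. G (x, t) * (\<zeta> x * \<eta>' t)) = \<zeta> x * (LINT t|Iv b. G (x, t) * \<eta>' t)"
          unfolding integral_mult_right_zero[symmetric] by (simp_all add: mult_ac)
        ultimately show ?case by simp
      qed
      show "(\<lambda>x. LINT t|Iv b. g (x, t) * (\<zeta> x * \<eta> t)) \<in> borel_measurable (Iv a)"
        "(\<lambda>x. - (LINT t|Iv b. G (x, t) * (\<zeta> x * \<eta>' t))) \<in> borel_measurable (Iv a)"
        using Iv_pair_slices(2)[OF integrable_mult_tensor[OF ig \<zeta> \<eta>]]
          Iv_pair_slices(2)[OF integrable_mult_tensor[OF iG \<zeta> t']] by auto
    qed
    also have "\<dots> = - (LINT z|?M. G z * (\<zeta> (fst z) * \<eta>' (snd z)))"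
      using Iv_pair_slices(3)[OF integrable_mult_tensor[OF iG \<zeta> t']] by simp
    finally have "(LINT z|?M. v z * (\<zeta> (fst z) * \<eta>' (snd z))) = (LINT z|?M. G z * (\<zeta> (fst z) * \<eta>' (snd z)))"
      using weak[OF \<zeta> \<eta>] by (simp add: \<eta>')
    then show ?thesis
      using integrable_mult_tensor[OF iv \<zeta> t'] integrable_mult_tensor[OF iG \<zeta> t']
      by (simp add: D_def left_diff_distrib)
  qed
  have "integrable ?M (\<lambda>z. D z * \<theta> (snd z))"
  proof -
    obtain K where K: "K \<ge> 0" "\<And>x. \<bar>\<theta> x\<bar> \<le> K" using test_fun_bounded[OF \<theta>(1)] by metis
    have [measurable]: "\<theta> \<in> borel_measurable (Iv b)" using \<theta>(1) by (intro Iv_measurable test_fun_measurable)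
    show ?thesis
      by (rule Bochner_Integration.integrable_bound[of _ "\<lambda>z. D z * K"])
        (use iD K in \<open>auto simp: abs_mult intro!: mult_left_mono\<close>)
  qed
  from Iv_pair_slices(2)[OF this] have c: "integrable (Iv a) c" by (simp add: c_def[abs_def])
  have ic: "integrable ?M (\<lambda>z. c (fst z))" using integrable_fst_Iv(1)[OF c] b by simp
  have "AE z in ?M. D z - c (fst z) = 0"
  proof (rule AE_eq_0_if_tensor_tests_eq_0)
    show "integrable ?M (\<lambda>z. D z - c (fst z))" using iD ic by simp
    fix \<zeta> \<psi> assume \<zeta>: "test_fun {0<..<a} \<zeta>" and \<psi>: "test_fun {0<..<b} \<psi>"
    define k where "k = (LINT t|Iv b. \<psi> t)"
    have ip: "integrable (Iv b) \<psi>" "integrable (Iv b) \<theta>"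
      using \<psi> \<theta>(1) by (auto intro!: integrable_continuous_Iv smooth_continuous_on test_fun_smooth)
    have "test_fun {0<..<b} (\<lambda>t. \<psi> t + (- k) * \<theta> t)"
      by (intro test_fun_add \<psi> test_fun_cmult \<theta>)
    moreover have "(LINT t|Iv b. \<psi> t + (- k) * \<theta> t) = 0" using ip \<theta>(2) by (simp add: k_def)
    ultimately obtain \<eta> where \<eta>: "test_fun {0<..<b} \<eta>" "\<And>t. (\<eta> has_real_derivative \<psi> t + (- k) * \<theta> t) (at t)"
      using test_fun_antideriv[of b "\<lambda>t. \<psi> t + (- k) * \<theta> t"] by blast
    have \<eta>': "(\<lambda>t. \<psi> t + (- k) * \<theta> t) = pderivs [1] \<eta>"
      using DERIV_unique[OF \<eta>(2) smooth_has_real_derivative[OF test_fun_smooth[OF \<eta>(1)]]] by (rule ext)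
    note i1 = integrable_mult_tensor[OF iD \<zeta> \<psi>]
    note i2 = integrable_mult_tensor[OF iD \<zeta> \<theta>(1)]
    note i3 = integrable_mult_tensor[OF ic \<zeta> \<psi>]
    have "0 = (LINT z|?M. D z * (\<zeta> (fst z) * (\<psi> (snd z) + (- k) * \<theta> (snd z))))"
      using key[OF \<zeta> \<eta>(1) \<eta>'] by simp
    also have "\<dots> = (LINT z|?M. D z * (\<zeta> (fst z) * \<psi> (snd z)) - k * (D z * (\<zeta> (fst z) * \<theta> (snd z))))"
      by (intro Bochner_Integration.integral_cong) (auto simp: algebra_simps)
    also have "\<dots> = (LINT z|?M. D z * (\<zeta> (fst z) * \<psi> (snd z))) - k * (LINT z|?M. D z * (\<zeta> (fst z) * \<theta> (snd z)))"
      using i1 i2 by simp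
    finally have 1: "(LINT z|?M. D z * (\<zeta> (fst z) * \<psi> (snd z))) = k * (LINT z|?M. D z * (\<zeta> (fst z) * \<theta> (snd z)))"
      by simp
    have "(LINT z|?M. D z * (\<zeta> (fst z) * \<theta> (snd z))) = (LINT x|Iv a. LINT t|Iv b. D (x, t) * (\<zeta> x * \<theta> t))"
      using Iv_pair_slices(3)[OF i2] by simp
    also have "\<dots> = (LINT x|Iv a. \<zeta> x * c x)"
      unfolding c_def integral_mult_right_zero[symmetric]
      by (intro Bochner_Integration.integral_cong refl) (simp add: mult_ac)
    finally have 2: "(LINT z|?M. D z * (\<zeta> (fst z) * \<theta> (snd z))) = (LINT x|Iv a. \<zeta> x * c x)" .
    have "(LINT z|?M. c (fst z) * (\<zeta> (fst z) * \<psi> (snd z))) = (LINT x|Iv a. LINT t|Iv b. (c x * \<zeta> x) * \<psi> t)"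
      using Iv_pair_slices(3)[OF i3] by (simp add: mult.assoc)
    also have "\<dots> = k * (LINT x|Iv a. \<zeta> x * c x)"
      unfolding integral_mult_right_zero k_def[symmetric]
      by (simp add: mult.commute[of _ k] mult.commute[of "c _"])
    finally have 3: "(LINT z|?M. c (fst z) * (\<zeta> (fst z) * \<psi> (snd z))) = k * (LINT x|Iv a. \<zeta> x * c x)" .
    show "(LINT z|?M. (D z - c (fst z)) * (\<zeta> (fst z) * \<psi> (snd z))) = 0"
      using i1 i3 1 2 3 by (simp add: left_diff_distrib)
  qed
  then have "AE z in ?M. v z = c (fst z) + (LINT s|Iv b. kern 0 (snd z) s * g (fst z, s))"
    by eventually_elim (simp add: D_def G_def)
  with borel_measurable_integrable[OF c] show thesis by (rule that)
qed

subsection \<open>Bounds for functions that are primitives\<close>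

text \<open>A bound for the square of a function \<open>v\<close> on the slice at \<open>x\<close> in
  terms of \<open>v\<close> and of its derivative \<open>g\<close> on that slice.\<close>

definition slice_bound :: "real \<Rightarrow> (real \<times> real \<Rightarrow> real) \<Rightarrow> (real \<times> real \<Rightarrow> real) \<Rightarrow> real \<Rightarrow> real" where
  "slice_bound b v g x = 2 / b * (LINT r|Iv b. (v (x, r))\<^sup>2) + 8 * b * (LINT s|Iv b. (g (x, s))\<^sup>2)"

lemma slice_bound_integral:
  assumes "sq_integrable (Iv2 a b) v" "sq_integrable (Iv2 a b) g"
  shows "integrable (Iv a) (slice_bound b v g)"
    "(LINT x|Iv a. slice_bound b v g x) = 2 / b * (LINT z|Iv2 a b. (v z)\<^sup>2) + 8 * b * (LINT z|Iv2 a b. (g z)\<^sup>2)"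
proof -
  note i = sq_integrable_pair_slices(2)[OF assms(1)] sq_integrable_pair_slices(2)[OF assms(2)]
  show "integrable (Iv a) (slice_bound b v g)" unfolding slice_bound_def using i by simp
  show "(LINT x|Iv a. slice_bound b v g x) = 2 / b * (LINT z|Iv2 a b. (v z)\<^sup>2) + 8 * b * (LINT z|Iv2 a b. (g z)\<^sup>2)"
    unfolding slice_bound_def using i
    by (simp add: sq_integrable_pair_slices(3)[OF assms(1)] sq_integrable_pair_slices(3)[OF assms(2)])
qed

lemma slice_bound_nonneg: "b > 0 \<Longrightarrow> 0 \<le> slice_bound b v g x"
  unfolding slice_bound_def by (intro add_nonneg_nonneg mult_nonneg_nonneg Bochner_Integration.integral_nonneg) auto

lemma slice_bound_measurable [measurable]:
  assumes "sq_integrable (Iv2 a b) v" "sq_integrable (Iv2 a b) g"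
  shows "slice_bound b v g \<in> borel_measurable (Iv a)"
  using slice_bound_integral(1)[OF assms] by (rule borel_measurable_integrable)

lemma primitive_slices:
  assumes "sq_integrable (Iv2 a b) v" "sq_integrable (Iv2 a b) g"
    and "AE z in Iv2 a b. v z = c (fst z) + (LINT s|Iv b. kern s0 (snd z) s * g (fst z, s))"
  shows "AE x in Iv a. sq_integrable (Iv b) (\<lambda>t. v (x, t)) \<and> sq_integrable (Iv b) (\<lambda>t. g (x, t)) \<and>
     (AE t in Iv b. v (x, t) = c x + (LINT s|Iv b. kern s0 t s * g (x, s)))"
  using sq_integrable_pair_slices(1)[OF assms(1)] sq_integrable_pair_slices(1)[OF assms(2)] AE_Iv_pairD[OF assms(3)]
  by eventually_elim simp

lemma sq_add_le: "(p + q)\<^sup>2 \<le> 2 * p\<^sup>2 + 2 * q\<^sup>2" for p q :: real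
  using zero_le_power2[of "p - q"] by (simp add: power2_eq_square algebra_simps)

lemma sq_add3_le: "(p + q + r)\<^sup>2 \<le> 3 * p\<^sup>2 + 3 * q\<^sup>2 + 3 * r\<^sup>2" for p q r :: real
  using zero_le_power2[of "p - q"] zero_le_power2[of "p - r"] zero_le_power2[of "q - r"]
  by (simp add: power2_eq_square algebra_simps)

lemma integral_const_Iv: "b \<ge> 0 \<Longrightarrow> (LINT r|Iv b. k) = b * k"
  using measure_Iv[of b] by simp

lemma integrable_const_Iv: "integrable (Iv b) (\<lambda>r. k::real)"
proof -
  interpret finite_measure "Iv b" by (rule finite_measure_Iv)
  show ?thesis by simp
qed

text \<open>Compare the value at \<open>t\<close> with the value at \<open>r\<close> and average over
  \<open>r\<close>. The difference is one of two primitives whose squares are at most \<open>b\<close>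
  times the integral of \<open>g\<^sup>2\<close>, which produces the factor \<open>8 b\<close>.\<close>

lemma primitive_sq_le_slice_bound:
  assumes v: "sq_integrable (Iv2 a b) v" and g: "sq_integrable (Iv2 a b) g"
    and rep: "AE z in Iv2 a b. v z = c (fst z) + (LINT s|Iv b. kern s0 (snd z) s * g (fst z, s))"
    and b: "b > 0"
  shows "AE z in Iv2 a b. (v z)\<^sup>2 \<le> slice_bound b v g (fst z)"
proof (rule AE_Iv_pairI)
  note [measurable] = v[THEN sq_integrable_measurable] slice_bound_measurable[OF v g]
  show "Measurable.pred (Iv2 a b) (\<lambda>z. (v z)\<^sup>2 \<le> slice_bound b v g (fst z))" by measurable
  show "AE x in Iv a. AE t in Iv b. (v (x, t))\<^sup>2 \<le> slice_bound b v g (fst (x, t))"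
    using primitive_slices[OF v g rep]
  proof eventually_elim
    case (elim x)
    define E where "E = (LINT s|Iv b. (g (x, s))\<^sup>2)"
    define k where "k t = (LINT s|Iv b. kern s0 t s * g (x, s))" for t
    have k: "(k t)\<^sup>2 \<le> b * E" for t
      unfolding k_def E_def using elim b by (intro kern_integral_sq_le) auto
    have vx: "AE t in Iv b. v (x, t) = c x + k t" using elim by (simp add: k_def)
    then show "AE t in Iv b. (v (x, t))\<^sup>2 \<le> slice_bound b v g (fst (x, t))"
    proof eventually_elim
      case t: (elim t)
      have iv: "integrable (Iv b) (\<lambda>r. (v (x, r))\<^sup>2)" using elim by (simp add: sq_integrable_def)
      have "AE r in Iv b. (v (x, t))\<^sup>2 \<le> 2 * (v (x, r))\<^sup>2 + 8 * b * E"
        using vx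
      proof eventually_elim
        case (elim r)
        have "v (x, t) = v (x, r) + (k t - k r)" using t elim by simp
        then have "(v (x, t))\<^sup>2 \<le> 2 * (v (x, r))\<^sup>2 + 2 * (k t - k r)\<^sup>2" using sq_add_le by simp
        moreover have "(k t - k r)\<^sup>2 \<le> 2 * (k t)\<^sup>2 + 2 * (k r)\<^sup>2" using sq_add_le[of "k t" "- k r"] by simp
        ultimately show ?case using k[of t] k[of r] by linarith
      qed
      then have "(LINT r|Iv b. (v (x, t))\<^sup>2) \<le> (LINT r|Iv b. 2 * (v (x, r))\<^sup>2 + 8 * b * E)"
        by (intro integral_mono_AE integrable_const_Iv Bochner_Integration.integrable_add) (use iv in auto)
      also have "\<dots> = 2 * (LINT r|Iv b. (v (x, r))\<^sup>2) + b * (8 * b * E)"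
        using iv integrable_const_Iv[of b "8 * b * E"] integral_const_Iv[of b "8 * b * E"] b by simp
      finally have "b * (v (x, t))\<^sup>2 \<le> b * slice_bound b v g x"
        unfolding integral_const_Iv[OF less_imp_le[OF b]] slice_bound_def E_def[symmetric]
        using b by (simp add: algebra_simps)
      then show ?case using b by simp
    qed
  qed
qed

text \<open>The same averaging for \<open>c = v - (primitive of g)\<close>; one primitive instead of a
  difference of two gives \<open>2 b\<close>. For a trace \<open>c\<close> this is the trace
  inequality.\<close>

lemma primitive_constant_bound:
  assumes v: "sq_integrable (Iv2 a b) v" and g: "sq_integrable (Iv2 a b) g"
    and rep: "AE z in Iv2 a b. v z = c (fst z) + (LINT s|Iv b. kern s0 (snd z) s * g (fst z, s))"
    and b: "b > 0" and c: "c \<in> borel_measurable (Iv a)"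
  shows "sq_integrable (Iv a) c"
    "(LINT x|Iv a. (c x)\<^sup>2) \<le> 2 / b * (LINT z|Iv2 a b. (v z)\<^sup>2) + 2 * b * (LINT z|Iv2 a b. (g z)\<^sup>2)"
proof -
  let ?V = "\<lambda>x. 2 / b * (LINT r|Iv b. (v (x, r))\<^sup>2) + 2 * b * (LINT s|Iv b. (g (x, s))\<^sup>2)"
  note i = sq_integrable_pair_slices(2)[OF v] sq_integrable_pair_slices(2)[OF g]
  have iV: "integrable (Iv a) ?V" using i by simp
  have bnd: "AE x in Iv a. (c x)\<^sup>2 \<le> ?V x"
    using primitive_slices[OF v g rep]
  proof eventually_elim
    case (elim x)
    define E where "E = (LINT s|Iv b. (g (x, s))\<^sup>2)"
    define k where "k t = (LINT s|Iv b. kern s0 t s * g (x, s))" for t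
    have k: "(k t)\<^sup>2 \<le> b * E" for t
      unfolding k_def E_def using elim b by (intro kern_integral_sq_le) auto
    have iv: "integrable (Iv b) (\<lambda>r. (v (x, r))\<^sup>2)" using elim by (simp add: sq_integrable_def)
    have "AE r in Iv b. v (x, r) = c x + k r" using elim by (simp add: k_def)
    then have "AE r in Iv b. (c x)\<^sup>2 \<le> 2 * (v (x, r))\<^sup>2 + 2 * b * E"
    proof eventually_elim
      case (elim r)
      then have "c x = v (x, r) + (- k r)" by simp
      then have "(c x)\<^sup>2 \<le> 2 * (v (x, r))\<^sup>2 + 2 * (k r)\<^sup>2" using sq_add_le[of "v (x, r)" "- k r"] by simp
      then show ?case using k[of r] by linarith
    qed
    then have "(LINT r|Iv b. (c x)\<^sup>2) \<le> (LINT r|Iv b. 2 * (v (x, r))\<^sup>2 + 2 * b * E)"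
      by (intro integral_mono_AE integrable_const_Iv Bochner_Integration.integrable_add) (use iv in auto)
    also have "\<dots> = 2 * (LINT r|Iv b. (v (x, r))\<^sup>2) + b * (2 * b * E)"
      using iv integrable_const_Iv[of b "2 * b * E"] integral_const_Iv[of b "2 * b * E"] b by simp
    finally have "b * (c x)\<^sup>2 \<le> b * ?V x"
      unfolding integral_const_Iv[OF less_imp_le[OF b]] E_def[symmetric]
      using b by (simp add: algebra_simps)
    then show ?case using b by simp
  qed
  have ic: "integrable (Iv a) (\<lambda>x. (c x)\<^sup>2)"
    by (rule Bochner_Integration.integrable_bound[OF iV])
      (use bnd c in \<open>auto elim!: eventually_mono\<close>)
  then show "sq_integrable (Iv a) c" using c by (simp add: sq_integrable_def)
  have "(LINT x|Iv a. (c x)\<^sup>2) \<le> (LINT x|Iv a. ?V x)"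
    by (rule integral_mono_AE[OF ic iV bnd])
  also have "\<dots> = 2 / b * (LINT z|Iv2 a b. (v z)\<^sup>2) + 2 * b * (LINT z|Iv2 a b. (g z)\<^sup>2)"
    using i by (simp add: sq_integrable_pair_slices(3)[OF v] sq_integrable_pair_slices(3)[OF g])
  finally show "(LINT x|Iv a. (c x)\<^sup>2) \<le> 2 / b * (LINT z|Iv2 a b. (v z)\<^sup>2) + 2 * b * (LINT z|Iv2 a b. (g z)\<^sup>2)" .
qed

text \<open>The weight decreases, so \<open>\<phi> t \<le> \<phi> s\<close> for \<open>s < t\<close> and
  the weight can be moved inside the primitive: apply the Cauchy-Schwarz inequality to \<open>kern 0 t s
  * sqrt (\<phi> t / \<phi> s)\<close>, which is at most \<open>1\<close>, and \<open>g s * sqrt (\<phi>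
  s)\<close>.\<close>

lemma kern_integral_weighted_le:
  assumes g: "sq_integrable (Iv b) g" and b: "b \<ge> 0"
    and phi: "\<And>s. \<phi> s > 0" "\<And>s t. s \<le> t \<Longrightarrow> \<phi> t \<le> \<phi> s" "continuous_on UNIV \<phi>"
  shows "(LINT s|Iv b. kern 0 t s * g s)\<^sup>2 * \<phi> t \<le> b * (LINT s|Iv b. (g s)\<^sup>2 * \<phi> s)"
proof -
  interpret finite_measure "Iv b" by (rule finite_measure_Iv)
  note Iv_ident[measurable]
  have [measurable]: "g \<in> borel_measurable (Iv b)" "\<phi> \<in> borel_measurable (Iv b)"
    using g phi(3) by (auto intro!: Iv_measurable borel_measurable_continuous_onI)
  obtain K where K: "K \<ge> 0" "\<And>x. x \<in> {0..b} \<Longrightarrow> \<bar>\<phi> x\<bar> \<le> K" using continuous_bounded_Iv[OF phi(3)] by metis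
  define p where "p s = kern 0 t s * sqrt (\<phi> t / \<phi> s)" for s
  define q where "q s = g s * sqrt (\<phi> s)" for s
  have p_le: "\<bar>p s\<bar> \<le> 1" if "s \<in> {0<..<b}" for s
  proof (cases "s < t")
    case True
    then have "\<phi> t / \<phi> s \<le> 1" using phi(1)[of s] phi(2)[of s t] by simp
    then have "\<bar>kern 0 t s\<bar> * sqrt (\<phi> t / \<phi> s) \<le> 1 * 1"
      using phi(1)[of s] phi(1)[of t] by (intro mult_mono kern_bound) auto
    then show ?thesis using phi(1)[of s] phi(1)[of t] by (simp add: p_def abs_mult)
  next
    case False
    then have "kern 0 t s = 0" using that by (auto simp: kern_def indicator_def)
    then show ?thesis by (simp add: p_def)
  qed
  have sp: "sq_integrable (Iv b) p"
    by (rule sq_integrable_bounded[of _ 1]) (use p_le in \<open>auto simp: p_def[abs_def]\<close>)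
  have sq: "sq_integrable (Iv b) q"
  proof (rule sq_integrable_bound[OF sq_integrable_cmult[OF g, of "sqrt K"]])
    show "q \<in> borel_measurable (Iv b)" unfolding q_def[abs_def] by measurable
    have "\<bar>q s\<bar> \<le> \<bar>sqrt K * g s\<bar>" if "s \<in> {0<..<b}" for s
    proof -
      have "sqrt (\<phi> s) \<le> sqrt K" using K(2)[of s] that by (intro real_sqrt_le_mono) auto
      then have "\<bar>g s\<bar> * sqrt (\<phi> s) \<le> \<bar>g s\<bar> * sqrt K" by (rule mult_left_mono) simp
      then show ?thesis using phi(1)[of s] K(1) by (simp add: q_def abs_mult mult.commute)
    qed
    then show "AE s in Iv b. \<bar>q s\<bar> \<le> \<bar>sqrt K * g s\<bar>" by (intro AE_I2) simp
  qed
  have pq: "p s * q s = sqrt (\<phi> t) * (kern 0 t s * g s)" for s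
    using phi(1)[of s] phi(1)[of t] by (simp add: p_def q_def real_sqrt_divide)
  have "(LINT s|Iv b. kern 0 t s * g s)\<^sup>2 * \<phi> t = (LINT s|Iv b. p s * q s)\<^sup>2"
    using phi(1)[of t] by (simp add: pq power_mult_distrib)
  also have "\<dots> \<le> (LINT s|Iv b. (p s)\<^sup>2) * (LINT s|Iv b. (q s)\<^sup>2)"
    by (rule Cauchy_Schwarz_integral[OF sp sq])
  also have "\<dots> \<le> b * (LINT s|Iv b. (q s)\<^sup>2)"
  proof (rule mult_right_mono)
    have "(LINT s|Iv b. (p s)\<^sup>2) \<le> (LINT s|Iv b. 1)"
      using sp p_le integrable_const_Iv by (intro integral_mono) (auto simp: sq_integrable_def abs_square_le_1)
    then show "(LINT s|Iv b. (p s)\<^sup>2) \<le> b" using integral_const_Iv[OF b, of 1] by simp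
  qed simp
  also have "(\<lambda>s. (q s)\<^sup>2) = (\<lambda>s. (g s)\<^sup>2 * \<phi> s)"
    using phi(1) by (auto simp: q_def power_mult_distrib less_imp_le)
  finally show ?thesis .
qed

subsection \<open>Restrictions of approximating smooth functions\<close>

lemma sq_integrable_continuous_pair:
  fixes f :: "real \<times> real \<Rightarrow> real"
  assumes "continuous_on UNIV f"
  shows "sq_integrable (Iv2 a b) f"
proof -
  interpret finite_measure "Iv2 a b" by (rule finite_measure_Iv_pair)
  have "bounded (f ` ({0..a} \<times> {0..b}))"
    by (intro compact_imp_bounded compact_continuous_image continuous_on_subset[OF assms] compact_Times) auto
  then obtain K where K: "\<forall>z\<in>{0..a} \<times> {0..b}. \<bar>f z\<bar> \<le> K" by (auto simp: bounded_iff)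
  show ?thesis
  proof (rule sq_integrable_bounded)
    have "f \<in> borel_measurable borel" using assms by (rule borel_measurable_continuous_onI)
    then show "f \<in> borel_measurable (Iv2 a b)"
      unfolding Iv_pair by (intro measurable_restrict_space1) simp
    show "AE z in Iv2 a b. \<bar>f z\<bar> \<le> K"
      by (rule AE_I2) (use K in \<open>auto simp: space_pair_measure\<close>)
  qed
qed

lemma AE_fst_Iv:
  assumes "AE x in Iv a. P x"
  shows "AE z in Iv2 a b. P (fst z)"
proof -
  obtain N where N: "N \<in> null_sets (Iv a)" "{x \<in> space (Iv a). \<not> P x} \<subseteq> N"
    using assms by (auto simp: eventually_ae_filter)
  have [measurable]: "N \<in> sets (Iv a)" using N(1) by auto
  have "AE z in Iv2 a b. fst z \<notin> N"
  proof (rule AE_Iv_pairI)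
    show "AE x in Iv a. AE t in Iv b. fst (x, t) \<notin> N"
      using AE_not_in[OF N(1)] by eventually_elim simp
  qed measurable
  then show ?thesis
    using AE_space by eventually_elim (use N(2) in \<open>auto simp: space_pair_measure\<close>)
qed

text \<open>The fundamental theorem of calculus for \<open>f n\<close>, passed to the limit: the
  \<open>L\<^sup>2\<close> norm of the difference of the two sides is bounded by the three quantities
  that tend to zero.\<close>

theorem limit_primitive_representation:
  assumes u: "sq_integrable (Iv2 a b) u" and ut: "sq_integrable (Iv2 a b) ut"
    and g: "sq_integrable (Iv a) g" and b: "b > 0" and s0: "s0 \<in> {0..b}"
    and f: "\<And>n. continuous_on UNIV (f n)" "\<And>n. continuous_on UNIV (f' n)"
      "\<And>n x t. ((\<lambda>t. f n (x, t)) has_real_derivative f' n (x, t)) (at t)"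
    and lim: "(\<lambda>n. LINT z|Iv2 a b. (f n z - u z)\<^sup>2) \<longlonglongrightarrow> 0"
      "(\<lambda>n. LINT z|Iv2 a b. (f' n z - ut z)\<^sup>2) \<longlonglongrightarrow> 0"
      "(\<lambda>n. LINT x|Iv a. (f n (x, s0) - g x)\<^sup>2) \<longlonglongrightarrow> 0"
  shows "AE z in Iv2 a b. u z = g (fst z) + (LINT s|Iv b. kern s0 (snd z) s * ut (fst z, s))"
proof -
  let ?M = "Iv2 a b"
  define K where "K z = (LINT s|Iv b. kern s0 (snd z) s * ut (fst z, s))" for z
  define R where "R n z = (LINT s|Iv b. kern s0 (snd z) s * (f' n (fst z, s) - ut (fst z, s)))" for n z
  define D where "D z = u z - (g (fst z) + K z)" for z
  have sK: "sq_integrable ?M K" unfolding K_def using sq_integrable_prim(1)[OF ut] b by simp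
  have ig2: "integrable (Iv a) (\<lambda>x. (g x)\<^sup>2)" using g by (simp add: sq_integrable_def)
  have gm[measurable]: "g \<in> borel_measurable (Iv a)" using g by (rule sq_integrable_measurable)
  have sg: "sq_integrable ?M (\<lambda>z. g (fst z))"
    using integrable_fst_Iv(1)[OF ig2, of b] b by (simp add: sq_integrable_def)
  have sD: "sq_integrable ?M D" unfolding D_def by (intro sq_integrable_diff sq_integrable_add u sK sg)
  have sf': "sq_integrable ?M (\<lambda>z. f' n z - ut z)" and sf: "sq_integrable ?M (\<lambda>z. f n z - u z)" for n
    by (intro sq_integrable_diff sq_integrable_continuous_pair f u ut)+
  have R: "sq_integrable ?M (R n)" "(LINT z|?M. (R n z)\<^sup>2) \<le> b\<^sup>2 * (LINT z|?M. (f' n z - ut z)\<^sup>2)" for n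
    unfolding R_def using sq_integrable_prim[OF sf'[of n], of s0] b by simp_all
  have f0: "sq_integrable (Iv a) (\<lambda>x. f n (x, s0) - g x)" for n
    by (intro sq_integrable_diff g sq_integrable_continuous_Iv)
      (auto intro!: continuous_intros continuous_on_compose2[OF f(1)])
  have i0: "integrable (Iv a) (\<lambda>x. (f n (x, s0) - g x)\<^sup>2)" for n using f0 by (simp add: sq_integrable_def)
  have sl: "AE z in ?M. sq_integrable (Iv b) (\<lambda>s. ut (fst z, s))"
    by (rule AE_fst_Iv[OF sq_integrable_pair_slices(1)[OF ut]])
  have D: "AE z in ?M. D z = - (f n z - u z) + (f n (fst z, s0) - g (fst z)) + R n z" for n
    using sl AE_space
  proof eventually_elim
    case (elim z)
    have t: "snd z \<in> {0..b}" "fst z \<in> {0<..<a}" using elim by (auto simp: space_pair_measure)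
    have i1: "integrable (Iv b) (\<lambda>s. ut (fst z, s))"
      using elim(1) by (rule finite_measure.sq_integrable_integrable[OF finite_measure_Iv])
    have c: "continuous_on UNIV (\<lambda>s. f' n (fst z, s))"
      by (auto intro!: continuous_intros continuous_on_compose2[OF f(2)])
    have "(LINT s|Iv b. kern s0 (snd z) s * f' n (fst z, s)) = f n (fst z, snd z) - f n (fst z, s0)"
      by (rule FTC_kern[OF f(3) c s0 t(1)])
    then have "R n z = f n z - f n (fst z, s0) - K z"
      unfolding R_def K_def right_diff_distrib
      using integrable_kern[OF i1] integrable_kern[OF integrable_continuous_Iv[OF c]]
      by simp
    then show ?case by (simp add: D_def)
  qed
  have bound: "(LINT z|?M. (D z)\<^sup>2) \<le> 3 * (LINT z|?M. (f n z - u z)\<^sup>2) + 3 * (b * (LINT x|Iv a. (f n (x, s0) - g x)\<^sup>2))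
      + 3 * (b\<^sup>2 * (LINT z|?M. (f' n z - ut z)\<^sup>2))" for n
  proof -
    note i1 = integrable_fst_Iv[OF i0, of b n]
    have i2: "integrable ?M (\<lambda>z. (f n z - u z)\<^sup>2)" "integrable ?M (\<lambda>z. (R n z)\<^sup>2)" "integrable ?M (\<lambda>z. (D z)\<^sup>2)"
      using sf R(1) sD by (simp_all add: sq_integrable_def)
    have "(LINT z|?M. (D z)\<^sup>2) \<le> (LINT z|?M. 3 * (f n z - u z)\<^sup>2 + 3 * (f n (fst z, s0) - g (fst z))\<^sup>2 + 3 * (R n z)\<^sup>2)"
    proof (rule integral_mono_AE)
      show "AE z in ?M. (D z)\<^sup>2 \<le> 3 * (f n z - u z)\<^sup>2 + 3 * (f n (fst z, s0) - g (fst z))\<^sup>2 + 3 * (R n z)\<^sup>2"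
        using D[of n]
      proof eventually_elim
        case (elim z)
        show ?case unfolding elim using sq_add3_le[of "- (f n z - u z)" "f n (fst z, s0) - g (fst z)" "R n z"]
          by (simp only: power2_minus)
      qed
    qed (use i1 i2 b in auto)
    also have "\<dots> = 3 * (LINT z|?M. (f n z - u z)\<^sup>2) + 3 * (b * (LINT x|Iv a. (f n (x, s0) - g x)\<^sup>2)) + 3 * (LINT z|?M. (R n z)\<^sup>2)"
      using i1 i2 b by simp
    finally show ?thesis using R(2)[of n] by linarith
  qed
  have "(\<lambda>n. 3 * (LINT z|?M. (f n z - u z)\<^sup>2) + 3 * (b * (LINT x|Iv a. (f n (x, s0) - g x)\<^sup>2))
      + 3 * (b\<^sup>2 * (LINT z|?M. (f' n z - ut z)\<^sup>2))) \<longlonglongrightarrow> 3 * 0 + 3 * (b * 0) + 3 * (b\<^sup>2 * 0)"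
    by (intro tendsto_add tendsto_mult_left lim)
  then have "(LINT z|?M. (D z)\<^sup>2) \<le> 3 * 0 + 3 * (b * 0) + 3 * (b\<^sup>2 * 0)"
    by (rule LIMSEQ_le_const) (use bound in blast)
  then have "(LINT z|?M. (D z)\<^sup>2) = 0" by (intro antisym) simp_all
  then have "AE z in ?M. (D z)\<^sup>2 = 0"
    using integral_nonneg_eq_0_iff_AE[of ?M "\<lambda>z. (D z)\<^sup>2"] sD by (simp add: sq_integrable_def)
  then show ?thesis by eventually_elim (simp add: D_def K_def)
qed

section \<open>Smooth functions on a rectangle\<close>

abbreviation Rect :: "real \<Rightarrow> real \<Rightarrow> (real \<times> real) set" where
  "Rect a b \<equiv> {0<..<a} \<times> {0<..<b}"

lemma open_Rect: "open (Rect a b)" and bounded_Rect: "bounded (Rect a b)"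
  by (auto intro!: open_Times bounded_Times)

lemma Basis_real_pair: "Basis = {(1, 0), (0, 1) :: real \<times> real}"
  by (auto simp: Basis_prod_def)

lemma multi_indices_1: "multi_indices 1 = {{#}, {#e_x#}, {#e_t#}}"
proof (intro set_eqI iffI)
  fix m :: "(real \<times> real) multiset" assume m: "m \<in> multi_indices 1"
  show "m \<in> {{#}, {#e_x#}, {#e_t#}}"
  proof (cases m)
    case (add b n)
    with m have "n = {#}" "b \<in> Basis" by (auto simp: multi_indices_def)
    then show ?thesis using add by (auto simp: Basis_real_pair)
  qed simp
qed (auto simp: multi_indices_def Basis_real_pair)

lemma smooth_partial_derivative:
  fixes f :: "real \<times> real \<Rightarrow> real"
  assumes "smooth f"
  shows "((\<lambda>t. f (x, t)) has_real_derivative pderivs [(0, 1)] f (x, t)) (at t)"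
    "((\<lambda>x. f (x, t)) has_real_derivative pderivs [(1, 0)] f (x, t)) (at x)"
proof -
  have d: "(f has_derivative frechet_derivative f (at (x, t))) (at (x, t))"
    using assms by (intro has_derivative_frechet smooth_differentiable)
  have lin: "linear (frechet_derivative f (at (x, t)))"
    using assms by (intro linear_frechet_derivative smooth_differentiable)
  have "((\<lambda>t. f (x, t)) has_derivative (\<lambda>h. frechet_derivative f (at (x, t)) (0, h))) (at t)"
    by (rule has_derivative_compose[where f="\<lambda>t. (x, t)" and f'="\<lambda>h. (0, h)" and g=f, OF _ d])
      (rule has_derivative_Pair[OF has_derivative_const has_derivative_ident])
  moreover have "frechet_derivative f (at (x, t)) (0, h) = pderivs [(0, 1)] f (x, t) * h" for h
    using linear_scale[OF lin, of h "(0, 1)"]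
    by (simp only: pderivs.simps scaleR_Pair scaleR_zero_right real_scaleR_def mult_1_right mult_zero_right mult.commute[of _ h])
  ultimately show "((\<lambda>t. f (x, t)) has_real_derivative pderivs [(0, 1)] f (x, t)) (at t)"
    by (simp only: has_field_derivative_def)
  have "((\<lambda>x. f (x, t)) has_derivative (\<lambda>h. frechet_derivative f (at (x, t)) (h, 0))) (at x)"
    by (rule has_derivative_compose[where f="\<lambda>x. (x, t)" and f'="\<lambda>h. (h, 0)" and g=f, OF _ d])
      (rule has_derivative_Pair[OF has_derivative_ident has_derivative_const])
  moreover have "frechet_derivative f (at (x, t)) (h, 0) = pderivs [(1, 0)] f (x, t) * h" for h
    using linear_scale[OF lin, of h "(1, 0)"]
    by (simp only: pderivs.simps scaleR_Pair scaleR_zero_right real_scaleR_def mult_1_right mult_zero_right mult.commute[of _ h])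
  ultimately show "((\<lambda>x. f (x, t)) has_real_derivative pderivs [(1, 0)] f (x, t)) (at x)"
    by (simp only: has_field_derivative_def)
qed

lemma integral_swap_Iv:
  fixes f :: "real \<times> real \<Rightarrow> real"
  assumes "f \<in> borel_measurable (Iv2 a b)"
  shows "(LINT z|Iv2 b a. f (prod.swap z)) = (LINT z|Iv2 a b. f z)"
proof -
  interpret pair_sigma_finite "Iv a" "Iv b" by (rule pair_sigma_finite_Iv)
  show ?thesis using integral_product_swap[OF assms] by (simp add: prod.swap_def case_prod_unfold)
qed

lemma swap_eq: "prod.swap = (\<lambda>(x, y). (y, x))"
  by (auto simp: fun_eq_iff)

lemma swap_measurable_Iv [measurable]: "prod.swap \<in> measurable (Iv2 b a) (Iv2 a b)"
  unfolding swap_eq by (rule measurable_pair_swap')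

lemma sq_integrable_swap_Iv:
  assumes "sq_integrable (Iv2 a b) f"
  shows "sq_integrable (Iv2 b a) (\<lambda>z. f (prod.swap z))"
proof -
  interpret pair_sigma_finite "Iv a" "Iv b" by (rule pair_sigma_finite_Iv)
  have [measurable]: "f \<in> borel_measurable (Iv2 a b)" using assms by (rule sq_integrable_measurable)
  have "integrable (Iv2 b a) (\<lambda>z. (f (prod.swap z))\<^sup>2)"
    using integrable_product_swap[of "\<lambda>z. (f z)\<^sup>2"] assms
    by (simp add: prod.swap_def case_prod_unfold sq_integrable_def)
  then show ?thesis by (simp add: sq_integrable_def)
qed

lemma AE_swap_Iv:
  assumes "AE z in Iv2 b a. P (prod.swap z)"
  shows "AE z in Iv2 a b. P z"
proof -
  interpret pair_sigma_finite "Iv a" "Iv b" by (rule pair_sigma_finite_Iv)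
  have "AE z in distr (Iv2 a b) (Iv2 b a) prod.swap. P (prod.swap z)"
    using assms unfolding swap_eq pair_sigma_finite.distr_pair_swap[OF pair_sigma_finite_Iv, of b a, symmetric] .
  from AE_distrD[OF swap_measurable_Iv this] show ?thesis by simp
qed

text \<open>Integrate first along the lines parallel to the direction of differentiation.\<close>

lemma integral_pderiv_test_fun:
  assumes F: "test_fun (Rect a b) F" and ab: "a > 0" "b > 0"
  shows "(LINT z|Iv2 a b. pderivs [(0, 1)] F z) = 0"
    "(LINT z|Iv2 a b. pderivs [(1, 0)] F z) = 0"
proof -
  have sm: "smooth F" using F by (rule test_fun_smooth)
  have out: "F z = 0" if "z \<notin> Rect a b" for z
    using test_fun_supportE[OF F] that by (metis subsetD)
  have c: "continuous_on UNIV (pderivs [(0, 1)] F)" "continuous_on UNIV (pderivs [(1, 0)] F)"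
    using sm by (auto intro!: smooth_continuous_on smooth_pderiv simp: Basis_real_pair)
  interpret M: finite_measure "Iv2 a b" by (rule finite_measure_Iv_pair)
  interpret M': finite_measure "Iv2 b a" by (rule finite_measure_Iv_pair)
  have slice: "(LINT t|Iv d. f t) = G d - G 0"
    if "\<And>t. (G has_real_derivative f t) (at t)" "continuous_on UNIV f" "d > 0" for f G and d :: real
  proof -
    have "(LINT t|Iv d. f t) = (LINT t|Iv d. indicator {0<..<d} t * f t)"
      by (rule Bochner_Integration.integral_cong) auto
    then show ?thesis using FTC_Iv[OF that(1,2), of 0 d d] that(3) by simp
  qed
  have "(LINT t|Iv b. pderivs [(0, 1)] F (x, t)) = 0" for x
  proof -
    have "(LINT t|Iv b. pderivs [(0, 1)] F (x, t)) = F (x, b) - F (x, 0)"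
      by (rule slice[OF smooth_partial_derivative(1)[OF sm] _ ab(2)])
        (auto intro!: continuous_on_compose2[OF c(1)] continuous_intros simp del: pderivs.simps)
    then show ?thesis by (simp add: out)
  qed
  then show "(LINT z|Iv2 a b. pderivs [(0, 1)] F z) = 0"
    using Iv_pair_slices(3)[OF M.sq_integrable_integrable[OF sq_integrable_continuous_pair[OF c(1)]]] by simp
  have "(LINT x|Iv a. pderivs [(1, 0)] F (x, t)) = 0" for t
  proof -
    have "(LINT x|Iv a. pderivs [(1, 0)] F (x, t)) = F (a, t) - F (0, t)"
      by (rule slice[OF smooth_partial_derivative(2)[OF sm] _ ab(1)])
        (auto intro!: continuous_on_compose2[OF c(2)] continuous_intros simp del: pderivs.simps)
    then show ?thesis by (simp add: out)
  qed
  moreover have "integrable (Iv2 b a) (\<lambda>z. pderivs [(1, 0)] F (prod.swap z))"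
    by (intro M'.sq_integrable_integrable sq_integrable_swap_Iv sq_integrable_continuous_pair c)
  ultimately have "(LINT z|Iv2 b a. pderivs [(1, 0)] F (prod.swap z)) = 0"
    using Iv_pair_slices(3)[of b a "\<lambda>z. pderivs [(1, 0)] F (prod.swap z)"] by simp
  then show "(LINT z|Iv2 a b. pderivs [(1, 0)] F z) = 0"
    using integral_swap_Iv[of "pderivs [(1, 0)] F" a b] sq_integrable_continuous_pair[OF c(2), of a b]
    by (simp add: sq_integrable_def del: pderivs.simps)
qed

text \<open>Apply \<open>integral_pderiv_test_fun\<close> to the product of the smooth function with a
  test function.\<close>

lemma smooth_has_weak_deriv:
  assumes f: "smooth f" and ab: "a > 0" "b > 0" and e: "e \<in> {e_x, e_t}"
  shows "has_weak_deriv (Rect a b) {#e#} f (pderivs [e] f)"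
proof (rule has_weak_derivI[OF open_Rect])
  have eB: "e \<in> Basis" using e by (auto simp: Basis_real_pair)
  have sf': "smooth (pderivs [e] f)" using smooth_pderiv[OF f eB] by simp
  have sq: "sq_integrable (lres (Rect a b)) g" if "smooth g" for g
    using sq_integrable_continuous_pair[OF smooth_continuous_on[OF that], of a b] by (simp only: Iv_pair)
  have Rb: "Rect a b \<in> sets borel" using open_Rect by simp
  show "loc_integrable (Rect a b) f" "loc_integrable (Rect a b) (pderivs [e] f)"
    using sq f sf' Rb by (blast intro: sq_integrable_loc_integrable)+
  fix bs \<psi> assume bs: "mset bs = {#e#}" and \<psi>: "test_fun (Rect a b) \<psi>"
  have bs: "bs = [e]" using bs by simp
  have s\<psi>: "smooth \<psi>" using \<psi> by (rule test_fun_smooth)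
  have t: "test_fun (Rect a b) (\<lambda>z. f z * \<psi> z)"
  proof (rule test_fun_supportE[OF \<psi>])
    fix K assume "compact K" "K \<subseteq> Rect a b" "\<And>x. x \<notin> K \<Longrightarrow> \<psi> x = 0"
    then show ?thesis by (intro test_fun_supportI[of _ K] smooth_mult f s\<psi>) auto
  qed
  have "frechet_derivative (\<lambda>x. f x * \<psi> x) (at z) =
      (\<lambda>h. f z * frechet_derivative \<psi> (at z) h + frechet_derivative f (at z) h * \<psi> z)" for z
    by (intro frechet_derivative_eq has_derivative_mult has_derivative_frechet smooth_differentiable f s\<psi>)
  then have p: "pderivs [e] (\<lambda>z. f z * \<psi> z) = (\<lambda>z. f z * pderivs [e] \<psi> z + pderivs [e] f z * \<psi> z)"
    by simp
  have "(LINT z|lres (Rect a b). f z * pderivs [e] \<psi> z + pderivs [e] f z * \<psi> z) = 0"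
    using integral_pderiv_test_fun[OF t ab] e by (auto simp only: p[symmetric] Iv_pair)
  moreover have "integrable (lres (Rect a b)) (\<lambda>z. f z * pderivs [e] \<psi> z)" "integrable (lres (Rect a b)) (\<lambda>z. pderivs [e] f z * \<psi> z)"
    using smooth_pderivs[OF s\<psi>, of "[e]"] eB sf' f s\<psi> by (auto intro!: sq_integrable_mult sq simp del: pderivs.simps)
  ultimately show "(LINT x|lres (Rect a b). f x * pderivs bs \<psi> x) = (- 1) ^ length bs * (LINT x|lres (Rect a b). pderivs [e] f x * \<psi> x)"
    by (simp add: bs del: pderivs.simps)
qed

lemma smooth_sobolev_1:
  assumes f: "smooth f" and ab: "a > 0" "b > 0"
  shows "f \<in> sobolev 1 (Rect a b)"
    "e \<in> {e_x, e_t} \<Longrightarrow> AE z in lres (Rect a b). weak_deriv (Rect a b) {#e#} f z = pderivs [e] f z"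
proof -
  have Rb: "Rect a b \<in> sets borel" using open_Rect by simp
  have sq: "sq_integrable (lres (Rect a b)) g" if "smooth g" for g
    using sq_integrable_continuous_pair[OF smooth_continuous_on[OF that], of a b] by (simp only: Iv_pair)
  have w: "has_weak_deriv (Rect a b) {#e#} f (pderivs [e] f)" if "e \<in> {e_x, e_t}" for e
    by (rule smooth_has_weak_deriv[OF f ab that])
  have sf': "smooth (pderivs [e] f)" if "e \<in> {e_x, e_t}" for e
    using that f by (auto intro!: smooth_pderiv simp: Basis_real_pair)
  show "f \<in> sobolev 1 (Rect a b)"
  proof (rule sobolevI[OF open_Rect sq[OF f], of 1 "\<lambda>m. if m = {#} then f else if m = {#e_x#} then pderivs [e_x] f else pderivs [e_t] f"])
    fix m :: "(real \<times> real) multiset" assume "m \<in> multi_indices 1"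
    then consider "m = {#}" | "m = {#e_x#}" | "m = {#e_t#}" unfolding multi_indices_1 by blast
    note cases = this
    show "has_weak_deriv (Rect a b) m f (if m = {#} then f else if m = {#e_x#} then pderivs [e_x] f else pderivs [e_t] f)"
      using cases
    proof cases
      case 1
      then show ?thesis
        using has_weak_deriv_empty[OF open_Rect sq_integrable_loc_integrable[OF sq[OF f] Rb]] by simp
    qed (use w[of e_x] w[of e_t] in \<open>simp_all del: pderivs.simps\<close>)
    show "sq_integrable (lres (Rect a b)) (if m = {#} then f else if m = {#e_x#} then pderivs [e_x] f else pderivs [e_t] f)"
      using sq[OF f] sq[OF sf'[of e_x]] sq[OF sf'[of e_t]] by (simp del: pderivs.simps)
  qed
  show "e \<in> {e_x, e_t} \<Longrightarrow> AE z in lres (Rect a b). weak_deriv (Rect a b) {#e#} f z = pderivs [e] f z"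
    by (rule weak_deriv_eq(2)[OF open_Rect w]) (auto simp: Basis_real_pair)
qed

lemma sobolev_norm_1_sq:
  assumes "u \<in> sobolev 1 (Rect a b)"
  shows "(sobolev_norm 1 (Rect a b) u)\<^sup>2 = (LINT z|lres (Rect a b). (u z)\<^sup>2)
    + (LINT z|lres (Rect a b). (weak_deriv (Rect a b) {#e_x#} u z)\<^sup>2) + (LINT z|lres (Rect a b). (weak_deriv (Rect a b) {#e_t#} u z)\<^sup>2)"
proof -
  note [measurable] = sobolev_sq_integrable[OF open_Rect assms, THEN sq_integrable_measurable]
    sobolev_weak_deriv(2)[OF open_Rect assms empty_multi_indices, THEN sq_integrable_measurable]
  have "(LINT z|lres (Rect a b). (weak_deriv (Rect a b) {#} u z)\<^sup>2) = (LINT z|lres (Rect a b). (u z)\<^sup>2)"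
  proof (rule integral_cong_AE)
    show "AE z in lres (Rect a b). (weak_deriv (Rect a b) {#} u z)\<^sup>2 = (u z)\<^sup>2"
      using weak_deriv_empty[OF open_Rect assms] by eventually_elim simp
  qed measurable
  then show ?thesis
    unfolding sobolev_norm_sq[OF open_Rect] multi_indices_1 by simp
qed

lemma weak_deriv_tensor_test:
  assumes w: "has_weak_deriv (Rect a b) {#e#} u v" and t: "test_fun {0<..<a} \<zeta>" "test_fun {0<..<b} \<psi>"
  shows "e = e_t \<Longrightarrow> (LINT z|Iv2 a b. u z * (\<zeta> (fst z) * pderivs [1] \<psi> (snd z)))
        = - (LINT z|Iv2 a b. v z * (\<zeta> (fst z) * \<psi> (snd z)))"
   "e = e_x \<Longrightarrow> (LINT z|Iv2 a b. u z * (pderivs [1] \<zeta> (fst z) * \<psi> (snd z)))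
        = - (LINT z|Iv2 a b. v z * (\<zeta> (fst z) * \<psi> (snd z)))"
  using has_weak_deriv_test[OF open_Rect, of a b "[e]" u v, OF _ test_fun_tensor[OF t]] w
    pderivs_tensor[OF test_fun_smooth[OF t(1)] test_fun_smooth[OF t(2)]]
  by (simp_all add: Iv_pair del: pderivs.simps)

lemma weak_deriv_t_primitive:
  assumes "has_weak_deriv (Rect a b) {#e_t#} u v" "sq_integrable (lres (Rect a b)) u" "sq_integrable (lres (Rect a b)) v" "b > 0"
  obtains c where "c \<in> borel_measurable (Iv a)"
    "AE z in Iv2 a b. u z = c (fst z) + (LINT s|Iv b. kern 0 (snd z) s * v (fst z, s))"
  by (rule primitive_representation[OF assms(2,3)[folded Iv_pair] assms(4)])
    (use weak_deriv_tensor_test(1)[OF assms(1)] in auto)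

lemma weak_deriv_x_primitive:
  assumes "has_weak_deriv (Rect a b) {#e_x#} u v" "sq_integrable (lres (Rect a b)) u" "sq_integrable (lres (Rect a b)) v" "a > 0"
  obtains c where "c \<in> borel_measurable (Iv b)"
    "AE z in Iv2 b a. u (prod.swap z) = c (fst z) + (LINT s|Iv a. kern 0 (snd z) s * v (prod.swap (fst z, s)))"
proof (rule primitive_representation[OF sq_integrable_swap_Iv[OF assms(2)[folded Iv_pair]] sq_integrable_swap_Iv[OF assms(3)[folded Iv_pair]] assms(4)])
  have [measurable]: "u \<in> borel_measurable (Iv2 a b)" "v \<in> borel_measurable (Iv2 a b)"
    using assms(2,3) by (auto simp: Iv_pair sq_integrable_def)
  fix \<zeta> \<psi> :: "real \<Rightarrow> real" assume t: "test_fun {0<..<b} \<zeta>" "test_fun {0<..<a} \<psi>"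
  have t': "test_fun {0<..<a} (pderivs [1] \<psi>)" using t(2) by (rule test_fun_pderivs) simp
  have [measurable]: "\<zeta> \<in> borel_measurable (Iv b)" "\<psi> \<in> borel_measurable (Iv a)" "pderivs [1] \<psi> \<in> borel_measurable (Iv a)"
    using t t' by (auto intro!: Iv_measurable test_fun_measurable simp del: pderivs.simps)
  have "(LINT z|Iv2 b a. u (prod.swap z) * (\<zeta> (fst z) * pderivs [1] \<psi> (snd z)))
     = (LINT z|Iv2 a b. u z * (pderivs [1] \<psi> (fst z) * \<zeta> (snd z)))"
    using integral_swap_Iv[of "\<lambda>z. u z * (pderivs [1] \<psi> (fst z) * \<zeta> (snd z))" a b]
    by (simp add: mult.commute del: pderivs.simps)
  also have "\<dots> = - (LINT z|Iv2 a b. v z * (\<psi> (fst z) * \<zeta> (snd z)))"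
    by (rule weak_deriv_tensor_test(2)[OF assms(1) t(2,1) refl])
  also have "(LINT z|Iv2 a b. v z * (\<psi> (fst z) * \<zeta> (snd z))) = (LINT z|Iv2 b a. v (prod.swap z) * (\<zeta> (fst z) * \<psi> (snd z)))"
    using integral_swap_Iv[of "\<lambda>z. v z * (\<psi> (fst z) * \<zeta> (snd z))" a b]
    by (simp add: mult.commute)
  finally show "(LINT z|Iv2 b a. u (prod.swap z) * (\<zeta> (fst z) * pderivs [1] \<psi> (snd z)))
     = - (LINT z|Iv2 b a. v (prod.swap z) * (\<zeta> (fst z) * \<psi> (snd z)))" .
qed

section \<open>Traces\<close>

lemma Rect_borel [measurable]: "Rect a b \<in> sets borel"
  using open_Rect by simp

lemma smooth_sq_integrable: "smooth f \<Longrightarrow> sq_integrable (lres (Rect a b)) f"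
  using sq_integrable_continuous_pair[OF smooth_continuous_on, of f a b] by (simp only: Iv_pair)

lemma smooth_pderiv_e: "smooth f \<Longrightarrow> e \<in> {e_x, e_t} \<Longrightarrow> smooth (pderivs [e] f)"
  by (rule smooth_pderivs) (auto simp: Basis_real_pair)

lemma e_multi_index: "e \<in> {e_x, e_t} \<Longrightarrow> {#e#} \<in> multi_indices (Suc k)"
  by (auto simp: multi_indices_def Basis_real_pair)

lemma smooth_minus_sobolev_1:
  assumes u: "u \<in> sobolev 1 (Rect a b)" and f: "smooth f" and ab: "a > 0" "b > 0"
  shows "(\<lambda>z. f z - u z) \<in> sobolev 1 (Rect a b)"
    "(LINT z|lres (Rect a b). (f z - u z)\<^sup>2) \<le> (sobolev_norm 1 (Rect a b) (\<lambda>z. f z - u z))\<^sup>2"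
    "e \<in> {e_x, e_t} \<Longrightarrow> (LINT z|lres (Rect a b). (pderivs [e] f z - weak_deriv (Rect a b) {#e#} u z)\<^sup>2) \<le> (sobolev_norm 1 (Rect a b) (\<lambda>z. f z - u z))\<^sup>2"
proof -
  let ?w = "\<lambda>z. f z - u z"
  note f1 = smooth_sobolev_1[OF f ab]
  show w: "?w \<in> sobolev 1 (Rect a b)" by (rule sobolev_diff[OF open_Rect f1(1) u])
  have nn: "0 \<le> (LINT z|lres (Rect a b). (h z)\<^sup>2)" for h :: "real \<times> real \<Rightarrow> real" by simp
  show "(LINT z|lres (Rect a b). (?w z)\<^sup>2) \<le> (sobolev_norm 1 (Rect a b) ?w)\<^sup>2"
    unfolding sobolev_norm_1_sq[OF w] using nn[of "weak_deriv (Rect a b) {#e_x#} ?w"] nn[of "weak_deriv (Rect a b) {#e_t#} ?w"] by linarith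
  assume e: "e \<in> {e_x, e_t}"
  have em: "{#e#} \<in> multi_indices 1" using e_multi_index[OF e, of 0] by simp
  have sm: "smooth (pderivs [e] f)" using f e by (rule smooth_pderiv_e)
  note [measurable] = smooth_sq_integrable[OF sm, of a b, THEN sq_integrable_measurable]
    sobolev_weak_deriv(2)[OF open_Rect u em, THEN sq_integrable_measurable]
    sobolev_weak_deriv(2)[OF open_Rect w em, THEN sq_integrable_measurable]
  have "(LINT z|lres (Rect a b). (pderivs [e] f z - weak_deriv (Rect a b) {#e#} u z)\<^sup>2) = (LINT z|lres (Rect a b). (weak_deriv (Rect a b) {#e#} ?w z)\<^sup>2)"
  proof (rule integral_cong_AE)
    show "AE z in lres (Rect a b). (pderivs [e] f z - weak_deriv (Rect a b) {#e#} u z)\<^sup>2 = (weak_deriv (Rect a b) {#e#} ?w z)\<^sup>2"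
      using weak_deriv_diff[OF open_Rect f1(1) u em] f1(2)[OF e] by eventually_elim simp
  qed measurable
  also have "\<dots> \<le> (sobolev_norm 1 (Rect a b) ?w)\<^sup>2" by (rule weak_deriv_norm_le[OF open_Rect em])
  finally show "(LINT z|lres (Rect a b). (pderivs [e] f z - weak_deriv (Rect a b) {#e#} u z)\<^sup>2) \<le> (sobolev_norm 1 (Rect a b) ?w)\<^sup>2" .
qed

lemma smooth_approximation_limits:
  assumes u: "u \<in> sobolev 1 (Rect a b)" and f: "\<And>n. smooth (f n)" and ab: "a > 0" "b > 0"
    and lim: "(\<lambda>n. sobolev_norm 1 (Rect a b) (\<lambda>z. f n z - u z)) \<longlonglongrightarrow> 0"
  shows "(\<lambda>n. LINT z|lres (Rect a b). (f n z - u z)\<^sup>2) \<longlonglongrightarrow> 0"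
    "e \<in> {e_x, e_t} \<Longrightarrow> (\<lambda>n. LINT z|lres (Rect a b). (pderivs [e] (f n) z - weak_deriv (Rect a b) {#e#} u z)\<^sup>2) \<longlonglongrightarrow> 0"
proof -
  have l2: "(\<lambda>n. (sobolev_norm 1 (Rect a b) (\<lambda>z. f n z - u z))\<^sup>2) \<longlonglongrightarrow> 0"
    using tendsto_power[OF lim, of 2] by simp
  show "(\<lambda>n. LINT z|lres (Rect a b). (f n z - u z)\<^sup>2) \<longlonglongrightarrow> 0"
    by (rule tendsto_sandwich[OF _ _ tendsto_const l2])
      (simp, intro always_eventually allI smooth_minus_sobolev_1(2)[OF u f ab])
  show "e \<in> {e_x, e_t} \<Longrightarrow> (\<lambda>n. LINT z|lres (Rect a b). (pderivs [e] (f n) z - weak_deriv (Rect a b) {#e#} u z)\<^sup>2) \<longlonglongrightarrow> 0"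
    by (rule tendsto_sandwich[OF _ _ tendsto_const l2])
      (simp, intro always_eventually allI smooth_minus_sobolev_1(3)[OF u f ab])
qed

text \<open>The trace of a smooth function is its restriction, for which this is the fundamental theorem
  of calculus. The formula determines the trace, and it contains all that is used about traces
  below.\<close>

theorem trace_representation:
  assumes tr: "has_trace (Rect a b) (\<lambda>x. (x, s0)) {0<..<a} u g" and ab: "a > 0" "b > 0" and s0: "s0 \<in> {0..b}"
  shows "AE z in Iv2 a b. u z = g (fst z) + (LINT s|Iv b. kern s0 (snd z) s * weak_deriv (Rect a b) {#e_t#} u (fst z, s))"
proof -
  obtain f where f: "\<And>n. smooth (f n)" "(\<lambda>n. sobolev_norm 1 (Rect a b) (\<lambda>z. f n z - u z)) \<longlonglongrightarrow> 0"
    "(\<lambda>n. LINT s:{0<..<a}|lborel. (f n (s, s0) - g s)\<^sup>2) \<longlonglongrightarrow> 0"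
    and u: "u \<in> sobolev 1 (Rect a b)" and g: "g \<in> L2 {0<..<a}"
    using tr unfolding has_trace_def by blast
  have em: "{#e_t#} \<in> multi_indices 1" using e_multi_index[of e_t 0] by simp
  note lim = smooth_approximation_limits[OF u f(1) ab f(2)]
  show ?thesis
  proof (rule limit_primitive_representation[where f=f and f'="\<lambda>n. pderivs [e_t] (f n)"])
    show "sq_integrable (Iv2 a b) u" "sq_integrable (Iv2 a b) (weak_deriv (Rect a b) {#e_t#} u)"
      unfolding Iv_pair using sobolev_sq_integrable[OF open_Rect u] sobolev_weak_deriv(2)[OF open_Rect u em] by auto
    show "sq_integrable (Iv a) g" using g by (simp add: L2_iff_sq_integrable)
    show "continuous_on UNIV (f n)" "continuous_on UNIV (pderivs [e_t] (f n))" for n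
      by (rule smooth_continuous_on[OF f(1)], rule smooth_continuous_on[OF smooth_pderiv_e[OF f(1)]]) simp
    show "((\<lambda>t. f n (x, t)) has_real_derivative pderivs [e_t] (f n) (x, t)) (at t)" for n x t
      by (rule smooth_partial_derivative(1)[OF f(1)])
    show "(\<lambda>n. LINT z|Iv2 a b. (f n z - u z)\<^sup>2) \<longlonglongrightarrow> 0"
      "(\<lambda>n. LINT z|Iv2 a b. (pderivs [e_t] (f n) z - weak_deriv (Rect a b) {#e_t#} u z)\<^sup>2) \<longlonglongrightarrow> 0"
      unfolding Iv_pair using lim(1) lim(2)[of e_t] by auto
    show "(\<lambda>n. LINT x|Iv a. (f n (x, s0) - g x)\<^sup>2) \<longlonglongrightarrow> 0"
      using f(3) by (simp add: set_integral_lres)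
  qed (use ab s0 in auto)
qed

theorem left_trace_representation:
  assumes tr: "has_trace (Rect a b) (\<lambda>t. (0, t)) {0<..<b} u g" and ab: "a > 0" "b > 0"
  shows "AE z in Iv2 b a. u (prod.swap z) = g (fst z) + (LINT s|Iv a. kern 0 (snd z) s * weak_deriv (Rect a b) {#e_x#} u (prod.swap (fst z, s)))"
proof -
  obtain f where f: "\<And>n. smooth (f n)" "(\<lambda>n. sobolev_norm 1 (Rect a b) (\<lambda>z. f n z - u z)) \<longlonglongrightarrow> 0"
    "(\<lambda>n. LINT s:{0<..<b}|lborel. (f n (0, s) - g s)\<^sup>2) \<longlonglongrightarrow> 0"
    and u: "u \<in> sobolev 1 (Rect a b)" and g: "g \<in> L2 {0<..<b}"
    using tr unfolding has_trace_def by blast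
  have em: "{#e_x#} \<in> multi_indices 1" using e_multi_index[of e_x 0] by simp
  note lim = smooth_approximation_limits[OF u f(1) ab f(2)]
  have su: "sq_integrable (Iv2 a b) u" "sq_integrable (Iv2 a b) (weak_deriv (Rect a b) {#e_x#} u)"
    unfolding Iv_pair using sobolev_sq_integrable[OF open_Rect u] sobolev_weak_deriv(2)[OF open_Rect u em] by auto
  have c: "continuous_on UNIV (f n)" "continuous_on UNIV (pderivs [e_x] (f n))" for n
    by (rule smooth_continuous_on[OF f(1)], rule smooth_continuous_on[OF smooth_pderiv_e[OF f(1)]]) simp
  have sw: "(LINT z|Iv2 b a. (h (prod.swap z))\<^sup>2) = (LINT z|lres (Rect a b). (h z)\<^sup>2)"
    if "sq_integrable (Iv2 a b) h" for h
    using integral_swap_Iv[OF borel_measurable_power[OF sq_integrable_measurable[OF that]], of 2] by (simp only: Iv_pair)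
  show ?thesis
  proof (rule limit_primitive_representation[where f="\<lambda>n z. f n (prod.swap z)" and f'="\<lambda>n z. pderivs [e_x] (f n) (prod.swap z)"
        and u="\<lambda>z. u (prod.swap z)" and ut="\<lambda>z. weak_deriv (Rect a b) {#e_x#} u (prod.swap z)"])
    show "sq_integrable (Iv2 b a) (\<lambda>z. u (prod.swap z))"
      "sq_integrable (Iv2 b a) (\<lambda>z. weak_deriv (Rect a b) {#e_x#} u (prod.swap z))"
      using su by (auto intro: sq_integrable_swap_Iv)
    show "sq_integrable (Iv b) g" using g by (simp add: L2_iff_sq_integrable)
    show "continuous_on UNIV (\<lambda>z. f n (prod.swap z))" "continuous_on UNIV (\<lambda>z. pderivs [e_x] (f n) (prod.swap z))" for n
      by (rule continuous_on_compose2[OF c(1)] continuous_on_compose2[OF c(2)];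
          auto simp: swap_eq case_prod_unfold intro!: continuous_intros)+
    show "((\<lambda>t. f n (prod.swap (x, t))) has_real_derivative pderivs [e_x] (f n) (prod.swap (x, t))) (at t)" for n x t
      using smooth_partial_derivative(2)[OF f(1), of n x t] by (simp only: swap_simp)
    have "sq_integrable (Iv2 a b) (\<lambda>z. f n z - u z)"
      "sq_integrable (Iv2 a b) (\<lambda>z. pderivs [e_x] (f n) z - weak_deriv (Rect a b) {#e_x#} u z)" for n
      by (intro sq_integrable_diff sq_integrable_continuous_pair c su)+
    note sw' = this[THEN sw]
    show "(\<lambda>n. LINT z|Iv2 b a. (f n (prod.swap z) - u (prod.swap z))\<^sup>2) \<longlonglongrightarrow> 0"
      "(\<lambda>n. LINT z|Iv2 b a. (pderivs [e_x] (f n) (prod.swap z) - weak_deriv (Rect a b) {#e_x#} u (prod.swap z))\<^sup>2) \<longlonglongrightarrow> 0"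
      unfolding sw' using lim(1) lim(2)[of e_x] by auto
    show "(\<lambda>n. LINT x|Iv b. (f n (prod.swap (x, 0)) - g x)\<^sup>2) \<longlonglongrightarrow> 0"
      using f(3) by (simp add: set_integral_lres)
  qed (use ab in auto)
qed

lemma trace_bound:
  assumes tr: "has_trace (Rect a b) (\<lambda>x. (x, s0)) {0<..<a} u g" and ab: "a > 0" "b > 0" and s0: "s0 \<in> {0..b}"
  shows "(LINT x|Iv a. (g x)\<^sup>2) \<le> (2 / b + 2 * b) * (sobolev_norm 1 (Rect a b) u)\<^sup>2"
proof -
  have u: "u \<in> sobolev 1 (Rect a b)" and g: "g \<in> L2 {0<..<a}"
    using tr unfolding has_trace_def by blast+
  have em: "{#e_t#} \<in> multi_indices 1" using e_multi_index[of e_t 0] by simp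
  note s = sobolev_sq_integrable[OF open_Rect u] sobolev_weak_deriv(2)[OF open_Rect u em]
  have "g \<in> borel_measurable (Iv a)" using g by (simp add: L2_iff_sq_integrable sq_integrable_def)
  note bnd = primitive_constant_bound(2)[OF s[folded Iv_pair] trace_representation[OF tr ab s0] ab(2) this, unfolded Iv_pair]
  have nn: "0 \<le> (LINT z|lres (Rect a b). (h z)\<^sup>2)" for h :: "real \<times> real \<Rightarrow> real" by simp
  have "(LINT z|lres (Rect a b). (u z)\<^sup>2) \<le> (sobolev_norm 1 (Rect a b) u)\<^sup>2"
    unfolding sobolev_norm_1_sq[OF u] using nn[of "weak_deriv (Rect a b) {#e_x#} u"] nn[of "weak_deriv (Rect a b) {#e_t#} u"] by linarith
  then have "2 / b * (LINT z|lres (Rect a b). (u z)\<^sup>2) \<le> 2 / b * (sobolev_norm 1 (Rect a b) u)\<^sup>2"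
    using ab by (intro mult_left_mono) auto
  moreover have "2 * b * (LINT z|lres (Rect a b). (weak_deriv (Rect a b) {#e_t#} u z)\<^sup>2) \<le> 2 * b * (sobolev_norm 1 (Rect a b) u)\<^sup>2"
    using ab weak_deriv_norm_le[OF open_Rect em] by (intro mult_left_mono) auto
  ultimately show ?thesis using bnd by (simp add: distrib_right)
qed

subsection \<open>Smooth functions are dense in the first Sobolev space\<close>

text \<open>The normal derivatives of these functions vanish on the boundary of the rectangle.\<close>

inductive_set cos_span :: "real \<Rightarrow> real \<Rightarrow> (real \<times> real \<Rightarrow> real) set" for a b where
  base: "(\<lambda>z. r * (cos (of_int k * pi / a * fst z) * cos (of_int l * pi / b * snd z))) \<in> cos_span a b"
| add: "f \<in> cos_span a b \<Longrightarrow> g \<in> cos_span a b \<Longrightarrow> (\<lambda>z. f z + g z) \<in> cos_span a b"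

text \<open>A product of two cosines is a sum of two cosines.\<close>

lemma cos_span_mult:
  assumes "f \<in> cos_span a b" "g \<in> cos_span a b"
  shows "(\<lambda>z. f z * g z) \<in> cos_span a b"
  using assms(1)
proof induction
  case (base r k l)
  show ?case
    using assms(2)
  proof induction
    case (base r' k' l')
    let ?c = "\<lambda>k l z. r * r' / 4 * (cos (of_int k * pi / a * fst z) * cos (of_int l * pi / b * snd z))"
    have "(\<lambda>z. (?c (k + k') (l + l') z + ?c (k + k') (l - l') z) + (?c (k - k') (l + l') z + ?c (k - k') (l - l') z)) \<in> cos_span a b"
      by (intro cos_span.add cos_span.base)
    moreover have "(?c (k + k') (l + l') z + ?c (k + k') (l - l') z) + (?c (k - k') (l + l') z + ?c (k - k') (l - l') z) =
      r * (cos (of_int k * pi / a * fst z) * cos (of_int l * pi / b * snd z)) *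
      (r' * (cos (of_int k' * pi / a * fst z) * cos (of_int l' * pi / b * snd z)))" for z
      by (simp add: add_divide_distrib diff_divide_distrib distrib_right left_diff_distrib cos_add cos_diff)
        (simp add: field_simps)
    ultimately show ?case by simp
  next
    case (add f g)
    then show ?case using cos_span.add by (simp add: distrib_left)
  qed
next
  case (add f h)
  then show ?case using cos_span.add by (simp add: distrib_right)
qed

lemma cos_span_continuous: "f \<in> cos_span a b \<Longrightarrow> continuous_on S f"
  by (induction rule: cos_span.induct)
    (intro continuous_on_mult continuous_on_cos continuous_on_const continuous_on_fst continuous_on_snd
      continuous_on_id, intro continuous_on_add)

text \<open>The Stone-Weierstrass theorem; points are separated because the cosine is injective on
  \<open>[0, \<pi>]\<close>.\<close>

lemma cos_span_dense:
  assumes ab: "a > 0" "b > 0" and f: "continuous_on ({0..a} \<times> {0..b}) f" and e: "e > 0"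
  shows "\<exists>g\<in>cos_span a b. \<forall>z\<in>{0..a} \<times> {0..b}. \<bar>f z - g z\<bar> < e"
proof -
  have const: "(\<lambda>z. c) \<in> cos_span a b" for c using cos_span.base[of c 0 a 0 b] by simp
  have range: "0 \<le> pi / d * x" "pi / d * x \<le> pi" if "x \<in> {0..d}" "d > 0" for x d :: real
  proof -
    show "0 \<le> pi / d * x" using that by simp
    have "pi / d * x \<le> pi / d * d" by (rule mult_left_mono) (use that in auto)
    then show "pi / d * x \<le> pi" using that(2) by simp
  qed
  have inj: "x = y" if "cos (pi / d * x) = cos (pi / d * y)" "x \<in> {0..d}" "y \<in> {0..d}" "d > 0" for x y d :: real
  proof -
    have "pi / d * x = pi / d * y"
      by (rule cos_inj_pi[OF range(1)[OF that(2,4)] range(2)[OF that(2,4)] range(1)[OF that(3,4)] range(2)[OF that(3,4)] that(1)])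
    then show ?thesis using that(4) by simp
  qed
  have sep: "\<exists>f. f \<in> cos_span a b \<and> f z \<noteq> f w"
    if zw: "z \<in> {0..a} \<times> {0..b} \<and> w \<in> {0..a} \<times> {0..b} \<and> z \<noteq> w" for z w
  proof (rule ccontr)
    assume "\<nexists>f. f \<in> cos_span a b \<and> f z \<noteq> f w"
    then have eq: "f z = f w" if "f \<in> cos_span a b" for f using that by blast
    from eq[OF cos_span.base[of 1 1 a 0 b]] have "cos (pi / a * fst z) = cos (pi / a * fst w)" by simp
    then have 1: "fst z = fst w" by (rule inj) (use zw ab in auto)
    from eq[OF cos_span.base[of 1 0 a 1 b]] have "cos (pi / b * snd z) = cos (pi / b * snd w)" by simp
    then have 2: "snd z = snd w" by (rule inj) (use zw ab in auto)
    from 1 2 zw show False by (simp add: prod_eq_iff)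
  qed
  have "\<exists>g. g \<in> cos_span a b \<and> (\<forall>z\<in>{0..a} \<times> {0..b}. \<bar>f z - g z\<bar> < e)"
  proof (rule Stone_Weierstrass_HOL[where P="\<lambda>f. f \<in> cos_span a b" and S="{0..a} \<times> {0..b}" and f=f and e=e])
    show "compact ({0..a} \<times> {0..b})" by (intro compact_Times compact_Icc)
    show "(\<lambda>z. c) \<in> cos_span a b" for c by (rule const)
    show "continuous_on ({0..a} \<times> {0..b}) g" if "g \<in> cos_span a b" for g using that by (rule cos_span_continuous)
    show "(\<lambda>z. g z + h z) \<in> cos_span a b" if "g \<in> cos_span a b \<and> h \<in> cos_span a b" for g h
      using that by (blast intro: cos_span.add)
    show "(\<lambda>z. g z * h z) \<in> cos_span a b" if "g \<in> cos_span a b \<and> h \<in> cos_span a b" for g h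
      using that by (blast intro: cos_span_mult)
    show "\<exists>f. f \<in> cos_span a b \<and> f z \<noteq> f w"
      if "z \<in> {0..a} \<times> {0..b} \<and> w \<in> {0..a} \<times> {0..b} \<and> z \<noteq> w" for z w
      using that by (rule sep)
  qed (rule f, rule e)
  then show ?thesis by blast
qed

text \<open>The factor \<open>q\<close> vanishes at both ends, so no boundary term appears although
  \<open>v\<close> has no boundary condition.\<close>

lemma primitive_Neumann_by_parts:
  assumes v: "sq_integrable (Iv2 a b) v" and g: "sq_integrable (Iv2 a b) g"
    and rep: "AE z in Iv2 a b. v z = c (fst z) + (LINT s|Iv b. kern 0 (snd z) s * g (fst z, s))"
    and b: "b > 0" and p: "continuous_on UNIV p" and q: "\<And>t. (q has_real_derivative q' t) (at t)" "continuous_on UNIV q'"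
      "q 0 = 0" "q b = 0"
  shows "(LINT z|Iv2 a b. g z * (p (fst z) * q (snd z))) = - (LINT z|Iv2 a b. v z * (p (fst z) * q' (snd z)))"
proof -
  let ?M = "Iv2 a b"
  have cq: "continuous_on UNIV q" using q(1) by (meson DERIV_isCont continuous_at_imp_continuous_on)
  have i1: "integrable ?M (\<lambda>z. g z * (p (fst z) * q (snd z)))" "integrable ?M (\<lambda>z. v z * (p (fst z) * q' (snd z)))"
    by (intro sq_integrable_mult g v sq_integrable_continuous_pair continuous_intros
        continuous_on_compose2[OF p] continuous_on_compose2[OF q(2)] continuous_on_compose2[OF cq]; auto)+
  have "(LINT x|Iv a. LINT t|Iv b. g (x, t) * (p x * q t)) = (LINT x|Iv a. - (LINT t|Iv b. v (x, t) * (p x * q' t)))"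
  proof (rule integral_cong_AE)
    show "(\<lambda>x. LINT t|Iv b. g (x, t) * (p x * q t)) \<in> borel_measurable (Iv a)"
      "(\<lambda>x. - (LINT t|Iv b. v (x, t) * (p x * q' t))) \<in> borel_measurable (Iv a)"
      using Iv_pair_slices(2)[OF i1(1)] Iv_pair_slices(2)[OF i1(2)] by auto
    show "AE x in Iv a. (LINT t|Iv b. g (x, t) * (p x * q t)) = - (LINT t|Iv b. v (x, t) * (p x * q' t))"
      using primitive_slices[OF v g rep]
    proof eventually_elim
      case (elim x)
      interpret finite_measure "Iv b" by (rule finite_measure_Iv)
      define k where "k t = (LINT s|Iv b. kern 0 t s * g (x, s))" for t
      have ig: "integrable (Iv b) (\<lambda>t. g (x, t))" using elim by (blast intro: sq_integrable_integrable)
      have ibp: "(LINT t|Iv b. g (x, t) * q t) = - (LINT t|Iv b. k t * q' t)"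
        unfolding k_def by (rule kern_integral_by_parts[OF ig b q(1,2,4)])
      have sv: "sq_integrable (Iv b) (\<lambda>t. v (x, t))" using elim by blast
      have iq': "integrable (Iv b) q'" using q(2) by (rule integrable_continuous_Iv)
      have ivq: "integrable (Iv b) (\<lambda>t. v (x, t) * q' t)"
        by (rule sq_integrable_mult[OF sv sq_integrable_continuous_Iv[OF q(2)]])
      have "(LINT t|Iv b. q' t) = (LINT t|Iv b. indicator {0<..<b} t * q' t)"
        by (rule Bochner_Integration.integral_cong) auto
      then have zero: "(LINT t|Iv b. q' t) = 0" using FTC_Iv[OF q(1,2), of 0 b b] b q(3,4) by simp
      have "AE t in Iv b. k t * q' t = v (x, t) * q' t - c x * q' t"
        using elim by (auto simp: k_def algebra_simps elim!: eventually_mono)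
      moreover have "(\<lambda>t. k t * q' t) \<in> borel_measurable (Iv b)"
      proof -
        interpret sigma_finite_measure "Iv b" by (rule sigma_finite_Iv)
        note [measurable] = Iv_ident borel_measurable_integrable[OF ig] borel_measurable_integrable[OF iq']
        show ?thesis unfolding k_def by measurable
      qed
      ultimately have "(LINT t|Iv b. k t * q' t) = (LINT t|Iv b. v (x, t) * q' t - c x * q' t)"
        using ivq iq' by (intro integral_cong_AE) auto
      also have "\<dots> = (LINT t|Iv b. v (x, t) * q' t)"
        using ivq iq' zero by simp
      finally have eq: "(LINT t|Iv b. g (x, t) * q t) = - (LINT t|Iv b. v (x, t) * q' t)" using ibp by simp
      have "(LINT t|Iv b. g (x, t) * (p x * q t)) = p x * (LINT t|Iv b. g (x, t) * q t)"
        "(LINT t|Iv b. v (x, t) * (p x * q' t)) = p x * (LINT t|Iv b. v (x, t) * q' t)"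
        unfolding integral_mult_right_zero[symmetric] by (simp_all add: mult_ac)
      then show ?case using eq by simp
    qed
  qed
  then show ?thesis
    using Iv_pair_slices(3)[OF i1(1)] Iv_pair_slices(3)[OF i1(2)] by simp
qed

text \<open>By density the integrals against all continuous functions vanish, in particular those
  against test functions.\<close>

lemma AE_eq_0_if_cos_integrals_eq_0:
  assumes v: "sq_integrable (Iv2 a b) v" and ab: "a > 0" "b > 0"
    and zero: "\<And>k l. (LINT z|Iv2 a b. v z * (cos (of_int k * pi / a * fst z) * cos (of_int l * pi / b * snd z))) = 0"
  shows "AE z in Iv2 a b. v z = 0"
proof -
  let ?M = "Iv2 a b"
  interpret finite_measure ?M by (rule finite_measure_Iv_pair)
  have iv: "integrable ?M v" using v by (rule sq_integrable_integrable)
  have span: "(LINT z|?M. v z * f z) = 0" if "f \<in> cos_span a b" for f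
    using that
  proof induction
    case (base r k l)
    have "(LINT z|?M. v z * (r * (cos (of_int k * pi / a * fst z) * cos (of_int l * pi / b * snd z))))
        = (LINT z|?M. r * (v z * (cos (of_int k * pi / a * fst z) * cos (of_int l * pi / b * snd z))))"
      by (simp only: mult.left_commute)
    also have "\<dots> = 0" unfolding integral_mult_right_zero zero by simp
    finally show ?case .
  next
    case (add f g)
    have "integrable ?M (\<lambda>z. v z * f z)" "integrable ?M (\<lambda>z. v z * g z)"
      by (rule sq_integrable_mult[OF v sq_integrable_continuous_pair[OF cos_span_continuous[OF add.hyps(1)]]],
          rule sq_integrable_mult[OF v sq_integrable_continuous_pair[OF cos_span_continuous[OF add.hyps(2)]]])
    then show ?case using add.IH by (simp add: distrib_left)
  qed
  have cont: "(LINT z|?M. v z * f z) = 0" if f: "continuous_on UNIV f" for f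
  proof -
    have fm: "continuous_on ({0..a} \<times> {0..b}) f" using f by (rule continuous_on_subset) simp
    define K where "K = (LINT z|?M. \<bar>v z\<bar>)"
    have K0: "K \<ge> 0" unfolding K_def by simp
    have "\<bar>LINT z|?M. v z * f z\<bar> \<le> e * K" if e: "e > 0" for e
    proof -
      obtain g where g: "g \<in> cos_span a b" "\<And>z. z \<in> {0..a} \<times> {0..b} \<Longrightarrow> \<bar>f z - g z\<bar> < e"
        using cos_span_dense[OF ab fm e] by blast
      have i: "integrable ?M (\<lambda>z. v z * f z)" "integrable ?M (\<lambda>z. v z * g z)"
        by (rule sq_integrable_mult[OF v sq_integrable_continuous_pair[OF f]],
            rule sq_integrable_mult[OF v sq_integrable_continuous_pair[OF cos_span_continuous[OF g(1)]]])
      have "(LINT z|?M. v z * f z) = (LINT z|?M. v z * f z - v z * g z)"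
        using i span[OF g(1)] by simp
      also have "\<bar>\<dots>\<bar> \<le> (LINT z|?M. \<bar>v z * f z - v z * g z\<bar>)"
        using integral_norm_bound[of ?M "\<lambda>z. v z * f z - v z * g z"] by simp
      also have "\<dots> \<le> (LINT z|?M. e * \<bar>v z\<bar>)"
      proof (rule integral_mono_AE)
        show "AE z in ?M. \<bar>v z * f z - v z * g z\<bar> \<le> e * \<bar>v z\<bar>"
        proof (rule AE_I2)
          fix z assume "z \<in> space ?M"
          then have "z \<in> {0..a} \<times> {0..b}" by (auto simp: space_pair_measure)
          then have "\<bar>v z\<bar> * \<bar>f z - g z\<bar> \<le> \<bar>v z\<bar> * e" using g(2)[of z] by (intro mult_left_mono) auto
          then show "\<bar>v z * f z - v z * g z\<bar> \<le> e * \<bar>v z\<bar>"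
            unfolding right_diff_distrib[symmetric] abs_mult by (simp only: mult.commute)
        qed
      qed (use i iv in auto)
      also have "\<dots> = e * K" by (simp add: K_def)
      finally show ?thesis .
    qed
    note bound = this
    show ?thesis
    proof (rule ccontr)
      assume "(LINT z|?M. v z * f z) \<noteq> 0"
      then have pos: "\<bar>LINT z|?M. v z * f z\<bar> > 0" by simp
      define e where "e = \<bar>LINT z|?M. v z * f z\<bar> / (2 * (K + 1))"
      have "e > 0" unfolding e_def using pos K0 by (intro divide_pos_pos) auto
      from bound[OF this] have "\<bar>LINT z|?M. v z * f z\<bar> \<le> \<bar>LINT z|?M. v z * f z\<bar> * (K / (2 * (K + 1)))"
        by (simp add: e_def)
      also have "\<dots> < \<bar>LINT z|?M. v z * f z\<bar> * 1"
        using pos K0 by (intro mult_strict_left_mono) (auto simp: divide_less_eq)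
      finally show False by simp
    qed
  qed
  show ?thesis
  proof (rule AE_eq_0_if_tensor_tests_eq_0[OF iv])
    fix f g assume "test_fun {0<..<a} f" "test_fun {0<..<b} g"
    then have "smooth (\<lambda>z. f (fst z) * g (snd z))" by (intro smooth_tensor test_fun_smooth)
    then show "(LINT z|?M. v z * (f (fst z) * g (snd z))) = 0" by (rule cont[OF smooth_continuous_on])
  qed
qed

lemma sobolev_norm_zero: "sobolev_norm k (Rect a b) (\<lambda>z. 0) = 0"
proof -
  have "sq_integrable (lres (Rect a b)) (\<lambda>z. 0)" by (simp add: sq_integrable_def)
  then have l: "loc_integrable (Rect a b) (\<lambda>z. 0)" by (rule sq_integrable_loc_integrable) simp
  have "(LINT z|lres (Rect a b). (weak_deriv (Rect a b) m (\<lambda>z. 0) z)\<^sup>2) = 0" if m: "m \<in> multi_indices k" for m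
  proof -
    have w: "has_weak_deriv (Rect a b) m (\<lambda>z. 0) (\<lambda>z. 0)"
      by (rule has_weak_derivI[OF open_Rect l l]) simp
    have "AE z in lres (Rect a b). (weak_deriv (Rect a b) m (\<lambda>z. 0) z)\<^sup>2 = 0"
      using weak_deriv_eq(2)[OF open_Rect w multi_indices_Basis[OF m]] by eventually_elim simp
    then show ?thesis by (rule integral_eq_zero_AE)
  qed
  then have "(sobolev_norm k (Rect a b) (\<lambda>z. 0))\<^sup>2 = 0"
    unfolding sobolev_norm_sq[OF open_Rect] by simp
  then show ?thesis by simp
qed

lemma sobolev_inner_1_smooth:
  assumes u: "u \<in> sobolev 1 (Rect a b)" and f: "smooth f" and ab: "a > 0" "b > 0"
  shows "sobolev_inner 1 (Rect a b) u f = (LINT z|lres (Rect a b). u z * f z)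
    + (LINT z|lres (Rect a b). weak_deriv (Rect a b) {#e_x#} u z * pderivs [e_x] f z)
    + (LINT z|lres (Rect a b). weak_deriv (Rect a b) {#e_t#} u z * pderivs [e_t] f z)"
proof -
  note f1 = smooth_sobolev_1[OF f ab]
  have em: "{#e#} \<in> multi_indices 1" if "e \<in> {e_x, e_t}" for e using e_multi_index[OF that, of 0] by simp
  note [measurable] = sobolev_sq_integrable[OF open_Rect u, THEN sq_integrable_measurable]
    sobolev_sq_integrable[OF open_Rect f1(1), THEN sq_integrable_measurable]
    sobolev_weak_deriv(2)[OF open_Rect u, THEN sq_integrable_measurable]
    sobolev_weak_deriv(2)[OF open_Rect f1(1), THEN sq_integrable_measurable]
  have 0: "(LINT z|lres (Rect a b). weak_deriv (Rect a b) {#} u z * weak_deriv (Rect a b) {#} f z) = (LINT z|lres (Rect a b). u z * f z)"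
  proof (rule integral_cong_AE)
    show "AE z in lres (Rect a b). weak_deriv (Rect a b) {#} u z * weak_deriv (Rect a b) {#} f z = u z * f z"
      using weak_deriv_empty[OF open_Rect u] weak_deriv_empty[OF open_Rect f1(1)] by eventually_elim simp
  qed (use empty_multi_indices in measurable)
  have 1: "(LINT z|lres (Rect a b). weak_deriv (Rect a b) {#e#} u z * weak_deriv (Rect a b) {#e#} f z)
      = (LINT z|lres (Rect a b). weak_deriv (Rect a b) {#e#} u z * pderivs [e] f z)" if e: "e \<in> {e_x, e_t}" for e
  proof (rule integral_cong_AE)
    note [measurable] = smooth_sq_integrable[OF smooth_pderiv_e[OF f e], of a b, THEN sq_integrable_measurable]
    show "AE z in lres (Rect a b). weak_deriv (Rect a b) {#e#} u z * weak_deriv (Rect a b) {#e#} f z = weak_deriv (Rect a b) {#e#} u z * pderivs [e] f z"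
      using f1(2)[OF e] by eventually_elim simp
    show "(\<lambda>z. weak_deriv (Rect a b) {#e#} u z * weak_deriv (Rect a b) {#e#} f z) \<in> borel_measurable (lres (Rect a b))"
      "(\<lambda>z. weak_deriv (Rect a b) {#e#} u z * pderivs [e] f z) \<in> borel_measurable (lres (Rect a b))"
      using em[OF e] by measurable
  qed
  show ?thesis
    unfolding sobolev_inner_lres[OF open_Rect] multi_indices_1 using 0 1[of e_x] 1[of e_t] by simp
qed

text \<open>Let \<open>v\<close> be orthogonal to all smooth functions and \<open>F = cos (\<kappa> x)
  cos (\<mu> t)\<close> with \<open>\<kappa> = k \<pi> / a\<close> and \<open>\<mu> = l \<pi> /
  b\<close>. Integration by parts without boundary terms turns the \<open>H\<^sup>1\<close> product of
  \<open>v\<close> and \<open>F\<close> into \<open>(1 + \<kappa>\<^sup>2 + \<mu>\<^sup>2)\<close> times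
  the integral of \<open>v F\<close>. So all cosine coefficients of \<open>v\<close> vanish.\<close>

theorem smooth_dense_sobolev_1:
  assumes u: "u \<in> sobolev 1 (Rect a b)" and ab: "a > 0" "b > 0" and e: "e > 0"
  shows "\<exists>f. smooth f \<and> sobolev_norm 1 (Rect a b) (\<lambda>z. f z - u z) < e"
proof -
  let ?R = "Rect a b" and ?M = "Iv2 a b"
  interpret semi_hilbert "sobolev 1 ?R" "sobolev_inner 1 ?R"
    by (rule sobolev_semi_hilbert[OF open_Rect bounded_Rect])
  have "\<exists>f\<in>{f. smooth f}. sobolev_inner 1 ?R (\<lambda>z. f z - u z) (\<lambda>z. f z - u z) < e\<^sup>2"
  proof (rule dense_if_orthogonal_trivial)
    show "{f. smooth f} \<subseteq> sobolev 1 ?R" using smooth_sobolev_1(1) ab by blast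
    show "{f::real \<times> real \<Rightarrow> real. smooth f} \<noteq> {}" using smooth_const by blast
    show "(\<lambda>z. \<alpha> * f z + \<beta> * g z) \<in> {f. smooth f}" if "f \<in> {f. smooth f}" "g \<in> {f. smooth f}"
      for f g :: "real \<times> real \<Rightarrow> real" and \<alpha> \<beta>
      using that by (auto intro!: smooth_add smooth_cmult)
    show "u \<in> sobolev 1 ?R" "e\<^sup>2 > 0" using u e by auto
    fix v assume v: "v \<in> sobolev 1 ?R" and orth: "\<And>f. f \<in> {f. smooth f} \<Longrightarrow> sobolev_inner 1 ?R v f = 0"
    have em: "{#e_x#} \<in> multi_indices 1" "{#e_t#} \<in> multi_indices 1"
      using e_multi_index[of e_x 0] e_multi_index[of e_t 0] by auto
    define vx where "vx = weak_deriv ?R {#e_x#} v"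
    define vt where "vt = weak_deriv ?R {#e_t#} v"
    have sv: "sq_integrable ?M v" "sq_integrable ?M vx" "sq_integrable ?M vt"
      unfolding Iv_pair vx_def vt_def using sobolev_sq_integrable[OF open_Rect v] sobolev_weak_deriv(2)[OF open_Rect v] em by auto
    obtain c where "c \<in> borel_measurable (Iv a)"
      and c: "AE z in ?M. v z = c (fst z) + (LINT s|Iv b. kern 0 (snd z) s * vt (fst z, s))"
      by (rule weak_deriv_t_primitive[OF sobolev_weak_deriv(1)[OF open_Rect v em(2), folded vt_def] sv(1)[unfolded Iv_pair] sv(3)[unfolded Iv_pair] ab(2)])
    obtain c' where "c' \<in> borel_measurable (Iv b)"
      and c': "AE z in Iv2 b a. v (prod.swap z) = c' (fst z) + (LINT s|Iv a. kern 0 (snd z) s * vx (prod.swap (fst z, s)))"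
      by (rule weak_deriv_x_primitive[OF sobolev_weak_deriv(1)[OF open_Rect v em(1), folded vx_def] sv(1)[unfolded Iv_pair] sv(2)[unfolded Iv_pair] ab(1)])
    have "AE z in ?M. v z = 0"
    proof (rule AE_eq_0_if_cos_integrals_eq_0[OF sv(1) ab])
      fix k l :: int
      define \<kappa> where "\<kappa> = of_int k * pi / a"
      define \<mu> where "\<mu> = of_int l * pi / b"
      define C where "C x = cos (\<kappa> * x)" for x :: real
      define D where "D t = cos (\<mu> * t)" for t :: real
      have s: "smooth C" "smooth D" unfolding C_def D_def by (rule smooth_cos)+
      have cont: "continuous_on UNIV C" "continuous_on UNIV D" using s by (auto intro: smooth_continuous_on)
      have dC: "(C has_real_derivative - \<kappa> * sin (\<kappa> * x)) (at x)" for x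
        unfolding C_def by (auto intro!: derivative_eq_intros)
      have dD: "(D has_real_derivative - \<mu> * sin (\<mu> * x)) (at x)" for x
        unfolding D_def by (auto intro!: derivative_eq_intros)
      have pC: "pderivs [1] C = (\<lambda>x. - \<kappa> * sin (\<kappa> * x))"
        using DERIV_unique[OF smooth_has_real_derivative[OF s(1)] dC] by (rule ext)
      have pD: "pderivs [1] D = (\<lambda>x. - \<mu> * sin (\<mu> * x))"
        using DERIV_unique[OF smooth_has_real_derivative[OF s(2)] dD] by (rule ext)
      have ddC: "((\<lambda>x. - \<kappa> * sin (\<kappa> * x)) has_real_derivative - \<kappa>\<^sup>2 * C x) (at x)" for x
        unfolding C_def by (auto intro!: derivative_eq_intros simp: power2_eq_square)
      have ddD: "((\<lambda>x. - \<mu> * sin (\<mu> * x)) has_real_derivative - \<mu>\<^sup>2 * D x) (at x)" for x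
        unfolding D_def by (auto intro!: derivative_eq_intros simp: power2_eq_square)
      have sin0: "sin (\<kappa> * a) = 0" "sin (\<mu> * b) = 0"
        unfolding \<kappa>_def \<mu>_def using ab sin_npi_int[of k] sin_npi_int[of l] by (simp_all add: mult.commute)
      define F where "F z = C (fst z) * D (snd z)" for z
      have sF: "smooth F" unfolding F_def by (rule smooth_tensor[OF s])
      define I where "I = (LINT z|?M. v z * F z)"
      have "sobolev_inner 1 ?R v F = 0" using orth sF by blast
      then have eq: "I + (LINT z|?M. vx z * (- \<kappa> * sin (\<kappa> * fst z) * D (snd z)))
          + (LINT z|?M. vt z * (C (fst z) * (- \<mu> * sin (\<mu> * snd z)))) = 0"
        unfolding sobolev_inner_1_smooth[OF v sF ab] unfolding F_def[abs_def] pderivs_tensor[OF s] pC pD I_def Iv_pair vx_def vt_def .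
      have "(LINT z|?M. vt z * (C (fst z) * (- \<mu> * sin (\<mu> * snd z)))) = - (LINT z|?M. v z * (C (fst z) * (- \<mu>\<^sup>2 * D (snd z))))"
        by (rule primitive_Neumann_by_parts[OF sv(1,3) c ab(2) cont(1) ddD])
          (use cont sin0 in \<open>auto intro!: continuous_intros\<close>)
      also have "\<dots> = \<mu>\<^sup>2 * I"
        unfolding I_def F_def integral_mult_right_zero[symmetric] Bochner_Integration.integral_minus[symmetric]
        by (intro Bochner_Integration.integral_cong refl) (simp add: algebra_simps)
      finally have t: "(LINT z|?M. vt z * (C (fst z) * (- \<mu> * sin (\<mu> * snd z)))) = \<mu>\<^sup>2 * I" .
      note [measurable] = sv[THEN sq_integrable_measurable]
      have [measurable]: "C \<in> borel_measurable (Iv a)" "D \<in> borel_measurable (Iv b)" "(\<lambda>x. sin (\<kappa> * x)) \<in> borel_measurable (Iv a)"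
        using cont by (auto intro!: Iv_measurable borel_measurable_continuous_onI continuous_intros)
      have "(LINT z|?M. vx z * (- \<kappa> * sin (\<kappa> * fst z) * D (snd z)))
        = (LINT z|Iv2 b a. vx (prod.swap z) * (D (fst z) * (- \<kappa> * sin (\<kappa> * snd z))))"
        using integral_swap_Iv[of "\<lambda>z. vx z * (- \<kappa> * sin (\<kappa> * fst z) * D (snd z))" a b, symmetric] by (simp add: mult_ac)
      also have "\<dots> = - (LINT z|Iv2 b a. v (prod.swap z) * (D (fst z) * (- \<kappa>\<^sup>2 * C (snd z))))"
        by (rule primitive_Neumann_by_parts[OF sq_integrable_swap_Iv[OF sv(1)] sq_integrable_swap_Iv[OF sv(2)] c' ab(1) cont(2) ddC])
          (use cont sin0 in \<open>auto intro!: continuous_intros\<close>)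
      also have "(LINT z|Iv2 b a. v (prod.swap z) * (D (fst z) * (- \<kappa>\<^sup>2 * C (snd z)))) = (LINT z|?M. v z * (- \<kappa>\<^sup>2 * C (fst z) * D (snd z)))"
        using integral_swap_Iv[of "\<lambda>z. v z * (- \<kappa>\<^sup>2 * C (fst z) * D (snd z))" a b] by (simp add: mult_ac)
      also have "- \<dots> = \<kappa>\<^sup>2 * I"
        unfolding I_def F_def integral_mult_right_zero[symmetric] Bochner_Integration.integral_minus[symmetric]
        by (intro Bochner_Integration.integral_cong refl) (simp add: algebra_simps)
      finally have "(1 + \<kappa>\<^sup>2 + \<mu>\<^sup>2) * I = 0" using eq t by (simp add: algebra_simps)
      moreover have "1 + \<kappa>\<^sup>2 + \<mu>\<^sup>2 > 0" by (intro add_pos_nonneg) auto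
      ultimately have "I = 0" by (metis less_irrefl mult_eq_0_iff)
      then show "(LINT z|?M. v z * (cos (of_int k * pi / a * fst z) * cos (of_int l * pi / b * snd z))) = 0"
        by (simp add: I_def F_def C_def D_def \<kappa>_def \<mu>_def)
    qed
    then have "sobolev_norm 1 ?R v = sobolev_norm 1 ?R (\<lambda>z. 0)"
      unfolding Iv_pair using sobolev_sq_integrable[OF open_Rect v]
      by (intro sobolev_norm_cong_AE[OF open_Rect]) (auto dest: sq_integrable_measurable)
    then show "sobolev_inner 1 ?R v v = 0"
      unfolding sobolev_inner_self[OF open_Rect] by (simp add: sobolev_norm_zero del: One_nat_def)
  qed
  then obtain f where f: "smooth f" "(sobolev_norm 1 ?R (\<lambda>z. f z - u z))\<^sup>2 < e\<^sup>2"
    unfolding sobolev_inner_self[OF open_Rect] by blast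
  then show ?thesis using power2_less_imp_less[OF f(2)] e by auto
qed

subsection \<open>Existence and uniqueness of traces\<close>

lemma has_trace_smooth:
  assumes f: "smooth f" and ab: "a > 0" "b > 0" and c: "continuous_on UNIV c"
  shows "has_trace (Rect a b) c {0<..<d} f (\<lambda>s. f (c s))"
proof -
  have cf: "continuous_on UNIV (\<lambda>s. f (c s))"
    by (rule continuous_on_compose2[OF smooth_continuous_on[OF f, of UNIV] c]) simp
  show ?thesis
    unfolding has_trace_def
  proof (intro conjI exI[of _ "\<lambda>n. f"])
    show "f \<in> sobolev 1 (Rect a b)" by (rule smooth_sobolev_1(1)[OF f ab])
    show "(\<lambda>s. f (c s)) \<in> L2 {0<..<d}"
      using sq_integrable_continuous_Iv[OF cf] by (simp add: L2_iff_sq_integrable)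
    show "(\<lambda>n. sobolev_norm 1 (Rect a b) (\<lambda>z. f z - f z)) \<longlonglongrightarrow> 0"
      by (simp add: sobolev_norm_zero del: One_nat_def)
  qed (use f in simp_all)
qed

text \<open>By \<open>trace_bound\<close> the restrictions of a smooth approximating sequence are Cauchy
  in \<open>L\<^sup>2\<close>.\<close>

theorem trace_exists:
  assumes u: "u \<in> sobolev 1 (Rect a b)" and ab: "a > 0" "b > 0" and s0: "s0 \<in> {0..b}"
  shows "\<exists>g. has_trace (Rect a b) (\<lambda>x. (x, s0)) {0<..<a} u g"
proof -
  let ?N = "sobolev_norm 1 (Rect a b)"
  have "\<forall>n. \<exists>f. smooth f \<and> ?N (\<lambda>z. f z - u z) < 1 / Suc n"
    using smooth_dense_sobolev_1[OF u ab] by simp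
  then obtain f where f: "\<And>n. smooth (f n)" "\<And>n. ?N (\<lambda>z. f n z - u z) < 1 / Suc n" by metis
  have c: "continuous_on UNIV (\<lambda>x. (x, s0))" by (intro continuous_intros)
  have lim: "(\<lambda>n. ?N (\<lambda>z. f n z - u z)) \<longlonglongrightarrow> 0"
    by (rule tendsto_sandwich[OF _ _ tendsto_const LIMSEQ_Suc[OF lim_1_over_n]])
      (use f(2) sobolev_norm_nonneg[OF open_Rect] in \<open>auto intro!: always_eventually less_imp_le simp del: One_nat_def\<close>)
  define C where "C = 2 / b + 2 * b"
  have C: "C > 0" unfolding C_def using ab by (intro add_pos_pos) auto
  have fs: "(\<lambda>z. f n z - u z) \<in> sobolev 1 (Rect a b)" for n
    by (rule smooth_minus_sobolev_1(1)[OF u f(1) ab])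
  have diff: "(LINT x|Iv a. (f m (x, s0) - f n (x, s0))\<^sup>2) \<le> C * (1 / Suc m + 1 / Suc n)\<^sup>2" for m n
  proof -
    have sm: "smooth (\<lambda>z. f m z - f n z)" by (rule smooth_diff[OF f(1) f(1)])
    have "(LINT x|Iv a. (f m (x, s0) - f n (x, s0))\<^sup>2) \<le> C * (?N (\<lambda>z. f m z - f n z))\<^sup>2"
      unfolding C_def by (rule trace_bound[OF has_trace_smooth[OF sm ab c] ab s0])
    also have "\<dots> \<le> C * (1 / Suc m + 1 / Suc n)\<^sup>2"
    proof (intro mult_left_mono power_mono)
      have neg: "?N (\<lambda>z. - 1 * (f n z - u z)) = ?N (\<lambda>z. f n z - u z)"
        using sobolev_norm_cmult[OF open_Rect fs, of "- 1" n] by simp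
      have "(\<lambda>z. - 1 * (f n z - u z)) \<in> sobolev 1 (Rect a b)"
        using sobolev_lin[OF open_Rect fs fs, of "- 1" n 0 n] by simp
      from sobolev_norm_triangle[OF open_Rect bounded_Rect fs[of m] this]
      have "?N (\<lambda>z. f m z - f n z) \<le> ?N (\<lambda>z. f m z - u z) + ?N (\<lambda>z. f n z - u z)"
        unfolding neg by simp
      then show "?N (\<lambda>z. f m z - f n z) \<le> 1 / Suc m + 1 / Suc n" using f(2)[of m] f(2)[of n] by linarith
    qed (use C sobolev_norm_nonneg[OF open_Rect] in auto)
    finally show ?thesis .
  qed
  interpret finite_measure "Iv a" by (rule finite_measure_Iv)
  have "\<exists>g. sq_integrable (Iv a) g \<and> (\<lambda>n. LINT x|Iv a. (f n (x, s0) - g x)\<^sup>2) \<longlonglongrightarrow> 0"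
  proof (rule L2_complete[of "\<lambda>n x. f n (x, s0)"])
    show "sq_integrable (Iv a) (\<lambda>x. f n (x, s0))" for n
      by (intro sq_integrable_continuous_Iv continuous_on_compose2[OF smooth_continuous_on[OF f(1), of UNIV] c]) simp
    fix e :: real assume e: "e > 0"
    define d where "d = sqrt (e / C) / 2"
    have "d > 0" using e C by (simp add: d_def)
    then obtain N where N: "1 / real (Suc N) < d" using nat_approx_posE by auto
    have "(LINT x|Iv a. (f m (x, s0) - f n (x, s0))\<^sup>2) < e" if "m \<ge> N" "n \<ge> N" for m n
    proof -
      have k: "1 / real (Suc k) < d" if "k \<ge> N" for k
        using that by (intro le_less_trans[OF _ N] divide_left_mono) auto
      have "(1 / real (Suc m) + 1 / real (Suc n))\<^sup>2 < (2 * d)\<^sup>2"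
      proof (rule power_strict_mono)
        show "1 / real (Suc m) + 1 / real (Suc n) < 2 * d" using add_strict_mono[OF k[OF that(1)] k[OF that(2)]] by simp
      qed auto
      also have "(2 * d)\<^sup>2 = e / C" using e C by (simp add: d_def)
      finally have "C * (1 / real (Suc m) + 1 / real (Suc n))\<^sup>2 < C * (e / C)" using C by (rule mult_strict_left_mono)
      then show ?thesis using diff[of m n] C by simp
    qed
    then show "\<exists>N. \<forall>m\<ge>N. \<forall>n\<ge>N. (LINT x|Iv a. (f m (x, s0) - f n (x, s0))\<^sup>2) < e" by blast
  qed
  then obtain g where g: "sq_integrable (Iv a) g" "(\<lambda>n. LINT x|Iv a. (f n (x, s0) - g x)\<^sup>2) \<longlonglongrightarrow> 0" by blast
  have "has_trace (Rect a b) (\<lambda>x. (x, s0)) {0<..<a} u g"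
    unfolding has_trace_def using u f(1) lim g
    by (auto simp: L2_iff_sq_integrable set_integral_lres simp del: One_nat_def intro!: exI[of _ f])
  then show ?thesis by (rule exI[of _ g])
qed

lemma AE_const_Iv: "AE t in Iv b. P \<Longrightarrow> b > 0 \<Longrightarrow> P"
proof (rule ccontr)
  assume a: "AE t in Iv b. P" "b > 0" "\<not> P"
  then have "AE t in Iv b. False" by simp
  then have "emeasure (Iv b) (space (Iv b)) = 0" unfolding ae_filter_eq_bot_iff[symmetric] trivial_limit_def .
  then show False using a(2) by (simp add: emeasure_restrict_space)
qed

lemma AE_fst_IvD:
  assumes "AE z in Iv2 a b. P (fst z)" "b > 0"
  shows "AE x in Iv a. P x"
  using AE_Iv_pairD[OF assms(1)]
  by eventually_elim (use AE_const_Iv[OF _ assms(2)] in auto)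

text \<open>Two traces of \<open>u\<close> are both equal to \<open>u\<close> minus the same
  primitive.\<close>

theorem trace_unique:
  assumes "has_trace (Rect a b) (\<lambda>x. (x, s0)) {0<..<a} u g" "has_trace (Rect a b) (\<lambda>x. (x, s0)) {0<..<a} u h"
    and "a > 0" "b > 0" "s0 \<in> {0..b}"
  shows "AE x in Iv a. g x = h x"
proof -
  have "AE z in Iv2 a b. g (fst z) = h (fst z)"
    using trace_representation[OF assms(1,3-5)] trace_representation[OF assms(2-5)]
    by eventually_elim simp
  then show ?thesis by (rule AE_fst_IvD) (rule assms)
qed

lemma has_trace_lin:
  assumes u: "has_trace (Rect a b) c {0<..<d} u g" and v: "has_trace (Rect a b) c {0<..<d} v h"
    and ab: "a > 0" "b > 0" and c: "continuous_on UNIV c"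
  shows "has_trace (Rect a b) c {0<..<d} (\<lambda>z. \<alpha> * u z + \<beta> * v z) (\<lambda>s. \<alpha> * g s + \<beta> * h s)"
proof -
  let ?N = "sobolev_norm 1 (Rect a b)"
  obtain f where f: "\<And>n. smooth (f n)" "(\<lambda>n. ?N (\<lambda>z. f n z - u z)) \<longlonglongrightarrow> 0"
    "(\<lambda>n. LINT s|Iv d. (f n (c s) - g s)\<^sup>2) \<longlonglongrightarrow> 0" and us: "u \<in> sobolev 1 (Rect a b)" and g: "sq_integrable (Iv d) g"
    using u unfolding has_trace_def by (auto simp: set_integral_lres L2_iff_sq_integrable simp del: One_nat_def)
  obtain k where k: "\<And>n. smooth (k n)" "(\<lambda>n. ?N (\<lambda>z. k n z - v z)) \<longlonglongrightarrow> 0"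
    "(\<lambda>n. LINT s|Iv d. (k n (c s) - h s)\<^sup>2) \<longlonglongrightarrow> 0" and vs: "v \<in> sobolev 1 (Rect a b)" and h: "sq_integrable (Iv d) h"
    using v unfolding has_trace_def by (auto simp: set_integral_lres L2_iff_sq_integrable simp del: One_nat_def)
  have fs: "(\<lambda>z. f n z - u z) \<in> sobolev 1 (Rect a b)" "(\<lambda>z. k n z - v z) \<in> sobolev 1 (Rect a b)" for n
    by (rule smooth_minus_sobolev_1(1)[OF us f(1) ab], rule smooth_minus_sobolev_1(1)[OF vs k(1) ab])
  define F where "F n z = \<alpha> * f n z + \<beta> * k n z" for n z
  have F: "smooth (F n)" for n unfolding F_def by (intro smooth_add smooth_cmult f k)
  have cont: "sq_integrable (Iv d) (\<lambda>s. f n (c s) - g s)" "sq_integrable (Iv d) (\<lambda>s. k n (c s) - h s)" for n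
    by (intro sq_integrable_diff g h sq_integrable_continuous_Iv continuous_on_compose2[OF smooth_continuous_on[of _ UNIV] c] f k; simp)+
  have "(\<lambda>n. ?N (\<lambda>z. F n z - (\<alpha> * u z + \<beta> * v z))) \<longlonglongrightarrow> 0"
  proof (rule tendsto_sandwich[OF _ _ tendsto_const])
    show "\<forall>\<^sub>F n in sequentially. 0 \<le> ?N (\<lambda>z. F n z - (\<alpha> * u z + \<beta> * v z))"
      using sobolev_norm_nonneg[OF open_Rect] by (intro always_eventually allI)
    have "?N (\<lambda>z. F n z - (\<alpha> * u z + \<beta> * v z)) \<le> \<bar>\<alpha>\<bar> * ?N (\<lambda>z. f n z - u z) + \<bar>\<beta>\<bar> * ?N (\<lambda>z. k n z - v z)" for n
    proof -
      have m: "(\<lambda>z. \<alpha> * (f n z - u z)) \<in> sobolev 1 (Rect a b)" "(\<lambda>z. \<beta> * (k n z - v z)) \<in> sobolev 1 (Rect a b)"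
        using sobolev_lin[OF open_Rect fs(1) fs(1), of \<alpha> n 0 n] sobolev_lin[OF open_Rect fs(2) fs(2), of \<beta> n 0 n] by simp_all
      have "(\<lambda>z. F n z - (\<alpha> * u z + \<beta> * v z)) = (\<lambda>z. \<alpha> * (f n z - u z) + \<beta> * (k n z - v z))"
        by (auto simp: F_def algebra_simps)
      then show ?thesis
        using sobolev_norm_triangle[OF open_Rect bounded_Rect m]
        unfolding sobolev_norm_cmult[OF open_Rect fs(1)] sobolev_norm_cmult[OF open_Rect fs(2)] by simp
    qed
    then show "\<forall>\<^sub>F n in sequentially. ?N (\<lambda>z. F n z - (\<alpha> * u z + \<beta> * v z)) \<le> \<bar>\<alpha>\<bar> * ?N (\<lambda>z. f n z - u z) + \<bar>\<beta>\<bar> * ?N (\<lambda>z. k n z - v z)"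
      by (intro always_eventually allI)
    show "(\<lambda>n. \<bar>\<alpha>\<bar> * ?N (\<lambda>z. f n z - u z) + \<bar>\<beta>\<bar> * ?N (\<lambda>z. k n z - v z)) \<longlonglongrightarrow> 0"
      using tendsto_add[OF tendsto_mult_left[OF f(2), of "\<bar>\<alpha>\<bar>"] tendsto_mult_left[OF k(2), of "\<bar>\<beta>\<bar>"]] by simp
  qed
  moreover have "(\<lambda>n. LINT s|Iv d. (F n (c s) - (\<alpha> * g s + \<beta> * h s))\<^sup>2) \<longlonglongrightarrow> 0"
  proof (rule tendsto_sandwich[OF _ _ tendsto_const])
    show "\<forall>\<^sub>F n in sequentially. 0 \<le> (LINT s|Iv d. (F n (c s) - (\<alpha> * g s + \<beta> * h s))\<^sup>2)" by simp
    have "(LINT s|Iv d. (F n (c s) - (\<alpha> * g s + \<beta> * h s))\<^sup>2)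
       \<le> 2 * \<alpha>\<^sup>2 * (LINT s|Iv d. (f n (c s) - g s)\<^sup>2) + 2 * \<beta>\<^sup>2 * (LINT s|Iv d. (k n (c s) - h s)\<^sup>2)" for n
    proof -
      have i: "integrable (Iv d) (\<lambda>s. (f n (c s) - g s)\<^sup>2)" "integrable (Iv d) (\<lambda>s. (k n (c s) - h s)\<^sup>2)"
        using cont by (simp_all add: sq_integrable_def)
      have "sq_integrable (Iv d) (\<lambda>s. \<alpha> * (f n (c s) - g s) + \<beta> * (k n (c s) - h s))"
        by (intro sq_integrable_add sq_integrable_cmult cont)
      then have i2: "integrable (Iv d) (\<lambda>s. (\<alpha> * (f n (c s) - g s) + \<beta> * (k n (c s) - h s))\<^sup>2)" by (simp add: sq_integrable_def)
      have eq: "F n (c s) - (\<alpha> * g s + \<beta> * h s) = \<alpha> * (f n (c s) - g s) + \<beta> * (k n (c s) - h s)" for s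
        by (simp add: F_def algebra_simps)
      have "(LINT s|Iv d. (F n (c s) - (\<alpha> * g s + \<beta> * h s))\<^sup>2)
        \<le> (LINT s|Iv d. 2 * \<alpha>\<^sup>2 * (f n (c s) - g s)\<^sup>2 + 2 * \<beta>\<^sup>2 * (k n (c s) - h s)\<^sup>2)"
        unfolding eq
      proof (rule integral_mono[OF i2])
        show "integrable (Iv d) (\<lambda>s. 2 * \<alpha>\<^sup>2 * (f n (c s) - g s)\<^sup>2 + 2 * \<beta>\<^sup>2 * (k n (c s) - h s)\<^sup>2)" using i by simp
        show "(\<alpha> * (f n (c s) - g s) + \<beta> * (k n (c s) - h s))\<^sup>2 \<le> 2 * \<alpha>\<^sup>2 * (f n (c s) - g s)\<^sup>2 + 2 * \<beta>\<^sup>2 * (k n (c s) - h s)\<^sup>2" for s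
          using sq_add_le[of "\<alpha> * (f n (c s) - g s)" "\<beta> * (k n (c s) - h s)"] by (simp add: power_mult_distrib)
      qed
      also have "\<dots> = 2 * \<alpha>\<^sup>2 * (LINT s|Iv d. (f n (c s) - g s)\<^sup>2) + 2 * \<beta>\<^sup>2 * (LINT s|Iv d. (k n (c s) - h s)\<^sup>2)"
        using i by simp
      finally show ?thesis .
    qed
    then show "\<forall>\<^sub>F n in sequentially. (LINT s|Iv d. (F n (c s) - (\<alpha> * g s + \<beta> * h s))\<^sup>2)
       \<le> 2 * \<alpha>\<^sup>2 * (LINT s|Iv d. (f n (c s) - g s)\<^sup>2) + 2 * \<beta>\<^sup>2 * (LINT s|Iv d. (k n (c s) - h s)\<^sup>2)"
      by (intro always_eventually allI)
    show "(\<lambda>n. 2 * \<alpha>\<^sup>2 * (LINT s|Iv d. (f n (c s) - g s)\<^sup>2) + 2 * \<beta>\<^sup>2 * (LINT s|Iv d. (k n (c s) - h s)\<^sup>2)) \<longlonglongrightarrow> 0"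
      using tendsto_add[OF tendsto_mult_left[OF f(3), of "2 * \<alpha>\<^sup>2"] tendsto_mult_left[OF k(3), of "2 * \<beta>\<^sup>2"]] by simp
  qed
  moreover have "(\<lambda>z. \<alpha> * u z + \<beta> * v z) \<in> sobolev 1 (Rect a b)" by (rule sobolev_lin[OF open_Rect us vs])
  moreover have "sq_integrable (Iv d) (\<lambda>s. \<alpha> * g s + \<beta> * h s)"
    by (intro sq_integrable_add sq_integrable_cmult g h)
  ultimately show ?thesis
    unfolding has_trace_def using F
    by (auto simp: L2_iff_sq_integrable set_integral_lres simp del: One_nat_def intro!: exI[of _ F])
qed

lemma has_trace_cong_AE:
  assumes u: "has_trace (Rect a b) c I u g" and ab: "a > 0" "b > 0"
    and u': "u' \<in> borel_measurable (lres (Rect a b))" "AE z in lres (Rect a b). u z = u' z"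
  shows "has_trace (Rect a b) c I u' g"
proof -
  let ?N = "sobolev_norm 1 (Rect a b)"
  obtain f where f: "\<And>n. smooth (f n)" "(\<lambda>n. ?N (\<lambda>z. f n z - u z)) \<longlonglongrightarrow> 0"
    "(\<lambda>n. LINT s:I|lborel. (f n (c s) - g s)\<^sup>2) \<longlonglongrightarrow> 0" and us: "u \<in> sobolev 1 (Rect a b)" and g: "g \<in> L2 I"
    using u unfolding has_trace_def by blast
  have us': "u' \<in> sobolev 1 (Rect a b)" by (rule sobolev_cong_AE[OF open_Rect us u'])
  have "?N (\<lambda>z. f n z - u' z) = ?N (\<lambda>z. f n z - u z)" for n
  proof (rule sobolev_norm_cong_AE[OF open_Rect])
    show "AE z in lres (Rect a b). f n z - u' z = f n z - u z" using u'(2) by eventually_elim simp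
    show "(\<lambda>z. f n z - u z) \<in> borel_measurable (lres (Rect a b))" "(\<lambda>z. f n z - u' z) \<in> borel_measurable (lres (Rect a b))"
      using sobolev_sq_integrable[OF open_Rect smooth_minus_sobolev_1(1)[OF us f(1) ab]]
        sobolev_sq_integrable[OF open_Rect smooth_minus_sobolev_1(1)[OF us' f(1) ab]] by (auto simp: sq_integrable_def)
  qed
  with f(2) have f2: "(\<lambda>n. ?N (\<lambda>z. f n z - u' z)) \<longlonglongrightarrow> 0" by (simp only:)
  show ?thesis unfolding has_trace_def using us' g f(1,3) f2 by blast
qed

text \<open>A diagonal sequence: approximate each approximant by a smooth function whose restriction is
  close to \<open>g\<close>.\<close>

lemma has_trace_closed:
  assumes u: "u \<in> sobolev 1 (Rect a b)" and ab: "a > 0" "b > 0" and g: "g \<in> L2 I"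
    and approx: "\<And>e. e > 0 \<Longrightarrow> \<exists>v. has_trace (Rect a b) c I v g \<and> sobolev_norm 1 (Rect a b) (\<lambda>z. v z - u z) < e"
  shows "has_trace (Rect a b) c I u g"
proof -
  let ?N = "sobolev_norm 1 (Rect a b)"
  have "\<exists>f. smooth f \<and> ?N (\<lambda>z. f z - u z) < 2 * (1 / Suc n) \<and> \<bar>LINT s:I|lborel. (f (c s) - g s)\<^sup>2\<bar> < 1 / Suc n" for n
  proof -
    have e: "1 / real (Suc n) > 0" by simp
    obtain v where v: "has_trace (Rect a b) c I v g" "?N (\<lambda>z. v z - u z) < 1 / Suc n"
      using approx[OF e] by blast
    obtain f where f: "\<And>n. smooth (f n)" "(\<lambda>n. ?N (\<lambda>z. f n z - v z)) \<longlonglongrightarrow> 0"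
      "(\<lambda>n. LINT s:I|lborel. (f n (c s) - g s)\<^sup>2) \<longlonglongrightarrow> 0" and vs: "v \<in> sobolev 1 (Rect a b)"
      using v(1) unfolding has_trace_def by blast
    have "\<forall>\<^sub>F m in sequentially. ?N (\<lambda>z. f m z - v z) < 1 / Suc n \<and> \<bar>LINT s:I|lborel. (f m (c s) - g s)\<^sup>2\<bar> < 1 / Suc n"
      using order_tendstoD(2)[OF f(2) e] order_tendstoD(2)[OF tendsto_rabs_zero[OF f(3)] e] by (rule eventually_conj)
    then obtain m where m: "?N (\<lambda>z. f m z - v z) < 1 / Suc n" "\<bar>LINT s:I|lborel. (f m (c s) - g s)\<^sup>2\<bar> < 1 / Suc n"
      using eventually_happens'[OF sequentially_bot] by blast
    have "?N (\<lambda>z. f m z - u z) \<le> ?N (\<lambda>z. f m z - v z) + ?N (\<lambda>z. v z - u z)"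
      using sobolev_norm_triangle[OF open_Rect bounded_Rect smooth_minus_sobolev_1(1)[OF vs f(1) ab] sobolev_diff[OF open_Rect vs u]]
      by simp
    then have "?N (\<lambda>z. f m z - u z) < 2 * (1 / Suc n)" using m(1) v(2) by argo
    with m(2) f(1) show ?thesis by blast
  qed
  then have "\<forall>n. \<exists>f. smooth f \<and> ?N (\<lambda>z. f z - u z) < 2 * (1 / Suc n) \<and> \<bar>LINT s:I|lborel. (f (c s) - g s)\<^sup>2\<bar> < 1 / Suc n"
    by (rule allI)
  from choice[OF this] obtain f where ff: "\<forall>n. smooth (f n) \<and> ?N (\<lambda>z. f n z - u z) < 2 * (1 / Suc n)
      \<and> \<bar>LINT s:I|lborel. (f n (c s) - g s)\<^sup>2\<bar> < 1 / Suc n" by (rule exE)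
  have f: "smooth (f n)" "?N (\<lambda>z. f n z - u z) < 2 * (1 / Suc n)"
    "\<bar>LINT s:I|lborel. (f n (c s) - g s)\<^sup>2\<bar> < 1 / Suc n" for n
    by (rule spec[OF ff, of n, THEN conjunct1], rule spec[OF ff, of n, THEN conjunct2, THEN conjunct1],
        rule spec[OF ff, of n, THEN conjunct2, THEN conjunct2])
  have "(\<lambda>n. ?N (\<lambda>z. f n z - u z)) \<longlonglongrightarrow> 0"
  proof (rule tendsto_sandwich[OF _ _ tendsto_const])
    show "\<forall>\<^sub>F n in sequentially. 0 \<le> ?N (\<lambda>z. f n z - u z)"
      using sobolev_norm_nonneg[OF open_Rect] by (intro always_eventually allI)
    show "\<forall>\<^sub>F n in sequentially. ?N (\<lambda>z. f n z - u z) \<le> 2 * (1 / Suc n)"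
      using f(2) by (intro always_eventually allI less_imp_le)
    show "(\<lambda>n. 2 * (1 / real (Suc n))) \<longlonglongrightarrow> 0"
      using tendsto_mult_left[OF LIMSEQ_Suc[OF lim_1_over_n], of 2] by simp
  qed
  moreover have "(\<lambda>n. LINT s:I|lborel. (f n (c s) - g s)\<^sup>2) \<longlonglongrightarrow> 0"
    by (rule Lim_null_comparison[OF _ LIMSEQ_Suc[OF lim_1_over_n]])
      (use f(3) in \<open>auto intro!: always_eventually less_imp_le\<close>)
  ultimately show ?thesis unfolding has_trace_def using u g f(1) by blast
qed

subsection \<open>The derivative of a trace\<close>

text \<open>Tested with \<open>\<psi> x * \<omega> t\<close>, the weak derivative identity says that the
  difference of the two sides, as a function of \<open>t\<close>, has vanishing integral against every
  test function \<open>\<omega>\<close>.\<close>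

lemma weak_deriv_x_slices:
  assumes w: "has_weak_deriv (Rect a b) {#e_x#} v vx" and sv: "sq_integrable (Iv2 a b) v" "sq_integrable (Iv2 a b) vx"
    and \<psi>: "test_fun {0<..<a} \<psi>"
  shows "AE t in Iv b. (LINT x|Iv a. v (x, t) * pderivs [1] \<psi> x) = - (LINT x|Iv a. vx (x, t) * \<psi> x)"
proof -
  let ?M = "Iv2 b a"
  have \<psi>': "test_fun {0<..<a} (pderivs [1] \<psi>)" using \<psi> by (rule test_fun_pderivs) simp
  define q where "q = pderivs [1] \<psi>"
  have c: "continuous_on UNIV \<psi>" "continuous_on UNIV q"
    using \<psi> \<psi>' by (auto simp only: q_def intro!: smooth_continuous_on test_fun_smooth)
  have cs: "sq_integrable ?M (\<lambda>z. \<psi> (snd z))" "sq_integrable ?M (\<lambda>z. q (snd z))"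
    by (intro sq_integrable_continuous_pair continuous_on_compose2[OF c(1)] continuous_on_compose2[OF c(2)] continuous_intros; simp)+
  note sw = sq_integrable_swap_Iv[OF sv(1)] sq_integrable_swap_Iv[OF sv(2)]
  note i = sq_integrable_mult[OF sw(1) cs(2)] sq_integrable_mult[OF sw(2) cs(1)]
  define D where "D t = (LINT x|Iv a. v (x, t) * q x) + (LINT x|Iv a. vx (x, t) * \<psi> x)" for t
  have iD: "integrable (Iv b) D"
    unfolding D_def using Iv_pair_slices(2)[OF i(1)] Iv_pair_slices(2)[OF i(2)] by simp
  have "AE t in lborel. t \<in> {0<..<b} \<longrightarrow> D t = 0"
  proof (rule AE_eq_0_if_test_integrals_eq_0)
    show "loc_integrable {0<..<b} D"
      unfolding loc_integrable_def
    proof (intro allI impI)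
      fix K assume K: "compact K \<and> K \<subseteq> {0<..<b}"
      have "set_integrable lborel {0<..<b} D" using iD by (simp add: set_integrable_lres)
      then show "set_integrable lborel K D"
        by (rule set_integrable_subset) (use K in \<open>auto intro: borel_compact\<close>)
    qed
    fix \<omega> assume \<omega>: "test_fun {0<..<b} \<omega>"
    note [measurable] = sv[THEN sq_integrable_measurable]
    have [measurable]: "\<psi> \<in> borel_measurable (Iv a)" "q \<in> borel_measurable (Iv a)" "\<omega> \<in> borel_measurable (Iv b)"
      by (intro Iv_measurable borel_measurable_continuous_onI c,
          intro Iv_measurable borel_measurable_continuous_onI c, intro Iv_measurable test_fun_measurable[OF \<omega>])
    have cx: "continuous_on UNIV \<omega>" using \<omega> by (intro smooth_continuous_on test_fun_smooth)
    have ct: "sq_integrable ?M (\<lambda>z. \<omega> (fst z) * r (snd z))" if r: "continuous_on UNIV r" for r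
      by (intro sq_integrable_continuous_pair continuous_on_mult continuous_on_compose2[OF cx] continuous_on_compose2[OF r] continuous_intros) auto
    note i1 = sq_integrable_mult[OF sw(1) ct[OF c(2)]]
    note i2 = sq_integrable_mult[OF sw(2) ct[OF c(1)]]
    have e1: "(LINT t|Iv b. LINT x|Iv a. v (x, t) * (\<omega> t * q x)) = (LINT z|Iv2 a b. v z * (q (fst z) * \<omega> (snd z)))"
      using Iv_pair_slices(3)[OF i1] integral_swap_Iv[of "\<lambda>z. v z * (q (fst z) * \<omega> (snd z))" a b] by (simp add: mult_ac)
    have e2: "(LINT t|Iv b. LINT x|Iv a. vx (x, t) * (\<omega> t * \<psi> x)) = (LINT z|Iv2 a b. vx z * (\<psi> (fst z) * \<omega> (snd z)))"
      using Iv_pair_slices(3)[OF i2] integral_swap_Iv[of "\<lambda>z. vx z * (\<psi> (fst z) * \<omega> (snd z))" a b] by (simp add: mult_ac)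
    have pull: "(LINT x|Iv a. w x * (\<omega> t * r x)) = (LINT x|Iv a. w x * r x) * \<omega> t" for w r t
      unfolding integral_mult_left_zero[symmetric] by (simp add: mult_ac)
    have "(LINT t|Iv b. D t * \<omega> t) = (LINT t|Iv b. (LINT x|Iv a. v (x, t) * (\<omega> t * q x)) + (LINT x|Iv a. vx (x, t) * (\<omega> t * \<psi> x)))"
      unfolding D_def pull distrib_right ..
    also have "\<dots> = (LINT t|Iv b. LINT x|Iv a. v (x, t) * (\<omega> t * q x)) + (LINT t|Iv b. LINT x|Iv a. vx (x, t) * (\<omega> t * \<psi> x))"
      using Iv_pair_slices(2)[OF i1] Iv_pair_slices(2)[OF i2] by simp
    also have "\<dots> = 0"
      unfolding e1 e2 unfolding q_def using weak_deriv_tensor_test(2)[OF w \<psi> \<omega> refl] by simp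
    finally show "(LINT t:{0<..<b}|lborel. D t * \<omega> t) = 0" by (simp add: set_integral_lres)
  qed simp
  then have "AE t in Iv b. D t = 0" by (simp add: AE_lres_iff)
  then show ?thesis by eventually_elim (simp add: D_def q_def)
qed

text \<open>Represent \<open>u\<close> as \<open>g\<close> plus the primitive of
  \<open>u\<^sub>t\<close>, and \<open>u\<^sub>x\<close> as \<open>k\<close> plus the primitive of
  \<open>u\<^sub>x\<^sub>t\<close>. Against a fixed test function, \<open>u\<^sub>x\<close> acts on
  almost every slice as the weak derivative of \<open>u\<close>, and \<open>u\<^sub>x\<^sub>t\<close> as
  that of \<open>u\<^sub>t\<close>; so the two primitives cancel, and the identity that remains for
  \<open>g\<close> and \<open>k\<close> no longer contains \<open>t\<close>.\<close>

lemma trace_has_weak_deriv: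
  assumes u: "u \<in> sobolev 2 (Rect a b)" and ab: "a > 0" "b > 0" and s0: "s0 \<in> {0..b}"
    and g: "has_trace (Rect a b) (\<lambda>x. (x, s0)) {0<..<a} u g"
    and k: "has_trace (Rect a b) (\<lambda>x. (x, s0)) {0<..<a} (weak_deriv (Rect a b) {#e_x#} u) k"
  shows "has_weak_deriv {0<..<a} {#1#} g k"
proof (rule has_weak_derivI)
  have sg: "sq_integrable (Iv a) g" and sk: "sq_integrable (Iv a) k"
    using g k by (auto simp: has_trace_def L2_iff_sq_integrable)
  show "loc_integrable {0<..<a} g" "loc_integrable {0<..<a} k"
    using sg sk by (auto intro: sq_integrable_loc_integrable)
  let ?R = "Rect a b"
  define ux where "ux = weak_deriv ?R {#e_x#} u"
  define ut where "ut = weak_deriv ?R {#e_t#} u"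
  define uxt where "uxt = weak_deriv ?R {#e_t#} ux"
  have B: "e_x \<in> Basis" "e_t \<in> Basis" by (auto simp: Basis_real_pair)
  have u2: "u \<in> sobolev (Suc 1) ?R" using u by (simp add: numeral_2_eq_2)
  have u1: "u \<in> sobolev 1 ?R" by (rule sobolev_mono[OF open_Rect _ u]) simp
  have em: "{#e_x#} \<in> multi_indices 1" "{#e_t#} \<in> multi_indices 1"
    using e_multi_index[of e_x 0] e_multi_index[of e_t 0] by auto
  have ux1: "ux \<in> sobolev 1 ?R" and ut1: "ut \<in> sobolev 1 ?R"
    unfolding ux_def ut_def using weak_deriv_sobolev(1)[OF open_Rect u2] B by blast+
  have wut: "has_weak_deriv ?R {#e_x#} ut uxt"
  proof (rule has_weak_deriv_cong_AE[OF open_Rect sobolev_weak_deriv(1)[OF open_Rect ut1 em(1)]])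
    have "AE z in lres ?R. weak_deriv ?R {#e_x#} ut z = weak_deriv ?R {#e_t, e_x#} u z"
      unfolding ut_def by (rule weak_deriv_sobolev(2)[OF open_Rect u2 B(2) em(1)])
    moreover have "AE z in lres ?R. uxt z = weak_deriv ?R {#e_x, e_t#} u z"
      unfolding uxt_def ux_def by (rule weak_deriv_sobolev(2)[OF open_Rect u2 B(1) em(2)])
    ultimately show "AE z in lres ?R. weak_deriv ?R {#e_x#} ut z = uxt z"
      by eventually_elim (simp add: add_mset_commute)
    show "ut \<in> borel_measurable (lres ?R)" "uxt \<in> borel_measurable (lres ?R)"
      unfolding uxt_def using sobolev_sq_integrable[OF open_Rect ut1] sobolev_weak_deriv(2)[OF open_Rect ux1 em(2)]
      by (auto simp: sq_integrable_def)
  qed (use B in auto)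
  have wu: "has_weak_deriv ?R {#e_x#} u ux" unfolding ux_def by (rule sobolev_weak_deriv(1)[OF open_Rect u1 em(1)])
  have s: "sq_integrable (Iv2 a b) u" "sq_integrable (Iv2 a b) ux" "sq_integrable (Iv2 a b) ut"
    "sq_integrable (Iv2 a b) uxt"
    unfolding Iv_pair uxt_def using sobolev_sq_integrable[OF open_Rect u1] sobolev_sq_integrable[OF open_Rect ux1]
      sobolev_sq_integrable[OF open_Rect ut1] sobolev_weak_deriv(2)[OF open_Rect ux1 em(2)] by auto
  fix bs \<psi> assume bs: "mset bs = {#1::real#}" and \<psi>: "test_fun {0<..<a} \<psi>"
  have bs: "bs = [1]" using bs by simp
  define q where "q = pderivs [1] \<psi>"
  have "test_fun {0<..<a} q" unfolding q_def using \<psi> by (rule test_fun_pderivs) simp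
  then have c: "continuous_on UNIV \<psi>" "continuous_on UNIV q"
    using \<psi> by (auto intro!: smooth_continuous_on test_fun_smooth)
  define Ku where "Ku x t = (LINT s|Iv b. kern s0 t s * ut (x, s))" for x t
  define Kx where "Kx x t = (LINT s|Iv b. kern s0 t s * uxt (x, s))" for x t
  have 1: "AE t in Iv b. AE x in Iv a. u (x, t) = g x + Ku x t"
  proof -
    have "AE z in Iv2 b a. u (prod.swap z) = g (fst (prod.swap z)) + Ku (fst (prod.swap z)) (snd (prod.swap z))"
      by (rule AE_swap_Iv) (use trace_representation[OF g ab s0] in \<open>simp add: Ku_def ut_def\<close>)
    from AE_Iv_pairD[OF this] show ?thesis by simp
  qed
  have 2: "AE t in Iv b. AE x in Iv a. ux (x, t) = k x + Kx x t"
  proof -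
    have "AE z in Iv2 b a. ux (prod.swap z) = k (fst (prod.swap z)) + Kx (fst (prod.swap z)) (snd (prod.swap z))"
      by (rule AE_swap_Iv) (use trace_representation[OF k ab s0] in \<open>simp add: Kx_def uxt_def ux_def\<close>)
    from AE_Iv_pairD[OF this] show ?thesis by simp
  qed
  note 3 = weak_deriv_x_slices[OF wu s(1,2) \<psi>, folded q_def]
  note 4 = weak_deriv_x_slices[OF wut s(3,4) \<psi>, folded q_def]
  note 5 = sq_integrable_pair_slices(1)[OF sq_integrable_swap_Iv[OF s(1)]] sq_integrable_pair_slices(1)[OF sq_integrable_swap_Iv[OF s(2)]]
  have fub: "integrable (Iv a) (\<lambda>x. (LINT s|Iv b. kern s0 t s * w (x, s)) * r x)"
      "(LINT x|Iv a. (LINT s|Iv b. kern s0 t s * w (x, s)) * r x) = (LINT s|Iv b. kern s0 t s * (LINT x|Iv a. w (x, s) * r x))"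
    if w: "sq_integrable (Iv2 a b) w" and r: "continuous_on UNIV r" for w r t
  proof -
    interpret pair_sigma_finite "Iv a" "Iv b" by (rule pair_sigma_finite_Iv)
    interpret M: finite_measure "Iv2 a b" by (rule finite_measure_Iv_pair)
    note Iv_ident[measurable]
    have [measurable]: "r \<in> borel_measurable (Iv a)" using r by (intro Iv_measurable borel_measurable_continuous_onI)
    have sr: "sq_integrable (Iv2 a b) (\<lambda>z. r (fst z))"
      by (intro sq_integrable_continuous_pair continuous_on_compose2[OF r] continuous_intros) simp
    have "sq_integrable (Iv2 a b) (\<lambda>z. kern s0 t (snd z) * r (fst z))"
      by (rule sq_integrable_bound[OF sr]) (auto simp: abs_mult intro!: mult_left_le_one_le kern_bound)
    from sq_integrable_mult[OF w this]
    have i: "integrable (Iv2 a b) (\<lambda>(x, s). kern s0 t s * w (x, s) * r x)"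
      by (simp add: case_prod_unfold mult_ac)
    show "integrable (Iv a) (\<lambda>x. (LINT s|Iv b. kern s0 t s * w (x, s)) * r x)"
      using integrable_fst[OF i] by simp
    have "(LINT x|Iv a. (LINT s|Iv b. kern s0 t s * w (x, s)) * r x) = (LINT x|Iv a. LINT s|Iv b. kern s0 t s * w (x, s) * r x)"
      by simp
    also have "\<dots> = (LINT s|Iv b. LINT x|Iv a. kern s0 t s * w (x, s) * r x)" by (rule Fubini_integral[OF i, symmetric])
    also have "\<dots> = (LINT s|Iv b. kern s0 t s * (LINT x|Iv a. w (x, s) * r x))" by (simp add: mult.assoc)
    finally show "(LINT x|Iv a. (LINT s|Iv b. kern s0 t s * w (x, s)) * r x) = (LINT s|Iv b. kern s0 t s * (LINT x|Iv a. w (x, s) * r x))" .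
  qed
  have slice: "(LINT x|Iv a. U x * r x) = (LINT x|Iv a. f x * r x) + (LINT s|Iv b. kern s0 t s * (LINT x|Iv a. w (x, s) * r x))"
    if U: "AE x in Iv a. U x = f x + (LINT s|Iv b. kern s0 t s * w (x, s))" "sq_integrable (Iv a) U" and f: "sq_integrable (Iv a) f"
      and w: "sq_integrable (Iv2 a b) w" and r: "continuous_on UNIV r" for U f w r t
  proof -
    have i: "integrable (Iv a) (\<lambda>x. f x * r x)" "integrable (Iv a) (\<lambda>x. U x * r x)"
      by (intro sq_integrable_mult f U sq_integrable_continuous_Iv r)+
    have "(LINT x|Iv a. U x * r x) = (LINT x|Iv a. f x * r x + (LINT s|Iv b. kern s0 t s * w (x, s)) * r x)"
      by (rule integral_cong_AE) (use i fub(1)[OF w r] U(1) in \<open>auto elim!: eventually_mono simp: distrib_right\<close>)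
    then show ?thesis using i fub[OF w r, of t] by simp
  qed
  have "AE t in Iv b. (LINT x|Iv a. g x * q x) = - (LINT x|Iv a. k x * \<psi> x)"
    using 1 2 3 5
  proof eventually_elim
    case (elim t)
    have su: "sq_integrable (Iv a) (\<lambda>x. u (x, t))" "sq_integrable (Iv a) (\<lambda>x. ux (x, t))"
      using elim by (simp_all only: swap_simp)
    have A: "(LINT x|Iv a. u (x, t) * q x) = (LINT x|Iv a. g x * q x) + (LINT s|Iv b. kern s0 t s * (LINT x|Iv a. ut (x, s) * q x))"
      by (rule slice[OF _ su(1) sg s(3) c(2)]) (use elim in \<open>simp add: Ku_def\<close>)
    have B: "(LINT x|Iv a. ux (x, t) * \<psi> x) = (LINT x|Iv a. k x * \<psi> x) + (LINT s|Iv b. kern s0 t s * (LINT x|Iv a. uxt (x, s) * \<psi> x))"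
      by (rule slice[OF _ su(2) sk s(4) c(1)]) (use elim in \<open>simp add: Kx_def\<close>)
    have "(LINT s|Iv b. kern s0 t s * (LINT x|Iv a. ut (x, s) * q x)) = (LINT s|Iv b. - (kern s0 t s * (LINT x|Iv a. uxt (x, s) * \<psi> x)))"
    proof (rule integral_cong_AE)
      show "AE s in Iv b. kern s0 t s * (LINT x|Iv a. ut (x, s) * q x) = - (kern s0 t s * (LINT x|Iv a. uxt (x, s) * \<psi> x))"
        using 4 by eventually_elim simp
      interpret sigma_finite_measure "Iv a" by (rule sigma_finite_Iv)
      note [measurable] = Iv_ident s(3,4)[THEN sq_integrable_measurable]
      have [measurable]: "q \<in> borel_measurable (Iv a)" "\<psi> \<in> borel_measurable (Iv a)"
        using c by (auto intro!: Iv_measurable borel_measurable_continuous_onI)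
      show "(\<lambda>s. kern s0 t s * (LINT x|Iv a. ut (x, s) * q x)) \<in> borel_measurable (Iv b)"
        "(\<lambda>s. - (kern s0 t s * (LINT x|Iv a. uxt (x, s) * \<psi> x))) \<in> borel_measurable (Iv b)" by measurable
    qed
    then show ?case using A B elim(3) by simp
  qed
  then have "(LINT x|Iv a. g x * q x) = - (LINT x|Iv a. k x * \<psi> x)" by (rule AE_const_Iv) (rule ab)
  then show "(LINT x|lres {0<..<a}. g x * pderivs bs \<psi> x) = (- 1) ^ length bs * (LINT x|lres {0<..<a}. k x * \<psi> x)"
    by (simp add: bs q_def)
qed simp

section \<open>Estimates in the third Sobolev space\<close>

lemma tensor_integral_Iv:
  fixes f g :: "real \<Rightarrow> real"
  assumes f: "integrable (Iv a) f" and g: "integrable (Iv b) g"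
  shows "integrable (Iv2 a b) (\<lambda>z. f (fst z) * g (snd z))"
    "(LINT z|Iv2 a b. f (fst z) * g (snd z)) = (LINT x|Iv a. f x) * (LINT t|Iv b. g t)"
proof -
  interpret pair_sigma_finite "Iv a" "Iv b" by (rule pair_sigma_finite_Iv)
  note [measurable] = borel_measurable_integrable[OF f] borel_measurable_integrable[OF g]
  show i: "integrable (Iv2 a b) (\<lambda>z. f (fst z) * g (snd z))"
  proof (rule Fubini_integrable)
    show "integrable (Iv a) (\<lambda>x. LINT y|Iv b. norm (f (fst (x, y)) * g (snd (x, y))))"
      using f by (simp add: abs_mult)
    show "AE x in Iv a. integrable (Iv b) (\<lambda>y. f (fst (x, y)) * g (snd (x, y)))"
      using g by simp
  qed measurable
  show "(LINT z|Iv2 a b. f (fst z) * g (snd z)) = (LINT x|Iv a. f x) * (LINT t|Iv b. g t)"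
    using integral_fst'[OF i] by simp
qed

lemma weak_deriv_norm_mono:
  assumes S: "open S" and u: "u \<in> sobolev (Suc k) S" and b: "b \<in> Basis"
  shows "sobolev_norm k S (weak_deriv S {#b#} u) \<le> sobolev_norm (Suc k) S u"
proof (rule power2_le_imp_le)
  let ?I = "\<lambda>m. LINT x|lres S. (weak_deriv S m u x)\<^sup>2"
  have bm: "add_mset b m \<in> multi_indices (Suc k)" if "m \<in> multi_indices k" for m
    using that b by (simp add: multi_indices_def)
  have "(sobolev_norm k S (weak_deriv S {#b#} u))\<^sup>2 = (\<Sum>m\<in>multi_indices k. ?I (add_mset b m))"
    unfolding sobolev_norm_sq[OF S]
  proof (intro sum.cong refl integral_cong_AE)
    fix m :: "'a multiset" assume m: "m \<in> multi_indices k"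
    note [measurable] = sobolev_weak_deriv(2)[OF S u bm[OF m], THEN sq_integrable_measurable]
      sobolev_weak_deriv(2)[OF S weak_deriv_sobolev(1)[OF S u b] m, THEN sq_integrable_measurable]
    show "AE x in lres S. (weak_deriv S m (weak_deriv S {#b#} u) x)\<^sup>2 = (weak_deriv S (add_mset b m) u x)\<^sup>2"
      using weak_deriv_sobolev(2)[OF S u b m] by eventually_elim simp
    show "(\<lambda>x. (weak_deriv S m (weak_deriv S {#b#} u) x)\<^sup>2) \<in> borel_measurable (lres S)"
      "(\<lambda>x. (weak_deriv S (add_mset b m) u x)\<^sup>2) \<in> borel_measurable (lres S)" by measurable
  qed
  also have "\<dots> = (\<Sum>m\<in>add_mset b ` multi_indices k. ?I m)"
    by (subst sum.reindex) (auto simp: inj_on_def)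
  also have "\<dots> \<le> (\<Sum>m\<in>multi_indices (Suc k). ?I m)"
    by (rule sum_mono2) (use bm finite_multi_indices in auto)
  finally show "(sobolev_norm k S (weak_deriv S {#b#} u))\<^sup>2 \<le> (sobolev_norm (Suc k) S u)\<^sup>2"
    unfolding sobolev_norm_sq[OF S] .
qed (rule sobolev_norm_nonneg[OF S])

lemma sobolev_L2_le_norm:
  assumes S: "open S" and u: "u \<in> sobolev k S"
  shows "(LINT z|lres S. (u z)\<^sup>2) \<le> (sobolev_norm k S u)\<^sup>2"
proof -
  note [measurable] = sobolev_sq_integrable[OF S u, THEN sq_integrable_measurable]
    sobolev_weak_deriv(2)[OF S u empty_multi_indices, THEN sq_integrable_measurable]
  have "(LINT z|lres S. (u z)\<^sup>2) = (LINT z|lres S. (weak_deriv S {#} u z)\<^sup>2)"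
  proof (rule integral_cong_AE)
    show "AE z in lres S. (u z)\<^sup>2 = (weak_deriv S {#} u z)\<^sup>2"
      using weak_deriv_empty[OF S u] by eventually_elim simp
  qed measurable
  also have "\<dots> \<le> (sobolev_norm k S u)\<^sup>2" by (rule weak_deriv_norm_le[OF S empty_multi_indices])
  finally show ?thesis .
qed

text \<open>Functions in \<open>H\<^sup>1\<close> of a planar domain need not be bounded. These bounds,
  obtained from the primitives in \<open>x\<close> and in \<open>t\<close>, are the substitute for
  second derivatives of functions in \<open>H\<^sup>3\<close>.\<close>

lemma sobolev_1_slice_bounds:
  assumes v: "v \<in> sobolev 1 (Rect a b)" and ab: "a > 0" "b > 0"
  obtains A B where "integrable (Iv b) A" "\<And>t. 0 \<le> A t" "AE z in Iv2 a b. (v z)\<^sup>2 \<le> A (snd z)"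
    "(LINT t|Iv b. A t) \<le> (2 / a + 8 * a) * (sobolev_norm 1 (Rect a b) v)\<^sup>2"
    "integrable (Iv a) B" "\<And>x. 0 \<le> B x" "AE z in Iv2 a b. (v z)\<^sup>2 \<le> B (fst z)"
    "(LINT x|Iv a. B x) \<le> (2 / b + 8 * b) * (sobolev_norm 1 (Rect a b) v)\<^sup>2"
proof -
  let ?R = "Rect a b" and ?M = "Iv2 a b"
  define vx where "vx = weak_deriv ?R {#e_x#} v"
  define vt where "vt = weak_deriv ?R {#e_t#} v"
  have em: "{#e_x#} \<in> multi_indices 1" "{#e_t#} \<in> multi_indices 1"
    using e_multi_index[of e_x 0] e_multi_index[of e_t 0] by auto
  have s: "sq_integrable ?M v" "sq_integrable ?M vx" "sq_integrable ?M vt"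
    unfolding Iv_pair vx_def vt_def using sobolev_sq_integrable[OF open_Rect v] sobolev_weak_deriv(2)[OF open_Rect v] em by auto
  have n: "(LINT z|?M. (v z)\<^sup>2) \<le> (sobolev_norm 1 ?R v)\<^sup>2" "(LINT z|?M. (vx z)\<^sup>2) \<le> (sobolev_norm 1 ?R v)\<^sup>2"
    "(LINT z|?M. (vt z)\<^sup>2) \<le> (sobolev_norm 1 ?R v)\<^sup>2"
    unfolding Iv_pair vx_def vt_def
    by (rule sobolev_L2_le_norm[OF open_Rect v] weak_deriv_norm_le[OF open_Rect em(1)] weak_deriv_norm_le[OF open_Rect em(2)])+
  obtain c where "c \<in> borel_measurable (Iv a)"
    and c: "AE z in ?M. v z = c (fst z) + (LINT s|Iv b. kern 0 (snd z) s * vt (fst z, s))"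
    by (rule weak_deriv_t_primitive[OF sobolev_weak_deriv(1)[OF open_Rect v em(2), folded vt_def] s(1)[unfolded Iv_pair] s(3)[unfolded Iv_pair] ab(2)])
  obtain c' where "c' \<in> borel_measurable (Iv b)"
    and c': "AE z in Iv2 b a. v (prod.swap z) = c' (fst z) + (LINT s|Iv a. kern 0 (snd z) s * vx (prod.swap (fst z, s)))"
    by (rule weak_deriv_x_primitive[OF sobolev_weak_deriv(1)[OF open_Rect v em(1), folded vx_def] s(1)[unfolded Iv_pair] s(2)[unfolded Iv_pair] ab(1)])
  note sw = sq_integrable_swap_Iv[OF s(1)] sq_integrable_swap_Iv[OF s(2)]
  define A where "A = slice_bound a (\<lambda>z. v (prod.swap z)) (\<lambda>z. vx (prod.swap z))"
  define B where "B = slice_bound b v vt"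
  have swi: "(LINT z|Iv2 b a. (h (prod.swap z))\<^sup>2) = (LINT z|?M. (h z)\<^sup>2)" if "sq_integrable ?M h" for h
    using integral_swap_Iv[OF borel_measurable_power[OF sq_integrable_measurable[OF that]], of 2] .
  show thesis
  proof (rule that[of A B])
    show "integrable (Iv b) A" unfolding A_def by (rule slice_bound_integral(1)[OF sw])
    show "integrable (Iv a) B" unfolding B_def by (rule slice_bound_integral(1)[OF s(1,3)])
    show "0 \<le> A t" "0 \<le> B x" for t x unfolding A_def B_def using slice_bound_nonneg ab by auto
    show "AE z in ?M. (v z)\<^sup>2 \<le> B (fst z)" unfolding B_def by (rule primitive_sq_le_slice_bound[OF s(1,3) c ab(2)])
    have "AE z in Iv2 b a. (v (prod.swap z))\<^sup>2 \<le> A (snd (prod.swap z))"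
      unfolding A_def using primitive_sq_le_slice_bound[OF sw c' ab(1)] by simp
    then show "AE z in ?M. (v z)\<^sup>2 \<le> A (snd z)" by (rule AE_swap_Iv)
    have "2 / a * (LINT z|?M. (v z)\<^sup>2) + 8 * a * (LINT z|?M. (vx z)\<^sup>2) \<le> 2 / a * (sobolev_norm 1 ?R v)\<^sup>2 + 8 * a * (sobolev_norm 1 ?R v)\<^sup>2"
      using ab n by (intro add_mono mult_left_mono) auto
    then show "(LINT t|Iv b. A t) \<le> (2 / a + 8 * a) * (sobolev_norm 1 ?R v)\<^sup>2"
      unfolding A_def slice_bound_integral(2)[OF sw] swi[OF s(1)] swi[OF s(2)] by (simp add: distrib_right)
    have "2 / b * (LINT z|?M. (v z)\<^sup>2) + 8 * b * (LINT z|?M. (vt z)\<^sup>2) \<le> 2 / b * (sobolev_norm 1 ?R v)\<^sup>2 + 8 * b * (sobolev_norm 1 ?R v)\<^sup>2"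
      using ab n by (intro add_mono mult_left_mono) auto
    then show "(LINT x|Iv a. B x) \<le> (2 / b + 8 * b) * (sobolev_norm 1 ?R v)\<^sup>2"
      unfolding B_def slice_bound_integral(2)[OF s(1,3)] by (simp add: distrib_right)
  qed
qed

definition sup_const :: "real \<Rightarrow> real \<Rightarrow> real" where
  "sup_const a b = (2 / a + 8 * a) * (2 / b + 8 * b)"

text \<open>Bound \<open>u\<^sup>2\<close> on a slice \<open>x = const\<close> by the integrals of
  \<open>u\<^sup>2\<close> and \<open>u\<^sub>t\<^sup>2\<close> over the slice. Both \<open>u\<close>
  and \<open>u\<^sub>t\<close> are in \<open>H\<^sup>1\<close>, so these integrals are in turn bounded
  uniformly in \<open>x\<close> by a slice bound in the other direction.\<close>

theorem sobolev_2_bounded: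
  assumes u: "u \<in> sobolev 2 (Rect a b)" and ab: "a > 0" "b > 0"
  shows "AE z in Iv2 a b. (u z)\<^sup>2 \<le> sup_const a b * (sobolev_norm 2 (Rect a b) u)\<^sup>2"
proof -
  let ?R = "Rect a b" and ?M = "Iv2 a b"
  have B: "e_x \<in> Basis" "e_t \<in> Basis" by (auto simp: Basis_real_pair)
  have u2: "u \<in> sobolev (Suc 1) ?R" using u by (simp add: numeral_2_eq_2)
  have u1: "u \<in> sobolev 1 ?R" by (rule sobolev_mono[OF open_Rect _ u]) simp
  have em: "{#e_x#} \<in> multi_indices 1" "{#e_t#} \<in> multi_indices 1"
    using e_multi_index[of e_x 0] e_multi_index[of e_t 0] by auto
  define N where "N = (sobolev_norm 2 ?R u)\<^sup>2"
  define ux where "ux = weak_deriv ?R {#e_x#} u"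
  have ux1: "ux \<in> sobolev 1 ?R"
    unfolding ux_def by (rule weak_deriv_sobolev(1)[OF open_Rect u2 B(1)])
  have "sobolev_norm 1 ?R ux \<le> sobolev_norm 2 ?R u"
    unfolding ux_def using weak_deriv_norm_mono[OF open_Rect u2 B(1)] by (simp add: numeral_2_eq_2)
  then have nux: "(sobolev_norm 1 ?R ux)\<^sup>2 \<le> N" unfolding N_def using sobolev_norm_nonneg[OF open_Rect] by (rule power_mono)
  have nu: "(sobolev_norm 1 ?R u)\<^sup>2 \<le> N"
    unfolding N_def sobolev_norm_sq[OF open_Rect]
    by (rule sum_mono2) (use finite_multi_indices multi_indices_mono[of 1 2] in auto)
  have s: "sq_integrable ?M u" "sq_integrable ?M ux"
    unfolding Iv_pair using sobolev_sq_integrable[OF open_Rect u1] sobolev_sq_integrable[OF open_Rect ux1] by auto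
  obtain A1 B1 where A1: "integrable (Iv a) B1" "AE z in ?M. (u z)\<^sup>2 \<le> B1 (fst z)"
    "(LINT x|Iv a. B1 x) \<le> (2 / b + 8 * b) * (sobolev_norm 1 ?R u)\<^sup>2"
    by (rule sobolev_1_slice_bounds[OF u1 ab], rule that)
  obtain A2 B2 where A2: "integrable (Iv a) B2" "AE z in ?M. (ux z)\<^sup>2 \<le> B2 (fst z)"
    "(LINT x|Iv a. B2 x) \<le> (2 / b + 8 * b) * (sobolev_norm 1 ?R ux)\<^sup>2"
    by (rule sobolev_1_slice_bounds[OF ux1 ab], rule that)
  obtain c' where "c' \<in> borel_measurable (Iv b)"
    and c': "AE z in Iv2 b a. u (prod.swap z) = c' (fst z) + (LINT s|Iv a. kern 0 (snd z) s * ux (prod.swap (fst z, s)))"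
    by (rule weak_deriv_x_primitive[OF sobolev_weak_deriv(1)[OF open_Rect u1 em(1), folded ux_def] s(1)[unfolded Iv_pair] s(2)[unfolded Iv_pair] ab(1)])
  note sw = sq_integrable_swap_Iv[OF s(1)] sq_integrable_swap_Iv[OF s(2)]
  define A where "A = slice_bound a (\<lambda>z. u (prod.swap z)) (\<lambda>z. ux (prod.swap z))"
  have slice: "AE t in Iv b. (LINT x|Iv a. (v (x, t))\<^sup>2) \<le> (2 / b + 8 * b) * N"
    if V: "sq_integrable ?M v" "AE z in ?M. (v z)\<^sup>2 \<le> V (fst z)" "integrable (Iv a) V"
      "(LINT x|Iv a. V x) \<le> (2 / b + 8 * b) * K" "K \<le> N" for v V K
  proof -
    have "AE z in Iv2 b a. (v (prod.swap z))\<^sup>2 \<le> V (fst (prod.swap z))"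
      by (rule AE_swap_Iv) (use V(2) in simp)
    from AE_Iv_pairD[OF this] sq_integrable_pair_slices(1)[OF sq_integrable_swap_Iv[OF V(1)]]
    show ?thesis
    proof eventually_elim
      case (elim t)
      have "(LINT x|Iv a. (v (x, t))\<^sup>2) \<le> (LINT x|Iv a. V x)"
        by (rule integral_mono_AE) (use elim V(3) in \<open>auto simp: sq_integrable_def\<close>)
      also have "\<dots> \<le> (2 / b + 8 * b) * K" by (rule V(4))
      also have "\<dots> \<le> (2 / b + 8 * b) * N" using V(5) ab by (intro mult_left_mono) auto
      finally show ?case .
    qed
  qed
  have "AE t in Iv b. A t \<le> sup_const a b * N"
    using slice[OF s(1) A1(2,1,3) nu] slice[OF s(2) A2(2,1,3) nux]
  proof eventually_elim
    case (elim t)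
    have "A t \<le> 2 / a * ((2 / b + 8 * b) * N) + 8 * a * ((2 / b + 8 * b) * N)"
      unfolding A_def slice_bound_def swap_simp using elim ab by (intro add_mono mult_left_mono) auto
    then show ?case by (simp only: sup_const_def distrib_right mult.assoc)
  qed
  from AE_fst_Iv[OF this, of a] primitive_sq_le_slice_bound[OF sw c' ab(1)]
  have "AE z in Iv2 b a. (u (prod.swap z))\<^sup>2 \<le> sup_const a b * N"
    unfolding A_def by eventually_elim simp
  then show ?thesis unfolding N_def by (rule AE_swap_Iv)
qed

section \<open>The operator as a quadratic map\<close>

text \<open>The integral of \<open>v\<^sub>x\<close> over \<open>(0, t)\<close>, written with
  \<open>kern\<close> as an integral over the fixed interval \<open>(0, T)\<close>.\<close>

definition volt :: "real \<Rightarrow> (real \<times> real \<Rightarrow> real) \<Rightarrow> real \<times> real \<Rightarrow> real" where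
  "volt T v z = (LINT s|Iv T. kern 0 (snd z) s * dx T v (fst z, s))"

definition A_op :: "real \<Rightarrow> (real \<times> real \<Rightarrow> real) \<Rightarrow> real \<times> real \<Rightarrow> real" where
  "A_op T u z = dxx T u z - 2 * dxt T u z"

text \<open>Polarisation of the quadratic part of the operator. It is not symmetrised, so that each
  argument keeps its own bounds: \<open>u\<close> enters through first derivatives, \<open>v\<close>
  through \<open>v\<close> and \<open>volt T v\<close>.\<close>

definition N_op :: "real \<Rightarrow> (real \<times> real \<Rightarrow> real) \<Rightarrow> (real \<times> real \<Rightarrow> real) \<Rightarrow> real \<times> real \<Rightarrow> real" where
  "N_op T u v z = 2 * dx T u z * volt T v z - 2 * dx T u z * v z - 2 * dt T u z * volt T v z"

abbreviation H3 :: "real \<Rightarrow> (real \<times> real \<Rightarrow> real) set" where "H3 T \<equiv> sobolev 3 (rect T)"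
abbreviation "H3_norm T \<equiv> sobolev_norm 3 (rect T)"
abbreviation "H3_inner T \<equiv> sobolev_inner 3 (rect T)"

lemma rect_eq: "rect T = Rect 1 T"
  by (simp add: rect_def)

abbreviation Rm :: "real \<Rightarrow> (real \<times> real) measure" where "Rm T \<equiv> Iv2 1 T"

lemma Rm_eq: "lres (rect T) = Rm T"
  by (simp add: rect_eq Iv_pair)

lemma open_rect: "open (rect T)" and bounded_rect: "bounded (rect T)" and rect_borel: "rect T \<in> sets borel"
  using open_Rect bounded_Rect by (auto simp: rect_eq)

lemma volt_eq:
  assumes "t \<in> {0<..<T}"
  shows "(LINT s:{0<..<t}|lborel. dx T w (x, s)) = volt T w (x, t)"
proof -
  have "(LINT s|lres {0<..<T}. kern 0 t s * dx T w (x, s)) = (LINT s|lborel. indicator {0<..<T} s *\<^sub>R (kern 0 t s * dx T w (x, s)))"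
    by (rule integral_restrict_space) simp
  also have "\<dots> = (LINT s:{0<..<t}|lborel. dx T w (x, s))"
    unfolding set_lebesgue_integral_def
    by (rule Bochner_Integration.integral_cong) (use assms in \<open>auto simp: kern_def indicator_def\<close>)
  finally show ?thesis by (simp add: volt_def)
qed

lemma L_op_eq: "z \<in> rect T \<Longrightarrow> L_op T w z = A_op T w z + N_op T w w z"
proof -
  assume z: "z \<in> rect T"
  obtain x t where xt: "z = (x, t)" by (cases z)
  then have t: "t \<in> {0<..<T}" using z by (simp add: rect_def)
  show ?thesis
    unfolding L_op_def Let_def xt prod.case volt_eq[OF t] A_op_def N_op_def by simp
qed

lemma space_Rm: "space (Rm T) = rect T"
  by (auto simp: space_pair_measure rect_def)

context
  fixes T :: real
  assumes T: "T > 0"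
begin

lemma e_Basis: "e_x \<in> Basis" "e_t \<in> Basis"
  by (auto simp: Basis_real_pair)

lemma jet_multi_indices: "{#e_x#} \<in> multi_indices 3" "{#e_t#} \<in> multi_indices 3" "{#e_x, e_x#} \<in> multi_indices 3" "{#e_x, e_t#} \<in> multi_indices 3"
  by (auto simp: multi_indices_def Basis_real_pair)

lemma H3_sq_integrable:
  assumes u: "u \<in> H3 T"
  shows "sq_integrable (Rm T) u" "sq_integrable (Rm T) (dx T u)" "sq_integrable (Rm T) (dt T u)"
    "sq_integrable (Rm T) (dxx T u)" "sq_integrable (Rm T) (dxt T u)" "sq_integrable (Rm T) (volt T u)" "sq_integrable (Rm T) (A_op T u)"
proof -
  show *: "sq_integrable (Rm T) u" "sq_integrable (Rm T) (dx T u)" "sq_integrable (Rm T) (dt T u)"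
    "sq_integrable (Rm T) (dxx T u)" "sq_integrable (Rm T) (dxt T u)"
    unfolding Rm_eq[symmetric]
    by (rule sobolev_sq_integrable[OF open_rect u] sobolev_weak_deriv(2)[OF open_rect u jet_multi_indices(1)]
        sobolev_weak_deriv(2)[OF open_rect u jet_multi_indices(2)] sobolev_weak_deriv(2)[OF open_rect u jet_multi_indices(3)]
        sobolev_weak_deriv(2)[OF open_rect u jet_multi_indices(4)])+
  show "sq_integrable (Rm T) (volt T u)"
    unfolding volt_def[abs_def] using sq_integrable_prim(1)[OF *(2)] T by simp
  show "sq_integrable (Rm T) (A_op T u)"
    unfolding A_op_def[abs_def] by (intro sq_integrable_diff sq_integrable_cmult *)
qed

text \<open>The weak derivative is linear almost everywhere on almost every line \<open>x =
  const\<close>, and there the integrals agree for every \<open>t\<close>.\<close>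

lemma volt_lin:
  assumes u: "u \<in> H3 T" and v: "v \<in> H3 T"
  shows "AE z in Rm T. volt T (\<lambda>z. a * u z + b * v z) z = a * volt T u z + b * volt T v z"
proof -
  have "AE x in Iv 1. AE s in Iv T. dx T (\<lambda>z. a * u z + b * v z) (x, s) = a * dx T u (x, s) + b * dx T v (x, s)"
    using weak_deriv_lin[OF open_rect u v jet_multi_indices(1), of a b] unfolding Rm_eq by (rule AE_Iv_pairD)
  then have "AE x in Iv 1. \<forall>t. volt T (\<lambda>z. a * u z + b * v z) (x, t) = a * volt T u (x, t) + b * volt T v (x, t)"
    using sq_integrable_pair_slices(1)[OF H3_sq_integrable(2)[OF u]] sq_integrable_pair_slices(1)[OF H3_sq_integrable(2)[OF v]]
      sq_integrable_pair_slices(1)[OF H3_sq_integrable(2)[OF sobolev_lin[OF open_rect u v, of a b]]]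
  proof eventually_elim
    case (elim x)
    interpret finite_measure "Iv T" by (rule finite_measure_Iv)
    note i = elim(2-4)[THEN sq_integrable_integrable]
    show ?case
    proof
      fix t
      have "(LINT s|Iv T. kern 0 t s * dx T (\<lambda>z. a * u z + b * v z) (x, s))
          = (LINT s|Iv T. a * (kern 0 t s * dx T u (x, s)) + b * (kern 0 t s * dx T v (x, s)))"
      proof (rule integral_cong_AE)
        show "AE s in Iv T. kern 0 t s * dx T (\<lambda>z. a * u z + b * v z) (x, s) = a * (kern 0 t s * dx T u (x, s)) + b * (kern 0 t s * dx T v (x, s))"
          using elim(1) by eventually_elim (simp add: algebra_simps)
      qed (use i[THEN integrable_kern[where ?s0.0=0 and t=t]] in \<open>auto dest: borel_measurable_integrable\<close>)
      also have "\<dots> = a * (LINT s|Iv T. kern 0 t s * dx T u (x, s)) + b * (LINT s|Iv T. kern 0 t s * dx T v (x, s))"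
        using i[THEN integrable_kern[where ?s0.0=0 and t=t]] by simp
      finally show "volt T (\<lambda>z. a * u z + b * v z) (x, t) = a * volt T u (x, t) + b * volt T v (x, t)"
        by (simp add: volt_def)
    qed
  qed
  from AE_fst_Iv[OF this, of T] show ?thesis
  proof eventually_elim
    case (elim z)
    then show ?case by (cases z) simp
  qed
qed

lemma jet_lin:
  assumes u: "u \<in> H3 T" and v: "v \<in> H3 T"
  shows "AE z in Rm T. dx T (\<lambda>z. a * u z + b * v z) z = a * dx T u z + b * dx T v z \<and>
    dt T (\<lambda>z. a * u z + b * v z) z = a * dt T u z + b * dt T v z \<and>
    volt T (\<lambda>z. a * u z + b * v z) z = a * volt T u z + b * volt T v z \<and>
    A_op T (\<lambda>z. a * u z + b * v z) z = a * A_op T u z + b * A_op T v z"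
  using volt_lin[OF u v, of a b] weak_deriv_lin[OF open_rect u v jet_multi_indices(1), of a b, unfolded Rm_eq]
    weak_deriv_lin[OF open_rect u v jet_multi_indices(2), of a b, unfolded Rm_eq]
    weak_deriv_lin[OF open_rect u v jet_multi_indices(3), of a b, unfolded Rm_eq]
    weak_deriv_lin[OF open_rect u v jet_multi_indices(4), of a b, unfolded Rm_eq]
  by eventually_elim (simp add: A_op_def algebra_simps)

lemma H3_bounded:
  assumes u: "u \<in> H3 T" and K: "sqrt (sup_const 1 T) * H3_norm T u \<le> K"
  shows "AE z in Rm T. \<bar>u z\<bar> \<le> K \<and> \<bar>dx T u z\<bar> \<le> K \<and> \<bar>dt T u z\<bar> \<le> K \<and> \<bar>volt T u z\<bar> \<le> T * K"
proof -
  have sc: "sup_const 1 T \<ge> 0" unfolding sup_const_def using T by simp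
  have nn: "0 \<le> sobolev_norm k (rect T) v" for k v by (rule sobolev_norm_nonneg[OF open_rect])
  have K0: "K \<ge> 0" using K sc nn by (meson mult_nonneg_nonneg order_trans real_sqrt_ge_zero)
  have u3: "u \<in> sobolev (Suc 2) (rect T)" using u by (simp add: numeral_3_eq_3 numeral_2_eq_2)
  have bnd: "AE z in Rm T. \<bar>v z\<bar> \<le> K"
    if v: "v \<in> sobolev 2 (rect T)" and n: "sobolev_norm 2 (rect T) v \<le> H3_norm T u" for v
  proof -
    have "AE z in Rm T. (v z)\<^sup>2 \<le> sup_const 1 T * (sobolev_norm 2 (rect T) v)\<^sup>2"
      using sobolev_2_bounded[OF v[unfolded rect_eq]] T by (simp add: rect_eq)
    then show ?thesis
    proof eventually_elim
      case (elim z)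
      have "\<bar>v z\<bar> \<le> sqrt (sup_const 1 T * (sobolev_norm 2 (rect T) v)\<^sup>2)"
        using elim real_sqrt_le_mono by fastforce
      also have "\<dots> = sqrt (sup_const 1 T) * sobolev_norm 2 (rect T) v" using nn by (simp add: real_sqrt_mult)
      also have "\<dots> \<le> sqrt (sup_const 1 T) * H3_norm T u" using n sc by (intro mult_left_mono) auto
      finally show ?case using K by linarith
    qed
  qed
  have 0: "AE z in Rm T. \<bar>u z\<bar> \<le> K"
  proof (rule bnd)
    show "u \<in> sobolev 2 (rect T)" by (rule sobolev_mono[OF open_rect _ u]) simp
    have "(sobolev_norm 2 (rect T) u)\<^sup>2 \<le> (H3_norm T u)\<^sup>2"
      unfolding sobolev_norm_sq[OF open_rect]
      by (rule sum_mono2) (use finite_multi_indices multi_indices_mono[of 2 3] in auto)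
    then show "sobolev_norm 2 (rect T) u \<le> H3_norm T u" using nn by (rule power2_le_imp_le)
  qed
  have 1: "AE z in Rm T. \<bar>dx T u z\<bar> \<le> K"
    by (rule bnd[OF weak_deriv_sobolev(1)[OF open_rect u3 e_Basis(1)]])
      (use weak_deriv_norm_mono[OF open_rect u3 e_Basis(1)] in \<open>simp add: numeral_3_eq_3 numeral_2_eq_2\<close>)
  have 2: "AE z in Rm T. \<bar>dt T u z\<bar> \<le> K"
    by (rule bnd[OF weak_deriv_sobolev(1)[OF open_rect u3 e_Basis(2)]])
      (use weak_deriv_norm_mono[OF open_rect u3 e_Basis(2)] in \<open>simp add: numeral_3_eq_3 numeral_2_eq_2\<close>)
  have "AE x in Iv 1. \<forall>t. \<bar>volt T u (x, t)\<bar> \<le> T * K"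
    using AE_Iv_pairD[OF 1] sq_integrable_pair_slices(1)[OF H3_sq_integrable(2)[OF u]]
  proof eventually_elim
    case (elim x)
    show ?case
    proof
      fix t
      have "(LINT s|Iv T. kern 0 t s * dx T u (x, s))\<^sup>2 \<le> T * (LINT s|Iv T. (dx T u (x, s))\<^sup>2)"
        using T elim(2) by (intro kern_integral_sq_le) auto
      also have "\<dots> \<le> T * (LINT s|Iv T. K\<^sup>2)"
      proof (intro mult_left_mono integral_mono_AE)
        show "AE s in Iv T. (dx T u (x, s))\<^sup>2 \<le> K\<^sup>2"
          using elim(1) by eventually_elim (use K0 in \<open>simp add: abs_le_square_iff[symmetric]\<close>)
      qed (use elim(2) T integrable_const_Iv in \<open>auto simp: sq_integrable_def\<close>)
      also have "\<dots> = (T * K)\<^sup>2" using integral_const_Iv[of T "K\<^sup>2"] T by (simp add: power2_eq_square)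
      finally show "\<bar>volt T u (x, t)\<bar> \<le> T * K"
        unfolding volt_def fst_conv snd_conv using T K0 by (simp add: abs_le_square_iff[symmetric])
    qed
  qed
  from AE_fst_Iv[OF this, of T] have 3: "AE z in Rm T. \<bar>volt T u z\<bar> \<le> T * K"
  proof eventually_elim
    case (elim z)
    then show ?case by (cases z) simp
  qed
  from 0 1 2 3 show ?thesis by eventually_elim simp
qed

lemma N_op_sq_integrable:
  assumes u: "u \<in> H3 T" and v: "v \<in> H3 T"
  shows "sq_integrable (Rm T) (N_op T u v)"
proof -
  interpret finite_measure "Rm T" by (rule finite_measure_Iv_pair)
  define K where "K = max (sqrt (sup_const 1 T) * H3_norm T u) (sqrt (sup_const 1 T) * H3_norm T v)"
  note [measurable] = H3_sq_integrable[OF u, THEN sq_integrable_measurable] H3_sq_integrable[OF v, THEN sq_integrable_measurable]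
  show ?thesis
  proof (rule sq_integrable_bounded)
    show "N_op T u v \<in> borel_measurable (Rm T)" unfolding N_op_def[abs_def] by measurable
    have "AE z in Rm T. \<bar>u z\<bar> \<le> K \<and> \<bar>dx T u z\<bar> \<le> K \<and> \<bar>dt T u z\<bar> \<le> K \<and> \<bar>volt T u z\<bar> \<le> T * K"
      by (rule H3_bounded[OF u]) (unfold K_def, rule max.cobounded1)
    moreover have "AE z in Rm T. \<bar>v z\<bar> \<le> K \<and> \<bar>dx T v z\<bar> \<le> K \<and> \<bar>dt T v z\<bar> \<le> K \<and> \<bar>volt T v z\<bar> \<le> T * K"
      by (rule H3_bounded[OF v]) (unfold K_def, rule max.cobounded2)
    ultimately show "AE z in Rm T. \<bar>N_op T u v z\<bar> \<le> 2 * (K * (T * K)) + 2 * (K * K) + 2 * (K * (T * K))"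
    proof eventually_elim
      case (elim z)
      have K0: "K \<ge> 0" using elim by linarith
      have "\<bar>dx T u z\<bar> * \<bar>volt T v z\<bar> \<le> K * (T * K)" "\<bar>dx T u z\<bar> * \<bar>v z\<bar> \<le> K * K" "\<bar>dt T u z\<bar> * \<bar>volt T v z\<bar> \<le> K * (T * K)"
        using elim K0 by (intro mult_mono; simp)+
      then show ?case unfolding N_op_def abs_mult[symmetric] by linarith
    qed
  qed
qed

end

section \<open>Weighted estimates\<close>

lemma weight_eq: "weight \<alpha> lam z = exp (- 2 * lam * (fst z + \<alpha> * snd z))"
  by (cases z) (simp add: weight_def)

lemma weight_pos: "0 < weight \<alpha> lam z"
  by (simp add: weight_eq)

lemma weight_continuous: "continuous_on S (weight \<alpha> lam)"
  unfolding weight_eq[abs_def] by (intro continuous_intros)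

lemma weight_le_1: "0 \<le> lam \<Longrightarrow> 0 \<le> \<alpha> \<Longrightarrow> z \<in> rect T \<Longrightarrow> weight \<alpha> lam z \<le> 1"
  by (auto simp: weight_eq rect_def)

lemma weight_measurable [measurable]: "weight \<alpha> lam \<in> borel_measurable (Rm T)"
  using sq_integrable_continuous_pair[OF weight_continuous] by (rule sq_integrable_measurable)

lemma integrable_mult_weight:
  assumes f: "integrable (Rm T) f" and w: "0 \<le> lam" "0 \<le> \<alpha>"
  shows "integrable (Rm T) (\<lambda>z. f z * weight \<alpha> lam z)"
proof (rule Bochner_Integration.integrable_bound[OF f])
  show "(\<lambda>z. f z * weight \<alpha> lam z) \<in> borel_measurable (Rm T)"
    using borel_measurable_integrable[OF f] by measurable
  show "AE z in Rm T. norm (f z * weight \<alpha> lam z) \<le> norm (f z)"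
  proof (rule AE_I2)
    fix z assume "z \<in> space (Rm T)"
    then have "\<bar>f z\<bar> * weight \<alpha> lam z \<le> \<bar>f z\<bar> * 1"
      using weight_le_1[OF w, of z T] by (intro mult_left_mono) (auto simp: space_Rm)
    then show "norm (f z * weight \<alpha> lam z) \<le> norm (f z)"
      using weight_pos[of \<alpha> lam z] by (simp add: abs_mult)
  qed
qed

lemma integral_mult_weight_le:
  assumes f: "integrable (Rm T) f" "\<And>z. 0 \<le> f z" and w: "0 \<le> lam" "0 \<le> \<alpha>"
  shows "(LINT z|Rm T. f z * weight \<alpha> lam z) \<le> (LINT z|Rm T. f z)"
proof (rule integral_mono_AE[OF integrable_mult_weight[OF f(1) w] f(1)])
  show "AE z in Rm T. f z * weight \<alpha> lam z \<le> f z"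
    by (rule AE_I2) (use f(2) weight_le_1[OF w] in \<open>auto simp: space_Rm intro!: mult_left_le\<close>)
qed

text \<open>The Carleman estimate controls \<open>\<lambda>\<close> times this quantity; all quadratic
  errors are measured by it.\<close>

definition energy :: "real \<Rightarrow> real \<Rightarrow> real \<Rightarrow> (real \<times> real \<Rightarrow> real) \<Rightarrow> real" where
  "energy T \<alpha> lam h = (LINT z|Rm T. ((dx T h z)\<^sup>2 + (dt T h z)\<^sup>2) * weight \<alpha> lam z)"

definition drift_const :: "real \<Rightarrow> real \<Rightarrow> real" where
  "drift_const T D = 4 * (sup_const 1 T * D\<^sup>2) * (2 * T + 4)\<^sup>2 * (T\<^sup>2 + 2)"

definition second_order_const :: "real \<Rightarrow> real \<Rightarrow> real" where
  "second_order_const T D = 2 + 4 * T * (100 * D\<^sup>2) + 20 * (2 / T + 8 * T) * D\<^sup>2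
    + (4 * T\<^sup>2 + 2) * (sup_const 1 T * D\<^sup>2 * (4 * T + 2))\<^sup>2"

context
  fixes T \<alpha> lam :: real
  assumes T: "T > 0" and lam: "0 \<le> lam" and alpha: "0 \<le> \<alpha>"
begin

lemma energy_parts:
  assumes h: "h \<in> H3 T"
  shows "integrable (Rm T) (\<lambda>z. (dx T h z)\<^sup>2 * weight \<alpha> lam z)" "integrable (Rm T) (\<lambda>z. (dt T h z)\<^sup>2 * weight \<alpha> lam z)"
    "integrable (Rm T) (\<lambda>z. ((dx T h z)\<^sup>2 + (dt T h z)\<^sup>2) * weight \<alpha> lam z)"
    "(LINT z|Rm T. (dx T h z)\<^sup>2 * weight \<alpha> lam z) \<le> energy T \<alpha> lam h" "0 \<le> energy T \<alpha> lam h"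
proof -
  have i: "integrable (Rm T) (\<lambda>z. (dx T h z)\<^sup>2)" "integrable (Rm T) (\<lambda>z. (dt T h z)\<^sup>2)"
    using H3_sq_integrable[OF T h] by (simp_all add: sq_integrable_def)
  show x: "integrable (Rm T) (\<lambda>z. (dx T h z)\<^sup>2 * weight \<alpha> lam z)" and "integrable (Rm T) (\<lambda>z. (dt T h z)\<^sup>2 * weight \<alpha> lam z)"
    by (intro integrable_mult_weight i lam alpha)+
  show e: "integrable (Rm T) (\<lambda>z. ((dx T h z)\<^sup>2 + (dt T h z)\<^sup>2) * weight \<alpha> lam z)"
    by (intro integrable_mult_weight Bochner_Integration.integrable_add i lam alpha)
  show "(LINT z|Rm T. (dx T h z)\<^sup>2 * weight \<alpha> lam z) \<le> energy T \<alpha> lam h"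
    unfolding energy_def by (rule integral_mono[OF x e]) (simp add: weight_pos less_imp_le)
  show "0 \<le> energy T \<alpha> lam h"
    unfolding energy_def by (intro Bochner_Integration.integral_nonneg mult_nonneg_nonneg) (auto simp: weight_pos less_imp_le)
qed

text \<open>The weight decreases in \<open>t\<close>, so \<open>kern_integral_weighted_le\<close>
  applies on every line \<open>x = const\<close>; \<open>m x\<close> is the weighted integral of
  \<open>h\<^sub>x\<^sup>2\<close> over that line.\<close>

lemma volt_weighted_bound:
  assumes h: "h \<in> H3 T"
  obtains m where "integrable (Iv 1) m" "\<And>x. 0 \<le> m x" "(LINT x|Iv 1. m x) \<le> energy T \<alpha> lam h"
    "AE z in Rm T. (volt T h z)\<^sup>2 * weight \<alpha> lam z \<le> T * m (fst z)"
proof (rule that)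
  let ?m = "\<lambda>x. LINT s|Iv T. (dx T h (x, s))\<^sup>2 * weight \<alpha> lam (x, s)"
  note i = Iv_pair_slices(2,3)[OF energy_parts(1)[OF h]]
  show "integrable (Iv 1) ?m" by (rule i(1))
  show "0 \<le> ?m x" for x by (intro Bochner_Integration.integral_nonneg mult_nonneg_nonneg) (auto simp: weight_pos less_imp_le)
  show "(LINT x|Iv 1. ?m x) \<le> energy T \<alpha> lam h" unfolding i(2) by (rule energy_parts(4)[OF h])
  have "AE x in Iv 1. \<forall>t. (volt T h (x, t))\<^sup>2 * weight \<alpha> lam (x, t) \<le> T * ?m x"
    using sq_integrable_pair_slices(1)[OF H3_sq_integrable(2)[OF T h]]
  proof eventually_elim
    case (elim x)
    show ?case
    proof
      fix t
      show "(volt T h (x, t))\<^sup>2 * weight \<alpha> lam (x, t) \<le> T * ?m x"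
        unfolding volt_def fst_conv snd_conv
      proof (rule kern_integral_weighted_le[OF elim, of "\<lambda>t. weight \<alpha> lam (x, t)"])
        show "weight \<alpha> lam (x, t) \<le> weight \<alpha> lam (x, s)" if "s \<le> t" for s t
          using that lam alpha by (auto simp: weight_eq intro!: mult_left_mono add_mono)
        show "continuous_on UNIV (\<lambda>t. weight \<alpha> lam (x, t))"
          unfolding weight_eq by (intro continuous_intros)
      qed (use T weight_pos in auto)
    qed
  qed
  from AE_fst_Iv[OF this, of T] show "AE z in Rm T. (volt T h z)\<^sup>2 * weight \<alpha> lam z \<le> T * ?m (fst z)"
  proof eventually_elim
    case (elim z)
    then show ?case by (cases z) simp
  qed
qed

text \<open>As \<open>h\<close> vanishes at \<open>x = 0\<close>, it is the primitive of
  \<open>h\<^sub>x\<close> in \<open>x\<close>, and the weight decreases in \<open>x\<close>. Here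
  \<open>n t\<close> is the weighted integral of \<open>h\<^sub>x\<^sup>2\<close> over the line \<open>t
  = const\<close>.\<close>

lemma left_weighted_bound:
  assumes h: "h \<in> H3 T" and tr: "left_trace T h (\<lambda>_. 0)"
  obtains n where "integrable (Iv T) n" "\<And>t. 0 \<le> n t" "(LINT t|Iv T. n t) \<le> energy T \<alpha> lam h"
    "AE z in Rm T. (h z)\<^sup>2 * weight \<alpha> lam z \<le> n (snd z)"
proof (rule that)
  let ?n = "\<lambda>t. LINT x|Iv 1. (dx T h (x, t))\<^sup>2 * weight \<alpha> lam (x, t)"
  have rep: "AE z in Iv2 T 1. h (prod.swap z) = 0 + (LINT s|Iv 1. kern 0 (snd z) s * dx T h (prod.swap (fst z, s)))"
    using left_trace_representation[OF tr[unfolded rect_eq] _ T] by (simp add: rect_eq)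
  note sw = sq_integrable_swap_Iv[OF H3_sq_integrable(2)[OF T h]]
  interpret pair_sigma_finite "Iv 1" "Iv T" by (rule pair_sigma_finite_Iv)
  have e: "integrable (Rm T) (\<lambda>(x, t). (dx T h (x, t))\<^sup>2 * weight \<alpha> lam (x, t))"
    using energy_parts(1)[OF h] by (simp add: case_prod_unfold)
  show "integrable (Iv T) ?n" by (rule integrable_snd[OF e])
  show "0 \<le> ?n t" for t by (intro Bochner_Integration.integral_nonneg mult_nonneg_nonneg) (auto simp: weight_pos less_imp_le)
  have "(LINT t|Iv T. ?n t) = (LINT z|Rm T. (dx T h z)\<^sup>2 * weight \<alpha> lam z)"
    using integral_snd[OF e] by (simp add: case_prod_unfold)
  then show "(LINT t|Iv T. ?n t) \<le> energy T \<alpha> lam h" using energy_parts(4)[OF h] by simp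
  have "AE t in Iv T. AE x in Iv 1. (h (x, t))\<^sup>2 * weight \<alpha> lam (x, t) \<le> ?n t"
    using AE_Iv_pairD[OF rep] sq_integrable_pair_slices(1)[OF sw]
  proof eventually_elim
    case (elim t)
    show ?case
      using elim(1)
    proof eventually_elim
      case x: (elim x)
      have "(LINT s|Iv 1. kern 0 x s * dx T h (s, t))\<^sup>2 * weight \<alpha> lam (x, t) \<le> 1 * (LINT s|Iv 1. (dx T h (s, t))\<^sup>2 * weight \<alpha> lam (s, t))"
      proof (rule kern_integral_weighted_le[of 1 _ "\<lambda>x. weight \<alpha> lam (x, t)"])
        show "sq_integrable (Iv 1) (\<lambda>s. dx T h (s, t))" using elim(2) by simp
        show "weight \<alpha> lam (x, t) \<le> weight \<alpha> lam (s, t)" if "s \<le> x" for s x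
          using that lam alpha by (auto simp: weight_eq intro!: mult_left_mono add_mono)
        show "continuous_on UNIV (\<lambda>x. weight \<alpha> lam (x, t))"
          unfolding weight_eq by (intro continuous_intros)
      qed (use weight_pos in auto)
      then show ?case using x by simp
    qed
  qed
  moreover have "Measurable.pred (Iv2 T 1) (\<lambda>z. (h (prod.swap z))\<^sup>2 * weight \<alpha> lam (prod.swap z) \<le> ?n (fst z))"
  proof -
    note [measurable] = H3_sq_integrable(1)[OF T h, THEN sq_integrable_measurable] borel_measurable_integrable[OF integrable_snd[OF e]]
    show ?thesis by measurable
  qed
  ultimately have "AE z in Iv2 T 1. (h (prod.swap z))\<^sup>2 * weight \<alpha> lam (prod.swap z) \<le> ?n (snd (prod.swap z))"
    using AE_Iv_pairI[where a=T and b=1 and P="\<lambda>z. (h (prod.swap z))\<^sup>2 * weight \<alpha> lam (prod.swap z) \<le> ?n (fst z)"] by simp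
  then show "AE z in Rm T. (h z)\<^sup>2 * weight \<alpha> lam z \<le> ?n (snd z)" by (rule AE_swap_Iv)
qed

text \<open>Every term of \<open>b = N(w2, h) + N(h, w1)\<close> is the product of a bounded factor from
  \<open>w1\<close> or \<open>w2\<close> with one of \<open>volt T h\<close>, \<open>h\<close>,
  \<open>h\<^sub>x\<close>, \<open>h\<^sub>t\<close>, and the weighted \<open>L\<^sup>2\<close> norm of
  each of these is controlled by the energy.\<close>

lemma weighted_drift_bound:
  assumes w: "w1 \<in> H3 T" "w2 \<in> H3 T" "H3_norm T w1 \<le> D" "H3_norm T w2 \<le> D"
    and h: "h \<in> H3 T" "left_trace T h (\<lambda>_. 0)"
  shows "(LINT z|Rm T. (N_op T w2 h z + N_op T h w1 z)\<^sup>2 * weight \<alpha> lam z) \<le> drift_const T D * energy T \<alpha> lam h"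
proof -
  define K where "K = sqrt (sup_const 1 T) * D"
  define C where "C = 4 * K\<^sup>2 * (2 * T + 4)\<^sup>2"
  define E where "E = energy T \<alpha> lam h"
  have sc: "sup_const 1 T \<ge> 0" unfolding sup_const_def using T by simp
  have K2: "K\<^sup>2 = sup_const 1 T * D\<^sup>2" unfolding K_def using sc by (simp add: power_mult_distrib)
  have C0: "C \<ge> 0" by (simp add: C_def)
  obtain m where m: "integrable (Iv 1) m" "(LINT x|Iv 1. m x) \<le> energy T \<alpha> lam h" "AE z in Rm T. (volt T h z)\<^sup>2 * weight \<alpha> lam z \<le> T * m (fst z)"
    by (rule volt_weighted_bound[OF h(1)], rule that)
  obtain n where n: "integrable (Iv T) n" "(LINT t|Iv T. n t) \<le> energy T \<alpha> lam h" "AE z in Rm T. (h z)\<^sup>2 * weight \<alpha> lam z \<le> n (snd z)"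
    by (rule left_weighted_bound[OF h], rule that)
  have Kle: "sqrt (sup_const 1 T) * H3_norm T w1 \<le> K" "sqrt (sup_const 1 T) * H3_norm T w2 \<le> K"
    unfolding K_def using w(3,4) sc by (auto intro!: mult_left_mono)
  have im: "integrable (Rm T) (\<lambda>z. T * m (fst z))" "(LINT z|Rm T. T * m (fst z)) \<le> T\<^sup>2 * E"
    using integrable_fst_Iv[OF m(1), of T] T m(2) by (auto simp: power2_eq_square E_def)
  have "in": "integrable (Rm T) (\<lambda>z. n (snd z))" "(LINT z|Rm T. n (snd z)) \<le> E"
    using integrable_snd_Iv[OF n(1), of 1] n(2) by (auto simp: E_def)
  let ?e = "\<lambda>z. ((dx T h z)\<^sup>2 + (dt T h z)\<^sup>2) * weight \<alpha> lam z"
  note ie = energy_parts(3)[OF h(1)]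
  have sb: "sq_integrable (Rm T) (\<lambda>z. N_op T w2 h z + N_op T h w1 z)"
    by (intro sq_integrable_add N_op_sq_integrable T w h)
  have "(LINT z|Rm T. (N_op T w2 h z + N_op T h w1 z)\<^sup>2 * weight \<alpha> lam z)
      \<le> (LINT z|Rm T. C * (T * m (fst z) + n (snd z) + ?e z))"
  proof (rule integral_mono_AE)
    show "integrable (Rm T) (\<lambda>z. (N_op T w2 h z + N_op T h w1 z)\<^sup>2 * weight \<alpha> lam z)"
      using sb by (intro integrable_mult_weight lam alpha) (simp add: sq_integrable_def)
    show "integrable (Rm T) (\<lambda>z. C * (T * m (fst z) + n (snd z) + ?e z))"
      by (rule integrable_mult_right[OF Bochner_Integration.integrable_add[OF Bochner_Integration.integrable_add[OF im(1) "in"(1)] ie]])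
    show "AE z in Rm T. (N_op T w2 h z + N_op T h w1 z)\<^sup>2 * weight \<alpha> lam z \<le> C * (T * m (fst z) + n (snd z) + ?e z)"
      using m(3) n(3) H3_bounded[OF T w(1) Kle(1)] H3_bounded[OF T w(2) Kle(2)]
    proof eventually_elim
      case (elim z)
      define X where "X = \<bar>volt T h z\<bar>"
      define Y where "Y = \<bar>h z\<bar>"
      define U where "U = \<bar>dx T h z\<bar>"
      define V where "V = \<bar>dt T h z\<bar>"
      have nn: "X \<ge> 0" "Y \<ge> 0" "U \<ge> 0" "V \<ge> 0" "K \<ge> 0" using elim by (auto simp: X_def Y_def U_def V_def)
      define G where "G = K * (2 * T + 4)"
      have p: "\<bar>dx T w2 z * volt T h z\<bar> \<le> K * X" "\<bar>dx T w2 z * h z\<bar> \<le> K * Y" "\<bar>dt T w2 z * volt T h z\<bar> \<le> K * X"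
        "\<bar>dx T h z * volt T w1 z\<bar> \<le> U * (T * K)" "\<bar>dx T h z * w1 z\<bar> \<le> U * K" "\<bar>dt T h z * volt T w1 z\<bar> \<le> V * (T * K)"
        unfolding abs_mult X_def Y_def U_def V_def using elim nn T by (intro mult_mono; simp)+
      have "\<bar>N_op T w2 h z + N_op T h w1 z\<bar> \<le> 2 * (K * X) + 2 * (K * Y) + 2 * (K * X) + 2 * (U * (T * K)) + 2 * (U * K) + 2 * (V * (T * K))"
        unfolding N_op_def using p by linarith
      also have "\<dots> = (4 * K) * X + (2 * K) * Y + (K * (2 * T + 2)) * U + (K * (2 * T)) * V" by (simp add: algebra_simps)
      also have "\<dots> \<le> G * X + G * Y + G * U + G * V"
        unfolding G_def using nn T by (intro add_mono mult_right_mono) (auto simp: algebra_simps)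
      also have "\<dots> = G * (X + Y + U + V)" by (simp add: algebra_simps)
      finally have "(N_op T w2 h z + N_op T h w1 z)\<^sup>2 \<le> (G * (X + Y + U + V))\<^sup>2" by (rule abs_le_square_iff[THEN iffD1, OF order_trans[OF _ abs_ge_self]])
      also have "\<dots> = G\<^sup>2 * (X + Y + U + V)\<^sup>2" by (rule power_mult_distrib)
      also have "(X + Y + U + V)\<^sup>2 \<le> 4 * (X\<^sup>2 + Y\<^sup>2 + U\<^sup>2 + V\<^sup>2)"
      proof -
        have "(X + Y + U + V)\<^sup>2 \<le> 2 * (X + Y)\<^sup>2 + 2 * (U + V)\<^sup>2" using sq_add_le[of "X + Y" "U + V"] by (simp add: add.assoc)
        also have "\<dots> \<le> 2 * (2 * X\<^sup>2 + 2 * Y\<^sup>2) + 2 * (2 * U\<^sup>2 + 2 * V\<^sup>2)"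
          by (intro add_mono mult_left_mono sq_add_le) simp_all
        finally show ?thesis by simp
      qed
      then have "G\<^sup>2 * (X + Y + U + V)\<^sup>2 \<le> G\<^sup>2 * (4 * (X\<^sup>2 + Y\<^sup>2 + U\<^sup>2 + V\<^sup>2))" by (rule mult_left_mono) simp
      also have "\<dots> = C * (X\<^sup>2 + Y\<^sup>2 + U\<^sup>2 + V\<^sup>2)" unfolding G_def C_def by (simp add: power_mult_distrib)
      finally have "(N_op T w2 h z + N_op T h w1 z)\<^sup>2 \<le> C * (X\<^sup>2 + Y\<^sup>2 + U\<^sup>2 + V\<^sup>2)" by simp
      then have "(N_op T w2 h z + N_op T h w1 z)\<^sup>2 * weight \<alpha> lam z \<le> C * (X\<^sup>2 + Y\<^sup>2 + U\<^sup>2 + V\<^sup>2) * weight \<alpha> lam z"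
        by (rule mult_right_mono) (simp add: weight_pos less_imp_le)
      also have "\<dots> = C * (X\<^sup>2 * weight \<alpha> lam z + Y\<^sup>2 * weight \<alpha> lam z + (U\<^sup>2 + V\<^sup>2) * weight \<alpha> lam z)"
        by (simp add: algebra_simps)
      also have "\<dots> \<le> C * (T * m (fst z) + n (snd z) + (U\<^sup>2 + V\<^sup>2) * weight \<alpha> lam z)"
        using elim C0 by (intro mult_left_mono add_mono) (auto simp: X_def Y_def)
      finally show ?case by (simp add: U_def V_def)
    qed
  qed
  also have "\<dots> = C * ((LINT z|Rm T. T * m (fst z)) + (LINT z|Rm T. n (snd z)) + E)"
    unfolding integral_mult_right_zero E_def energy_def
      Bochner_Integration.integral_add[OF Bochner_Integration.integrable_add[OF im(1) "in"(1)] ie] Bochner_Integration.integral_add[OF im(1) "in"(1)] ..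
  also have "\<dots> \<le> C * (T\<^sup>2 * E + E + E)" using im(2) "in"(2) C0 by (intro mult_left_mono add_mono) auto
  also have "\<dots> = drift_const T D * E" unfolding C_def drift_const_def K2 by (simp add: algebra_simps)
  finally show ?thesis unfolding E_def .
qed

text \<open>The second derivatives of \<open>w\<close> belong to \<open>H\<^sup>1\<close>.\<close>

lemma A_op_slice_bounds:
  assumes w: "w \<in> H3 T" and D: "H3_norm T w \<le> D"
  obtains p q where "integrable (Iv T) p" "AE z in Rm T. (A_op T w z)\<^sup>2 \<le> p (snd z)" "(LINT t|Iv T. p t) \<le> 100 * D\<^sup>2"
    "integrable (Iv 1) q" "AE z in Rm T. (A_op T w z)\<^sup>2 \<le> q (fst z)" "(LINT x|Iv 1. q x) \<le> 10 * (2 / T + 8 * T) * D\<^sup>2"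
proof -
  let ?R = "Rect 1 T"
  have w3: "w \<in> sobolev (Suc 2) ?R" using w by (simp add: numeral_3_eq_3 numeral_2_eq_2 rect_eq)
  define wx where "wx = weak_deriv ?R {#e_x#} w"
  have wx2: "wx \<in> sobolev (Suc 1) ?R"
    using weak_deriv_sobolev(1)[OF open_Rect w3 e_Basis(1)[OF T]] by (simp add: wx_def numeral_2_eq_2)
  have nwx: "sobolev_norm (Suc 1) ?R wx \<le> D"
    using weak_deriv_norm_mono[OF open_Rect w3 e_Basis(1)[OF T]] D by (simp add: wx_def numeral_3_eq_3 numeral_2_eq_2 rect_eq)
  have v: "weak_deriv ?R {#e#} wx \<in> sobolev 1 ?R" "(sobolev_norm 1 ?R (weak_deriv ?R {#e#} wx))\<^sup>2 \<le> D\<^sup>2"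
    "AE z in Rm T. weak_deriv ?R {#e#} wx z = weak_deriv ?R {#e_x, e#} w z" if e: "e \<in> Basis" for e
  proof -
    show "weak_deriv ?R {#e#} wx \<in> sobolev 1 ?R" by (rule weak_deriv_sobolev(1)[OF open_Rect wx2 e])
    have "sobolev_norm 1 ?R (weak_deriv ?R {#e#} wx) \<le> D"
      using weak_deriv_norm_mono[OF open_Rect wx2 e] nwx by linarith
    then show "(sobolev_norm 1 ?R (weak_deriv ?R {#e#} wx))\<^sup>2 \<le> D\<^sup>2"
      by (rule power_mono) (rule sobolev_norm_nonneg[OF open_Rect])
    show "AE z in Rm T. weak_deriv ?R {#e#} wx z = weak_deriv ?R {#e_x, e#} w z"
      unfolding Iv_pair wx_def
      by (rule weak_deriv_sobolev(2)[OF open_Rect w3 e_Basis(1)[OF T]]) (use e in \<open>simp add: multi_indices_def\<close>)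
  qed
  obtain A1 B1 where 1: "integrable (Iv T) A1" "AE z in Rm T. (weak_deriv ?R {#e_x#} wx z)\<^sup>2 \<le> A1 (snd z)"
    "(LINT t|Iv T. A1 t) \<le> (2 / 1 + 8 * 1) * (sobolev_norm 1 ?R (weak_deriv ?R {#e_x#} wx))\<^sup>2"
    "integrable (Iv 1) B1" "AE z in Rm T. (weak_deriv ?R {#e_x#} wx z)\<^sup>2 \<le> B1 (fst z)"
    "(LINT x|Iv 1. B1 x) \<le> (2 / T + 8 * T) * (sobolev_norm 1 ?R (weak_deriv ?R {#e_x#} wx))\<^sup>2"
    by (rule sobolev_1_slice_bounds[OF v(1)[OF e_Basis(1)[OF T]] zero_less_one T], rule that)
  obtain A2 B2 where 2: "integrable (Iv T) A2" "AE z in Rm T. (weak_deriv ?R {#e_t#} wx z)\<^sup>2 \<le> A2 (snd z)"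
    "(LINT t|Iv T. A2 t) \<le> (2 / 1 + 8 * 1) * (sobolev_norm 1 ?R (weak_deriv ?R {#e_t#} wx))\<^sup>2"
    "integrable (Iv 1) B2" "AE z in Rm T. (weak_deriv ?R {#e_t#} wx z)\<^sup>2 \<le> B2 (fst z)"
    "(LINT x|Iv 1. B2 x) \<le> (2 / T + 8 * T) * (sobolev_norm 1 ?R (weak_deriv ?R {#e_t#} wx))\<^sup>2"
    by (rule sobolev_1_slice_bounds[OF v(1)[OF e_Basis(2)[OF T]] zero_less_one T], rule that)
  have A: "AE z in Rm T. (A_op T w z)\<^sup>2 \<le> 2 * (weak_deriv ?R {#e_x#} wx z)\<^sup>2 + 8 * (weak_deriv ?R {#e_t#} wx z)\<^sup>2"
    using v(3)[OF e_Basis(1)[OF T]] v(3)[OF e_Basis(2)[OF T]]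
  proof eventually_elim
    case (elim z)
    show ?case unfolding elim A_op_def rect_eq
      using sq_add_le[of "weak_deriv ?R {#e_x, e_x#} w z" "- 2 * weak_deriv ?R {#e_x, e_t#} w z"] by (simp add: power_mult_distrib)
  qed
  have TT: "0 \<le> 2 / T + 8 * T" using T by simp
  have n: "(sobolev_norm 1 ?R (weak_deriv ?R {#e_x#} wx))\<^sup>2 \<le> D\<^sup>2" "(sobolev_norm 1 ?R (weak_deriv ?R {#e_t#} wx))\<^sup>2 \<le> D\<^sup>2"
    by (rule v(2)[OF e_Basis(1)[OF T]], rule v(2)[OF e_Basis(2)[OF T]])
  show thesis
  proof (rule that[of "\<lambda>t. 2 * A1 t + 8 * A2 t" "\<lambda>x. 2 * B1 x + 8 * B2 x"])
    show "integrable (Iv T) (\<lambda>t. 2 * A1 t + 8 * A2 t)" "integrable (Iv 1) (\<lambda>x. 2 * B1 x + 8 * B2 x)" using 1 2 by auto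
    show "AE z in Rm T. (A_op T w z)\<^sup>2 \<le> 2 * A1 (snd z) + 8 * A2 (snd z)"
      using A 1(2) 2(2) by eventually_elim linarith
    show "AE z in Rm T. (A_op T w z)\<^sup>2 \<le> 2 * B1 (fst z) + 8 * B2 (fst z)"
      using A 1(5) 2(5) by eventually_elim linarith
    have "(LINT t|Iv T. 2 * A1 t + 8 * A2 t) = 2 * (LINT t|Iv T. A1 t) + 8 * (LINT t|Iv T. A2 t)" using 1 2 by simp
    then show "(LINT t|Iv T. 2 * A1 t + 8 * A2 t) \<le> 100 * D\<^sup>2" using 1(3) 2(3) n by simp
    have "(LINT x|Iv 1. 2 * B1 x + 8 * B2 x) = 2 * (LINT x|Iv 1. B1 x) + 8 * (LINT x|Iv 1. B2 x)" using 1 2 by simp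
    also have "\<dots> \<le> 2 * ((2 / T + 8 * T) * D\<^sup>2) + 8 * ((2 / T + 8 * T) * D\<^sup>2)"
      using order_trans[OF 1(6) mult_left_mono[OF n(1) TT]] order_trans[OF 2(6) mult_left_mono[OF n(2) TT]]
      by (intro add_mono mult_left_mono) auto
    finally show "(LINT x|Iv 1. 2 * B1 x + 8 * B2 x) \<le> 10 * (2 / T + 8 * T) * D\<^sup>2" by (simp only: mult.assoc)
  qed
qed

text \<open>With \<open>F = A w + N(w, w)\<close>, the inequality \<open>2 p q \<le> p\<^sup>2 +
  q\<^sup>2\<close> reduces the integrand to \<open>h\<^sub>x\<^sup>2 + h\<^sub>t\<^sup>2\<close>,
  \<open>F\<^sup>2 (volt T h)\<^sup>2\<close> and \<open>F\<^sup>2 h\<^sup>2\<close>, times the weight.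
  The factor \<open>F\<close> may be unbounded, but \<open>F\<^sup>2\<close> is at most a function
  \<open>p\<close> of \<open>t\<close> and at most a function \<open>q\<close> of \<open>x\<close>, up
  to constants. Choose \<open>p(t)\<close> against \<open>m(x)\<close> and \<open>q(x)\<close> against
  \<open>n(t)\<close>: in both cases the integral of the product is the product of the
  integrals.\<close>

lemma weighted_second_order_bound:
  assumes w: "w \<in> H3 T" and D: "H3_norm T w \<le> D"
    and h: "h \<in> H3 T" "left_trace T h (\<lambda>_. 0)"
  shows "integrable (Rm T) (\<lambda>z. (A_op T w z + N_op T w w z) * N_op T h h z * weight \<alpha> lam z)"
    "\<bar>LINT z|Rm T. (A_op T w z + N_op T w w z) * N_op T h h z * weight \<alpha> lam z\<bar> \<le> second_order_const T D * energy T \<alpha> lam h"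
proof -
  define K where "K = sqrt (sup_const 1 T) * D"
  define M where "M = K\<^sup>2 * (4 * T + 2)"
  define E where "E = energy T \<alpha> lam h"
  let ?F = "\<lambda>z. A_op T w z + N_op T w w z"
  have sc: "sup_const 1 T \<ge> 0" unfolding sup_const_def using T by simp
  have K2: "K\<^sup>2 = sup_const 1 T * D\<^sup>2" unfolding K_def using sc by (simp add: power_mult_distrib)
  have E0: "E \<ge> 0" unfolding E_def by (rule energy_parts(5)[OF h(1)])
  obtain m where m: "integrable (Iv 1) m" "\<And>x. 0 \<le> m x" "(LINT x|Iv 1. m x) \<le> energy T \<alpha> lam h"
    "AE z in Rm T. (volt T h z)\<^sup>2 * weight \<alpha> lam z \<le> T * m (fst z)"
    by (rule volt_weighted_bound[OF h(1)], rule that)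
  obtain n where n: "integrable (Iv T) n" "\<And>t. 0 \<le> n t" "(LINT t|Iv T. n t) \<le> energy T \<alpha> lam h"
    "AE z in Rm T. (h z)\<^sup>2 * weight \<alpha> lam z \<le> n (snd z)"
    by (rule left_weighted_bound[OF h], rule that)
  obtain p q where pq: "integrable (Iv T) p" "AE z in Rm T. (A_op T w z)\<^sup>2 \<le> p (snd z)" "(LINT t|Iv T. p t) \<le> 100 * D\<^sup>2"
    "integrable (Iv 1) q" "AE z in Rm T. (A_op T w z)\<^sup>2 \<le> q (fst z)" "(LINT x|Iv 1. q x) \<le> 10 * (2 / T + 8 * T) * D\<^sup>2"
    by (rule A_op_slice_bounds[OF w D], rule that)
  have m0: "0 \<le> (LINT x|Iv 1. m x)" and n0: "0 \<le> (LINT t|Iv T. n t)"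
    using m(2) n(2) by (simp_all add: Bochner_Integration.integral_nonneg)
  have Kle: "sqrt (sup_const 1 T) * H3_norm T w \<le> K"
    unfolding K_def using D sc by (auto intro!: mult_left_mono)
  have F: "sq_integrable (Rm T) ?F" by (intro sq_integrable_add H3_sq_integrable N_op_sq_integrable T w)
  have N: "sq_integrable (Rm T) (N_op T h h)" by (intro N_op_sq_integrable T h)
  show i: "integrable (Rm T) (\<lambda>z. ?F z * N_op T h h z * weight \<alpha> lam z)"
    by (intro integrable_mult_weight lam alpha sq_integrable_mult F N)
  let ?e = "\<lambda>z. ((dx T h z)\<^sup>2 + (dt T h z)\<^sup>2) * weight \<alpha> lam z"
  note ie = energy_parts(3)[OF h(1)]
  note pm = tensor_integral_Iv[OF m(1) pq(1)] and qn = tensor_integral_Iv[OF pq(4) n(1)]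
  note mi = integrable_fst_Iv[OF m(1), of T] and ni = integrable_snd_Iv[OF n(1), of 1]
  let ?G = "\<lambda>z. 2 * ?e z + 4 * T * (m (fst z) * p (snd z)) + 4 * T * M\<^sup>2 * m (fst z) + 2 * (q (fst z) * n (snd z)) + 2 * M\<^sup>2 * n (snd z)"
  have iG: "integrable (Rm T) ?G"
    using ie pm(1) qn(1) mi(1) ni(1) T by (intro Bochner_Integration.integrable_add integrable_mult_right) auto
  have "\<bar>LINT z|Rm T. ?F z * N_op T h h z * weight \<alpha> lam z\<bar> \<le> (LINT z|Rm T. \<bar>?F z * N_op T h h z * weight \<alpha> lam z\<bar>)"
    by (rule integral_abs_bound)
  also have "\<dots> \<le> (LINT z|Rm T. ?G z)"
  proof (rule integral_mono_AE[OF integrable_abs[OF i] iG])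
    show "AE z in Rm T. \<bar>?F z * N_op T h h z * weight \<alpha> lam z\<bar> \<le> ?G z"
      using m(4) n(4) pq(2) pq(5) H3_bounded[OF T w Kle]
    proof eventually_elim
      case (elim z)
      define X where "X = \<bar>volt T h z\<bar>"
      define Y where "Y = \<bar>h z\<bar>"
      define U where "U = \<bar>dx T h z\<bar>"
      define V where "V = \<bar>dt T h z\<bar>"
      define \<phi> where "\<phi> = weight \<alpha> lam z"
      define H where "H = \<bar>?F z\<bar>"
      have \<phi>: "\<phi> > 0" by (simp add: \<phi>_def weight_pos)
      have nn: "X \<ge> 0" "Y \<ge> 0" "U \<ge> 0" "V \<ge> 0" "H \<ge> 0" by (auto simp: X_def Y_def U_def V_def H_def)
      have K0: "K \<ge> 0" using elim by linarith
      have b: "\<bar>dx T w z * volt T w z\<bar> \<le> K * (T * K)" "\<bar>dx T w z * w z\<bar> \<le> K * K" "\<bar>dt T w z * volt T w z\<bar> \<le> K * (T * K)"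
        unfolding abs_mult using elim K0 by (intro mult_mono; simp)+
      have "\<bar>N_op T w w z\<bar> \<le> 2 * (K * (T * K)) + 2 * (K * K) + 2 * (K * (T * K))" unfolding N_op_def using b by linarith
      also have "\<dots> = M" by (simp add: M_def power2_eq_square algebra_simps)
      finally have "(N_op T w w z)\<^sup>2 \<le> M\<^sup>2" by (rule abs_le_square_iff[THEN iffD1, OF order_trans[OF _ abs_ge_self]])
      then have H2: "H\<^sup>2 \<le> 2 * (A_op T w z)\<^sup>2 + 2 * M\<^sup>2"
        using sq_add_le[of "A_op T w z" "N_op T w w z"] unfolding H_def power2_abs by linarith
      have X2: "X\<^sup>2 * \<phi> \<le> T * m (fst z)" and Y2: "Y\<^sup>2 * \<phi> \<le> n (snd z)" using elim by (auto simp: X_def Y_def \<phi>_def)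
      have p1: "H\<^sup>2 \<le> 2 * p (snd z) + 2 * M\<^sup>2" and q1: "H\<^sup>2 \<le> 2 * q (fst z) + 2 * M\<^sup>2" using H2 elim by linarith+
      have HX: "H\<^sup>2 * (X\<^sup>2 * \<phi>) \<le> (2 * p (snd z) + 2 * M\<^sup>2) * (T * m (fst z))"
        by (rule mult_mono[OF p1 X2 order_trans[OF zero_le_power2 p1]]) (use \<phi> in simp)
      have HY: "H\<^sup>2 * (Y\<^sup>2 * \<phi>) \<le> (2 * q (fst z) + 2 * M\<^sup>2) * n (snd z)"
        by (rule mult_mono[OF q1 Y2 order_trans[OF zero_le_power2 q1]]) (use \<phi> in simp)
      have "\<bar>N_op T h h z\<bar> \<le> 2 * (U * X) + 2 * (U * Y) + 2 * (V * X)"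
        unfolding N_op_def U_def V_def X_def Y_def abs_mult[symmetric] by linarith
      then have "H * \<bar>N_op T h h z\<bar> \<le> H * (2 * (U * X) + 2 * (U * Y) + 2 * (V * X))" using nn by (intro mult_left_mono)
      also have "\<dots> \<le> 2 * (U\<^sup>2 + V\<^sup>2) + 2 * (H\<^sup>2 * X\<^sup>2) + H\<^sup>2 * Y\<^sup>2"
      proof -
        have "2 * U * (H * X) \<le> U\<^sup>2 + (H * X)\<^sup>2" "2 * U * (H * Y) \<le> U\<^sup>2 + (H * Y)\<^sup>2" "2 * V * (H * X) \<le> V\<^sup>2 + (H * X)\<^sup>2"
          by (rule sum_squares_bound)+
        moreover have "H * (2 * (U * X) + 2 * (U * Y) + 2 * (V * X)) = 2 * U * (H * X) + 2 * U * (H * Y) + 2 * V * (H * X)"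
          by (simp add: algebra_simps)
        moreover have "0 \<le> V\<^sup>2" by simp
        moreover have "a \<le> 2 * (u + v) + 2 * (h * x) + h * y"
          if "p \<le> u + h * x" "q \<le> u + h * y" "r \<le> v + h * x" "a = p + q + r" "0 \<le> v" for a p q r u v h x y :: real
          using that by argo
        ultimately show ?thesis unfolding power_mult_distrib by blast
      qed
      finally have "H * \<bar>N_op T h h z\<bar> * \<phi> \<le> (2 * (U\<^sup>2 + V\<^sup>2) + 2 * (H\<^sup>2 * X\<^sup>2) + H\<^sup>2 * Y\<^sup>2) * \<phi>"
        using \<phi> by (intro mult_right_mono) auto
      also have "\<dots> = 2 * ((U\<^sup>2 + V\<^sup>2) * \<phi>) + 2 * (H\<^sup>2 * (X\<^sup>2 * \<phi>)) + H\<^sup>2 * (Y\<^sup>2 * \<phi>)" by (simp add: algebra_simps)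
      also have "\<dots> \<le> 2 * ((U\<^sup>2 + V\<^sup>2) * \<phi>) + 2 * ((2 * p (snd z) + 2 * M\<^sup>2) * (T * m (fst z))) + (2 * q (fst z) + 2 * M\<^sup>2) * n (snd z)"
        using HX HY by linarith
      also have "\<dots> = 2 * ((U\<^sup>2 + V\<^sup>2) * \<phi>) + 4 * T * (m (fst z) * p (snd z)) + 4 * T * M\<^sup>2 * m (fst z) + 2 * (q (fst z) * n (snd z)) + 2 * M\<^sup>2 * n (snd z)"
        by (simp add: algebra_simps)
      finally show ?case using \<phi> by (simp add: abs_mult H_def U_def V_def \<phi>_def)
    qed
  qed
  also have "\<dots> = 2 * E + 4 * T * ((LINT x|Iv 1. m x) * (LINT t|Iv T. p t)) + 4 * T * M\<^sup>2 * (T * (LINT x|Iv 1. m x))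
      + 2 * ((LINT x|Iv 1. q x) * (LINT t|Iv T. n t)) + 2 * M\<^sup>2 * (LINT t|Iv T. n t)"
    using ie pm qn mi ni T by (simp add: E_def energy_def)
  also have "\<dots> \<le> 2 * E + 4 * T * (E * (100 * D\<^sup>2)) + 4 * T * M\<^sup>2 * (T * E) + 2 * (10 * (2 / T + 8 * T) * D\<^sup>2 * E) + 2 * M\<^sup>2 * E"
  proof -
    have "(LINT x|Iv 1. m x) * (LINT t|Iv T. p t) \<le> (LINT x|Iv 1. m x) * (100 * D\<^sup>2)" using m0 pq(3) by (rule mult_left_mono[rotated])
    also have "\<dots> \<le> E * (100 * D\<^sup>2)" using m(3) by (intro mult_right_mono) (auto simp: E_def)
    finally have 1: "(LINT x|Iv 1. m x) * (LINT t|Iv T. p t) \<le> E * (100 * D\<^sup>2)" .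
    have "(LINT x|Iv 1. q x) * (LINT t|Iv T. n t) \<le> 10 * (2 / T + 8 * T) * D\<^sup>2 * (LINT t|Iv T. n t)" using pq(6) n0 by (rule mult_right_mono)
    also have "\<dots> \<le> 10 * (2 / T + 8 * T) * D\<^sup>2 * E" using n(3) T by (intro mult_left_mono) (auto simp: E_def)
    finally have 2: "(LINT x|Iv 1. q x) * (LINT t|Iv T. n t) \<le> 10 * (2 / T + 8 * T) * D\<^sup>2 * E" .
    show ?thesis using 1 2 m(3) n(3) T unfolding E_def[symmetric] by (intro add_mono mult_left_mono) auto
  qed
  also have "\<dots> = second_order_const T D * E" unfolding second_order_const_def M_def K2 by (simp add: algebra_simps power2_eq_square)
  finally show "\<bar>LINT z|Rm T. ?F z * N_op T h h z * weight \<alpha> lam z\<bar> \<le> second_order_const T D * energy T \<alpha> lam h"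
    unfolding E_def .
qed

end

section \<open>Expansion of the functional\<close>

lemma sobolev_norm_mono:
  assumes "open S" "k \<le> l"
  shows "sobolev_norm k S u \<le> sobolev_norm l S u"
proof (rule power2_le_imp_le)
  show "(sobolev_norm k S u)\<^sup>2 \<le> (sobolev_norm l S u)\<^sup>2"
    unfolding sobolev_norm_sq[OF assms(1)]
    by (rule sum_mono2) (use finite_multi_indices multi_indices_mono[OF assms(2)] in auto)
qed (rule sobolev_norm_nonneg[OF assms(1)])

lemma integrable_sq_weight:
  "sq_integrable (Rm T) f \<Longrightarrow> 0 \<le> lam \<Longrightarrow> 0 \<le> \<alpha> \<Longrightarrow> integrable (Rm T) (\<lambda>z. (f z)\<^sup>2 * weight \<alpha> lam z)"
  by (rule integrable_mult_weight) (simp_all add: sq_integrable_def)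

lemma integrable_prod_weight:
  "sq_integrable (Rm T) f \<Longrightarrow> sq_integrable (Rm T) g \<Longrightarrow> 0 \<le> lam \<Longrightarrow> 0 \<le> \<alpha> \<Longrightarrow>
    integrable (Rm T) (\<lambda>z. f z * g z * weight \<alpha> lam z)"
  by (rule integrable_mult_weight[OF sq_integrable_mult])

lemma semi_hilbert_H3: "semi_hilbert (H3 T) (H3_inner T)"
  by (rule sobolev_semi_hilbert[OF open_rect bounded_rect])

lemma abs_sobolev_inner_le:
  "u \<in> H3 T \<Longrightarrow> v \<in> H3 T \<Longrightarrow>
    \<bar>H3_inner T u v\<bar> \<le> H3_norm T u * H3_norm T v"
  unfolding sobolev_norm_def by (rule semi_hilbert.abs_ip_le[OF semi_hilbert_H3])

lemma sobolev_inner_lin_right: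
  "u \<in> H3 T \<Longrightarrow> v \<in> H3 T \<Longrightarrow> w \<in> H3 T \<Longrightarrow>
    H3_inner T w (\<lambda>z. a * u z + b * v z) = a * H3_inner T w u + b * H3_inner T w v"
  by (simp only: sobolev_inner_sym[OF open_rect, of 3 T w] sobolev_inner_lin[OF open_rect])

definition deriv_op :: "real \<Rightarrow> (real \<times> real \<Rightarrow> real) \<Rightarrow> (real \<times> real \<Rightarrow> real) \<Rightarrow> real \<times> real \<Rightarrow> real" where
  "deriv_op T w h z = A_op T h z + (N_op T w h z + N_op T h w z)"

text \<open>The derivative of the functional at \<open>w\<close> as a linear form in \<open>h\<close>,
  prior to its representation by an element of \<open>H\<^sub>0\<^sup>3\<close>.\<close>

definition deriv_J :: "real \<Rightarrow> real \<Rightarrow> real \<Rightarrow> real \<Rightarrow> (real \<times> real \<Rightarrow> real) \<Rightarrow> (real \<times> real \<Rightarrow> real) \<Rightarrow> real" where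
  "deriv_J T \<alpha> lam \<beta> w h = 2 * (LINT z|Rm T. (A_op T w z + N_op T w w z) * deriv_op T w h z * weight \<alpha> lam z)
    + 2 * \<beta> * H3_inner T w h"

lemma J_eq:
  "J T \<alpha> lam \<beta> w = (LINT z|Rm T. (A_op T w z + N_op T w w z)\<^sup>2 * weight \<alpha> lam z) + \<beta> * (H3_norm T w)\<^sup>2"
proof -
  have "(LINT z:rect T|lborel. (L_op T w z)\<^sup>2 * weight \<alpha> lam z) = (LINT z|Rm T. (L_op T w z)\<^sup>2 * weight \<alpha> lam z)"
    using rect_borel by (simp add: set_integral_lres Rm_eq)
  also have "\<dots> = (LINT z|Rm T. (A_op T w z + N_op T w w z)\<^sup>2 * weight \<alpha> lam z)"
    by (rule Bochner_Integration.integral_cong) (simp_all add: space_Rm L_op_eq)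
  finally show ?thesis by (simp add: J_def)
qed

context
  fixes T :: real
  assumes T: "T > 0"
begin

lemma deriv_op_sq_integrable:
  "w \<in> H3 T \<Longrightarrow> h \<in> H3 T \<Longrightarrow> sq_integrable (Rm T) (deriv_op T w h)"
  unfolding deriv_op_def[abs_def] by (intro sq_integrable_add H3_sq_integrable N_op_sq_integrable T)

lemma deriv_op_lin:
  assumes w: "w \<in> H3 T" and u: "u \<in> H3 T" and v: "v \<in> H3 T"
  shows "AE z in Rm T. deriv_op T w (\<lambda>z. a * u z + b * v z) z = a * deriv_op T w u z + b * deriv_op T w v z"
  using jet_lin[OF T u v, of a b]
proof eventually_elim
  case (elim z)
  then show ?case by (simp add: deriv_op_def N_op_def algebra_simps)
qed

lemma A_op_L2_bound:
  assumes h: "h \<in> H3 T"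
  shows "(LINT z|Rm T. (A_op T h z)\<^sup>2) \<le> 10 * (H3_norm T h)\<^sup>2"
proof -
  have i: "integrable (Rm T) (\<lambda>z. (dxx T h z)\<^sup>2)" "integrable (Rm T) (\<lambda>z. (dxt T h z)\<^sup>2)" "integrable (Rm T) (\<lambda>z. (A_op T h z)\<^sup>2)"
    using H3_sq_integrable[OF T h] by (auto simp: sq_integrable_def)
  have "(LINT z|Rm T. (A_op T h z)\<^sup>2) \<le> (LINT z|Rm T. 2 * (dxx T h z)\<^sup>2 + 8 * (dxt T h z)\<^sup>2)"
  proof (rule integral_mono)
    show "(A_op T h z)\<^sup>2 \<le> 2 * (dxx T h z)\<^sup>2 + 8 * (dxt T h z)\<^sup>2" for z
      unfolding A_op_def using sq_add_le[of "dxx T h z" "- 2 * dxt T h z"] by (simp add: power_mult_distrib)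
  qed (use i in auto)
  also have "\<dots> = 2 * (LINT z|Rm T. (dxx T h z)\<^sup>2) + 8 * (LINT z|Rm T. (dxt T h z)\<^sup>2)" using i by simp
  also have "\<dots> \<le> 10 * (H3_norm T h)\<^sup>2"
    using weak_deriv_norm_le[OF open_rect[of T] jet_multi_indices(3)[OF T], where u=h] weak_deriv_norm_le[OF open_rect[of T] jet_multi_indices(4)[OF T], where u=h]
    by (simp add: Rm_eq)
  finally show ?thesis .
qed

lemma energy_le_norm:
  assumes h: "h \<in> H3 T" and "0 \<le> lam" "0 \<le> \<alpha>"
  shows "energy T \<alpha> lam h \<le> 2 * (H3_norm T h)\<^sup>2"
proof -
  have i: "integrable (Rm T) (\<lambda>z. (dx T h z)\<^sup>2)" "integrable (Rm T) (\<lambda>z. (dt T h z)\<^sup>2)"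
    using H3_sq_integrable[OF T h] by (auto simp: sq_integrable_def)
  have "energy T \<alpha> lam h \<le> (LINT z|Rm T. (dx T h z)\<^sup>2 + (dt T h z)\<^sup>2)"
    unfolding energy_def by (rule integral_mult_weight_le) (use i assms in auto)
  also have "\<dots> = (LINT z|Rm T. (dx T h z)\<^sup>2) + (LINT z|Rm T. (dt T h z)\<^sup>2)" using i by simp
  also have "\<dots> \<le> 2 * (H3_norm T h)\<^sup>2"
    using weak_deriv_norm_le[OF open_rect[of T] jet_multi_indices(1)[OF T], where u=h] weak_deriv_norm_le[OF open_rect[of T] jet_multi_indices(2)[OF T], where u=h]
    by (simp add: Rm_eq)
  finally show ?thesis .
qed

lemma drift_const_nonneg: "0 \<le> drift_const T D"
  unfolding drift_const_def sup_const_def using T by simp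

lemma second_order_const_nonneg: "0 \<le> second_order_const T D"
  unfolding second_order_const_def using T by simp

context
  fixes \<alpha> lam \<beta> :: real
  assumes lam: "0 \<le> lam" and alpha: "0 \<le> \<alpha>"
begin

text \<open>If \<open>F\<close>, \<open>D\<close>, \<open>N\<close> are the terms of \<open>L(w +
  h)\<close> of order zero, one and two in \<open>h\<close>, then \<open>(F + D + N)\<^sup>2 = F\<^sup>2
  + 2 F D + 2 F N + (D + N)\<^sup>2\<close>. The square is kept intact because \<open>D + N = A h +
  b\<close> with \<open>b = N(w + h, h) + N(h, w)\<close>, whose coefficients involve only
  \<open>w\<close> and \<open>w + h\<close>; these are bounded on the constraint set, whereas a separate
  estimate of the quartic term would need bounds for \<open>h\<close>.\<close>

lemma J_expansion:
  assumes w: "w \<in> H3 T" and h: "h \<in> H3 T"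
  shows "J T \<alpha> lam \<beta> (\<lambda>z. w z + h z) - J T \<alpha> lam \<beta> w - deriv_J T \<alpha> lam \<beta> w h =
      (LINT z|Rm T. (A_op T h z + (N_op T (\<lambda>z. w z + h z) h z + N_op T h w z))\<^sup>2 * weight \<alpha> lam z)
      + 2 * (LINT z|Rm T. (A_op T w z + N_op T w w z) * N_op T h h z * weight \<alpha> lam z)
      + \<beta> * (H3_norm T h)\<^sup>2"
proof -
  let ?F = "\<lambda>z. A_op T w z + N_op T w w z" and ?D = "deriv_op T w h" and ?N = "N_op T h h" and ?u = "\<lambda>z. w z + h z"
  let ?b = "\<lambda>z. A_op T h z + (N_op T ?u h z + N_op T h w z)"
  let ?\<phi> = "weight \<alpha> lam"
  have u: "?u \<in> H3 T" by (rule sobolev_add[OF open_rect w h])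
  have F: "sq_integrable (Rm T) ?F" and D: "sq_integrable (Rm T) ?D" and N: "sq_integrable (Rm T) ?N" and b: "sq_integrable (Rm T) ?b"
    by (intro sq_integrable_add H3_sq_integrable N_op_sq_integrable deriv_op_sq_integrable T w h u)+
  have i: "integrable (Rm T) (\<lambda>z. (?F z)\<^sup>2 * ?\<phi> z)" "integrable (Rm T) (\<lambda>z. ?F z * ?D z * ?\<phi> z)"
    "integrable (Rm T) (\<lambda>z. ?F z * ?N z * ?\<phi> z)" "integrable (Rm T) (\<lambda>z. (?b z)\<^sup>2 * ?\<phi> z)"
    by (rule integrable_sq_weight[OF F lam alpha] integrable_prod_weight[OF F D lam alpha]
        integrable_prod_weight[OF F N lam alpha] integrable_sq_weight[OF b lam alpha])+
  have jl: "AE z in Rm T. dx T ?u z = dx T w z + dx T h z \<and> dt T ?u z = dt T w z + dt T h z \<and>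
      volt T ?u z = volt T w z + volt T h z \<and> A_op T ?u z = A_op T w z + A_op T h z"
    using jet_lin[OF T w h, of 1 1] by simp
  have "(LINT z|Rm T. (A_op T ?u z + N_op T ?u ?u z)\<^sup>2 * ?\<phi> z)
      = (LINT z|Rm T. (?F z)\<^sup>2 * ?\<phi> z + 2 * (?F z * ?D z * ?\<phi> z) + 2 * (?F z * ?N z * ?\<phi> z) + (?b z)\<^sup>2 * ?\<phi> z)"
  proof (rule integral_cong_AE)
    show "AE z in Rm T. (A_op T ?u z + N_op T ?u ?u z)\<^sup>2 * ?\<phi> z
        = (?F z)\<^sup>2 * ?\<phi> z + 2 * (?F z * ?D z * ?\<phi> z) + 2 * (?F z * ?N z * ?\<phi> z) + (?b z)\<^sup>2 * ?\<phi> z"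
      using jl
    proof eventually_elim
      case (elim z)
      have 1: "A_op T ?u z + N_op T ?u ?u z = ?F z + ?D z + ?N z"
        using elim by (simp add: deriv_op_def N_op_def algebra_simps)
      have 2: "?b z = ?D z + ?N z"
        using elim by (simp add: deriv_op_def N_op_def algebra_simps)
      show ?case unfolding 1 2 by (simp add: power2_eq_square algebra_simps)
    qed
    have "sq_integrable (Rm T) (\<lambda>z. A_op T ?u z + N_op T ?u ?u z)"
      by (intro sq_integrable_add H3_sq_integrable N_op_sq_integrable T u)
    note [measurable] = sq_integrable_measurable[OF this]
    show "(\<lambda>z. (A_op T ?u z + N_op T ?u ?u z)\<^sup>2 * ?\<phi> z) \<in> borel_measurable (Rm T)" by measurable
  qed (use i in \<open>auto dest: borel_measurable_integrable\<close>)
  also have "\<dots> = (LINT z|Rm T. (?F z)\<^sup>2 * ?\<phi> z) + 2 * (LINT z|Rm T. ?F z * ?D z * ?\<phi> z)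
      + 2 * (LINT z|Rm T. ?F z * ?N z * ?\<phi> z) + (LINT z|Rm T. (?b z)\<^sup>2 * ?\<phi> z)"
    using i by simp
  finally have 1: "(LINT z|Rm T. (A_op T ?u z + N_op T ?u ?u z)\<^sup>2 * ?\<phi> z) = \<dots>" .
  have 2: "(H3_norm T ?u)\<^sup>2
      = (H3_norm T w)\<^sup>2 + 2 * H3_inner T w h + (H3_norm T h)\<^sup>2"
    using semi_hilbert.ip_lin_lin[OF semi_hilbert_H3 w h, of 1 1] by (simp add: sobolev_inner_self[OF open_rect])
  show ?thesis unfolding J_eq deriv_J_def 1 2 by (simp add: algebra_simps)
qed

lemma deriv_J_lin:
  assumes w: "w \<in> H3 T" and u: "u \<in> H3 T" and v: "v \<in> H3 T"
  shows "deriv_J T \<alpha> lam \<beta> w (\<lambda>z. a * u z + b * v z) = a * deriv_J T \<alpha> lam \<beta> w u + b * deriv_J T \<alpha> lam \<beta> w v"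
proof -
  let ?F = "\<lambda>z. A_op T w z + N_op T w w z" and ?\<phi> = "weight \<alpha> lam"
  have F: "sq_integrable (Rm T) ?F" by (intro sq_integrable_add H3_sq_integrable N_op_sq_integrable T w)
  have i: "integrable (Rm T) (\<lambda>z. ?F z * deriv_op T w k z * ?\<phi> z)" if "k \<in> H3 T" for k
    by (intro integrable_mult_weight lam alpha sq_integrable_mult F deriv_op_sq_integrable w that)
  have "(LINT z|Rm T. ?F z * deriv_op T w (\<lambda>z. a * u z + b * v z) z * ?\<phi> z)
      = (LINT z|Rm T. a * (?F z * deriv_op T w u z * ?\<phi> z) + b * (?F z * deriv_op T w v z * ?\<phi> z))"
  proof (rule integral_cong_AE)
    show "AE z in Rm T. ?F z * deriv_op T w (\<lambda>z. a * u z + b * v z) z * ?\<phi> z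
        = a * (?F z * deriv_op T w u z * ?\<phi> z) + b * (?F z * deriv_op T w v z * ?\<phi> z)"
      using deriv_op_lin[OF w u v, of a b] by eventually_elim (simp add: algebra_simps)
  qed (use i[OF u] i[OF v] i[OF sobolev_lin[OF open_rect u v, of a b]] in \<open>auto dest: borel_measurable_integrable\<close>)
  also have "\<dots> = a * (LINT z|Rm T. ?F z * deriv_op T w u z * ?\<phi> z) + b * (LINT z|Rm T. ?F z * deriv_op T w v z * ?\<phi> z)"
    using i[OF u] i[OF v] by simp
  finally show ?thesis
    unfolding deriv_J_def using sobolev_inner_lin_right[OF u v w, of a b] by (simp add: algebra_simps)
qed

text \<open>With the weight \<open>1\<close>, that is \<open>\<lambda> = 0\<close>, the drift estimate
  bounds the first order terms in \<open>L\<^sup>2\<close>.\<close>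

lemma deriv_J_bounded:
  assumes w: "w \<in> H3 T"
  obtains K where "\<And>h. h \<in> H3 T \<Longrightarrow> left_trace T h (\<lambda>_. 0) \<Longrightarrow>
    \<bar>deriv_J T \<alpha> lam \<beta> w h\<bar> \<le> K * H3_norm T h"
proof -
  define D where "D = H3_norm T w"
  let ?F = "\<lambda>z. A_op T w z + N_op T w w z" and ?\<phi> = "weight \<alpha> lam"
  have F: "sq_integrable (Rm T) ?F" by (intro sq_integrable_add H3_sq_integrable N_op_sq_integrable T w)
  define F2 where "F2 = (LINT z|Rm T. (?F z)\<^sup>2)"
  define M where "M = 20 + 4 * drift_const T D"
  show thesis
  proof (rule that)
    fix h assume h: "h \<in> H3 T" "left_trace T h (\<lambda>_. 0)"
    let ?n = "H3_norm T h"
    have n0: "?n \<ge> 0" by (rule sobolev_norm_nonneg[OF open_rect])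
    let ?b = "\<lambda>z. N_op T w h z + N_op T h w z"
    have Dop: "sq_integrable (Rm T) (deriv_op T w h)" by (rule deriv_op_sq_integrable[OF w h(1)])
    have A: "sq_integrable (Rm T) (A_op T h)" by (rule H3_sq_integrable[OF T h(1)])
    have b: "sq_integrable (Rm T) ?b" by (intro sq_integrable_add N_op_sq_integrable T w h)
    have "(LINT z|Rm T. (?b z)\<^sup>2) = (LINT z|Rm T. (?b z)\<^sup>2 * weight 0 0 z)" by (simp add: weight_eq)
    also have "\<dots> \<le> drift_const T D * energy T 0 0 h"
      by (rule weighted_drift_bound[OF T order_refl order_refl w w _ _ h]) (simp_all add: D_def)
    also have "\<dots> \<le> drift_const T D * (2 * ?n\<^sup>2)"
      by (intro mult_left_mono energy_le_norm h drift_const_nonneg order_refl)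
    finally have b2: "(LINT z|Rm T. (?b z)\<^sup>2) \<le> drift_const T D * (2 * ?n\<^sup>2)" .
    have i: "integrable (Rm T) (\<lambda>z. (A_op T h z)\<^sup>2)" "integrable (Rm T) (\<lambda>z. (?b z)\<^sup>2)" "integrable (Rm T) (\<lambda>z. (deriv_op T w h z)\<^sup>2)"
      using A b Dop by (auto simp: sq_integrable_def)
    have "(LINT z|Rm T. (deriv_op T w h z)\<^sup>2) \<le> (LINT z|Rm T. 2 * (A_op T h z)\<^sup>2 + 2 * (?b z)\<^sup>2)"
      by (rule integral_mono) (use i sq_add_le in \<open>auto simp: deriv_op_def\<close>)
    also have "\<dots> = 2 * (LINT z|Rm T. (A_op T h z)\<^sup>2) + 2 * (LINT z|Rm T. (?b z)\<^sup>2)" using i by simp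
    also have "\<dots> \<le> M * ?n\<^sup>2" using A_op_L2_bound[OF h(1)] b2 by (simp add: M_def algebra_simps)
    finally have D2: "(LINT z|Rm T. (deriv_op T w h z)\<^sup>2) \<le> M * ?n\<^sup>2" .
    have M0: "M \<ge> 0" using drift_const_nonneg[of D] by (simp add: M_def)
    have iF: "integrable (Rm T) (\<lambda>z. ?F z * deriv_op T w h z)" by (rule sq_integrable_mult[OF F Dop])
    have F': "sq_integrable (Rm T) (\<lambda>z. \<bar>?F z\<bar>)" "sq_integrable (Rm T) (\<lambda>z. \<bar>deriv_op T w h z\<bar>)" using F Dop by (auto simp: sq_integrable_def)
    have "\<bar>LINT z|Rm T. ?F z * deriv_op T w h z * ?\<phi> z\<bar> \<le> (LINT z|Rm T. \<bar>?F z * deriv_op T w h z * ?\<phi> z\<bar>)"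
      by (rule integral_abs_bound)
    also have "\<dots> = (LINT z|Rm T. \<bar>?F z * deriv_op T w h z\<bar> * ?\<phi> z)"
      using weight_pos by (simp add: abs_mult less_imp_le)
    also have "\<dots> \<le> (LINT z|Rm T. \<bar>?F z * deriv_op T w h z\<bar>)"
      using iF by (intro integral_mult_weight_le lam alpha) auto
    also have "\<dots> = (LINT z|Rm T. \<bar>?F z\<bar> * \<bar>deriv_op T w h z\<bar>)" by (simp add: abs_mult)
    finally have 1: "\<bar>LINT z|Rm T. ?F z * deriv_op T w h z * ?\<phi> z\<bar> \<le> (LINT z|Rm T. \<bar>?F z\<bar> * \<bar>deriv_op T w h z\<bar>)" .
    have "(LINT z|Rm T. \<bar>?F z\<bar> * \<bar>deriv_op T w h z\<bar>)\<^sup>2 \<le> F2 * (LINT z|Rm T. (deriv_op T w h z)\<^sup>2)"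
      using Cauchy_Schwarz_integral[OF F'] by (simp add: F2_def)
    also have "\<dots> \<le> F2 * (M * ?n\<^sup>2)" by (rule mult_left_mono[OF D2]) (simp add: F2_def)
    also have "\<dots> = F2 * M * ?n\<^sup>2" by simp
    finally have "(LINT z|Rm T. \<bar>?F z\<bar> * \<bar>deriv_op T w h z\<bar>) \<le> sqrt (F2 * M * ?n\<^sup>2)" by (rule real_le_rsqrt)
    also have "\<dots> = sqrt (F2 * M) * ?n" using n0 by (simp add: real_sqrt_mult)
    finally have 2: "\<bar>LINT z|Rm T. ?F z * deriv_op T w h z * ?\<phi> z\<bar> \<le> sqrt (F2 * M) * ?n" using 1 by linarith
    have 3: "\<bar>2 * \<beta> * H3_inner T w h\<bar> \<le> 2 * \<bar>\<beta>\<bar> * (D * ?n)"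
      unfolding abs_mult using abs_sobolev_inner_le[OF w h(1)] by (intro mult_mono) (auto simp: D_def)
    have "\<bar>deriv_J T \<alpha> lam \<beta> w h\<bar> \<le> 2 * (sqrt (F2 * M) * ?n) + 2 * \<bar>\<beta>\<bar> * (D * ?n)"
      unfolding deriv_J_def using 2 3 by linarith
    then show "\<bar>deriv_J T \<alpha> lam \<beta> w h\<bar> \<le> (2 * sqrt (F2 * M) + 2 * \<bar>\<beta>\<bar> * D) * ?n" by (simp add: algebra_simps)
  qed
qed

text \<open>For \<open>\<parallel>h\<parallel> \<le> 1\<close> the coefficients \<open>w\<close> and
  \<open>w + h\<close> in the expansion have norm at most \<open>\<parallel>w\<parallel> +
  1\<close>.\<close>

lemma J_remainder_quadratic:
  assumes w: "w \<in> H3 T"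
  obtains K where "K > 0" "\<And>h. h \<in> H3 T \<Longrightarrow> left_trace T h (\<lambda>_. 0) \<Longrightarrow> H3_norm T h \<le> 1 \<Longrightarrow>
    \<bar>J T \<alpha> lam \<beta> (\<lambda>z. w z + h z) - J T \<alpha> lam \<beta> w - deriv_J T \<alpha> lam \<beta> w h\<bar> \<le> K * (H3_norm T h)\<^sup>2"
proof -
  define D where "D = H3_norm T w + 1"
  define K where "K = 20 + 4 * drift_const T D + 4 * second_order_const T D + \<bar>\<beta>\<bar>"
  show thesis
  proof (rule that)
    show "K > 0" using drift_const_nonneg[of D] second_order_const_nonneg[of D] by (simp add: K_def add_pos_nonneg)
    fix h assume h: "h \<in> H3 T" "left_trace T h (\<lambda>_. 0)" and h1: "H3_norm T h \<le> 1"
    let ?n2 = "(H3_norm T h)\<^sup>2" and ?\<phi> = "weight \<alpha> lam" and ?u = "\<lambda>z. w z + h z"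
    let ?b = "\<lambda>z. N_op T ?u h z + N_op T h w z"
    have u: "?u \<in> H3 T" by (rule sobolev_add[OF open_rect w h(1)])
    have nu: "H3_norm T ?u \<le> D"
      using sobolev_norm_triangle[OF open_rect bounded_rect w h(1)] h1 by (simp add: D_def)
    have nw: "H3_norm T w \<le> D" by (simp add: D_def)
    have A: "sq_integrable (Rm T) (A_op T h)" by (rule H3_sq_integrable[OF T h(1)])
    have b: "sq_integrable (Rm T) ?b" by (intro sq_integrable_add N_op_sq_integrable T w h u)
    have i: "integrable (Rm T) (\<lambda>z. (A_op T h z)\<^sup>2)" using A by (simp add: sq_integrable_def)
    have j: "integrable (Rm T) (\<lambda>z. (A_op T h z)\<^sup>2 * ?\<phi> z)" "integrable (Rm T) (\<lambda>z. (?b z)\<^sup>2 * ?\<phi> z)"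
      "integrable (Rm T) (\<lambda>z. (A_op T h z + ?b z)\<^sup>2 * ?\<phi> z)"
      by (rule integrable_sq_weight[OF A lam alpha] integrable_sq_weight[OF b lam alpha]
          integrable_sq_weight[OF sq_integrable_add[OF A b] lam alpha])+
    have e: "energy T \<alpha> lam h \<le> 2 * ?n2" by (rule energy_le_norm[OF h(1) lam alpha])
    have "(LINT z|Rm T. (?b z)\<^sup>2 * ?\<phi> z) \<le> drift_const T D * energy T \<alpha> lam h"
      by (rule weighted_drift_bound[OF T lam alpha w u nw nu h])
    also have "\<dots> \<le> drift_const T D * (2 * ?n2)" by (intro mult_left_mono e drift_const_nonneg)
    finally have b2: "(LINT z|Rm T. (?b z)\<^sup>2 * ?\<phi> z) \<le> drift_const T D * (2 * ?n2)" .
    have "(LINT z|Rm T. (A_op T h z)\<^sup>2 * ?\<phi> z) \<le> (LINT z|Rm T. (A_op T h z)\<^sup>2)"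
      by (rule integral_mult_weight_le[OF i _ lam alpha]) simp
    then have a2: "(LINT z|Rm T. (A_op T h z)\<^sup>2 * ?\<phi> z) \<le> 10 * ?n2" using A_op_L2_bound[OF h(1)] by linarith
    have "(LINT z|Rm T. (A_op T h z + ?b z)\<^sup>2 * ?\<phi> z) \<le> (LINT z|Rm T. 2 * ((A_op T h z)\<^sup>2 * ?\<phi> z) + 2 * ((?b z)\<^sup>2 * ?\<phi> z))"
    proof (rule integral_mono)
      show "(A_op T h z + ?b z)\<^sup>2 * ?\<phi> z \<le> 2 * ((A_op T h z)\<^sup>2 * ?\<phi> z) + 2 * ((?b z)\<^sup>2 * ?\<phi> z)" for z
        using mult_right_mono[OF sq_add_le[of "A_op T h z" "?b z"] less_imp_le[OF weight_pos[of \<alpha> lam z]]] by (simp only: distrib_right mult.assoc)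
    qed (use j in auto)
    also have "\<dots> = 2 * (LINT z|Rm T. (A_op T h z)\<^sup>2 * ?\<phi> z) + 2 * (LINT z|Rm T. (?b z)\<^sup>2 * ?\<phi> z)" using j by simp
    finally have 1: "(LINT z|Rm T. (A_op T h z + ?b z)\<^sup>2 * ?\<phi> z) \<le> 2 * (10 * ?n2) + 2 * (drift_const T D * (2 * ?n2))"
      using a2 b2 by linarith
    have nn: "0 \<le> (LINT z|Rm T. (A_op T h z + ?b z)\<^sup>2 * ?\<phi> z)"
      by (intro Bochner_Integration.integral_nonneg mult_nonneg_nonneg) (auto simp: weight_pos less_imp_le)
    have "\<bar>LINT z|Rm T. (A_op T w z + N_op T w w z) * N_op T h h z * ?\<phi> z\<bar> \<le> second_order_const T D * energy T \<alpha> lam h"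
      by (rule weighted_second_order_bound(2)[OF T lam alpha w nw h])
    also have "\<dots> \<le> second_order_const T D * (2 * ?n2)" by (intro mult_left_mono e second_order_const_nonneg)
    finally have 2: "\<bar>LINT z|Rm T. (A_op T w z + N_op T w w z) * N_op T h h z * ?\<phi> z\<bar> \<le> second_order_const T D * (2 * ?n2)" .
    have 3: "\<bar>\<beta> * ?n2\<bar> = \<bar>\<beta>\<bar> * ?n2" by (simp add: abs_mult)
    have "\<bar>J T \<alpha> lam \<beta> ?u - J T \<alpha> lam \<beta> w - deriv_J T \<alpha> lam \<beta> w h\<bar>
        \<le> 2 * (10 * ?n2) + 2 * (drift_const T D * (2 * ?n2)) + 2 * (second_order_const T D * (2 * ?n2)) + \<bar>\<beta>\<bar> * ?n2"
      unfolding J_expansion[OF w h(1)] using 1 nn 2 3 by linarith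
    also have "\<dots> = K * ?n2" by (simp add: K_def algebra_simps)
    finally show "\<bar>J T \<alpha> lam \<beta> ?u - J T \<alpha> lam \<beta> w - deriv_J T \<alpha> lam \<beta> w h\<bar> \<le> K * ?n2" .
  qed
qed

end

end

section \<open>The space of increments\<close>

context
  fixes T :: real
  assumes T: "T > 0"
begin

lemma sobolev_3_imp:
  assumes "u \<in> H3 T"
  shows "u \<in> sobolev (Suc 2) (rect T)" "u \<in> sobolev 2 (rect T)" "u \<in> sobolev 1 (rect T)"
    "dx T u \<in> sobolev 2 (rect T)" "dx T u \<in> sobolev 1 (rect T)"
proof -
  show s: "u \<in> sobolev (Suc 2) (rect T)" using assms by (simp add: numeral_3_eq_3 numeral_2_eq_2)
  show "u \<in> sobolev 2 (rect T)" "u \<in> sobolev 1 (rect T)" by (rule sobolev_mono[OF open_rect _ assms]; simp)+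
  show d: "dx T u \<in> sobolev 2 (rect T)" by (rule weak_deriv_sobolev(1)[OF open_rect s e_Basis(1)[OF T]])
  show "dx T u \<in> sobolev 1 (rect T)" by (rule sobolev_mono[OF open_rect _ d]) simp
qed

lemma dx_norm_le:
  assumes "u \<in> H3 T"
  shows "sobolev_norm 1 (rect T) u \<le> H3_norm T u"
    "sobolev_norm 1 (rect T) (dx T u) \<le> H3_norm T u"
proof -
  show "sobolev_norm 1 (rect T) u \<le> H3_norm T u" by (rule sobolev_norm_mono[OF open_rect]) simp
  have "sobolev_norm 1 (rect T) (dx T u) \<le> sobolev_norm 2 (rect T) (dx T u)" by (rule sobolev_norm_mono[OF open_rect]) simp
  also have "\<dots> \<le> sobolev_norm (Suc 2) (rect T) u" by (rule weak_deriv_norm_mono[OF open_rect sobolev_3_imp(1)[OF assms] e_Basis(1)[OF T]])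
  finally show "sobolev_norm 1 (rect T) (dx T u) \<le> H3_norm T u" by (simp add: numeral_3_eq_3 numeral_2_eq_2)
qed

lemma dx_norm_diff_le:
  assumes u: "u \<in> H3 T" and v: "v \<in> H3 T"
  shows "sobolev_norm 1 (rect T) (\<lambda>z. dx T u z - dx T v z) \<le> H3_norm T (\<lambda>z. u z - v z)"
proof -
  have uv: "(\<lambda>z. u z - v z) \<in> H3 T" by (rule sobolev_diff[OF open_rect u v])
  have "sobolev_norm 1 (rect T) (dx T (\<lambda>z. u z - v z)) = sobolev_norm 1 (rect T) (\<lambda>z. dx T u z - dx T v z)"
  proof (rule sobolev_norm_cong_AE[OF open_rect])
    show "AE z in lres (rect T). dx T (\<lambda>z. u z - v z) z = dx T u z - dx T v z"
      by (rule weak_deriv_diff[OF open_rect u v jet_multi_indices(1)[OF T]])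
  qed (intro sq_integrable_measurable[where M="lres (rect T)"] sq_integrable_diff sobolev_weak_deriv(2)[OF open_rect _ jet_multi_indices(1)[OF T]] u v uv)+
  then show ?thesis using dx_norm_le(2)[OF uv] by simp
qed

text \<open>The chosen weak derivative of a combination agrees with the combination of the chosen ones
  only almost everywhere, and traces do not see the difference.\<close>

lemma trace_dx_lin:
  assumes u: "u \<in> H3 T" and v: "v \<in> H3 T" and c: "continuous_on UNIV c"
    and tu: "has_trace (rect T) c {0<..<l} (dx T u) g" and tv: "has_trace (rect T) c {0<..<l} (dx T v) k"
  shows "has_trace (rect T) c {0<..<l} (dx T (\<lambda>z. a * u z + b * v z)) (\<lambda>s. a * g s + b * k s)"
proof -
  have "AE z in lres (rect T). a * dx T u z + b * dx T v z = dx T (\<lambda>z. a * u z + b * v z) z"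
    using weak_deriv_lin[OF open_rect u v jet_multi_indices(1)[OF T], of a b] by eventually_elim simp
  then show ?thesis
    using has_trace_cong_AE[OF has_trace_lin[OF tu[unfolded rect_eq] tv[unfolded rect_eq] zero_less_one T c, of a b] zero_less_one T,
        of "dx T (\<lambda>z. a * u z + b * v z)"]
      sq_integrable_measurable[OF sobolev_weak_deriv(2)[OF open_rect sobolev_lin[OF open_rect u v, of a b] jet_multi_indices(1)[OF T]]]
    unfolding rect_eq by blast
qed

lemma boundary_curve_continuous: "continuous_on UNIV (\<lambda>t::real. (0::real, t))" "continuous_on UNIV (\<lambda>x::real. (x, s::real))"
  by (auto intro!: continuous_intros)

lemma trace_lin:
  "has_trace (rect T) c {0<..<l} u g \<Longrightarrow> has_trace (rect T) c {0<..<l} v k \<Longrightarrow> continuous_on UNIV c \<Longrightarrow>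
    has_trace (rect T) c {0<..<l} (\<lambda>z. a * u z + b * v z) (\<lambda>s. a * g s + b * k s)"
  unfolding rect_eq by (rule has_trace_lin[OF _ _ zero_less_one T])

lemma H03_iff: "u \<in> H03 T \<longleftrightarrow> u \<in> H3 T \<and> left_trace T u (\<lambda>_. 0) \<and> left_trace T (dx T u) (\<lambda>_. 0)"
  using sobolev_3_imp(2) by (auto simp: H03_def H02_def)

lemma H03_lin:
  assumes u: "u \<in> H03 T" and v: "v \<in> H03 T"
  shows "(\<lambda>z. a * u z + b * v z) \<in> H03 T"
  using u v trace_lin[of _ _ u "\<lambda>_. 0" v "\<lambda>_. 0" a b, OF _ _ boundary_curve_continuous(1)]
    trace_dx_lin[of u v "\<lambda>t. (0, t)" _ "\<lambda>_. 0" "\<lambda>_. 0" a b, OF _ _ boundary_curve_continuous(1)]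
    sobolev_lin[OF open_rect, of u 3 T v a b]
  unfolding H03_iff by simp

lemma H03_zero: "(\<lambda>_. 0) \<in> H03 T"
proof -
  have z: "(\<lambda>_. 0) \<in> H3 T"
  proof -
    have "has_weak_deriv (rect T) m (\<lambda>_. 0) (\<lambda>_. 0)" for m
      unfolding has_weak_deriv_def loc_integrable_def by (simp add: set_lebesgue_integral_def set_integrable_def)
    then show ?thesis by (intro sobolevI[OF open_rect, where v="\<lambda>_ _. 0"]) (auto simp: sq_integrable_def)
  qed
  have s: "smooth (\<lambda>_::real \<times> real. 0)"
  proof -
    have "pderivs bs (\<lambda>_::real \<times> real. 0) = (\<lambda>_. 0)" for bs
      by (induction bs) simp_all
    then show ?thesis by (simp add: smooth_def)
  qed
  have t: "left_trace T (\<lambda>_. 0) (\<lambda>_. 0)"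
    using has_trace_smooth[OF s zero_less_one T boundary_curve_continuous(1)] by (simp add: rect_eq)
  have "AE z in lres (rect T). 0 = dx T (\<lambda>_. 0) z"
    using weak_deriv_lin[OF open_rect z z jet_multi_indices(1)[OF T], of 0 0] by simp
  then have "left_trace T (dx T (\<lambda>_. 0)) (\<lambda>_. 0)"
    using has_trace_cong_AE[OF t[unfolded rect_eq] zero_less_one T, of "dx T (\<lambda>_. 0)"]
      sq_integrable_measurable[OF sobolev_weak_deriv(2)[OF open_rect z jet_multi_indices(1)[OF T]]]
    unfolding rect_eq by blast
  then show ?thesis using z t by (simp add: H03_iff)
qed

lemma left_traces_closed:
  assumes w: "w \<in> H3 T"
    and approx: "\<And>e. e > 0 \<Longrightarrow> \<exists>v\<in>H3 T. left_trace T v g \<and> left_trace T (dx T v) k \<and> H3_norm T (\<lambda>z. v z - w z) < e"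
  shows "left_trace T w g" "left_trace T (dx T w) k"
proof -
  obtain v where "left_trace T v g" "left_trace T (dx T v) k" using approx[of 1] by auto
  then have L2: "g \<in> L2 {0<..<T}" "k \<in> L2 {0<..<T}" by (auto simp: has_trace_def)
  show "left_trace T w g"
    unfolding rect_eq
  proof (rule has_trace_closed[OF sobolev_3_imp(3)[OF w, unfolded rect_eq] zero_less_one T L2(1)])
    fix e :: real assume "e > 0"
    then obtain v where v: "v \<in> H3 T" "left_trace T v g" "H3_norm T (\<lambda>z. v z - w z) < e"
      using approx by blast
    have "sobolev_norm 1 (rect T) (\<lambda>z. v z - w z) < e"
      using dx_norm_le(1)[OF sobolev_diff[OF open_rect v(1) w]] v(3) by simp
    then show "\<exists>v. has_trace (Rect 1 T) (\<lambda>t. (0, t)) {0<..<T} v g \<and> sobolev_norm 1 (Rect 1 T) (\<lambda>z. v z - w z) < e"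
      using v(2) unfolding rect_eq by blast
  qed
  show "left_trace T (dx T w) k"
    unfolding rect_eq
  proof (rule has_trace_closed[OF sobolev_3_imp(5)[OF w, unfolded rect_eq] zero_less_one T L2(2)])
    fix e :: real assume "e > 0"
    then obtain v where v: "v \<in> H3 T" "left_trace T (dx T v) k" "H3_norm T (\<lambda>z. v z - w z) < e"
      using approx by blast
    have "sobolev_norm 1 (rect T) (\<lambda>z. dx T v z - dx T w z) < e"
      using dx_norm_diff_le[OF v(1) w] v(3) by simp
    then show "\<exists>v. has_trace (Rect 1 T) (\<lambda>t. (0, t)) {0<..<T} v k \<and>
        sobolev_norm 1 (Rect 1 T) (\<lambda>z. v z - weak_deriv (Rect 1 T) {#e_x#} w z) < e"
      using v(2) unfolding rect_eq by blast
  qed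
qed

lemma H03_closed:
  assumes "w \<in> H3 T" "\<And>e. e > 0 \<Longrightarrow> \<exists>v\<in>H03 T. H3_norm T (\<lambda>z. v z - w z) < e"
  shows "w \<in> H03 T"
proof -
  have *: "\<exists>v\<in>H3 T. left_trace T v (\<lambda>_. 0) \<and> left_trace T (dx T v) (\<lambda>_. 0) \<and> H3_norm T (\<lambda>z. v z - w z) < e"
    if e: "e > 0" for e
  proof -
    obtain v where "v \<in> H03 T" "H3_norm T (\<lambda>z. v z - w z) < e" using assms(2)[OF e] by blast
    then show ?thesis by (intro bexI[of _ v]) (simp_all add: H03_iff)
  qed
  show ?thesis unfolding H03_iff by (intro conjI assms(1) left_traces_closed[OF assms(1) *])
qed

subsection \<open>The gradient\<close>

text \<open>The Riesz theorem represents \<open>deriv_J\<close> by a limit of elements of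
  \<open>H\<^sub>0\<^sup>3\<close>, which is again in \<open>H\<^sub>0\<^sup>3\<close> because traces
  are stable under limits.\<close>

lemma frechet_deriv_exists:
  assumes w: "w \<in> H3 T" and lam: "0 \<le> lam" and alpha: "0 \<le> \<alpha>"
  obtains G where "has_frechet_deriv T (J T \<alpha> lam \<beta>) w G" "\<And>h. h \<in> H03 T \<Longrightarrow> H3_inner T G h = deriv_J T \<alpha> lam \<beta> w h"
proof -
  let ?N = "H3_norm T" and ?ip = "H3_inner T" and ?J = "J T \<alpha> lam \<beta>"
  obtain K where K: "\<And>h. h \<in> H3 T \<Longrightarrow> left_trace T h (\<lambda>_. 0) \<Longrightarrow> \<bar>deriv_J T \<alpha> lam \<beta> w h\<bar> \<le> K * ?N h"
    by (rule deriv_J_bounded[OF T lam alpha w], rule that)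
  obtain G where G: "G \<in> H3 T" "\<And>h. h \<in> H03 T \<Longrightarrow> ?ip G h = deriv_J T \<alpha> lam \<beta> w h"
    "\<And>e. e > 0 \<Longrightarrow> \<exists>v\<in>H03 T. ?ip (\<lambda>z. v z - G z) (\<lambda>z. v z - G z) < e"
  proof (rule semi_hilbert.riesz_subspace[OF semi_hilbert_H3[of T], of "H03 T" "deriv_J T \<alpha> lam \<beta> w" K])
    show "H03 T \<subseteq> H3 T" by (auto simp: H03_def)
    show "H03 T \<noteq> {}" using H03_zero by blast
    show "(\<lambda>z. a * u z + b * v z) \<in> H03 T" if "u \<in> H03 T" "v \<in> H03 T" for u v a b using that by (rule H03_lin)
    show "deriv_J T \<alpha> lam \<beta> w (\<lambda>z. a * u z + b * v z) = a * deriv_J T \<alpha> lam \<beta> w u + b * deriv_J T \<alpha> lam \<beta> w v"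
      if "u \<in> H03 T" "v \<in> H03 T" for u v a b
      using that by (intro deriv_J_lin[OF T lam alpha w]) (auto simp: H03_def)
    show "\<bar>deriv_J T \<alpha> lam \<beta> w v\<bar> \<le> K * sqrt (?ip v v)" if "v \<in> H03 T" for v
      using K[of v] that by (auto simp: H03_iff sobolev_norm_def)
  qed (rule that)
  obtain K2 where K2: "K2 > 0" "\<And>h. h \<in> H3 T \<Longrightarrow> left_trace T h (\<lambda>_. 0) \<Longrightarrow> ?N h \<le> 1 \<Longrightarrow>
    \<bar>?J (\<lambda>z. w z + h z) - ?J w - deriv_J T \<alpha> lam \<beta> w h\<bar> \<le> K2 * (?N h)\<^sup>2"
    by (rule J_remainder_quadratic[OF T lam alpha w, where \<beta>=\<beta>], rule that)
  have GH: "G \<in> H03 T"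
  proof (rule H03_closed[OF G(1)])
    fix e :: real assume e: "e > 0"
    then obtain v where v: "v \<in> H03 T" "?ip (\<lambda>z. v z - G z) (\<lambda>z. v z - G z) < e\<^sup>2" using G(3)[of "e\<^sup>2"] by auto
    have "?N (\<lambda>z. v z - G z) < e" unfolding sobolev_norm_def using v(2) e by (simp add: real_less_lsqrt)
    with v(1) show "\<exists>v\<in>H03 T. ?N (\<lambda>z. v z - G z) < e" by blast
  qed
  have "has_frechet_deriv T ?J w G"
    unfolding has_frechet_deriv_def
  proof (intro conjI allI impI GH)
    fix e :: real assume e: "e > 0"
    show "\<exists>\<delta>>0. \<forall>h\<in>H03 T. ?N h < \<delta> \<longrightarrow> \<bar>?J (\<lambda>z. w z + h z) - ?J w - ?ip G h\<bar> \<le> e * ?N h"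
    proof (rule exI[of _ "min 1 (e / K2)"], intro conjI ballI impI)
      show "0 < min 1 (e / K2)" using e K2(1) by simp
      fix h assume h: "h \<in> H03 T" "?N h < min 1 (e / K2)"
      have n0: "0 \<le> ?N h" by (rule sobolev_norm_nonneg[OF open_rect])
      have "\<bar>?J (\<lambda>z. w z + h z) - ?J w - ?ip G h\<bar> \<le> K2 * (?N h)\<^sup>2"
        unfolding G(2)[OF h(1)] using h by (intro K2(2)) (auto simp: H03_iff)
      also have "\<dots> = (K2 * ?N h) * ?N h" by (simp add: power2_eq_square)
      also have "\<dots> \<le> e * ?N h"
        using h(2) K2(1) n0 by (intro mult_right_mono) (auto simp: field_simps)
      finally show "\<bar>?J (\<lambda>z. w z + h z) - ?J w - ?ip G h\<bar> \<le> e * ?N h" .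
    qed
  qed
  then show thesis using G(2) by (rule that)
qed

text \<open>The difference \<open>k\<close> of two representatives lies in
  \<open>H\<^sub>0\<^sup>3\<close> and may itself be used, scaled down, as an increment: this gives
  \<open>\<parallel>k\<parallel>\<^sup>2 \<le> e \<parallel>k\<parallel>\<close> for every \<open>e >
  0\<close>.\<close>

lemma has_frechet_deriv_unique:
  assumes G: "has_frechet_deriv T F w G" and G': "has_frechet_deriv T F w G'" and h: "h \<in> H03 T"
  shows "H3_inner T G h = H3_inner T G' h"
proof -
  let ?N = "H3_norm T" and ?ip = "H3_inner T"
  have GH: "G \<in> H03 T" "G' \<in> H03 T" using G G' by (auto simp: has_frechet_deriv_def)
  have S: "u \<in> H3 T" if "u \<in> H03 T" for u using that by (simp add: H03_def)
  define k where "k = (\<lambda>z. G z - G' z)"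
  have k: "k \<in> H03 T" using H03_lin[OF GH, of 1 "-1"] by (simp add: k_def)
  have ipk: "?ip k u = ?ip G u - ?ip G' u" if "u \<in> H03 T" for u
    using sobolev_inner_lin[OF open_rect S[OF GH(1)] S[OF GH(2)] S[OF that], of 1 "-1"] by (simp add: k_def)
  have n0: "0 \<le> ?N k" by (rule sobolev_norm_nonneg[OF open_rect])
  have "?N k \<le> 0 + e" if e: "e > 0" for e
  proof (cases "?N k = 0")
    case False
    then have kp: "?N k > 0" using n0 by simp
    obtain d1 where d1: "d1 > 0" "\<And>h. h \<in> H03 T \<Longrightarrow> ?N h < d1 \<Longrightarrow> \<bar>F (\<lambda>z. w z + h z) - F w - ?ip G h\<bar> \<le> e / 2 * ?N h"
      using G e unfolding has_frechet_deriv_def by (meson half_gt_zero)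
    obtain d2 where d2: "d2 > 0" "\<And>h. h \<in> H03 T \<Longrightarrow> ?N h < d2 \<Longrightarrow> \<bar>F (\<lambda>z. w z + h z) - F w - ?ip G' h\<bar> \<le> e / 2 * ?N h"
      using G' e unfolding has_frechet_deriv_def by (meson half_gt_zero)
    define s where "s = min d1 d2 / (2 * ?N k)"
    have s: "s > 0" using d1 d2 kp by (simp add: s_def)
    define u where "u = (\<lambda>z. s * k z)"
    have u: "u \<in> H03 T" using H03_lin[OF k k, of s 0] by (simp add: u_def)
    have Nu: "?N u = s * ?N k" unfolding u_def using sobolev_norm_cmult[OF open_rect S[OF k], of s] s by simp
    have "s * ?N k = min d1 d2 / 2" using kp by (simp add: s_def)
    then have "?N u < d1" "?N u < d2" using Nu d1(1) d2(1) by auto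
    then have "\<bar>?ip k u\<bar> \<le> e * ?N u" using d1(2)[OF u] d2(2)[OF u] unfolding ipk[OF u] by linarith
    moreover have "?ip k u = s * (?N k)\<^sup>2"
      using sobolev_inner_lin_right[OF S[OF k] S[OF k] S[OF k], of s 0] by (simp add: u_def sobolev_inner_self[OF open_rect])
    ultimately have "s * (?N k)\<^sup>2 \<le> e * (s * ?N k)" using Nu by simp
    then have "(s * ?N k) * ?N k \<le> (s * ?N k) * e" by (simp add: power2_eq_square mult.commute mult.left_commute)
    then show ?thesis using s kp by simp
  qed (use e in simp)
  then have "?N k \<le> 0" by (rule field_le_epsilon)
  then have "?N k = 0" using n0 by simp
  then have "?ip k h = 0" using abs_sobolev_inner_le[OF S[OF k] S[OF h]] by simp
  then show ?thesis using ipk[OF h] by simp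
qed

text \<open>By uniqueness, any choice of the derivative acts on \<open>H\<^sub>0\<^sup>3\<close> as
  \<open>deriv_J\<close>.\<close>

theorem frechet_deriv_J:
  assumes w: "w \<in> H3 T" and lam: "0 \<le> lam" and alpha: "0 \<le> \<alpha>"
  shows "has_frechet_deriv T (J T \<alpha> lam \<beta>) w (frechet_deriv T (J T \<alpha> lam \<beta>) w)"
    "h \<in> H03 T \<Longrightarrow> H3_inner T (frechet_deriv T (J T \<alpha> lam \<beta>) w) h = deriv_J T \<alpha> lam \<beta> w h"
proof -
  obtain G where G: "has_frechet_deriv T (J T \<alpha> lam \<beta>) w G" "\<And>h. h \<in> H03 T \<Longrightarrow> H3_inner T G h = deriv_J T \<alpha> lam \<beta> w h"
    by (rule frechet_deriv_exists[OF w lam alpha, where \<beta>=\<beta>], rule that)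
  show f: "has_frechet_deriv T (J T \<alpha> lam \<beta>) w (frechet_deriv T (J T \<alpha> lam \<beta>) w)"
    unfolding frechet_deriv_def by (rule someI[of "has_frechet_deriv T (J T \<alpha> lam \<beta>) w", OF G(1)])
  show "H3_inner T (frechet_deriv T (J T \<alpha> lam \<beta>) w) h = deriv_J T \<alpha> lam \<beta> w h" if "h \<in> H03 T"
    using has_frechet_deriv_unique[OF f G(1) that] G(2)[OF that] by simp
qed

end

section \<open>Restriction to subdomains\<close>

text \<open>A test function on \<open>S'\<close> is one on \<open>S\<close>, and the integrands vanish
  outside \<open>S'\<close>.\<close>

lemma has_weak_deriv_restrict:
  assumes v: "has_weak_deriv S m u v" and S: "open S" "open S'" "S' \<subseteq> S" and m: "set_mset m \<subseteq> Basis"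
  shows "has_weak_deriv S' m u v"
proof (rule has_weak_derivI[OF S(2)])
  have loc: "loc_integrable S u" "loc_integrable S v" using v by (auto simp: has_weak_deriv_def)
  then show "loc_integrable S' u" "loc_integrable S' v" using S(3) unfolding loc_integrable_def by blast+
  fix bs f assume bs: "mset bs = m" and f: "test_fun S' f"
  have ext: "(LINT x|lres S'. g x * k x) = (LINT x:S|lborel. g x * k x)" if k: "test_fun S' k" for g k
  proof -
    have "k x = 0" if "x \<notin> S'" for x
      using k that closure_subset[of "{x. k x \<noteq> 0}"] unfolding test_fun_def by blast
    then have "(\<lambda>x. indicator S' x *\<^sub>R (g x * k x)) = (\<lambda>x. indicator S x *\<^sub>R (g x * k x))"
      using S(3) by (auto simp: indicator_def fun_eq_iff)
    moreover have "(LINT x|lres S'. g x * k x) = (LINT x:S'|lborel. g x * k x)" using S(2) by (simp add: set_integral_lres)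
    ultimately show ?thesis unfolding set_lebesgue_integral_def by simp
  qed
  have "test_fun S' (pderivs bs f)" using test_fun_pderivs[OF f, of bs] bs m by auto
  note e = ext[OF this] ext[OF f]
  show "(LINT x|lres S'. u x * pderivs bs f x) = (-1) ^ length bs * (LINT x|lres S'. v x * f x)"
    unfolding e using v test_fun_mono[OF f S(3)] bs unfolding has_weak_deriv_def by auto
qed

text \<open>On a subdomain the weak derivatives chosen by \<open>weak_deriv\<close> need not be the
  restrictions of those chosen on the whole domain; the norm may nevertheless be computed with the
  latter.\<close>

lemma sobolev_norm_sq_eq:
  assumes S: "open S" and v: "\<And>m. m \<in> multi_indices k \<Longrightarrow> has_weak_deriv S m u (v m)"
  shows "(sobolev_norm k S u)\<^sup>2 = (\<Sum>m\<in>multi_indices k. LINT z|lres S. (v m z)\<^sup>2)"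
  unfolding sobolev_norm_sq[OF S]
proof (rule sum.cong[OF refl])
  fix m :: "'a multiset" assume m: "m \<in> multi_indices k"
  have mB: "set_mset m \<subseteq> Basis" using m by (simp add: multi_indices_def)
  note w = weak_deriv_eq[OF S v[OF m] mB]
  have [measurable]: "weak_deriv S m u \<in> borel_measurable (lres S)" "v m \<in> borel_measurable (lres S)"
    using w(1) v[OF m] loc_integrable_measurable[OF _ S] by (auto simp: has_weak_deriv_def)
  show "(LINT z|lres S. (weak_deriv S m u z)\<^sup>2) = (LINT z|lres S. (v m z)\<^sup>2)"
  proof (rule integral_cong_AE)
    show "AE z in lres S. (weak_deriv S m u z)\<^sup>2 = (v m z)\<^sup>2" using w(2) by eventually_elim simp
  qed measurable
qed

lemma multi_indices_1_real: "multi_indices 1 = {{#}, {#1::real#}}"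
proof (intro set_eqI iffI)
  fix m :: "real multiset" assume m: "m \<in> multi_indices 1"
  show "m \<in> {{#}, {#1#}}"
    using m by (cases m) (auto simp: multi_indices_def)
qed (auto simp: multi_indices_def)

lemma restricted_integral_weighted_le:
  fixes f :: "'a::euclidean_space \<Rightarrow> real"
  assumes A: "A \<subseteq> S" "A \<in> sets borel" "S \<in> sets borel" and f: "integrable (lres S) f" "\<And>z. 0 \<le> f z"
    and f\<phi>: "integrable (lres S) (\<lambda>z. f z * \<phi> z)" and \<phi>: "\<And>z. 0 \<le> \<phi> z" "\<And>z. z \<in> A \<Longrightarrow> c \<le> \<phi> z"
  shows "c * (LINT z|lres A. f z) \<le> (LINT z|lres S. f z * \<phi> z)"
proof -
  have iS: "integrable lborel (\<lambda>z. indicator S z *\<^sub>R f z)" "integrable lborel (\<lambda>z. indicator S z *\<^sub>R (f z * \<phi> z))"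
    using f(1) f\<phi> A(3) by (simp_all add: integrable_restrict_space)
  have "integrable lborel (\<lambda>z. indicator A z *\<^sub>R (indicator S z *\<^sub>R f z))"
    using A(2) by (intro integrable_mult_indicator iS) simp
  also have "(\<lambda>z. indicator A z *\<^sub>R (indicator S z *\<^sub>R f z)) = (\<lambda>z. indicator A z *\<^sub>R f z)"
    using A(1) by (auto simp: indicator_def fun_eq_iff)
  finally have iA: "integrable lborel (\<lambda>z. indicator A z *\<^sub>R f z)" .
  have "c * (LINT z|lres A. f z) = (LINT z|lborel. c * (indicator A z *\<^sub>R f z))"
    using A(2) by (simp add: integral_restrict_space)
  also have "\<dots> \<le> (LINT z|lborel. indicator S z *\<^sub>R (f z * \<phi> z))"
  proof (rule integral_mono)
    fix z
    have "f z * c \<le> f z * \<phi> z" if "z \<in> A" using \<phi>(2)[OF that] f(2) by (rule mult_left_mono)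
    then show "c * (indicator A z *\<^sub>R f z) \<le> indicator S z *\<^sub>R (f z * \<phi> z)"
      using A(1) f(2)[of z] \<phi>(1)[of z] by (auto simp: indicator_def mult.commute)
  qed (use iA iS in auto)
  also have "\<dots> = (LINT z|lres S. f z * \<phi> z)" using A(3) by (simp add: integral_restrict_space)
  finally show ?thesis .
qed

section \<open>The constraint set\<close>

context
  fixes T :: real
  assumes T: "T > 0"
begin

lemma closure_B:
  assumes w: "w \<in> H3_closure T (B T d p0 p1)"
  shows "w \<in> H3 T" "H3_norm T w \<le> d" "left_trace T w p0" "left_trace T (dx T w) p1"
proof -
  let ?N = "H3_norm T"
  show ws: "w \<in> H3 T" using w by (simp add: H3_closure_def)
  have approx: "\<exists>v. v \<in> H3 T \<and> left_trace T v p0 \<and> left_trace T (dx T v) p1 \<and> ?N v < d \<and> ?N (\<lambda>z. v z - w z) < e" if "e > 0" for e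
    using w that unfolding H3_closure_def B_def by blast
  show "?N w \<le> d"
  proof (rule field_le_epsilon)
    fix e :: real assume "e > 0"
    then obtain v where v: "v \<in> H3 T" "?N v < d" "?N (\<lambda>z. v z - w z) < e" using approx by blast
    have vw: "(\<lambda>z. v z - w z) \<in> H3 T" by (rule sobolev_diff[OF open_rect v(1) ws])
    have vw': "(\<lambda>z. - 1 * (v z - w z)) \<in> H3 T" using sobolev_lin[OF open_rect vw vw, of "-1" 0] by simp
    have "?N w = ?N (\<lambda>z. v z + - 1 * (v z - w z))" by simp
    also have "\<dots> \<le> ?N v + ?N (\<lambda>z. - 1 * (v z - w z))" by (rule sobolev_norm_triangle[OF open_rect bounded_rect v(1) vw'])
    also have "?N (\<lambda>z. - 1 * (v z - w z)) = ?N (\<lambda>z. v z - w z)" using sobolev_norm_cmult[OF open_rect vw, of "-1"] by simp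
    finally show "?N w \<le> d + e" using v by linarith
  qed
  have "\<exists>v\<in>H3 T. left_trace T v p0 \<and> left_trace T (dx T v) p1 \<and> ?N (\<lambda>z. v z - w z) < e" if "e > 0" for e
    using approx[OF that] by blast
  note c = left_traces_closed[OF T ws this]
  show "left_trace T w p0" "left_trace T (dx T w) p1" by (rule c; assumption)+
qed

lemma closure_B_diff:
  assumes w: "w1 \<in> H3_closure T (B T d p0 p1)" "w2 \<in> H3_closure T (B T d p0 p1)"
  shows "(\<lambda>z. w2 z - w1 z) \<in> H03 T"
  using sobolev_diff[OF open_rect closure_B(1)[OF w(2)] closure_B(1)[OF w(1)]]
    trace_lin[OF T closure_B(3)[OF w(2)] closure_B(3)[OF w(1)] boundary_curve_continuous(1)[OF T], of 1 "-1"]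
    trace_dx_lin[OF T closure_B(1)[OF w(2)] closure_B(1)[OF w(1)] boundary_curve_continuous(1)[OF T] closure_B(4)[OF w(2)] closure_B(4)[OF w(1)], of 1 "-1"]
  by (simp add: H03_iff[OF T])

text \<open>Both approximants have the same boundary values, and so has every convex combination of
  them.\<close>

lemma closure_B_convex:
  assumes w: "w1 \<in> H3_closure T (B T d p0 p1)" "w2 \<in> H3_closure T (B T d p0 p1)" and s: "0 < s" "s < 1"
  shows "(\<lambda>z. (1 - s) * w1 z + s * w2 z) \<in> H3_closure T (B T d p0 p1)"
  unfolding H3_closure_def
proof (intro CollectI conjI allI impI)
  let ?N = "H3_norm T"
  have ws: "w1 \<in> H3 T" "w2 \<in> H3 T" by (rule closure_B(1)[OF w(1)], rule closure_B(1)[OF w(2)])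
  show "(\<lambda>z. (1 - s) * w1 z + s * w2 z) \<in> H3 T" by (rule sobolev_lin[OF open_rect ws])
  have comb: "?N (\<lambda>z. (1 - s) * u z + s * v z) \<le> (1 - s) * ?N u + s * ?N v"
    if "u \<in> H3 T" "v \<in> H3 T" for u v
  proof -
    have c: "(\<lambda>z. (1 - s) * u z) \<in> H3 T" "(\<lambda>z. s * v z) \<in> H3 T"
      using sobolev_lin[OF open_rect that(1) that(1), of "1 - s" 0] sobolev_lin[OF open_rect that(2) that(2), of s 0] by simp_all
    show ?thesis
      using sobolev_norm_triangle[OF open_rect bounded_rect c] s
      by (simp add: sobolev_norm_cmult[OF open_rect that(1)] sobolev_norm_cmult[OF open_rect that(2)])
  qed
  have conv: "(1 - s) * a + s * b < c" if "a < c" "b < c" for a b c :: real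
  proof -
    have "(1 - s) * a + s * b < (1 - s) * c + s * c" using that s by (intro add_strict_mono mult_strict_left_mono) auto
    then show ?thesis by (simp add: algebra_simps)
  qed
  fix e :: real assume e: "e > 0"
  obtain v1 where v1: "v1 \<in> B T d p0 p1" "?N (\<lambda>z. v1 z - w1 z) < e" using w(1) e unfolding H3_closure_def by blast
  obtain v2 where v2: "v2 \<in> B T d p0 p1" "?N (\<lambda>z. v2 z - w2 z) < e" using w(2) e unfolding H3_closure_def by blast
  have v1': "v1 \<in> H3 T" "left_trace T v1 p0" "left_trace T (dx T v1) p1" "right_trace T (dx T v1) (\<lambda>_. 0)" "?N v1 < d"
    using v1(1) by (auto simp: B_def)
  have v2': "v2 \<in> H3 T" "left_trace T v2 p0" "left_trace T (dx T v2) p1" "right_trace T (dx T v2) (\<lambda>_. 0)" "?N v2 < d"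
    using v2(1) by (auto simp: B_def)
  have rc: "continuous_on UNIV (\<lambda>t::real. (1::real, t))" by (intro continuous_intros)
  have p: "(\<lambda>t. (1 - s) * q t + s * q t) = q" for q :: "real \<Rightarrow> real" by (auto simp: fun_eq_iff algebra_simps)
  let ?v = "\<lambda>z. (1 - s) * v1 z + s * v2 z"
  have "?v \<in> B T d p0 p1"
    unfolding B_def
  proof (intro CollectI conjI)
    show "?v \<in> H3 T" by (rule sobolev_lin[OF open_rect v1'(1) v2'(1)])
    show "left_trace T ?v p0" using trace_lin[OF T v1'(2) v2'(2) boundary_curve_continuous(1)[OF T], of "1 - s" s] by (simp only: p)
    show "left_trace T (dx T ?v) p1"
      using trace_dx_lin[OF T v1'(1) v2'(1) boundary_curve_continuous(1)[OF T] v1'(3) v2'(3), of "1 - s" s] by (simp only: p)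
    show "right_trace T (dx T ?v) (\<lambda>_. 0)"
      using trace_dx_lin[OF T v1'(1) v2'(1) rc v1'(4) v2'(4), of "1 - s" s] by simp
    show "?N ?v < d" using comb[OF v1'(1) v2'(1)] conv[OF v1'(5) v2'(5)] by linarith
  qed
  moreover have "?N (\<lambda>z. ?v z - ((1 - s) * w1 z + s * w2 z)) < e"
  proof -
    have "(\<lambda>z. ?v z - ((1 - s) * w1 z + s * w2 z)) = (\<lambda>z. (1 - s) * (v1 z - w1 z) + s * (v2 z - w2 z))"
      by (auto simp: fun_eq_iff algebra_simps)
    then show ?thesis
      using comb[OF sobolev_diff[OF open_rect v1'(1) ws(1)] sobolev_diff[OF open_rect v2'(1) ws(2)]] conv[OF v1(2) v2(2)] by simp
  qed
  ultimately show "\<exists>v\<in>B T d p0 p1. ?N (\<lambda>z. v z - ((1 - s) * w1 z + s * w2 z)) < e" by (intro bexI[of _ ?v])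
qed

end

section \<open>Strict convexity\<close>

text \<open>From \<open>exp y \<ge> (1 + y / 4) ^ 4 \<ge> (y / 4) ^ 4\<close> with \<open>y = a
  \<lambda>\<close>; hence the constant \<open>256 = 4 ^ 4\<close>.\<close>

lemma cube_exp_decay:
  fixes a c lam :: real
  assumes a: "a > 0" and c: "c \<ge> 0" and lam: "lam \<ge> 256 * c / a ^ 4" "lam > 0"
  shows "c * lam ^ 3 * exp (- a * lam) \<le> 1"
proof -
  have "(a * lam / 4) ^ 4 \<le> (1 + a * lam / real 4) ^ 4" using a lam by (intro power_mono) auto
  also have "\<dots> \<le> exp (a * lam)" by (rule exp_ge_one_plus_x_over_n_power_n) (use mult_pos_pos[OF a lam(2)] in auto)
  finally have 1: "a ^ 4 * lam ^ 4 \<le> 256 * exp (a * lam)" by (simp add: power_divide power_mult_distrib)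
  have "256 * c \<le> lam * a ^ 4" using lam(1) a by (simp add: pos_divide_le_eq)
  then have "256 * c * lam ^ 3 \<le> (lam * a ^ 4) * lam ^ 3" using lam(2) by (intro mult_right_mono) auto
  also have "\<dots> = a ^ 4 * lam ^ 4" by (simp add: eval_nat_numeral)
  also note 1
  finally have "c * lam ^ 3 \<le> exp (a * lam)" by simp
  then show ?thesis by (simp add: exp_minus field_simps)
qed

lemma trace_t_has_trace:
  assumes T: "T > 0" and u: "u \<in> sobolev 1 (rect T)" and s: "s \<in> {0..T}"
  shows "has_trace (rect T) (\<lambda>x. (x, s)) {0<..<1} u (trace_t T s u)"
  unfolding trace_on_def by (rule someI_ex[of "has_trace (rect T) (\<lambda>x. (x, s)) {0<..<1} u"]) (use trace_exists[of u 1 T s] u T s in \<open>simp add: rect_eq\<close>)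

lemma trace_t_integral_le:
  assumes T: "T > 0" and u: "u \<in> sobolev 1 (rect T)" and s: "s \<in> {0..T}"
  shows "(LINT x|Iv 1. (trace_t T s u x)\<^sup>2) \<le> (2 / T + 2 * T) * (sobolev_norm 1 (rect T) u)\<^sup>2"
    "sq_integrable (Iv 1) (trace_t T s u)"
  using trace_bound[OF trace_t_has_trace[OF assms, unfolded rect_eq] zero_less_one T s] trace_t_has_trace[OF assms]
  by (simp_all add: rect_eq has_trace_def L2_iff_sq_integrable)

lemma exp_weight_integrable:
  assumes f: "sq_integrable (Iv 1) f" and lam: "0 \<le> lam"
  shows "integrable (Iv 1) (\<lambda>x. (f x)\<^sup>2 * exp (- 2 * lam * x))"
proof (rule Bochner_Integration.integrable_bound)
  show "integrable (Iv 1) (\<lambda>x. (f x)\<^sup>2)" using f by (simp add: sq_integrable_def)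
  note [measurable] = sq_integrable_measurable[OF f]
  have "(\<lambda>x::real. exp (- 2 * lam * x)) \<in> borel_measurable (Iv 1)"
    by (rule sq_integrable_measurable[OF sq_integrable_continuous_Iv]) (intro continuous_intros)
  note [measurable] = this
  show "(\<lambda>x. (f x)\<^sup>2 * exp (- 2 * lam * x)) \<in> borel_measurable (Iv 1)" by measurable
  show "AE x in Iv 1. norm ((f x)\<^sup>2 * exp (- 2 * lam * x)) \<le> norm ((f x)\<^sup>2)"
  proof (rule AE_I2)
    fix x assume "x \<in> space (Iv 1)"
    then have "exp (- 2 * lam * x) \<le> 1" using lam by simp
    then have "(f x)\<^sup>2 * exp (- 2 * lam * x) \<le> (f x)\<^sup>2 * 1" by (intro mult_left_mono) auto
    then show "norm ((f x)\<^sup>2 * exp (- 2 * lam * x)) \<le> norm ((f x)\<^sup>2)" by simp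
  qed
qed

text \<open>The inclusion uses \<open>2 \<alpha> < 1\<close> for \<open>x < 1\<close>, and
  \<open>\<alpha> t < 2 \<alpha>\<close> together with \<open>T \<ge> 2\<close> for \<open>t <
  T\<close>.\<close>

lemma Tr_subset_rect:
  assumes "T \<ge> 2" "0 < \<alpha>" "\<alpha> < 1/2" "0 < \<epsilon>"
  shows "Tr \<alpha> \<epsilon> \<subseteq> rect T"
proof
  fix z assume "z \<in> Tr \<alpha> \<epsilon>"
  then obtain x t where z: "z = (x, t)" "x + \<alpha> * t < 2 * \<alpha> - \<epsilon>" "x > 0" "t > 0" by (auto simp: Tr_def)
  have "\<alpha> * t > 0" using z assms by simp
  then have "x < 1" using z assms by linarith
  have "\<alpha> * t < \<alpha> * 2" using z assms by linarith
  then have "t < 2" using assms(2) by simp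
  then show "z \<in> rect T" using z \<open>x < 1\<close> assms(1) by (simp add: rect_def)
qed

lemma open_Tr: "open (Tr \<alpha> \<epsilon>)"
proof -
  have "Tr \<alpha> \<epsilon> = {z. fst z + \<alpha> * snd z < 2 * \<alpha> - \<epsilon>} \<inter> ({z. 0 < fst z} \<inter> {z. 0 < snd z})"
    by (auto simp: Tr_def)
  also have "open \<dots>" by (intro open_Int open_Collect_less continuous_intros)
  finally show ?thesis .
qed

text \<open>On the triangle \<open>x + \<alpha> t < 2 \<alpha> - \<epsilon>\<close> the weight is at
  least the exponential factor.\<close>

lemma weighted_H1_Tr:
  assumes T: "T \<ge> 2" and a: "0 < \<alpha>" "\<alpha> < 1/2" "0 < \<epsilon>" and lam: "0 \<le> lam" and h: "h \<in> H3 T"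
  shows "exp (- 2 * lam * (2 * \<alpha> - \<epsilon>)) * (sobolev_norm 1 (Tr \<alpha> \<epsilon>) h)\<^sup>2
    \<le> (LINT z|Rm T. (h z)\<^sup>2 * weight \<alpha> lam z) + energy T \<alpha> lam h"
proof -
  let ?S = "Tr \<alpha> \<epsilon>" and ?c = "exp (- 2 * lam * (2 * \<alpha> - \<epsilon>))" and ?\<phi> = "weight \<alpha> lam"
  have T0: "T > 0" using T by simp
  have a0: "0 \<le> \<alpha>" using a by simp
  note sub = Tr_subset_rect[OF T a]
  have Tb: "?S \<in> sets borel" using open_Tr by (rule borel_open)
  define v where "v m = (if m = {#} then h else weak_deriv (rect T) m h)" for m
  have m3: "m \<in> multi_indices 3" if "m \<in> multi_indices 1" for m :: "(real \<times> real) multiset"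
    using that multi_indices_mono[of 1 3] by auto
  have "has_weak_deriv ?S m h (v m)" if m: "m \<in> multi_indices 1" for m
  proof (rule has_weak_deriv_restrict[OF _ open_rect open_Tr sub])
    show "set_mset m \<subseteq> Basis" using m by (simp add: multi_indices_def)
    show "has_weak_deriv (rect T) m h (v m)"
      using sobolev_weak_deriv(1)[OF open_rect h m3[OF m]]
        has_weak_deriv_empty[OF open_rect sq_integrable_loc_integrable[OF sobolev_sq_integrable[OF open_rect h] rect_borel]]
      by (simp add: v_def)
  qed
  then have "(sobolev_norm 1 ?S h)\<^sup>2 = (\<Sum>m\<in>multi_indices 1. LINT z|lres ?S. (v m z)\<^sup>2)"
    by (rule sobolev_norm_sq_eq[OF open_Tr])
  also have "\<dots> = (LINT z|lres ?S. (h z)\<^sup>2) + ((LINT z|lres ?S. (dx T h z)\<^sup>2) + (LINT z|lres ?S. (dt T h z)\<^sup>2))"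
    unfolding multi_indices_1 by (simp add: v_def)
  finally have n: "(sobolev_norm 1 ?S h)\<^sup>2 = \<dots>" .
  have le: "?c * (LINT z|lres ?S. (f z)\<^sup>2) \<le> (LINT z|Rm T. (f z)\<^sup>2 * ?\<phi> z)" if f: "sq_integrable (Rm T) f" for f
    unfolding Rm_eq[symmetric]
  proof (rule restricted_integral_weighted_le[OF sub Tb rect_borel])
    show "integrable (lres (rect T)) (\<lambda>z. (f z)\<^sup>2)" using f by (simp add: sq_integrable_def Rm_eq)
    show "integrable (lres (rect T)) (\<lambda>z. (f z)\<^sup>2 * ?\<phi> z)" unfolding Rm_eq by (rule integrable_sq_weight[OF f lam a0])
    show "0 \<le> ?\<phi> z" for z using weight_pos less_imp_le by blast
    show "?c \<le> ?\<phi> z" if "z \<in> ?S" for z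
      using that lam by (auto simp: Tr_def weight_def intro!: mult_left_mono)
  qed simp
  have "energy T \<alpha> lam h = (LINT z|Rm T. (dx T h z)\<^sup>2 * ?\<phi> z) + (LINT z|Rm T. (dt T h z)\<^sup>2 * ?\<phi> z)"
    unfolding energy_def distrib_right
    by (rule Bochner_Integration.integral_add[OF energy_parts(1,2)[OF T0 lam a0 h]])
  then show ?thesis
    unfolding n distrib_left using le[OF H3_sq_integrable(1)[OF T0 h]] le[OF H3_sq_integrable(2)[OF T0 h]] le[OF H3_sq_integrable(3)[OF T0 h]]
    by linarith
qed

text \<open>The difference of the traces of \<open>w2\<close> and \<open>w1\<close> is, almost
  everywhere, the trace of \<open>h\<close>, and its weak derivative is the trace of
  \<open>h\<^sub>x\<close>: these are the two traces at \<open>t = 0\<close> in the Carleman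
  estimate.\<close>

lemma weighted_H1_initial:
  assumes T: "T > 0" and l: "0 < l" "l < 1" and lam: "0 \<le> lam"
    and w: "w1 \<in> H3 T" "w2 \<in> H3 T" and h: "h = (\<lambda>z. w2 z - w1 z)"
  shows "exp (- 2 * lam * l) * (sobolev_norm 1 {0<..<l} (\<lambda>x. trace_t T 0 w2 x - trace_t T 0 w1 x))\<^sup>2
    \<le> (LINT x|Iv 1. (trace_t T 0 h x)\<^sup>2 * exp (- 2 * lam * x)) + (LINT x|Iv 1. (trace_t T 0 (dx T h) x)\<^sup>2 * exp (- 2 * lam * x))"
proof -
  let ?g = "\<lambda>x. trace_t T 0 w2 x - trace_t T 0 w1 x" and ?k = "trace_t T 0 (dx T h)" and ?r = "trace_t T 0 h"
  have hs: "h \<in> H3 T" unfolding h by (rule sobolev_diff[OF open_rect w(2,1)])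
  note imp = sobolev_3_imp[OF T]
  have s0: "(0::real) \<in> {0..T}" using T by simp
  have tr: "has_trace (rect T) (\<lambda>x. (x, 0)) {0<..<1} h ?g"
    using trace_lin[OF T trace_t_has_trace[OF T imp(3)[OF w(2)] s0] trace_t_has_trace[OF T imp(3)[OF w(1)] s0] boundary_curve_continuous(2)[OF T], of 1 "-1"]
    by (simp add: h)
  note trk = trace_t_has_trace[OF T imp(5)[OF hs] s0] and trg = trace_t_has_trace[OF T imp(3)[OF hs] s0]
  have ae: "AE x in Iv 1. ?g x = ?r x"
    using trace_unique[OF tr[unfolded rect_eq] trg[unfolded rect_eq] zero_less_one T s0] by (simp add: rect_eq)
  have wd: "has_weak_deriv {0<..<1} {#1#} ?g ?k"
    using trace_has_weak_deriv[OF imp(2)[OF hs, unfolded rect_eq] zero_less_one T s0 tr[unfolded rect_eq] trk[unfolded rect_eq]]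
    by (simp add: rect_eq)
  have sg: "sq_integrable (Iv 1) ?g" using tr by (simp add: has_trace_def L2_iff_sq_integrable)
  note sk = trace_t_integral_le(2)[OF T imp(5)[OF hs] s0] and sg0 = trace_t_integral_le(2)[OF T imp(3)[OF hs] s0]
  have sub: "{0<..<l} \<subseteq> {0<..<1}" using l by auto
  define v where "v m = (if m = {#} then ?g else ?k)" for m :: "real multiset"
  have e: "has_weak_deriv {0<..<1} {#} ?g ?g"
    by (rule has_weak_deriv_empty[OF open_greaterThanLessThan sq_integrable_loc_integrable[OF sg]]) simp
  have "has_weak_deriv {0<..<l} m ?g (v m)" if m: "m \<in> multi_indices 1" for m
  proof (rule has_weak_deriv_restrict[OF _ open_greaterThanLessThan open_greaterThanLessThan sub])
    show "set_mset m \<subseteq> Basis" using m by (simp add: multi_indices_def)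
    show "has_weak_deriv {0<..<1} m ?g (v m)" using m e wd unfolding multi_indices_1_real v_def by auto
  qed
  then have "(sobolev_norm 1 {0<..<l} ?g)\<^sup>2 = (\<Sum>m\<in>multi_indices 1. LINT z|Iv l. (v m z)\<^sup>2)"
    by (rule sobolev_norm_sq_eq[OF open_greaterThanLessThan])
  also have "\<dots> = (LINT x|Iv l. (?g x)\<^sup>2) + (LINT x|Iv l. (?k x)\<^sup>2)"
    unfolding multi_indices_1_real by (simp add: v_def)
  finally have n: "(sobolev_norm 1 {0<..<l} ?g)\<^sup>2 = \<dots>" .
  have le: "exp (- 2 * lam * l) * (LINT x|Iv l. (f x)\<^sup>2) \<le> (LINT x|Iv 1. (f x)\<^sup>2 * exp (- 2 * lam * x))"
    if f: "sq_integrable (Iv 1) f" for f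
  proof (rule restricted_integral_weighted_le[OF sub])
    show "integrable (Iv 1) (\<lambda>z. (f z)\<^sup>2)" using f by (simp add: sq_integrable_def)
    show "integrable (Iv 1) (\<lambda>x. (f x)\<^sup>2 * exp (- 2 * lam * x))" by (rule exp_weight_integrable[OF f lam])
    show "exp (- 2 * lam * l) \<le> exp (- 2 * lam * x)" if "x \<in> {0<..<l}" for x
      using that lam by (auto intro!: mult_left_mono)
  qed simp_all
  have "(LINT x|Iv 1. (?g x)\<^sup>2 * exp (- 2 * lam * x)) = (LINT x|Iv 1. (?r x)\<^sup>2 * exp (- 2 * lam * x))"
  proof (rule integral_cong_AE)
    show "AE x in Iv 1. (?g x)\<^sup>2 * exp (- 2 * lam * x) = (?r x)\<^sup>2 * exp (- 2 * lam * x)"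
      using ae by eventually_elim simp
  qed (use exp_weight_integrable[OF sg lam] exp_weight_integrable[OF sg0 lam] in \<open>auto dest: borel_measurable_integrable\<close>)
  then show ?thesis unfolding n distrib_left using le[OF sg] le[OF sk] by linarith
qed

text \<open>In the expansion, \<open>(A h)\<^sup>2 \<le> 2 (A h + b)\<^sup>2 + 2 b\<^sup>2\<close>
  isolates the term to which the Carleman estimate applies; the remaining terms are bounded by the
  energy.\<close>

lemma Bregman_lower_bound:
  assumes T: "T > 0" and lam: "0 \<le> lam" and a: "0 \<le> \<alpha>"
    and w: "w1 \<in> H3 T" "w2 \<in> H3 T" "H3_norm T w1 \<le> d" "H3_norm T w2 \<le> d"
    and h: "h = (\<lambda>z. w2 z - w1 z)" "h \<in> H03 T"
  shows "J T \<alpha> lam \<beta> w2 - J T \<alpha> lam \<beta> w1 - deriv_J T \<alpha> lam \<beta> w1 h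
    \<ge> (LINT z|Rm T. (A_op T h z)\<^sup>2 * weight \<alpha> lam z) / 2
      - (drift_const T d + 2 * second_order_const T d) * energy T \<alpha> lam h + \<beta> * (H3_norm T h)\<^sup>2"
proof -
  have hs: "h \<in> H3 T" "left_trace T h (\<lambda>_. 0)" using h(2) by (simp_all add: H03_iff[OF T])
  have w2: "(\<lambda>z. w1 z + h z) = w2" by (simp add: h(1))
  let ?b = "\<lambda>z. N_op T w2 h z + N_op T h w1 z" and ?\<phi> = "weight \<alpha> lam"
  have A: "sq_integrable (Rm T) (A_op T h)" and b: "sq_integrable (Rm T) ?b"
    by (intro sq_integrable_add H3_sq_integrable N_op_sq_integrable T w hs)+
  note i = integrable_sq_weight[OF A lam a] integrable_sq_weight[OF b lam a] integrable_sq_weight[OF sq_integrable_add[OF A b] lam a]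
  have "(LINT z|Rm T. (A_op T h z)\<^sup>2 * ?\<phi> z) \<le> (LINT z|Rm T. 2 * ((A_op T h z + ?b z)\<^sup>2 * ?\<phi> z) + 2 * ((?b z)\<^sup>2 * ?\<phi> z))"
  proof (rule integral_mono)
    fix z
    have "(A_op T h z)\<^sup>2 \<le> 2 * (A_op T h z + ?b z)\<^sup>2 + 2 * (?b z)\<^sup>2"
      using sq_add_le[of "A_op T h z + ?b z" "- ?b z"] by (simp only: power2_minus add_uminus_conv_diff add_diff_cancel_right')
    from mult_right_mono[OF this less_imp_le[OF weight_pos[of \<alpha> lam z]]]
    show "(A_op T h z)\<^sup>2 * ?\<phi> z \<le> 2 * ((A_op T h z + ?b z)\<^sup>2 * ?\<phi> z) + 2 * ((?b z)\<^sup>2 * ?\<phi> z)"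
      by (simp only: distrib_right mult.assoc)
  qed (use i in auto)
  also have "\<dots> = 2 * (LINT z|Rm T. (A_op T h z + ?b z)\<^sup>2 * ?\<phi> z) + 2 * (LINT z|Rm T. (?b z)\<^sup>2 * ?\<phi> z)"
    using i by simp
  finally have 1: "(LINT z|Rm T. (A_op T h z)\<^sup>2 * ?\<phi> z)
      \<le> 2 * (LINT z|Rm T. (A_op T h z + ?b z)\<^sup>2 * ?\<phi> z) + 2 * (LINT z|Rm T. (?b z)\<^sup>2 * ?\<phi> z)" .
  have 2: "(LINT z|Rm T. (?b z)\<^sup>2 * ?\<phi> z) \<le> drift_const T d * energy T \<alpha> lam h"
    by (rule weighted_drift_bound[OF T lam a w hs])
  have 3: "\<bar>LINT z|Rm T. (A_op T w1 z + N_op T w1 w1 z) * N_op T h h z * ?\<phi> z\<bar> \<le> second_order_const T d * energy T \<alpha> lam h"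
    by (rule weighted_second_order_bound(2)[OF T lam a w(1,3) hs])
  show ?thesis
    using J_expansion[OF T lam a w(1) hs(1), where \<beta>=\<beta>, unfolded w2] 1 2 3 unfolding distrib_right by linarith
qed

text \<open>Half of the Carleman estimate: the assumption \<open>4 K / C \<le> \<lambda>\<close> lets a
  quarter of \<open>C \<lambda>\<close> times the energy absorb \<open>K\<close> times the energy. The
  traces at \<open>t = T\<close> are bounded by \<open>\<kappa> \<parallel>h\<parallel>\<^sup>2\<close>
  with \<open>\<kappa> = 2 / T + 2 T\<close>, and each of the two terms there is at most \<open>\<beta>
  / 2 * \<parallel>h\<parallel>\<^sup>2\<close>. As \<open>\<lambda> \<ge> 1\<close>, the powers of
  \<open>\<lambda>\<close> in the positive terms may be dropped.\<close>

lemma carleman_lower_bound: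
  assumes T: "T > 0" and C: "0 < C" and lam: "1 \<le> lam" and a: "0 < \<alpha>" and h: "h \<in> H03 T"
    and K: "0 \<le> K" "4 * K / C \<le> lam"
    and decay: "256 * (C * (2 / T + 2 * T)) / (\<alpha> * T) ^ 4 \<le> lam" and \<beta>: "2 * exp (- lam * \<alpha> * T) \<le> \<beta>"
    and carl: "(LINT z:rect T|lborel. (dxx T h z - 2 * dxt T h z)\<^sup>2 * weight \<alpha> lam z)
        \<ge> C * lam * (LINT z:rect T|lborel. ((dx T h z)\<^sup>2 + (dt T h z)\<^sup>2) * weight \<alpha> lam z)
          + C * lam ^ 3 * (LINT z:rect T|lborel. (h z)\<^sup>2 * weight \<alpha> lam z)
          + C * lam * (LINT x:{0<..<1}|lborel. (trace_t T 0 (dx T h) x)\<^sup>2 * exp (- 2 * lam * x))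
          + C * lam ^ 3 * (LINT x:{0<..<1}|lborel. (trace_t T 0 h x)\<^sup>2 * exp (- 2 * lam * x))
          - C * lam * exp (- 2 * lam * \<alpha> * T) * (LINT x:{0<..<1}|lborel. (trace_t T T (dx T h) x)\<^sup>2)
          - C * lam ^ 3 * exp (- 2 * lam * \<alpha> * T) * (LINT x:{0<..<1}|lborel. (trace_t T T h x)\<^sup>2)"
  shows "(LINT z|Rm T. (A_op T h z)\<^sup>2 * weight \<alpha> lam z) / 2 - K * energy T \<alpha> lam h + \<beta> * (H3_norm T h)\<^sup>2
    \<ge> C / 4 * ((LINT z|Rm T. (h z)\<^sup>2 * weight \<alpha> lam z) + energy T \<alpha> lam h)
      + C / 4 * ((LINT x|Iv 1. (trace_t T 0 h x)\<^sup>2 * exp (- 2 * lam * x)) + (LINT x|Iv 1. (trace_t T 0 (dx T h) x)\<^sup>2 * exp (- 2 * lam * x)))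
      + \<beta> / 2 * (H3_norm T h)\<^sup>2"
proof -
  have hs: "h \<in> H3 T" using h by (simp add: H03_def)
  let ?n2 = "(H3_norm T h)\<^sup>2"
  define P where "P = (LINT z|Rm T. (A_op T h z)\<^sup>2 * weight \<alpha> lam z)"
  define E where "E = energy T \<alpha> lam h"
  define H where "H = (LINT z|Rm T. (h z)\<^sup>2 * weight \<alpha> lam z)"
  define I0 where "I0 = (LINT x|Iv 1. (trace_t T 0 h x)\<^sup>2 * exp (- 2 * lam * x))"
  define I1 where "I1 = (LINT x|Iv 1. (trace_t T 0 (dx T h) x)\<^sup>2 * exp (- 2 * lam * x))"
  define S0 where "S0 = (LINT x|Iv 1. (trace_t T T h x)\<^sup>2)"
  define S1 where "S1 = (LINT x|Iv 1. (trace_t T T (dx T h) x)\<^sup>2)"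
  define q where "q = exp (- 2 * lam * \<alpha> * T)"
  define \<kappa> where "\<kappa> = 2 / T + 2 * T"
  have carl': "P \<ge> C * lam * E + C * lam ^ 3 * H + C * lam * I1 + C * lam ^ 3 * I0 - C * lam * q * S1 - C * lam ^ 3 * q * S0"
    using carl rect_borel unfolding P_def E_def H_def I0_def I1_def S0_def S1_def q_def energy_def A_op_def
    by (simp add: set_integral_lres Rm_eq)
  have nn: "0 \<le> E" "0 \<le> H" "0 \<le> I0" "0 \<le> I1" "0 \<le> S0" "0 \<le> S1" "0 < q"
    unfolding E_def H_def I0_def I1_def S0_def S1_def energy_def q_def
    by (auto intro!: Bochner_Integration.integral_nonneg mult_nonneg_nonneg simp: weight_pos less_imp_le)
  have \<kappa>0: "0 \<le> \<kappa>" using T by (simp add: \<kappa>_def)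
  note imp = sobolev_3_imp[OF T hs]
  have TT: "T \<in> {0..T}" using T by simp
  have "S0 \<le> \<kappa> * (sobolev_norm 1 (rect T) h)\<^sup>2" unfolding S0_def \<kappa>_def by (rule trace_t_integral_le(1)[OF T imp(3) TT])
  also have "\<dots> \<le> \<kappa> * ?n2" by (intro mult_left_mono power_mono dx_norm_le[OF T hs] sobolev_norm_nonneg open_rect \<kappa>0)
  finally have S0: "S0 \<le> \<kappa> * ?n2" .
  have "S1 \<le> \<kappa> * (sobolev_norm 1 (rect T) (dx T h))\<^sup>2" unfolding S1_def \<kappa>_def by (rule trace_t_integral_le(1)[OF T imp(5) TT])
  also have "\<dots> \<le> \<kappa> * ?n2" by (intro mult_left_mono power_mono dx_norm_le[OF T hs] sobolev_norm_nonneg open_rect \<kappa>0)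
  finally have S1: "S1 \<le> \<kappa> * ?n2" .
  have l3: "lam \<le> lam ^ 3" using power_increasing[of 1 3 lam] lam by simp
  have Cl: "C * lam \<le> C * lam ^ 3" using l3 C by simp
  have Cl1: "C \<le> C * lam" using lam C by simp
  have e2: "q = exp (- lam * \<alpha> * T) * exp (- lam * \<alpha> * T)" unfolding q_def by (simp add: exp_add[symmetric])
  have "C * \<kappa> * lam ^ 3 * exp (- (\<alpha> * T) * lam) \<le> 1"
    by (rule cube_exp_decay) (use a T C \<kappa>0 decay lam in \<open>auto simp: \<kappa>_def\<close>)
  then have dec: "C * \<kappa> * lam ^ 3 * exp (- lam * \<alpha> * T) \<le> 1" by (simp add: mult_ac)
  \<comment> \<open>One of the two factors \<open>exp (- \<lambda> \<alpha> T)\<close> compensates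
    \<open>\<lambda>\<^sup>3\<close>, the other one is at most \<open>\<beta> / 2\<close>.\<close>
  have "C * lam ^ 3 * q * \<kappa> = (C * \<kappa> * lam ^ 3 * exp (- lam * \<alpha> * T)) * exp (- lam * \<alpha> * T)"
    unfolding e2 by (simp add: mult_ac)
  also have "\<dots> \<le> 1 * exp (- lam * \<alpha> * T)" using dec by (rule mult_right_mono) simp
  also have "\<dots> \<le> \<beta> / 2" using \<beta> by simp
  finally have q\<kappa>: "C * lam ^ 3 * q * \<kappa> \<le> \<beta> / 2" .
  have "C * lam * q * S1 \<le> C * lam ^ 3 * q * S1" using Cl nn by (intro mult_right_mono) auto
  also have "\<dots> \<le> C * lam ^ 3 * q * (\<kappa> * ?n2)" using S1 C lam nn by (intro mult_left_mono) auto
  also have "\<dots> = (C * lam ^ 3 * q * \<kappa>) * ?n2" by simp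
  also have "\<dots> \<le> \<beta> / 2 * ?n2" by (rule mult_right_mono[OF q\<kappa>]) simp
  finally have t1: "C * lam * q * S1 \<le> \<beta> / 2 * ?n2" .
  have "C * lam ^ 3 * q * S0 \<le> C * lam ^ 3 * q * (\<kappa> * ?n2)" using S0 C lam nn by (intro mult_left_mono) auto
  also have "\<dots> = (C * lam ^ 3 * q * \<kappa>) * ?n2" by simp
  also have "\<dots> \<le> \<beta> / 2 * ?n2" by (rule mult_right_mono[OF q\<kappa>]) simp
  finally have t0: "C * lam ^ 3 * q * S0 \<le> \<beta> / 2 * ?n2" .
  have "4 * K \<le> C * lam" using K(2) C by (simp add: pos_divide_le_eq mult.commute)
  then have KE: "4 * (K * E) \<le> C * lam * E" using mult_right_mono[OF _ nn(1), of "4 * K" "C * lam"] by simp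
  have E1: "C * E \<le> C * lam * E" and I1: "C * I1 \<le> C * lam * I1" using Cl1 nn by (auto intro: mult_right_mono)
  have C3: "C \<le> C * lam ^ 3" using Cl Cl1 by linarith
  have H1: "C * H \<le> C * lam ^ 3 * H" and I0: "C * I0 \<le> C * lam ^ 3 * I0" using C3 nn by (auto intro: mult_right_mono)
  have pos: "0 \<le> C * H" "0 \<le> C * I0" "0 \<le> C * I1" using C nn by auto
  have "P / 2 - K * E + \<beta> * ?n2 \<ge> C / 4 * (H + E) + C / 4 * (I0 + I1) + \<beta> / 2 * ?n2"
  proof -
    have "p / 2 - ke + 2 * x \<ge> (h + e) / 4 + (i0 + i1) / 4 + x"
      if "p \<ge> le + lh + li1 + li0 - y1 - y0" "y0 \<le> x" "y1 \<le> x" "4 * ke \<le> le" "e \<le> le" "i1 \<le> li1" "h \<le> lh" "i0 \<le> li0"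
        "0 \<le> h" "0 \<le> i0" "0 \<le> i1" for p ke x h e i0 i1 le lh li1 li0 y1 y0 :: real
      using that by argo
    from this[OF carl' t0 t1 KE E1 I1 H1 I0 pos] show ?thesis
      by (simp add: distrib_left add_divide_distrib)
  qed
  then show ?thesis unfolding P_def E_def H_def I0_def I1_def .
qed

text \<open>Apply the lower bound at the base point \<open>u = (1 - s) w1 + s w2\<close> towards
  \<open>w1\<close> and towards \<open>w2\<close>. The increments are \<open>- s k\<close> and \<open>(1
  - s) k\<close> with \<open>k = w2 - w1\<close>, so the linear terms cancel in the convex
  combination.\<close>

lemma strictly_convex_onI:
  assumes A: "\<And>u v s. u \<in> A \<Longrightarrow> v \<in> A \<Longrightarrow> 0 < s \<Longrightarrow> s < 1 \<Longrightarrow> (\<lambda>z. (1 - s) * u z + s * v z) \<in> A"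
    and AS: "A \<subseteq> H3 T" and b: "b > 0"
    and lin: "\<And>u k c. u \<in> A \<Longrightarrow> k \<in> H03 T \<Longrightarrow> l u (\<lambda>z. c * k z) = c * l u k"
    and diff: "\<And>u v. u \<in> A \<Longrightarrow> v \<in> A \<Longrightarrow> (\<lambda>z. v z - u z) \<in> H03 T"
    and lower: "\<And>u v. u \<in> A \<Longrightarrow> v \<in> A \<Longrightarrow> F v - F u - l u (\<lambda>z. v z - u z) \<ge> b * (H3_norm T (\<lambda>z. v z - u z))\<^sup>2"
  shows "strictly_convex_on T A F"
  unfolding strictly_convex_on_def
proof (intro ballI impI)
  let ?N = "H3_norm T"
  fix w1 w2 s assume w: "w1 \<in> A" "w2 \<in> A" and s: "s \<in> {0<..<1::real}" and n: "?N (\<lambda>z. w2 z - w1 z) \<noteq> 0"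
  define u where "u = (\<lambda>z. (1 - s) * w1 z + s * w2 z)"
  define k where "k = (\<lambda>z. w2 z - w1 z)"
  have u: "u \<in> A" unfolding u_def using A[OF w] s by simp
  have k: "k \<in> H03 T" unfolding k_def by (rule diff[OF w])
  have kS: "k \<in> H3 T" using k by (simp add: H03_def)
  have e: "(\<lambda>z. w1 z - u z) = (\<lambda>z. (- s) * k z)" "(\<lambda>z. w2 z - u z) = (\<lambda>z. (1 - s) * k z)"
    by (auto simp: u_def k_def algebra_simps)
  have "F w1 - F u - (- s) * l u k \<ge> b * (s * ?N k)\<^sup>2"
    using lower[OF u w(1)] s unfolding e lin[OF u k] sobolev_norm_cmult[OF open_rect kS] by simp
  moreover have "b * (s * ?N k)\<^sup>2 > 0" using b s n by (simp add: k_def)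
  ultimately have 1: "F w1 - F u + s * l u k > 0" by simp
  have "F w2 - F u - (1 - s) * l u k \<ge> b * ((1 - s) * ?N k)\<^sup>2"
    using lower[OF u w(2)] s unfolding e lin[OF u k] sobolev_norm_cmult[OF open_rect kS] by simp
  moreover have "b * ((1 - s) * ?N k)\<^sup>2 \<ge> 0" using b by simp
  ultimately have 2: "F w2 - F u - (1 - s) * l u k \<ge> 0" by linarith
  have "(1 - s) * (F w1 - F u + s * l u k) > 0" using 1 s by simp
  moreover have "s * (F w2 - F u - (1 - s) * l u k) \<ge> 0" using 2 s by simp
  ultimately have "(1 - s) * (F w1 - F u + s * l u k) + s * (F w2 - F u - (1 - s) * l u k) > 0" by linarith
  also have "(1 - s) * (F w1 - F u + s * l u k) + s * (F w2 - F u - (1 - s) * l u k) = (1 - s) * F w1 + s * F w2 - F u"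
    by (simp add: algebra_simps)
  finally show "F (\<lambda>z. (1 - s) * w1 z + s * w2 z) < (1 - s) * F w1 + s * F w2" unfolding u_def by simp
qed

theorem theorem4p2:
  fixes T \<alpha> \<epsilon> d :: real
  assumes "T \<ge> 2" and "0 < \<alpha>" "\<alpha> < 1/2" and "0 < \<epsilon>" "\<epsilon> < 2 * \<alpha>" and "d > 0"
  shows
    "(\<forall>p0 p1 lam \<beta>. lam > 0 \<longrightarrow> \<beta> > 0 \<longrightarrow>
        (\<forall>w\<in>H3_closure T (B T d p0 p1).
           has_frechet_deriv T (J T \<alpha> lam \<beta>) w (frechet_deriv T (J T \<alpha> lam \<beta>) w)))
     \<and>
     (\<forall>lam0. carleman_estimate T \<alpha> lam0 \<longrightarrow>
        (\<exists>lam1\<ge>lam0. \<exists>C1>0. \<forall>p0 p1. \<forall>lam\<ge>lam1. \<forall>\<beta>\<in>{2 * exp (- lam * \<alpha> * T)..<1}.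
           strictly_convex_on T (H3_closure T (B T d p0 p1)) (J T \<alpha> lam \<beta>) \<and>
           (\<forall>w1\<in>H3_closure T (B T d p0 p1). \<forall>w2\<in>H3_closure T (B T d p0 p1).
              J T \<alpha> lam \<beta> w2 - J T \<alpha> lam \<beta> w1
                - sobolev_inner 3 (rect T) (frechet_deriv T (J T \<alpha> lam \<beta>) w1) (\<lambda>z. w2 z - w1 z)
              \<ge> C1 * exp (- 2 * lam * (2 * \<alpha> - \<epsilon>))
                    * (sobolev_norm 1 (Tr \<alpha> \<epsilon>) (\<lambda>z. w2 z - w1 z))\<^sup>2
                + C1 * exp (- 2 * lam * (2 * \<alpha> - \<epsilon>))
                    * (sobolev_norm 1 {0<..<2 * \<alpha> - \<epsilon>} (\<lambda>x. trace_t T 0 w2 x - trace_t T 0 w1 x))\<^sup>2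
                + \<beta> / 2 * (sobolev_norm 3 (rect T) (\<lambda>z. w2 z - w1 z))\<^sup>2)))"
proof -
  have T0: "T > 0" and a0: "0 \<le> \<alpha>" using assms by auto
  have sub: "H3_closure T (B T d p0 p1) \<subseteq> sobolev 3 (rect T)" for p0 p1 by (auto simp: H3_closure_def)
  have frechet: "\<forall>p0 p1 lam \<beta>. lam > 0 \<longrightarrow> \<beta> > 0 \<longrightarrow> (\<forall>w\<in>H3_closure T (B T d p0 p1).
      has_frechet_deriv T (J T \<alpha> lam \<beta>) w (frechet_deriv T (J T \<alpha> lam \<beta>) w))"
    using frechet_deriv_J(1)[OF T0 _ _ a0] sub by (meson less_imp_le subsetD)
  have convex: "\<exists>lam1\<ge>lam0. \<exists>C1>0. \<forall>p0 p1. \<forall>lam\<ge>lam1. \<forall>\<beta>\<in>{2 * exp (- lam * \<alpha> * T)..<1}.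
           strictly_convex_on T (H3_closure T (B T d p0 p1)) (J T \<alpha> lam \<beta>) \<and>
           (\<forall>w1\<in>H3_closure T (B T d p0 p1). \<forall>w2\<in>H3_closure T (B T d p0 p1).
              J T \<alpha> lam \<beta> w2 - J T \<alpha> lam \<beta> w1
                - sobolev_inner 3 (rect T) (frechet_deriv T (J T \<alpha> lam \<beta>) w1) (\<lambda>z. w2 z - w1 z)
              \<ge> C1 * exp (- 2 * lam * (2 * \<alpha> - \<epsilon>)) * (sobolev_norm 1 (Tr \<alpha> \<epsilon>) (\<lambda>z. w2 z - w1 z))\<^sup>2
                + C1 * exp (- 2 * lam * (2 * \<alpha> - \<epsilon>))
                    * (sobolev_norm 1 {0<..<2 * \<alpha> - \<epsilon>} (\<lambda>x. trace_t T 0 w2 x - trace_t T 0 w1 x))\<^sup>2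
                + \<beta> / 2 * (sobolev_norm 3 (rect T) (\<lambda>z. w2 z - w1 z))\<^sup>2)"
    if carleman: "carleman_estimate T \<alpha> lam0" for lam0
  proof -
    obtain C where lam0: "lam0 \<ge> 1" and C: "C > 0" and carl: "\<And>u lam. u \<in> H02 T \<Longrightarrow> lam \<ge> lam0 \<Longrightarrow>
        (LINT z:rect T|lborel. (dxx T u z - 2 * dxt T u z)\<^sup>2 * weight \<alpha> lam z)
        \<ge> C * lam * (LINT z:rect T|lborel. ((dx T u z)\<^sup>2 + (dt T u z)\<^sup>2) * weight \<alpha> lam z)
          + C * lam ^ 3 * (LINT z:rect T|lborel. (u z)\<^sup>2 * weight \<alpha> lam z)
          + C * lam * (LINT x:{0<..<1}|lborel. (trace_t T 0 (dx T u) x)\<^sup>2 * exp (- 2 * lam * x))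
          + C * lam ^ 3 * (LINT x:{0<..<1}|lborel. (trace_t T 0 u x)\<^sup>2 * exp (- 2 * lam * x))
          - C * lam * exp (- 2 * lam * \<alpha> * T) * (LINT x:{0<..<1}|lborel. (trace_t T T (dx T u) x)\<^sup>2)
          - C * lam ^ 3 * exp (- 2 * lam * \<alpha> * T) * (LINT x:{0<..<1}|lborel. (trace_t T T u x)\<^sup>2)"
      using carleman unfolding carleman_estimate_def by blast
    define K where "K = drift_const T d + 2 * second_order_const T d"
    have K0: "0 \<le> K" using drift_const_nonneg[OF T0] second_order_const_nonneg[OF T0] by (simp add: K_def)
    \<comment> \<open>The three lower bounds for \<open>\<lambda>\<close>: the Carleman estimate
      holds, it absorbs \<open>K\<close> times the energy, and the terms at \<open>t = T\<close> are
      absorbed by the regularisation.\<close>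
    define lam1 where "lam1 = max lam0 (max (4 * K / C) (256 * (C * (2 / T + 2 * T)) / (\<alpha> * T) ^ 4))"
    have estimate: "J T \<alpha> lam \<beta> w2 - J T \<alpha> lam \<beta> w1 - deriv_J T \<alpha> lam \<beta> w1 (\<lambda>z. w2 z - w1 z)
        \<ge> C / 4 * exp (- 2 * lam * (2 * \<alpha> - \<epsilon>)) * (sobolev_norm 1 (Tr \<alpha> \<epsilon>) (\<lambda>z. w2 z - w1 z))\<^sup>2
          + C / 4 * exp (- 2 * lam * (2 * \<alpha> - \<epsilon>))
              * (sobolev_norm 1 {0<..<2 * \<alpha> - \<epsilon>} (\<lambda>x. trace_t T 0 w2 x - trace_t T 0 w1 x))\<^sup>2
          + \<beta> / 2 * (sobolev_norm 3 (rect T) (\<lambda>z. w2 z - w1 z))\<^sup>2"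
      if lam: "lam \<ge> lam1" and \<beta>: "2 * exp (- lam * \<alpha> * T) \<le> \<beta>"
        and w1: "w1 \<in> H3_closure T (B T d p0 p1)" and w2: "w2 \<in> H3_closure T (B T d p0 p1)" for lam \<beta> p0 p1 w1 w2
    proof -
      define h where "h = (\<lambda>z. w2 z - w1 z)"
      have h: "h \<in> H03 T" unfolding h_def by (rule closure_B_diff[OF T0 w1 w2])
      have l: "lam \<ge> lam0" "4 * K / C \<le> lam" "256 * (C * (2 / T + 2 * T)) / (\<alpha> * T) ^ 4 \<le> lam"
        using lam by (simp_all add: lam1_def)
      have l1: "1 \<le> lam" and l0: "0 \<le> lam" using l(1) lam0 by linarith+
      have h2: "h \<in> H02 T" using h by (simp add: H03_def)
      have hs: "h \<in> sobolev 3 (rect T)" using h by (simp add: H03_def)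
      note s = closure_B[OF T0 w1] closure_B[OF T0 w2]
      have 1: "J T \<alpha> lam \<beta> w2 - J T \<alpha> lam \<beta> w1 - deriv_J T \<alpha> lam \<beta> w1 h
          \<ge> (LINT z|Rm T. (A_op T h z)\<^sup>2 * weight \<alpha> lam z) / 2 - K * energy T \<alpha> lam h + \<beta> * (sobolev_norm 3 (rect T) h)\<^sup>2"
        unfolding K_def by (rule Bregman_lower_bound[OF T0 l0 a0 s(1) s(5) s(2) s(6) h_def h])
      note 2 = carleman_lower_bound[OF T0 C l1 assms(2) h K0 l(2,3) \<beta> carl[OF h2 l(1)]]
      have "C / 4 * (exp (- 2 * lam * (2 * \<alpha> - \<epsilon>)) * (sobolev_norm 1 (Tr \<alpha> \<epsilon>) h)\<^sup>2)
          \<le> C / 4 * ((LINT z|Rm T. (h z)\<^sup>2 * weight \<alpha> lam z) + energy T \<alpha> lam h)"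
        by (rule mult_left_mono[OF weighted_H1_Tr[OF assms(1-4) l0 hs]]) (use C in simp)
      moreover have "C / 4 * (exp (- 2 * lam * (2 * \<alpha> - \<epsilon>))
            * (sobolev_norm 1 {0<..<2 * \<alpha> - \<epsilon>} (\<lambda>x. trace_t T 0 w2 x - trace_t T 0 w1 x))\<^sup>2)
          \<le> C / 4 * ((LINT x|Iv 1. (trace_t T 0 h x)\<^sup>2 * exp (- 2 * lam * x)) + (LINT x|Iv 1. (trace_t T 0 (dx T h) x)\<^sup>2 * exp (- 2 * lam * x)))"
        by (rule mult_left_mono[OF weighted_H1_initial[OF T0 _ _ l0 s(1) s(5) h_def]]) (use C assms in auto)
      ultimately show ?thesis using 1 2 unfolding h_def[symmetric] mult.assoc[of "C / 4"] by linarith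
    qed
    show ?thesis
    proof (rule exI[of _ lam1], intro conjI, simp add: lam1_def, rule exI[of _ "C / 4"], intro conjI allI impI ballI)
      show "0 < C / 4" using C by simp
      fix p0 p1 lam \<beta> assume lam: "lam1 \<le> lam" and "\<beta> \<in> {2 * exp (- lam * \<alpha> * T)..<1}"
      then have \<beta>: "2 * exp (- lam * \<alpha> * T) \<le> \<beta>" by simp
      have \<beta>0: "\<beta> > 0" using \<beta> exp_gt_zero[of "- lam * \<alpha> * T"] by linarith
      have l0: "0 \<le> lam" using lam lam0 unfolding lam1_def by linarith
      let ?A = "H3_closure T (B T d p0 p1)"
      show "strictly_convex_on T ?A (J T \<alpha> lam \<beta>)"
      proof (rule strictly_convex_onI[where b="\<beta> / 2" and l="deriv_J T \<alpha> lam \<beta>"])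
        show "(\<lambda>z. (1 - s) * u z + s * v z) \<in> ?A" if "u \<in> ?A" "v \<in> ?A" "0 < s" "s < 1" for u v s
          by (rule closure_B_convex[OF T0 that])
        show "deriv_J T \<alpha> lam \<beta> u (\<lambda>z. c * k z) = c * deriv_J T \<alpha> lam \<beta> u k" if "u \<in> ?A" "k \<in> H03 T" for u k c
        proof -
          have "k \<in> sobolev 3 (rect T)" using that by (simp add: H03_def)
          from deriv_J_lin[OF T0 l0 a0 closure_B(1)[OF T0 that(1)] this this, of _ c 0] show ?thesis by simp
        qed
        show "(\<lambda>z. v z - u z) \<in> H03 T" if "u \<in> ?A" "v \<in> ?A" for u v by (rule closure_B_diff[OF T0 that])
        show "\<beta> / 2 * (sobolev_norm 3 (rect T) (\<lambda>z. v z - u z))\<^sup>2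
            \<le> J T \<alpha> lam \<beta> v - J T \<alpha> lam \<beta> u - deriv_J T \<alpha> lam \<beta> u (\<lambda>z. v z - u z)" if "u \<in> ?A" "v \<in> ?A" for u v
        proof -
          have "0 \<le> C / 4 * exp (- 2 * lam * (2 * \<alpha> - \<epsilon>)) * x\<^sup>2" for x :: real using C by simp
          from add_mono[OF this this] show ?thesis using estimate[OF lam \<beta> that] by (smt (verit))
        qed
      qed (use sub \<beta>0 in auto)
      fix w1 w2 assume w: "w1 \<in> ?A" "w2 \<in> ?A"
      show "C / 4 * exp (- 2 * lam * (2 * \<alpha> - \<epsilon>)) * (sobolev_norm 1 (Tr \<alpha> \<epsilon>) (\<lambda>z. w2 z - w1 z))\<^sup>2
          + C / 4 * exp (- 2 * lam * (2 * \<alpha> - \<epsilon>))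
              * (sobolev_norm 1 {0<..<2 * \<alpha> - \<epsilon>} (\<lambda>x. trace_t T 0 w2 x - trace_t T 0 w1 x))\<^sup>2
          + \<beta> / 2 * (sobolev_norm 3 (rect T) (\<lambda>z. w2 z - w1 z))\<^sup>2
        \<le> J T \<alpha> lam \<beta> w2 - J T \<alpha> lam \<beta> w1
          - sobolev_inner 3 (rect T) (frechet_deriv T (J T \<alpha> lam \<beta>) w1) (\<lambda>z. w2 z - w1 z)"
        unfolding frechet_deriv_J(2)[OF T0 closure_B(1)[OF T0 w(1)] l0 a0 closure_B_diff[OF T0 w]]
        by (rule estimate[OF lam \<beta> w])
    qed
  qed
  show ?thesis using frechet convex by blast
qed

end
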